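(* Let $\theta>0$, let $f:S^1\to\mathbb{C}$ be real analytic, let $x\in S^1$, and let $S_n$ be endowed with the Ewens measure with parameter $\theta$. Assume that either (i) $x$ is not a root of unity and is of finite type, and all zeros of $f$ are roots of unity; or (ii) $x$ is a root of unity of order $p$ and $f(x^m)\neq0$ for all $1\le m\le p$. Let $\mathcal{N}$ be the complex normal random variable that is the limit in distribution of $\frac{w^n(f)(x)}{\sqrt{\log n}}-\theta\sqrt{\log n}\,m(f)(x)$ (described explicitly in the context). Then, identifying $\mathbb{C}$ with $\mathbb{R}^2$, as $n\to\infty$, $$\mathrm{d}_{wW}\left(\mathcal{N},\ \frac{w^n(f)(x)}{\sqrt{\log n}}-\theta\sqrt{\log n}\; m(f)(x)\right)=O\bigl(\log^{-1/2}(n)\bigr).$$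
   Context: Weak Wasserstein distance: for $\mathbb{R}^d$-valued random variables $X_1,X_2$ (not necessarily on the same space), $\mathrm{d}_{wW}(X_1,X_2)=\sup_{g\in\mathcal{G}}|\mathbb{E}[g(X_1)]-\mathbb{E}[g(X_2)]|$ with $\mathcal{G}=\{g\in C^\infty(\mathbb{R}^d,\mathbb{R}): M_1(g)\le1,\ M_2(g)\le1\}$ and $M_k(g)=\sup_{u\in\mathbb{R}^d,\,1\le i_1,\dots,i_k\le d}\left|\frac{\partial^k g}{\partial u_{i_1}\cdots\partial u_{i_k}}(u)\right|$. Here $d=2$. Ewens measure: $\mathbb{P}_\theta[\sigma]=\frac{\theta^{\ell(\sigma)}}{\theta(\theta+1)\cdots(\theta+n-1)}$ for $\sigma\in S_n$, where $\ell(\sigma)$ is the total number of cycles of $\sigma$ (fixed points included). $C_m^{(n)}(\sigma)$ is the number of cycles of length $m$ of $\sigma\in S_n$. $S^1=\{z\in\mathbb{C}:|z|=1\}$ and $w^n(f)(x)=\sum_{m=1}^n C_m^{(n)}\log(f(x^m))$, where $\log$ is the principal branch, with $\log(-y)=\log(y)+i\pi$ for $y>0$ and $\log(0)=\infty$; $\arg$ denotes the imaginary part of this logarithm. $m(f)(x)=\frac1p\sum_{m=1}^p\log(f(x^m))$ if $x$ is a root of unity of order $p$ (i.e. $x^p=1$, $p\geq 1$ minimal), and $m(f)(x)=\int_0^1\log(f(e^{2\pi i s}))\,ds$ if $x$ is not a root of unity. Finite type: $x=e^{2\pi i t}$ ($t\in\mathbb{R}$) is of finite type if there exist $K,\gamma>0$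 such that $\|\{mt\}\|>\frac{K}{|m|^\gamma}$ for all $m\in\mathbb{Z}\setminus\{0\}$, where $\{s\}=s-\lfloor s\rfloor$ and $\|s\|=\min\{s,1-s\}$ for $s\in[0,1]$. The limit $\mathcal{N}$: $(\mathrm{Re}\,\mathcal{N},\mathrm{Im}\,\mathcal{N})$ is a centered (possibly degenerate) Gaussian vector with covariance matrix $\theta\begin{pmatrix} V_a & E_{ab} \\ E_{ab} & V_b \end{pmatrix}$, where, in case (i), with $a(s)=\log|f(e^{2\pi i s})|$ and $b(s)=\arg(f(e^{2\pi i s}))$, $V_a=\int_0^1a(s)^2ds$, $V_b=\int_0^1b(s)^2ds$, $E_{ab}=\int_0^1a(s)b(s)ds$; and in case (ii), with $a_m=\log|f(x^m)|$, $b_m=\arg(f(x^m))$, $V_a=\frac1p\sum_{m=1}^pa_m^2$, $V_b=\frac1p\sum_{m=1}^pb_m^2$, $E_{ab}=\frac1p\sum_{m=1}^pa_mb_m$. *)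

theory Defs
  imports "HOL-Probability.Probability" "HOL-Combinatorics.Orbits"
begin

section \<open>The weak Wasserstein distance\<close>

definition partial_deriv :: "'a::euclidean_space \<Rightarrow> ('a \<Rightarrow> real) \<Rightarrow> 'a \<Rightarrow> real" where
  "partial_deriv b g u = frechet_derivative g (at u) b"

definition iter_partial_deriv :: "'a::euclidean_space list \<Rightarrow> ('a \<Rightarrow> real) \<Rightarrow> 'a \<Rightarrow> real" where
  "iter_partial_deriv bs g = foldr partial_deriv bs g"

text \<open>Differentiability of every iterated partial derivative makes all of them exist and be
  continuous, and conversely continuity of all partial derivatives gives differentiability,
  so this is the class of infinitely differentiable functions.\<close>

definition smooth :: "('a::euclidean_space \<Rightarrow> real) \<Rightarrow> bool" where
  "smooth g \<longleftrightarrow> (\<forall>bs\<in>lists Basis. \<forall>u. iter_partial_deriv bs g differentiable (at u))"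

text \<open>The supremum is taken in the extended nonnegative reals, so it is \<open>\<infinity>\<close> for unbounded
  derivatives. The list \<open>bs\<close> plays the role of the indices \<open>i\<^sub>1, \<dots>, i\<^sub>k\<close>.\<close>

definition deriv_bound :: "nat \<Rightarrow> ('a::euclidean_space \<Rightarrow> real) \<Rightarrow> ennreal" where
  "deriv_bound k g =
     (SUP u. SUP bs\<in>{bs \<in> lists Basis. length bs = k}. ennreal \<bar>iter_partial_deriv bs g u\<bar>)"

definition weak_wasserstein_tests :: "('a::euclidean_space \<Rightarrow> real) set" where
  "weak_wasserstein_tests = {g. smooth g \<and> deriv_bound 1 g \<le> 1 \<and> deriv_bound 2 g \<le> 1}"

text \<open>Distance between the laws of \<open>X\<^sub>1\<close> on \<open>M\<^sub>1\<close> and of \<open>X\<^sub>2\<close> on \<open>M\<^sub>2\<close>. For the Euclidean space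
  \<^typ>\<open>complex\<close>, whose basis is \<open>{1, \<i>}\<close>, this is the distance for random vectors in the plane.\<close>

definition weak_wasserstein ::
  "'w measure \<Rightarrow> ('w \<Rightarrow> 'a::euclidean_space) \<Rightarrow> 'v measure \<Rightarrow> ('v \<Rightarrow> 'a) \<Rightarrow> ennreal" where
  "weak_wasserstein M\<^sub>1 X\<^sub>1 M\<^sub>2 X\<^sub>2 =
     (SUP g\<in>weak_wasserstein_tests.
        ennreal \<bar>(\<integral>\<omega>. g (X\<^sub>1 \<omega>) \<partial>M\<^sub>1) - (\<integral>\<omega>. g (X\<^sub>2 \<omega>) \<partial>M\<^sub>2)\<bar>)"

section \<open>Gaussian vectors\<close>

definition gaussian_real :: "'w measure \<Rightarrow> ('w \<Rightarrow> real) \<Rightarrow> real \<Rightarrow> real \<Rightarrow> bool" where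
  "gaussian_real M X \<mu> \<sigma> \<longleftrightarrow> X \<in> borel_measurable M \<and>
     (if \<sigma> = 0 then (AE \<omega> in M. X \<omega> = \<mu>)
      else \<sigma> > 0 \<and> distributed M lborel X (\<lambda>t. ennreal (normal_density \<mu> \<sigma> t)))"

definition gaussian_vector :: "'w measure \<Rightarrow> ('w \<Rightarrow> 'a::euclidean_space) \<Rightarrow> bool" where
  "gaussian_vector M X \<longleftrightarrow>
     prob_space M \<and> X \<in> borel_measurable M \<and> (\<forall>v. \<exists>\<mu> \<sigma>. gaussian_real M (\<lambda>\<omega>. X \<omega> \<bullet> v) \<mu> \<sigma>)"

definition covariance :: "'w measure \<Rightarrow> ('w \<Rightarrow> real) \<Rightarrow> ('w \<Rightarrow> real) \<Rightarrow> real" where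
  "covariance M X Y = (\<integral>\<omega>. (X \<omega> - (\<integral>\<omega>'. X \<omega>' \<partial>M)) * (Y \<omega> - (\<integral>\<omega>'. Y \<omega>' \<partial>M)) \<partial>M)"

text \<open>The parameters \<open>va\<close>, \<open>vb\<close>, \<open>e\<close> are the entries of the covariance matrix
  of the real and imaginary parts, which may be singular.\<close>

definition centered_complex_gaussian ::
  "'w measure \<Rightarrow> ('w \<Rightarrow> complex) \<Rightarrow> real \<Rightarrow> real \<Rightarrow> real \<Rightarrow> bool" where
  "centered_complex_gaussian M Z va vb e \<longleftrightarrow>
     gaussian_vector M Z \<and>
     (\<integral>\<omega>. Re (Z \<omega>) \<partial>M) = 0 \<and> (\<integral>\<omega>. Im (Z \<omega>) \<partial>M) = 0 \<and>
     covariance M (\<lambda>\<omega>. Re (Z \<omega>)) (\<lambda>\<omega>. Re (Z \<omega>)) = va \<and>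
     covariance M (\<lambda>\<omega>. Im (Z \<omega>)) (\<lambda>\<omega>. Im (Z \<omega>)) = vb \<and>
     covariance M (\<lambda>\<omega>. Re (Z \<omega>)) (\<lambda>\<omega>. Im (Z \<omega>)) = e"

section \<open>Cycle counts and the Ewens measure\<close>

definition cycle_sets :: "nat \<Rightarrow> (nat \<Rightarrow> nat) \<Rightarrow> nat set set" where
  "cycle_sets n \<sigma> = orbit \<sigma> ` {1..n}"

definition cycle_count :: "nat \<Rightarrow> nat \<Rightarrow> (nat \<Rightarrow> nat) \<Rightarrow> nat" where
  "cycle_count n m \<sigma> = card {c \<in> cycle_sets n \<sigma>. card c = m}"

definition ewens_measure :: "real \<Rightarrow> nat \<Rightarrow> (nat \<Rightarrow> nat) measure" where
  "ewens_measure \<theta> n =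
     point_measure {\<sigma>. \<sigma> permutes {1..n}}
       (\<lambda>\<sigma>. ennreal (\<theta> ^ card (cycle_sets n \<sigma>) / pochhammer \<theta> n))"

section \<open>Points of the unit circle\<close>

definition root_of_unity :: "complex \<Rightarrow> bool" where
  "root_of_unity z \<longleftrightarrow> (\<exists>p\<ge>1. z ^ p = 1)"

definition root_order :: "complex \<Rightarrow> nat" where
  "root_order z = (LEAST p. p \<ge> 1 \<and> z ^ p = 1)"

definition dist_to_int :: "real \<Rightarrow> real" where
  "dist_to_int s = min (frac s) (1 - frac s)"

definition finite_type :: "complex \<Rightarrow> bool" where
  "finite_type x \<longleftrightarrow> (\<exists>t::real. x = cis (2 * pi * t) \<and>
     (\<exists>K>0. \<exists>\<gamma>>0. \<forall>m::int. m \<noteq> 0 \<longrightarrow>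
        dist_to_int (of_int m * t) > K / \<bar>of_int m\<bar> powr \<gamma>))"

text \<open>Only the values of \<open>f\<close> on the unit circle matter. Real analyticity is understood in the
  angular coordinate: the lifted function has a convergent power series (with complex
  coefficients) around every real point.\<close>

definition real_analytic_on_circle :: "(complex \<Rightarrow> complex) \<Rightarrow> bool" where
  "real_analytic_on_circle f \<longleftrightarrow>
     (\<forall>t\<^sub>0::real. \<exists>r>0. \<exists>c::nat \<Rightarrow> complex. \<forall>t. \<bar>t - t\<^sub>0\<bar> < r \<longrightarrow>
        (\<lambda>k. c k * of_real (t - t\<^sub>0) ^ k) sums f (cis (2 * pi * t)))"

section \<open>The statistic and its limiting parameters\<close>

text \<open>\<^const>\<open>Ln\<close> is the principal branch with imaginary part in \<open>(-\<pi>, \<pi>]\<close>, so that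
  \<open>Ln (-y) = ln y + \<i> \<pi>\<close> for \<open>y > 0\<close>. The convention \<open>log 0 = \<infinity>\<close> is not reproduced: in both
  cases considered no \<open>f (x ^ m)\<close> vanishes, and when \<open>x\<close> is not a root of unity \<open>f\<close> has only
  finitely many zeros on the circle, which the integrals do not see.\<close>

definition w_stat :: "(complex \<Rightarrow> complex) \<Rightarrow> complex \<Rightarrow> nat \<Rightarrow> (nat \<Rightarrow> nat) \<Rightarrow> complex" where
  "w_stat f x n \<sigma> = (\<Sum>m=1..n. of_nat (cycle_count n m \<sigma>) * Ln (f (x ^ m)))"

text \<open>The average of \<open>h\<close> over the orbit \<open>x, x\<^sup>2, \<dots>, x\<^sup>p\<close> if \<open>x\<close> is a root of unity of order \<open>p\<close>,
  and over the whole circle otherwise.\<close>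

definition circle_mean ::
  "complex \<Rightarrow> (complex \<Rightarrow> 'b::{banach, second_countable_topology}) \<Rightarrow> 'b" where
  "circle_mean x h =
     (if root_of_unity x
      then (1 / real (root_order x)) *\<^sub>R (\<Sum>m=1..root_order x. h (x ^ m))
      else (LINT s:{0..1}|lborel. h (cis (2 * pi * s))))"

definition m_mean :: "(complex \<Rightarrow> complex) \<Rightarrow> complex \<Rightarrow> complex" where
  "m_mean f x = circle_mean x (\<lambda>z. Ln (f z))"

definition V_a :: "(complex \<Rightarrow> complex) \<Rightarrow> complex \<Rightarrow> real" where
  "V_a f x = circle_mean x (\<lambda>z. (ln (cmod (f z)))\<^sup>2)"

definition V_b :: "(complex \<Rightarrow> complex) \<Rightarrow> complex \<Rightarrow> real" where
  "V_b f x = circle_mean x (\<lambda>z. (Im (Ln (f z)))\<^sup>2)"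

definition E_ab :: "(complex \<Rightarrow> complex) \<Rightarrow> complex \<Rightarrow> real" where
  "E_ab f x = circle_mean x (\<lambda>z. ln (cmod (f z)) * Im (Ln (f z)))"

definition normalized_w ::
  "real \<Rightarrow> (complex \<Rightarrow> complex) \<Rightarrow> complex \<Rightarrow> nat \<Rightarrow> (nat \<Rightarrow> nat) \<Rightarrow> complex" where
  "normalized_w \<theta> f x n \<sigma> =
     w_stat f x n \<sigma> / of_real (sqrt (ln (real n)))
     - of_real (\<theta> * sqrt (ln (real n))) * m_mean f x"

end

theory Submission
  imports Defs
begin

text \<open>Removing the cycle of a given point from an Ewens permutation of \<open>n\<close> points leaves an Ewens
  permutation of \<open>j\<close> points, and \<open>j\<close> has an explicit law \<open>pr n j\<close>. The expectation \<open>A n y\<close> of a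
  test function at \<open>y\<close> plus the centered statistic therefore satisfies a linear recursion, whose
  increments are \<open>Ln (f (x ^ (n - j)))\<close>. Lindeberg's method compares \<open>A n\<close> with the Gaussian
  average at time \<open>\<Sum>i<n. 1 / (\<theta> + i)\<close>, which is \<open>ln n\<close> up to a bounded error. The averages of the
  increments and of their products along the recursion are close to their means along the orbit of
  \<open>x\<close>, with a power saving in the error; in the first case this is a quantitative form of
  equidistribution, where the finite type of \<open>x\<close> controls both the rational approximations of its
  angle and the growth of \<open>Ln (f (x ^ m))\<close> at zeros of \<open>f\<close>, which are roots of unity. The Gaussian
  average smooths only along the support of the limit law; but if the covariance is degenerate, then
  all but finitely many increments lie in this support. Test functions rescaled by \<open>1 / sqrt (ln n)\<close>
  turn a bounded error into the rate of the theorem.\<close>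

section \<open>The size left after removing a cycle\<close>

text \<open>The tests control two derivatives only, whereas comparing an increment with a Gaussian
  one leaves an error of third order. The missing derivative comes from the Gaussian average itself:
  after time \<open>s\<close> the second derivative varies along the support at a rate of order
  \<open>b\<^sub>2 / sqrt s\<close>. A step has mean duration \<open>1 / \<theta>\<close>, so these
  errors sum to order \<open>b\<^sub>2 * sqrt (ln n)\<close>, like the integral of
  \<open>1 / sqrt s\<close>. Rescaling the test makes \<open>b\<^sub>1\<close> of order
  \<open>1 / sqrt (ln n)\<close> and \<open>b\<^sub>2\<close> of order \<open>1 / ln n\<close>, and
  both contributions reach the same rate. The power saving in the means matters: an error
  \<open>real n powr - e\<close> is exponentially small in the time left, so its sum over all steps
  stays bounded. A saving of only \<open>1 / ln n\<close> would leave a sum that grows with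
  \<open>n\<close>.\<close>

lemma convergent_pos_bounds:
  fixes X :: "nat \<Rightarrow> real"
  assumes "X \<longlonglongrightarrow> l" "l > 0" "\<And>n. X n > 0"
  obtains c C where "c > 0" "C > 0" "\<And>n. c \<le> X n" "\<And>n. X n \<le> C"
proof -
  obtain C where C: "\<And>n. norm (X n) \<le> C" "C > 0"
    using convergent_imp_Bseq[OF convergentI[OF assms(1)]] by (auto simp: Bseq_def)
  have "(\<lambda>n. inverse (X n)) \<longlonglongrightarrow> inverse l"
    using assms by (intro tendsto_inverse) auto
  then have "Bseq (\<lambda>n. inverse (X n))" by (intro convergent_imp_Bseq convergentI)
  then obtain B where B: "\<And>n. norm (inverse (X n)) \<le> B" "B > 0" by (auto simp: Bseq_def)
  have "inverse B \<le> X n" for n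
  proof -
    have "inverse (X n) \<le> B" "inverse (X n) > 0" using B(1)[of n] assms(3)[of n] by auto
    then show ?thesis using le_imp_inverse_le by fastforce
  qed
  moreover have "X n \<le> C" for n using C(1)[of n] by auto
  ultimately show ?thesis using that[of "inverse B" C] C B by auto
qed

lemma powr_bound_mono:
  assumes "x \<le> C * real n powr e" "e \<le> e'" "n \<ge> 1" "C \<ge> 0"
  shows "x \<le> C * real n powr e'"
proof -
  have "real n powr e \<le> real n powr e'" using assms by (intro powr_mono) auto
  then show ?thesis using assms by (meson mult_left_mono order_trans)
qed

lemma power_diff_le:
  fixes x y :: real
  assumes "0 \<le> y" "y \<le> x"
  shows "x ^ Suc k - y ^ Suc k \<le> real (Suc k) * (x - y) * x ^ k"
proof (induction k)
  case (Suc k)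
  have "x ^ Suc (Suc k) - y ^ Suc (Suc k) = x * (x ^ Suc k - y ^ Suc k) + (x - y) * y ^ Suc k"
    by (simp add: algebra_simps)
  also have "\<dots> \<le> x * (real (Suc k) * (x - y) * x ^ k) + (x - y) * x ^ Suc k"
    using assms Suc by (intro add_mono mult_left_mono power_mono) auto
  also have "\<dots> = real (Suc (Suc k)) * (x - y) * x ^ Suc k"
    by (simp add: algebra_simps)
  finally show ?case .
qed auto

text \<open>The two clauses serve different ranges of the remaining size: the mean with a power
  saving is summed by parts, and the growth bound covers the range where the weights may be
  singular. The first clause by itself bounds \<open>H m\<close> only by a multiple of
  \<open>real m powr (1 - \<delta>)\<close>.\<close>

definition power_mean :: "(nat \<Rightarrow> real) \<Rightarrow> real \<Rightarrow> bool" where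
  "power_mean H \<mu> \<longleftrightarrow>
     (\<exists>\<delta>>0. \<delta> \<le> 1 \<and> (\<exists>C. \<forall>k\<ge>1. \<bar>(\<Sum>m=1..k. H m) - real k * \<mu>\<bar> \<le> C * real k powr (1 - \<delta>))) \<and>
     (\<forall>\<eta>>0. \<exists>B. \<forall>m\<ge>1. \<bar>H m\<bar> \<le> B * real m powr \<eta>)"

locale ewens =
  fixes \<theta> :: real
  assumes theta_pos: "\<theta> > 0"
begin

text \<open>The coefficients of \<open>(1 - z) powr - \<theta>\<close>: the total Ewens weight of
  the permutations of \<open>j\<close> points, divided by the number of these permutations.\<close>

definition wt :: "nat \<Rightarrow> real" where "wt j = pochhammer \<theta> j / fact j"

text \<open>\<open>\<theta> * time n\<close> is the mean number of cycles of an Ewens permutation of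
  \<open>n\<close> points. On this clock the removal of a cycle has mean duration exactly
  \<open>1 / \<theta>\<close>, and size 0 has time 0, where a logarithm would be singular.\<close>

definition time :: "nat \<Rightarrow> real" where "time n = (\<Sum>i<n. 1 / (\<theta> + real i))"

definition pr :: "nat \<Rightarrow> nat \<Rightarrow> real" where "pr n j = \<theta> * wt j / (real n * wt n)"

definition gap :: "nat \<Rightarrow> nat \<Rightarrow> real" where "gap n j = time n - time j"

lemma wt_pos: "wt j > 0"
  by (simp add: wt_def pochhammer_pos theta_pos)

lemma wt_Suc: "real (Suc j) * wt (Suc j) = (\<theta> + real j) * wt j"
proof -
  have "real (Suc j) * wt (Suc j) = real (Suc j) * (pochhammer \<theta> j * (\<theta> + real j)) / (real (Suc j) * fact j)"
    by (simp add: wt_def pochhammer_Suc)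
  also have "\<dots> = (\<theta> + real j) * wt j" by (simp add: wt_def del: of_nat_Suc)
  finally show ?thesis .
qed

lemma sum_wt: "(\<Sum>j<n. wt j) = real n * wt n / \<theta>"
proof (induction n)
  case (Suc n)
  then show ?case using wt_Suc[of n] theta_pos by (simp add: field_simps)
qed auto

text \<open>Summation by parts against \<open>sum_wt\<close>. The weights reappear on the right
  because \<open>real (Suc i) * wt (Suc i)\<close> is a multiple of \<open>wt i\<close>. The factor
  \<open>\<theta> + real i\<close> is the inverse of one increment of \<open>time\<close>, so powers
  of \<open>gap\<close> reduce to lower powers.\<close>

lemma abel_wt:
  "(\<Sum>j<n. wt j * f j) = f n * (real n * wt n / \<theta>) + (\<Sum>i<n. wt i * ((f i - f (Suc i)) * (\<theta> + real i) / \<theta>))"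
proof (induction n)
  case (Suc n)
  have "f (Suc n) * (real (Suc n) * wt (Suc n) / \<theta>) + wt n * ((f n - f (Suc n)) * (\<theta> + real n) / \<theta>)
      = f n * (real n * wt n / \<theta>) + wt n * f n"
    unfolding wt_Suc using theta_pos by (simp add: field_simps)
  then show ?case using Suc by simp
qed auto

lemma pr_pos: "n \<ge> 1 \<Longrightarrow> pr n j > 0"
  by (simp add: pr_def wt_pos theta_pos)

lemma sum_pr: "n \<ge> 1 \<Longrightarrow> (\<Sum>j<k. pr n j) = real k * wt k / (real n * wt n)"
  unfolding pr_def sum_divide_distrib[symmetric] sum_distrib_left[symmetric] sum_wt
  using theta_pos by simp

lemma sum_pr_1: "n \<ge> 1 \<Longrightarrow> (\<Sum>j<n. pr n j) = 1"
  using sum_pr[of n n] wt_pos[of n] by simp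

lemma abel_pr:
  assumes "n \<ge> 1"
  shows "(\<Sum>j<n. pr n j * f j) = f n + (\<Sum>i<n. pr n i * ((f i - f (Suc i)) * (\<theta> + real i) / \<theta>))"
proof -
  have *: "(\<Sum>j<n. pr n j * g j) = \<theta> / (real n * wt n) * (\<Sum>j<n. wt j * g j)" for g
    unfolding pr_def sum_distrib_left by (intro sum.cong) auto
  show ?thesis unfolding * abel_wt[of f n] using assms wt_pos[of n] theta_pos by (simp add: field_simps)
qed

lemma gap_step: "gap n i - gap n (Suc i) = 1 / (\<theta> + real i)"
  by (simp add: gap_def time_def)

lemma time_mono: "i \<le> j \<Longrightarrow> time i \<le> time j"
  unfolding time_def using theta_pos by (intro sum_mono2) auto

lemma time_nonneg: "time i \<ge> 0"
  unfolding time_def using theta_pos by (intro sum_nonneg) auto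

lemma gap_nonneg: "j \<le> n \<Longrightarrow> gap n j \<ge> 0"
  using time_mono[of j n] by (simp add: gap_def)

lemma gap_antimono: "i \<le> j \<Longrightarrow> gap n j \<le> gap n i"
  using time_mono[of i j] by (simp add: gap_def)

lemma gap_le: "gap n j \<le> time n"
  using time_nonneg[of j] by (simp add: gap_def)

lemma gap_self [simp]: "gap n n = 0" by (simp add: gap_def)

text \<open>Summation by parts turns each difference of \<open>gap\<close> into the constant
  \<open>1 / \<theta>\<close>. The cancellations of drift and of variance in
  \<open>lindeberg\<close> rest on this value being exact.\<close>

lemma sum_pr_gap: "n \<ge> 1 \<Longrightarrow> (\<Sum>j<n. pr n j * gap n j) = 1 / \<theta>"
proof -
  assume n: "n \<ge> 1"
  have "(\<Sum>j<n. pr n j * gap n j) = (\<Sum>i<n. pr n i * (1 / \<theta>))"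
    unfolding abel_pr[OF n, of "gap n"] gap_step
    using theta_pos by (auto intro!: sum.cong simp: add_pos_nonneg[THEN less_imp_neq, THEN not_sym])
  also have "\<dots> = 1 / \<theta>" using sum_pr_1[OF n] by (simp flip: sum_divide_distrib)
  finally show ?thesis .
qed

text \<open>\<open>2 / \<theta>\<^sup>2\<close> is the second moment of the exponential law of rate
  \<theta>. The correction stems from the squares of the single increments
  \<open>1 / (\<theta> + real i)\<close>; by \<open>sum_pr_over_size\<close> it decays like a power
  of \<open>n\<close>.\<close>

lemma sum_pr_gap_sq:
  assumes n: "n \<ge> 1"
  shows "(\<Sum>j<n. pr n j * gap n j ^ 2) = 2 / \<theta>\<^sup>2 - (\<Sum>i<n. pr n i / (\<theta> + real i)) / \<theta>"
proof -
  have *: "(gap n i ^ 2 - gap n (Suc i) ^ 2) * (\<theta> + real i) / \<theta>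
      = 2 / \<theta> * gap n i - 1 / (\<theta> + real i) / \<theta>" for i
  proof -
    have g: "gap n (Suc i) = gap n i - 1 / (\<theta> + real i)" using gap_step[of n i] by simp
    have t: "\<theta> + real i > 0" using theta_pos by simp
    have "(gap n i ^ 2 - gap n (Suc i) ^ 2) = 1 / (\<theta> + real i) * (2 * gap n i - 1 / (\<theta> + real i))"
      unfolding g by (simp add: power2_eq_square algebra_simps)
    then have "(gap n i ^ 2 - gap n (Suc i) ^ 2) * (\<theta> + real i) = 2 * gap n i - 1 / (\<theta> + real i)"
      using t by simp
    then show ?thesis by (simp add: diff_divide_distrib)
  qed
  have "(\<Sum>j<n. pr n j * gap n j ^ 2) = (\<Sum>i<n. 2 / \<theta> * (pr n i * gap n i) - (pr n i / (\<theta> + real i)) / \<theta>)"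
    unfolding abel_pr[OF n, of "\<lambda>j. gap n j ^ 2"] * by (simp add: algebra_simps)
  also have "\<dots> = 2 / \<theta> * (\<Sum>i<n. pr n i * gap n i) - (\<Sum>i<n. pr n i / (\<theta> + real i)) / \<theta>"
    by (simp add: sum_subtractf sum_distrib_left sum_divide_distrib)
  finally show ?thesis using sum_pr_gap[OF n] by (simp add: power2_eq_square)
qed

text \<open>\<open>fact k / \<theta> ^ k\<close> is the \<open>k\<close>-th moment of the
  exponential law of rate \<theta>. A difference of consecutive powers is at most the tangent bound
  at the larger value, so the recursion of these moments holds as an inequality.\<close>

lemma sum_pr_gap_power:
  assumes n: "n \<ge> 1"
  shows "(\<Sum>j<n. pr n j * gap n j ^ k) \<le> fact k / \<theta> ^ k"
proof (induction k)
  case 0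
  then show ?case using sum_pr_1[OF n] by simp
next
  case (Suc k)
  have *: "(gap n i ^ Suc k - gap n (Suc i) ^ Suc k) * (\<theta> + real i) / \<theta> \<le> real (Suc k) / \<theta> * gap n i ^ k"
    if "i < n" for i
  proof -
    have t: "\<theta> + real i > 0" using theta_pos by simp
    have "gap n i ^ Suc k - gap n (Suc i) ^ Suc k \<le> real (Suc k) * (gap n i - gap n (Suc i)) * gap n i ^ k"
      using that by (intro power_diff_le gap_nonneg gap_antimono) auto
    then have "(gap n i ^ Suc k - gap n (Suc i) ^ Suc k) * (\<theta> + real i)
        \<le> (real (Suc k) * (gap n i - gap n (Suc i)) * gap n i ^ k) * (\<theta> + real i)"
      using t by (intro mult_right_mono) auto
    also have "\<dots> = real (Suc k) * gap n i ^ k" unfolding gap_step using t by simp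
    finally show ?thesis using theta_pos by (simp add: divide_right_mono)
  qed
  have "(\<Sum>j<n. pr n j * gap n j ^ Suc k) =
     (\<Sum>i<n. pr n i * ((gap n i ^ Suc k - gap n (Suc i) ^ Suc k) * (\<theta> + real i) / \<theta>))"
    using abel_pr[OF n, of "\<lambda>j. gap n j ^ Suc k"] by simp
  also have "\<dots> \<le> (\<Sum>i<n. pr n i * (real (Suc k) / \<theta> * gap n i ^ k))"
    using * pr_pos[OF n] by (intro sum_mono mult_left_mono) (auto simp: less_imp_le)
  also have "\<dots> = real (Suc k) / \<theta> * (\<Sum>i<n. pr n i * gap n i ^ k)"
    by (simp add: sum_distrib_left mult_ac)
  also have "\<dots> \<le> real (Suc k) / \<theta> * (fact k / \<theta> ^ k)"
    using Suc theta_pos by (intro mult_left_mono) auto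
  finally show ?case by simp
qed

section \<open>Asymptotics of the time scale and of the weights\<close>

lemma time_bounds:
  assumes "n \<ge> 1"
  shows "ln (\<theta> + real n) - ln \<theta> \<le> time n" "time n \<le> 1 / \<theta> + ln (\<theta> + real n) - ln \<theta>"
proof -
  have t: "\<theta> + real i > 0" for i using theta_pos by (simp add: add_pos_nonneg)
  have step: "1 / (\<theta> + real (Suc n)) \<le> ln (\<theta> + real (Suc n)) - ln (\<theta> + real n)"
     "ln (\<theta> + real (Suc n)) - ln (\<theta> + real n) \<le> 1 / (\<theta> + real n)" for n
  proof -
    have "ln (\<theta> + real (Suc n)) - ln (\<theta> + real n) = ln ((\<theta> + real (Suc n)) / (\<theta> + real n))"
      using t[of n] t[of "Suc n"] by (simp add: ln_div)
    also have "\<dots> \<le> (\<theta> + real (Suc n)) / (\<theta> + real n) - 1"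
      using t[of n] t[of "Suc n"] by (intro ln_le_minus_one) (simp del: of_nat_Suc)
    also have "\<dots> = 1 / (\<theta> + real n)" using t[of n] by (simp add: field_simps)
    finally show "ln (\<theta> + real (Suc n)) - ln (\<theta> + real n) \<le> 1 / (\<theta> + real n)" .
    have "ln (\<theta> + real n) - ln (\<theta> + real (Suc n)) = ln ((\<theta> + real n) / (\<theta> + real (Suc n)))"
      using t[of n] t[of "Suc n"] by (simp add: ln_div)
    also have "\<dots> \<le> (\<theta> + real n) / (\<theta> + real (Suc n)) - 1"
      using t[of n] t[of "Suc n"] by (intro ln_le_minus_one) (simp del: of_nat_Suc)
    also have "\<dots> = - 1 / (\<theta> + real (Suc n))" using t[of "Suc n"] by (simp add: field_simps)
    finally show "1 / (\<theta> + real (Suc n)) \<le> ln (\<theta> + real (Suc n)) - ln (\<theta> + real n)" by simp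
  qed
  have "ln (\<theta> + real n) - ln \<theta> \<le> time n" for n
  proof (induction n)
    case (Suc n)
    then show ?case using step(2)[of n] by (simp add: time_def)
  qed (simp add: time_def)
  then show "ln (\<theta> + real n) - ln \<theta> \<le> time n" .
  \<comment> \<open>The first summand \<open>1 / \<theta>\<close> is kept apart, since comparing the
    others with a logarithm shifts the index by one.\<close>
  have *: "time (Suc n) \<le> 1 / \<theta> + ln (\<theta> + real n) - ln \<theta>" for n
  proof (induction n)
    case (Suc n)
    then show ?case using step(1)[of n] by (simp add: time_def)
  qed (simp add: time_def)
  obtain k where "n = Suc k" using assms by (cases n) auto
  then show "time n \<le> 1 / \<theta> + ln (\<theta> + real n) - ln \<theta>"
    using *[of k] t[of k] t[of n] by (smt (verit) ln_le_cancel_iff of_nat_Suc)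
qed

lemma time_ln: "\<exists>C. \<forall>n\<ge>1. \<bar>time n - ln (real n)\<bar> \<le> C"
proof (intro exI allI impI)
  fix n :: nat assume n: "n \<ge> 1"
  have "ln (real n) \<le> ln (\<theta> + real n)" using theta_pos n by simp
  moreover have "ln (\<theta> + real n) \<le> ln ((1 + \<theta>) * real n)"
    using theta_pos n by (intro ln_mono) (auto simp: algebra_simps)
  moreover have "\<dots> = ln (1 + \<theta>) + ln (real n)" using theta_pos n by (simp add: ln_mult)
  ultimately show "\<bar>time n - ln (real n)\<bar> \<le> 1 / \<theta> + \<bar>ln \<theta>\<bar> + ln (1 + \<theta>)"
    using time_bounds[OF n] theta_pos by (smt (verit) divide_pos_pos ln_gt_zero)
qed

text \<open>Lets powers of \<open>gap\<close> be absorbed like a sequence of subpolynomial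
  growth.\<close>

lemma time_powr_bound:
  assumes "\<eta> > 0"
  obtains C where "C > 0" "\<And>n. n \<ge> 1 \<Longrightarrow> 1 + time n \<le> C * real n powr \<eta>"
proof -
  obtain C where C: "\<And>n. n \<ge> 1 \<Longrightarrow> \<bar>time n - ln (real n)\<bar> \<le> C" using time_ln by blast
  have "1 + time n \<le> (1 + \<bar>C\<bar> + 1 / \<eta>) * real n powr \<eta>" if n: "n \<ge> 1" for n
  proof -
    have 1: "1 \<le> real n powr \<eta>" using n assms by (simp add: ge_one_powr_ge_zero)
    have "\<eta> * ln (real n) = ln (real n powr \<eta>)" using n by (simp add: ln_powr)
    also have "\<dots> \<le> real n powr \<eta>" using n by (intro ln_bound) auto
    finally have "ln (real n) \<le> 1 / \<eta> * real n powr \<eta>" using assms by (simp add: field_simps)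
    moreover have "1 + \<bar>C\<bar> \<le> (1 + \<bar>C\<bar>) * real n powr \<eta>"
      using mult_left_mono[OF 1, of "1 + \<bar>C\<bar>"] by simp
    ultimately show ?thesis using C[OF n] by (simp add: algebra_simps)
  qed
  then show ?thesis using that[of "1 + \<bar>C\<bar> + 1 / \<eta>"] assms by (simp add: add_pos_nonneg)
qed

text \<open>\<open>wt n\<close> behaves like
  \<open>real n powr (\<theta> - 1) / Gamma \<theta>\<close>: the quotient is positive and tends to
  the positive limit \<open>rGamma \<theta>\<close>, which bounds it on both sides.
  \<open>Suc n\<close> stands in the power so that \<open>n = 0\<close> is included.\<close>

lemma wt_bounds:
  obtains c C where "c > 0" "C > 0" "\<And>n. c * real (Suc n) powr (\<theta> - 1) \<le> wt n"
    "\<And>n. wt n \<le> C * real (Suc n) powr (\<theta> - 1)"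
proof -
  define X where "X n = wt n / real (Suc n) powr (\<theta> - 1)" for n
  \<comment> \<open>\<open>rGamma_series\<close> carries one more factor
    \<open>\<theta> + real n\<close> and a power of \<open>n\<close> itself; the second factor, with
    limit 1, converts it into \<open>X n\<close>.\<close>
  have lim: "(\<lambda>n. rGamma_series \<theta> n * ((real (n + 1) / (\<theta> + real n)) * (real n / real (n + 1)) powr \<theta>))
      \<longlonglongrightarrow> rGamma \<theta> * (1 * 1 powr \<theta>)"
  proof (intro tendsto_mult)
    show "(\<lambda>n. rGamma_series \<theta> n) \<longlonglongrightarrow> rGamma \<theta>" by (rule rGamma_series_LIMSEQ)
    show "(\<lambda>n. real (n + 1) / (\<theta> + real n)) \<longlonglongrightarrow> 1" by real_asymp
    have "(\<lambda>n. real n / real (n + 1)) \<longlonglongrightarrow> 1" by real_asymp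
    then show "(\<lambda>n. (real n / real (n + 1)) powr \<theta>) \<longlonglongrightarrow> 1 powr \<theta>"
      by (intro tendsto_powr) auto
  qed
  have "eventually (\<lambda>n. rGamma_series \<theta> n * ((real (n + 1) / (\<theta> + real n)) * (real n / real (n + 1)) powr \<theta>) = X n) sequentially"
    using eventually_gt_at_top[of 0]
  proof eventually_elim
    case (elim n)
    have t: "\<theta> + real n > 0" using theta_pos by simp
    have e: "exp (\<theta> * ln (real n)) = real n powr \<theta>" using elim by (simp add: powr_def)
    have "X n = wt n * real (Suc n) / real (Suc n) powr \<theta>"
      unfolding X_def by (simp add: powr_diff)
    moreover have "rGamma_series \<theta> n = wt n * (\<theta> + real n) / real n powr \<theta>"
      unfolding rGamma_series_def wt_def using e by (simp add: pochhammer_Suc)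
    moreover have "(real n / real (n + 1)) powr \<theta> = real n powr \<theta> / real (Suc n) powr \<theta>"
      by (simp add: powr_divide)
    ultimately show ?case using t elim by simp
  qed
  from Lim_transform_eventually[OF lim this] have "X \<longlonglongrightarrow> rGamma \<theta>" by simp
  moreover have "rGamma \<theta> > 0" using Gamma_real_pos[OF theta_pos] by (simp add: rGamma_inverse_Gamma)
  moreover have "X n > 0" for n by (simp add: X_def wt_pos)
  ultimately obtain c C where c: "c > 0" "C > 0" "\<And>n. c \<le> X n" "\<And>n. X n \<le> C"
    using convergent_pos_bounds by metis
  show ?thesis
  proof (rule that[OF c(1,2)])
    fix n
    have p: "real (Suc n) powr (\<theta> - 1) > 0" by simp
    show "c * real (Suc n) powr (\<theta> - 1) \<le> wt n" using c(3)[of n] p unfolding X_def by (simp add: field_simps)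
    show "wt n \<le> C * real (Suc n) powr (\<theta> - 1)" using c(4)[of n] p unfolding X_def by (simp add: field_simps)
  qed
qed

text \<open>Both bounds are used at \<open>k \<approx> n powr (1 - \<kappa>)\<close>: the first controls the remaining sizes below
  \<open>k\<close>, and the second removes the singularity of the weights at remaining size \<open>0\<close> when \<open>\<theta> < 1\<close>.\<close>

lemma pr_bounds:
  obtains C where "C > 0"
    "\<And>n k. 1 \<le> n \<Longrightarrow> k \<le> n \<Longrightarrow> (\<Sum>j<k. pr n j) \<le> C * (real (Suc k) / real (Suc n)) powr \<theta>"
    "\<And>n k j. 1 \<le> n \<Longrightarrow> k \<le> j \<Longrightarrow> j < n \<Longrightarrow> pr n j \<le> C / real (Suc k)"
proof -
  obtain c C where c: "c > 0" "C > 0" "\<And>n. c * real (Suc n) powr (\<theta> - 1) \<le> wt n"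
    "\<And>n. wt n \<le> C * real (Suc n) powr (\<theta> - 1)" using wt_bounds by metis
  have ratio: "wt k / wt n \<le> C / c * (real (Suc k) / real (Suc n)) powr (\<theta> - 1)" for k n
  proof -
    have "wt k / wt n \<le> C * real (Suc k) powr (\<theta> - 1) / (c * real (Suc n) powr (\<theta> - 1))"
      using c(1,2) c(3)[of n] c(4)[of k] by (intro frac_le) auto
    then show ?thesis by (simp add: powr_divide)
  qed
  have 1: "(\<Sum>j<k. pr n j) \<le> C / c * (real (Suc k) / real (Suc n)) powr \<theta>" if "1 \<le> n" "k \<le> n" for n k
  proof -
    have "(\<Sum>j<k. pr n j) = real k / real n * (wt k / wt n)" using sum_pr[OF that(1)] by simp
    also have "\<dots> \<le> (real (Suc k) / real (Suc n)) * (C / c * (real (Suc k) / real (Suc n)) powr (\<theta> - 1))"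
      using that c ratio[of k n] wt_pos[of k] wt_pos[of n]
      by (intro mult_mono) (auto simp: field_simps)
    also have "\<dots> = C / c * (real (Suc k) / real (Suc n)) powr \<theta>"
      by (simp add: powr_diff)
    finally show ?thesis .
  qed
  have 2: "pr n j \<le> 2 * \<theta> * (C / c) / real (Suc k)" if "1 \<le> n" "k \<le> j" "j < n" for n k j
  proof -
    have r: "0 < real (Suc j) / real (Suc n)" "real (Suc j) / real (Suc n) \<le> 1"
      using that by auto
    have "pr n j = \<theta> / real n * (wt j / wt n)" by (simp add: pr_def)
    also have "\<dots> \<le> \<theta> / real n * (C / c * (real (Suc j) / real (Suc n)) powr (\<theta> - 1))"
      using ratio theta_pos by (intro mult_left_mono) auto
    \<comment> \<open>The base is at most 1 and the exponent \<open>\<theta> - 1\<close> is at least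
      \<open>- 1\<close>, so the exponent \<open>- 1\<close> bounds increasing and decreasing
      weights alike.\<close>
    also have "\<dots> \<le> \<theta> / real n * (C / c * (real (Suc j) / real (Suc n)) powr (- 1))"
      using r theta_pos c by (intro mult_left_mono powr_mono') auto
    also have "\<dots> = \<theta> * (C / c) * (real (Suc n) / real n / real (Suc j))"
      using r by (simp add: powr_minus_divide mult_ac)
    also have "\<dots> \<le> \<theta> * (C / c) * (2 / real (Suc k))"
      using that theta_pos c by (intro mult_left_mono frac_le) (auto simp: field_simps)
    finally show ?thesis by (simp add: mult_ac)
  qed
  define K where "K = max (C / c) (2 * \<theta> * (C / c))"
  have K: "C / c \<le> K" "2 * \<theta> * (C / c) \<le> K" "K > 0"
    using c theta_pos by (auto simp: K_def less_max_iff_disj)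
  show ?thesis
  proof (rule that[OF K(3)])
    show "(\<Sum>j<k. pr n j) \<le> K * (real (Suc k) / real (Suc n)) powr \<theta>" if "1 \<le> n" "k \<le> n" for n k
      using 1[OF that] K(1) by (meson mult_right_mono order_trans powr_ge_zero)
    show "pr n j \<le> K / real (Suc k)" if "1 \<le> n" "k \<le> j" "j < n" for n k j
      using 2[OF that] K(2) by (meson divide_right_mono of_nat_0_le_iff order_trans)
  qed
qed

section \<open>Averages of a sequence over one step of the recursion\<close>

lemma pr_monotone:
  "(\<forall>i j. i \<le> j \<longrightarrow> pr n i \<le> pr n j) \<or> (\<forall>i j. i \<le> j \<longrightarrow> pr n j \<le> pr n i)"
proof -
  have wtS: "wt (Suc j) = (\<theta> + real j) / (1 + real j) * wt j" for j
    using wt_Suc[of j] by (simp add: field_simps)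
  define D where "D = \<theta> / (real n * wt n)"
  have p: "pr n i = D * wt i" for i by (simp add: pr_def D_def)
  have nn: "D \<ge> 0" using theta_pos wt_pos[of n] by (simp add: D_def)
  show ?thesis
  proof (cases "\<theta> \<ge> 1")
    case True
    have "wt j \<le> wt (Suc j)" for j
      using True wt_pos[of j] mult_right_mono[of 1 "(\<theta> + real j) / (1 + real j)" "wt j"] by (simp add: wtS)
    then have "i \<le> j \<Longrightarrow> wt i \<le> wt j" for i j by (rule lift_Suc_mono_le)
    then show ?thesis unfolding p using nn mult_left_mono by blast
  next
    case False
    have "wt (Suc j) \<le> wt j" for j
      using False theta_pos wt_pos[of j] mult_right_mono[of "(\<theta> + real j) / (1 + real j)" 1 "wt j"] by (simp add: wtS)
    then have "i \<le> j \<Longrightarrow> wt j \<le> wt i" for i j by (rule lift_Suc_antimono_le)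
    then show ?thesis unfolding p using nn mult_left_mono by blast
  qed
qed


text \<open>Away from remaining size 0 the weights vary slowly, so summation by parts uses only the
  partial sums of \<open>H m - \<mu>\<close>, which have a power saving. Remaining sizes below
  \<open>k\<close> have total probability of order at most
  \<open>real n powr (- \<kappa> * \<theta>)\<close>, and there the subpolynomial growth of
  \<open>H\<close> and of \<open>gap\<close> suffices.\<close>

lemma pr_moment_bound:
  assumes "power_mean H \<mu>" "r \<le> 1"
  shows "\<exists>C. \<exists>\<delta>>0. \<forall>n\<ge>1. \<bar>\<Sum>j<n. pr n j * gap n j ^ r * (H (n - j) - \<mu>)\<bar> \<le> C * real n powr - \<delta>"
proof -
  obtain \<delta> C where \<delta>: "\<delta> > 0" "\<delta> \<le> 1"
    and C: "\<And>k. k \<ge> 1 \<Longrightarrow> \<bar>(\<Sum>m=1..k. H m) - real k * \<mu>\<bar> \<le> C * real k powr (1 - \<delta>)"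
    using assms(1) by (auto simp: power_mean_def)
  \<comment> \<open>The sizes below \<open>k\<close> cost
    \<open>real n powr (- \<kappa> * \<theta> + 2 * \<eta>)\<close>, the others
    \<open>real n powr (\<kappa> - \<delta> + \<eta>)\<close>. With \<kappa> equal to
    \<open>\<delta> / 2\<close> and this \<eta> both exponents are at most
    \<open>- \<delta>'\<close>.\<close>
  define \<kappa> where "\<kappa> = \<delta> / 2"
  define \<eta> where "\<eta> = min (\<kappa> * \<theta>) (\<delta> / 2) / 4"
  have pos: "\<kappa> > 0" "\<kappa> < 1" "\<eta> > 0" using \<delta> theta_pos by (auto simp: \<kappa>_def \<eta>_def)
  define \<delta>' where "\<delta>' = min (\<kappa> * \<theta> / 2) (\<delta> / 4)"
  have \<delta>': "\<delta>' > 0" using pos \<delta> theta_pos by (auto simp: \<delta>'_def)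
  obtain B where B: "\<And>m. m \<ge> 1 \<Longrightarrow> \<bar>H m\<bar> \<le> B * real m powr \<eta>"
    using assms(1) pos(3) unfolding power_mean_def by blast
  obtain T where T: "T > 0" "\<And>n. n \<ge> 1 \<Longrightarrow> 1 + time n \<le> T * real n powr \<eta>"
    using time_powr_bound[OF pos(3)] by metis
  obtain K where K: "K > 0"
    "\<And>n k. 1 \<le> n \<Longrightarrow> k \<le> n \<Longrightarrow> (\<Sum>j<k. pr n j) \<le> K * (real (Suc k) / real (Suc n)) powr \<theta>"
    "\<And>n k j. 1 \<le> n \<Longrightarrow> k \<le> j \<Longrightarrow> j < n \<Longrightarrow> pr n j \<le> K / real (Suc k)"
    using pr_bounds by metis
  define C\<^sub>1 where "C\<^sub>1 = K * 2 powr \<theta> * T * (\<bar>B\<bar> + \<bar>\<mu>\<bar>)"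
  define C\<^sub>2 where "C\<^sub>2 = 4 * K * T * \<bar>C\<bar>"
  have Cpos: "C\<^sub>1 \<ge> 0" "C\<^sub>2 \<ge> 0" using K(1) T(1) by (auto simp: C\<^sub>1_def C\<^sub>2_def)
  show ?thesis
  proof (rule exI[of _ "C\<^sub>1 + C\<^sub>2"], rule exI[of _ \<delta>'], intro conjI allI impI)
    show "\<delta>' > 0" by fact
    fix n :: nat assume n: "n \<ge> 1"
    define k where "k = nat \<lfloor>real n powr (1 - \<kappa>)\<rfloor>"
    have np: "real n powr (1 - \<kappa>) \<ge> 1" using n pos by (simp add: ge_one_powr_ge_zero)
    have "real n powr (1 - \<kappa>) \<le> real n powr 1" using n pos by (intro powr_mono) auto
    then have kn: "k \<le> n" unfolding k_def using n by (simp add: nat_le_iff floor_le_iff)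
    have k1: "real n powr (1 - \<kappa>) \<le> real (Suc k)" unfolding k_def using np by linarith
    have k2: "real (Suc k) \<le> 2 * real n powr (1 - \<kappa>)" unfolding k_def using np by linarith
    define h where "h m = H m - \<mu>" for m
    define D where "D i = (\<Sum>m=1..i. h m)" for i
    have D: "\<bar>D i\<bar> \<le> \<bar>C\<bar> * real n powr (1 - \<delta>)" if "i \<le> n" for i
    proof (cases "i = 0")
      case False
      have "\<bar>D i\<bar> \<le> C * real i powr (1 - \<delta>)"
        using C[of i] False by (simp add: D_def h_def sum_subtractf)
      also have "\<dots> \<le> \<bar>C\<bar> * real n powr (1 - \<delta>)"
        using that \<delta> by (intro mult_mono powr_mono2) auto
      finally show ?thesis .
    qed (simp add: D_def)
    define w where "w j = pr n j * gap n j ^ r" for j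
    define G where "G = T * real n powr \<eta>"
    have G: "gap n j ^ r \<le> G" "gap n j ^ r \<ge> 0" "G \<ge> 0" if "j \<le> n" for j
    proof -
      have "gap n j ^ r \<le> 1 + gap n j" using gap_nonneg[OF that] assms(2) by (cases r) auto
      also have "\<dots> \<le> G" using gap_le[of n j] T(2)[OF n] unfolding G_def by linarith
      finally show "gap n j ^ r \<le> G" .
    qed (use gap_nonneg[OF that] T in \<open>auto simp: G_def\<close>)
    have split: "(\<Sum>j<n. w j * h (n - j)) = (\<Sum>j<k. w j * h (n - j)) + (\<Sum>j=k..<n. w j * h (n - j))"
      using kn by (metis (no_types, lifting) atLeast0LessThan sum.atLeastLessThan_concat zero_le)
    have h: "\<bar>h m\<bar> \<le> (\<bar>B\<bar> + \<bar>\<mu>\<bar>) * real n powr \<eta>" if "1 \<le> m" "m \<le> n" for m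
    proof -
      have 1: "1 \<le> real n powr \<eta>" using n pos by (simp add: ge_one_powr_ge_zero)
      have "\<bar>H m\<bar> \<le> B * real m powr \<eta>" by (rule B[OF that(1)])
      also have "\<dots> \<le> \<bar>B\<bar> * real n powr \<eta>" using that pos by (intro mult_mono powr_mono2) auto
      finally have "\<bar>H m\<bar> \<le> \<bar>B\<bar> * real n powr \<eta>" .
      moreover have "\<bar>\<mu>\<bar> \<le> \<bar>\<mu>\<bar> * real n powr \<eta>" using mult_left_mono[OF 1, of "\<bar>\<mu>\<bar>"] by simp
      ultimately show ?thesis unfolding h_def by (simp add: algebra_simps)
    qed
    have "\<bar>\<Sum>j<k. w j * h (n - j)\<bar> \<le> (\<Sum>j<k. pr n j * (G * ((\<bar>B\<bar> + \<bar>\<mu>\<bar>) * real n powr \<eta>)))"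
    proof (rule order.trans[OF sum_abs sum_mono])
      fix j assume "j \<in> {..<k}"
      then have j: "j < n" using kn by auto
      show "\<bar>w j * h (n - j)\<bar> \<le> pr n j * (G * ((\<bar>B\<bar> + \<bar>\<mu>\<bar>) * real n powr \<eta>))"
        unfolding w_def abs_mult mult.assoc using j n G[of j] h[of "n - j"] pr_pos[OF n, of j]
        by (intro mult_mono) auto
    qed
    also have "\<dots> = (\<Sum>j<k. pr n j) * (G * ((\<bar>B\<bar> + \<bar>\<mu>\<bar>) * real n powr \<eta>))"
      by (simp add: sum_distrib_right)
    also have "\<dots> \<le> (K * (2 powr \<theta> * real n powr (- \<kappa> * \<theta>))) * (G * ((\<bar>B\<bar> + \<bar>\<mu>\<bar>) * real n powr \<eta>))"
    proof (rule mult_right_mono)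
      have "real (Suc k) / real (Suc n) \<le> 2 * real n powr (1 - \<kappa>) / real n"
        using k2 n by (intro frac_le) auto
      also have "\<dots> = 2 * real n powr (- \<kappa>)" using n by (simp add: powr_diff powr_minus_divide)
      finally have "(real (Suc k) / real (Suc n)) powr \<theta> \<le> (2 * real n powr (- \<kappa>)) powr \<theta>"
        using theta_pos by (intro powr_mono2) auto
      also have "\<dots> = 2 powr \<theta> * real n powr (- \<kappa> * \<theta>)" by (simp add: powr_mult powr_powr)
      finally show "(\<Sum>j<k. pr n j) \<le> K * (2 powr \<theta> * real n powr (- \<kappa> * \<theta>))"
        using K(1) K(2)[OF n kn] by (meson mult_left_mono less_imp_le order_trans)
    qed (use G(3)[of n] in auto)
    also have "\<dots> = C\<^sub>1 * (real n powr (- \<kappa> * \<theta>) * (real n powr \<eta> * real n powr \<eta>))"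
      by (simp add: C\<^sub>1_def G_def)
    also have "\<dots> = C\<^sub>1 * real n powr (- \<kappa> * \<theta> + 2 * \<eta>)"
      by (metis powr_add mult_2)
    finally have A: "\<bar>\<Sum>j<k. w j * h (n - j)\<bar> \<le> C\<^sub>1 * real n powr - \<delta>'"
      by (rule powr_bound_mono) (use n Cpos in \<open>auto simp: \<eta>_def \<delta>'_def min_def\<close>)
    define P where "P = K / real (Suc k)"
    have P: "pr n j \<le> P" "0 \<le> pr n j" if "k \<le> j" "j < n" for j
      using K(3)[OF n that] pr_pos[OF n, of j] by (auto simp: P_def)
    have P0: "P \<ge> 0" using K(1) by (simp add: P_def)
    have "\<bar>\<Sum>j=k..<n. w j * h (n - j)\<bar> \<le> 4 * P * G * (\<bar>C\<bar> * real n powr (1 - \<delta>))"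
    proof (cases "k < n")
      case True
      have hD: "h (n - j) = D (n - j) - D (n - Suc j)" if "j < n" for j
      proof -
        have "n - j = Suc (n - Suc j)" using that by simp
        then show ?thesis by (simp add: D_def)
      qed
      \<comment> \<open>Summation by parts in \<open>D (n - j)\<close>, stated for partial ranges so
        that it can be proved by induction. At \<open>i = n\<close> the right boundary term contains
        \<open>D 0\<close>, which is 0.\<close>
      have ab: "(\<Sum>j=k..<i. w j * h (n - j)) = w k * D (n - k) - w (i - 1) * D (n - i)
            + (\<Sum>j=k..<i - 1. (w (Suc j) - w j) * D (n - Suc j))" if "k < i" "i \<le> n" for i
        using that
      proof (induction i)
        case (Suc i)
        show ?case
        proof (cases "k = i")
          case True
          then show ?thesis using Suc hD[of i] by (simp add: right_diff_distrib)
        next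
          case False
          then obtain l where l: "i = Suc l" "k \<le> l" using Suc by (cases i) auto
          have "(\<Sum>j=k..<Suc i. w j * h (n - j)) = (\<Sum>j=k..<i. w j * h (n - j)) + w i * h (n - i)"
            using l by simp
          moreover have "w i * h (n - i) = w i * D (n - i) - w i * D (n - Suc i)"
            using hD[of i] Suc by (simp add: right_diff_distrib)
          moreover have "(\<Sum>j=k..<Suc i - 1. (w (Suc j) - w j) * D (n - Suc j))
              = (\<Sum>j=k..<i - 1. (w (Suc j) - w j) * D (n - Suc j)) + (w i * D (n - i) - w (i - 1) * D (n - i))"
            using l by (simp add: left_diff_distrib)
          moreover have "(\<Sum>j=k..<i. w j * h (n - j)) = w k * D (n - k) - w (i - 1) * D (n - i)
            + (\<Sum>j=k..<i - 1. (w (Suc j) - w j) * D (n - Suc j))"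
            using Suc l by simp
          ultimately show ?thesis by simp
        qed
      qed auto
      have wb: "\<bar>w j\<bar> \<le> P * G" if "k \<le> j" "j < n" for j
        unfolding w_def abs_mult using P[OF that] G[of j] that P0 by (intro mult_mono) auto
      \<comment> \<open>The variation of the product is split into those of its factors. Both
        telescope: powers of \<open>gap\<close> decrease, and \<open>pr n\<close> is monotone by
        \<open>pr_monotone\<close>, in a direction that depends on \<theta>.\<close>
      have tv: "(\<Sum>j=k..<i. \<bar>w (Suc j) - w j\<bar>) \<le> \<bar>pr n i - pr n k\<bar> * G + P * (gap n k ^ r - gap n i ^ r)"
        if "k \<le> i" "i < n" for i
      proof -
        have "(\<Sum>j=k..<i. \<bar>w (Suc j) - w j\<bar>) \<le>
            (\<Sum>j=k..<i. \<bar>pr n (Suc j) - pr n j\<bar> * G + P * (gap n j ^ r - gap n (Suc j) ^ r))"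
        proof (rule sum_mono)
          fix j assume j: "j \<in> {k..<i}"
          have "w (Suc j) - w j = (pr n (Suc j) - pr n j) * gap n (Suc j) ^ r
              - pr n j * (gap n j ^ r - gap n (Suc j) ^ r)"
            by (simp add: w_def algebra_simps)
          also have "\<bar>\<dots>\<bar> \<le> \<bar>(pr n (Suc j) - pr n j) * gap n (Suc j) ^ r\<bar>
              + \<bar>pr n j * (gap n j ^ r - gap n (Suc j) ^ r)\<bar>" by (rule abs_triangle_ineq4)
          also have "\<dots> \<le> \<bar>pr n (Suc j) - pr n j\<bar> * G + P * (gap n j ^ r - gap n (Suc j) ^ r)"
          proof (rule add_mono)
            show "\<bar>(pr n (Suc j) - pr n j) * gap n (Suc j) ^ r\<bar> \<le> \<bar>pr n (Suc j) - pr n j\<bar> * G"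
              using G[of "Suc j"] j that by (simp add: abs_mult mult_left_mono)
            have "gap n (Suc j) ^ r \<le> gap n j ^ r"
              using j that by (intro power_mono gap_antimono gap_nonneg) auto
            then show "\<bar>pr n j * (gap n j ^ r - gap n (Suc j) ^ r)\<bar> \<le> P * (gap n j ^ r - gap n (Suc j) ^ r)"
              using P[of j] j that by (simp add: abs_mult mult_right_mono)
          qed
          finally show "\<bar>w (Suc j) - w j\<bar> \<le> \<dots>" .
        qed
        also have "\<dots> = (\<Sum>j=k..<i. \<bar>pr n (Suc j) - pr n j\<bar>) * G
            + P * (\<Sum>j=k..<i. gap n j ^ r - gap n (Suc j) ^ r)"
          by (simp add: sum.distrib sum_distrib_left sum_distrib_right)
        also have "(\<Sum>j=k..<i. gap n j ^ r - gap n (Suc j) ^ r) = gap n k ^ r - gap n i ^ r"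
          using sum_Suc_diff'[OF that(1), of "\<lambda>j. - (gap n j ^ r)"] by simp
        also have "(\<Sum>j=k..<i. \<bar>pr n (Suc j) - pr n j\<bar>) = \<bar>pr n i - pr n k\<bar>"
          using pr_monotone[of n]
        proof
          assume m: "\<forall>i j. i \<le> j \<longrightarrow> pr n i \<le> pr n j"
          then have "(\<Sum>j=k..<i. \<bar>pr n (Suc j) - pr n j\<bar>) = (\<Sum>j=k..<i. pr n (Suc j) - pr n j)"
            by (intro sum.cong) (auto simp: abs_of_nonneg)
          then show ?thesis using m that sum_Suc_diff'[OF that(1), of "pr n"] by auto
        next
          assume m: "\<forall>i j. i \<le> j \<longrightarrow> pr n j \<le> pr n i"
          then have "(\<Sum>j=k..<i. \<bar>pr n (Suc j) - pr n j\<bar>) = (\<Sum>j=k..<i. - pr n (Suc j) - - pr n j)"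
            by (intro sum.cong) (auto simp: abs_of_nonpos)
          then show ?thesis using m that sum_Suc_diff'[OF that(1), of "\<lambda>j. - pr n j"] by auto
        qed
        finally show ?thesis .
      qed
      let ?d = "\<bar>C\<bar> * real n powr (1 - \<delta>)"
      have e: "(\<Sum>j=k..<n. w j * h (n - j)) = w k * D (n - k)
            + (\<Sum>j=k..<n - 1. (w (Suc j) - w j) * D (n - Suc j))"
        using ab[OF True order.refl] by (simp add: D_def)
      have "\<bar>\<Sum>j=k..<n. w j * h (n - j)\<bar> \<le> \<bar>w k * D (n - k)\<bar>
            + \<bar>\<Sum>j=k..<n - 1. (w (Suc j) - w j) * D (n - Suc j)\<bar>"
        unfolding e by (rule abs_triangle_ineq)
      also have "\<dots> \<le> P * G * ?d + (\<Sum>j=k..<n - 1. \<bar>w (Suc j) - w j\<bar>) * ?d"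
      proof (rule add_mono)
        show "\<bar>w k * D (n - k)\<bar> \<le> P * G * ?d"
          unfolding abs_mult using wb[of k] D[of "n - k"] True P0 G(3)[of n] by (intro mult_mono) auto
        show "\<bar>\<Sum>j=k..<n - 1. (w (Suc j) - w j) * D (n - Suc j)\<bar> \<le> (\<Sum>j=k..<n - 1. \<bar>w (Suc j) - w j\<bar>) * ?d"
          unfolding sum_distrib_right
        proof (rule order.trans[OF sum_abs sum_mono])
          fix j
          show "\<bar>(w (Suc j) - w j) * D (n - Suc j)\<bar> \<le> \<bar>w (Suc j) - w j\<bar> * ?d"
            unfolding abs_mult using D[of "n - Suc j"] by (intro mult_left_mono) auto
        qed
      qed
      also have "\<dots> \<le> P * G * ?d + (3 * P * G) * ?d"
      proof (intro add_left_mono mult_right_mono)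
        have n1: "k \<le> n - 1" "n - 1 < n" using True by auto
        have "(\<Sum>j=k..<n - 1. \<bar>w (Suc j) - w j\<bar>) \<le>
            \<bar>pr n (n - 1) - pr n k\<bar> * G + P * (gap n k ^ r - gap n (n - 1) ^ r)" by (rule tv[OF n1])
        also have "\<dots> \<le> (2 * P) * G + P * G"
          using P[OF n1] P[OF order.refl True] G[of k] G[of "n - 1"] True P0
          by (intro add_mono mult_right_mono mult_left_mono) auto
        finally show "(\<Sum>j=k..<n - 1. \<bar>w (Suc j) - w j\<bar>) \<le> 3 * P * G" by (simp add: mult_ac)
      qed auto
      finally show ?thesis by (simp add: mult_ac)
    qed (use P0 G(3)[of n] in auto)
    also have "\<dots> \<le> 4 * (K / real n powr (1 - \<kappa>)) * G * (\<bar>C\<bar> * real n powr (1 - \<delta>))"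
    proof (intro mult_right_mono mult_left_mono)
      show "P \<le> K / real n powr (1 - \<kappa>)"
        unfolding P_def using k1 K(1) np n by (intro frac_le) auto
    qed (use G(3)[of n] in auto)
    also have "\<dots> = C\<^sub>2 * real n powr (\<kappa> - \<delta> + \<eta>)"
      using n by (simp add: C\<^sub>2_def G_def powr_add powr_diff)
    finally have A': "\<bar>\<Sum>j=k..<n. w j * h (n - j)\<bar> \<le> C\<^sub>2 * real n powr - \<delta>'"
    proof (rule powr_bound_mono)
      have "\<eta> \<le> \<delta> / 8" "\<delta>' \<le> \<delta> / 4" by (auto simp: \<eta>_def \<delta>'_def)
      then show "\<kappa> - \<delta> + \<eta> \<le> - \<delta>'" using \<delta> by (simp add: \<kappa>_def)
    qed (use n Cpos in auto)
    have "\<bar>\<Sum>j<n. w j * h (n - j)\<bar> \<le> (C\<^sub>1 + C\<^sub>2) * real n powr - \<delta>'"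
      unfolding split using A A' by (simp add: algebra_simps abs_if split: if_splits)
    then show "\<bar>\<Sum>j<n. pr n j * gap n j ^ r * (H (n - j) - \<mu>)\<bar> \<le> (C\<^sub>1 + C\<^sub>2) * real n powr - \<delta>'"
      by (simp add: w_def h_def)
  qed
qed


text \<open>The remaining size is rarely small: below about \<open>sqrt n\<close> the total
  probability is a negative power of \<open>n\<close>, and above it the factor
  \<open>1 / (\<theta> + real j)\<close> is of order at most \<open>1 / sqrt n\<close>.\<close>

lemma sum_pr_over_size:
  "\<exists>C. \<exists>\<delta>>0. \<forall>n\<ge>1. (\<Sum>j<n. pr n j / (\<theta> + real j)) \<le> C * real n powr - \<delta>"
proof -
  obtain K where K: "K > 0"
    "\<And>n k. 1 \<le> n \<Longrightarrow> k \<le> n \<Longrightarrow> (\<Sum>j<k. pr n j) \<le> K * (real (Suc k) / real (Suc n)) powr \<theta>"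
    "\<And>n k j. 1 \<le> n \<Longrightarrow> k \<le> j \<Longrightarrow> j < n \<Longrightarrow> pr n j \<le> K / real (Suc k)"
    using pr_bounds by metis
  define \<delta> where "\<delta> = min (\<theta> / 2) (1 / 2)"
  define c where "c = 1 + 1 / \<theta>"
  have c: "c > 0" "1 / \<theta> \<le> c" using theta_pos by (auto simp: c_def add_pos_pos)
  have inv: "1 / (\<theta> + real j) \<le> c / real (Suc j)" for j
  proof -
    have "c * (\<theta> + real j) = \<theta> + real (Suc j) + real j / \<theta>"
      using theta_pos by (simp add: c_def field_simps)
    then have "real (Suc j) \<le> c * (\<theta> + real j)" using theta_pos by simp
    then show ?thesis using theta_pos by (simp add: divide_simps add_pos_nonneg mult.commute)
  qed
  show ?thesis
  proof (rule exI[of _ "K * 2 powr \<theta> * c + c"], rule exI[of _ \<delta>], intro conjI allI impI)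
    show "\<delta> > 0" using theta_pos by (simp add: \<delta>_def)
    fix n :: nat assume n: "n \<ge> 1"
    define k where "k = nat \<lfloor>real n powr (1 / 2)\<rfloor>"
    have np: "real n powr (1 / 2) \<ge> 1" using n by (simp add: ge_one_powr_ge_zero)
    have "real n powr (1 / 2) \<le> real n powr 1" using n by (intro powr_mono) auto
    then have kn: "k \<le> n" unfolding k_def using n by (simp add: nat_le_iff floor_le_iff)
    have k1: "real n powr (1 / 2) \<le> real (Suc k)" unfolding k_def using np by linarith
    have k2: "real (Suc k) \<le> 2 * real n powr (1 / 2)" unfolding k_def using np by linarith
    have "(\<Sum>j<n. pr n j / (\<theta> + real j)) = (\<Sum>j<k. pr n j / (\<theta> + real j)) + (\<Sum>j=k..<n. pr n j / (\<theta> + real j))"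
      using kn by (metis (no_types, lifting) atLeast0LessThan sum.atLeastLessThan_concat zero_le)
    also have "\<dots> \<le> K * 2 powr \<theta> * c * real n powr - \<delta> + c * real n powr - \<delta>"
    proof (rule add_mono)
      have "(\<Sum>j<k. pr n j / (\<theta> + real j)) \<le> (\<Sum>j<k. pr n j * c)"
      proof (rule sum_mono)
        fix j
        have "c / real (Suc j) \<le> c" using c by (simp add: field_simps)
        then have "pr n j * (1 / (\<theta> + real j)) \<le> pr n j * c"
          using pr_pos[OF n, of j] inv[of j] by (intro mult_left_mono) auto
        then show "pr n j / (\<theta> + real j) \<le> pr n j * c" by simp
      qed
      also have "\<dots> = (\<Sum>j<k. pr n j) * c" by (simp add: sum_distrib_right)
      also have "\<dots> \<le> K * (2 powr \<theta> * real n powr (- (1 / 2) * \<theta>)) * c"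
      proof (rule mult_right_mono)
        have "real (Suc k) / real (Suc n) \<le> 2 * real n powr (1 / 2) / real n"
          using k2 n by (intro frac_le) auto
        also have "\<dots> = 2 * (real n powr (1 / 2) / real n powr 1)" by simp
        also have "\<dots> = 2 * real n powr (1 / 2 - 1)" unfolding powr_diff ..
        also have "1 / 2 - 1 = (- (1 / 2) :: real)" by simp
        finally have "(real (Suc k) / real (Suc n)) powr \<theta> \<le> (2 * real n powr (- (1 / 2))) powr \<theta>"
          using theta_pos by (intro powr_mono2) auto
        also have "\<dots> = 2 powr \<theta> * real n powr (- (1 / 2) * \<theta>)" by (simp add: powr_mult powr_powr)
        finally show "(\<Sum>j<k. pr n j) \<le> K * (2 powr \<theta> * real n powr (- (1 / 2) * \<theta>))"
          using K(1) K(2)[OF n kn] by (meson mult_left_mono less_imp_le order_trans)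
      qed (use c in auto)
      also have "\<dots> = K * 2 powr \<theta> * c * real n powr (- (1 / 2) * \<theta>)" by simp
      finally show "(\<Sum>j<k. pr n j / (\<theta> + real j)) \<le> K * 2 powr \<theta> * c * real n powr - \<delta>"
        by (rule powr_bound_mono) (use n K(1) c in \<open>auto simp: \<delta>_def min_def\<close>)
      have "(\<Sum>j=k..<n. pr n j / (\<theta> + real j)) \<le> (\<Sum>j=k..<n. pr n j * (c / real n powr (1 / 2)))"
      proof (rule sum_mono)
        fix j assume j: "j \<in> {k..<n}"
        have "c / real (Suc j) \<le> c / real n powr (1 / 2)"
          using c np k1 j by (intro divide_left_mono) auto
        then have "pr n j * (1 / (\<theta> + real j)) \<le> pr n j * (c / real n powr (1 / 2))"
          using pr_pos[OF n, of j] inv[of j] by (intro mult_left_mono) auto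
        then show "pr n j / (\<theta> + real j) \<le> pr n j * (c / real n powr (1 / 2))" by simp
      qed
      also have "\<dots> = (\<Sum>j=k..<n. pr n j) * (c / real n powr (1 / 2))" by (rule sum_distrib_right[symmetric])
      also have "\<dots> \<le> 1 * (c / real n powr (1 / 2))"
      proof (rule mult_right_mono)
        have "(\<Sum>j=k..<n. pr n j) \<le> (\<Sum>j<n. pr n j)"
          using pr_pos[OF n] by (intro sum_mono2) (auto simp: less_imp_le)
        then show "(\<Sum>j=k..<n. pr n j) \<le> 1" using sum_pr_1[OF n] by simp
      qed (use c in auto)
      also have "\<dots> = c * real n powr - (1 / 2)" by (simp add: powr_minus_divide)
      finally show "(\<Sum>j=k..<n. pr n j / (\<theta> + real j)) \<le> c * real n powr - \<delta>"
        by (rule powr_bound_mono) (use n c in \<open>auto simp: \<delta>_def\<close>)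
    qed
    finally show "(\<Sum>j<n. pr n j / (\<theta> + real j)) \<le> (K * 2 powr \<theta> * c + c) * real n powr - \<delta>"
      by (simp add: algebra_simps)
  qed
qed

lemma powr_bounds_add:
  assumes "\<exists>C. \<exists>\<delta>>0. \<forall>n\<ge>1. \<bar>f n\<bar> \<le> C * real n powr - \<delta>"
    and "\<exists>C. \<exists>\<delta>>0. \<forall>n\<ge>1. \<bar>g n\<bar> \<le> C * real n powr - \<delta>"
  shows "\<exists>C. \<exists>\<delta>>0. \<forall>n\<ge>1. \<bar>a * f n + b * g n\<bar> \<le> C * real n powr - \<delta>"
proof -
  obtain C \<delta> where 1: "\<delta> > 0" "\<And>n. n \<ge> 1 \<Longrightarrow> \<bar>f n\<bar> \<le> C * real n powr - \<delta>" using assms(1) by metis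
  obtain C' \<delta>' where 2: "\<delta>' > 0" "\<And>n. n \<ge> 1 \<Longrightarrow> \<bar>g n\<bar> \<le> C' * real n powr - \<delta>'" using assms(2) by metis
  show ?thesis
  proof (rule exI[of _ "\<bar>a\<bar> * \<bar>C\<bar> + \<bar>b\<bar> * \<bar>C'\<bar>"], rule exI[of _ "min \<delta> \<delta>'"], intro conjI allI impI)
    show "min \<delta> \<delta>' > 0" using 1 2 by simp
    fix n :: nat assume n: "n \<ge> 1"
    have A: "\<bar>f n\<bar> \<le> \<bar>C\<bar> * real n powr - min \<delta> \<delta>'"
      by (rule powr_bound_mono[of _ _ _ "- \<delta>"])
        (use n 1(2)[OF n] in \<open>auto intro: order.trans mult_right_mono\<close>)
    have B: "\<bar>g n\<bar> \<le> \<bar>C'\<bar> * real n powr - min \<delta> \<delta>'"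
      by (rule powr_bound_mono[of _ _ _ "- \<delta>'"])
        (use n 2(2)[OF n] in \<open>auto intro: order.trans mult_right_mono\<close>)
    have "\<bar>a * f n + b * g n\<bar> \<le> \<bar>a\<bar> * \<bar>f n\<bar> + \<bar>b\<bar> * \<bar>g n\<bar>"
      by (metis abs_mult abs_triangle_ineq)
    also have "\<dots> \<le> \<bar>a\<bar> * (\<bar>C\<bar> * real n powr - min \<delta> \<delta>') + \<bar>b\<bar> * (\<bar>C'\<bar> * real n powr - min \<delta> \<delta>')"
      using A B by (intro add_mono mult_left_mono) auto
    finally show "\<bar>a * f n + b * g n\<bar> \<le> (\<bar>a\<bar> * \<bar>C\<bar> + \<bar>b\<bar> * \<bar>C'\<bar>) * real n powr - min \<delta> \<delta>'"
      by (simp add: algebra_simps)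
  qed
qed

text \<open>The drift \<open>\<theta> * U * gap\<close> enters the second moment twice: its correlation with \<open>u\<close> contributes
  \<open>- 2 * U * W\<close> and its own second moment \<open>2 * U * W\<close>, since \<open>\<theta> * gap\<close> is asymptotically a standard
  exponential variable. Hence no correction of \<open>c\<close> is left.\<close>

lemma pr_covariance_bound:
  assumes u: "power_mean u U" and w: "power_mean w W" and uw: "power_mean (\<lambda>m. u m * w m) c"
  shows "\<exists>C. \<exists>\<delta>>0. \<forall>n\<ge>1.
    \<bar>(\<Sum>j<n. pr n j * ((u (n - j) - \<theta> * U * gap n j) * (w (n - j) - \<theta> * W * gap n j))) - c\<bar>
      \<le> C * real n powr - \<delta>"
proof -
  define A where "A n = (\<Sum>j<n. pr n j * gap n j ^ 0 * (u (n - j) * w (n - j) - c))" for n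
  define B1 where "B1 n = (\<Sum>j<n. pr n j * gap n j ^ 1 * (u (n - j) - U))" for n
  define B2 where "B2 n = (\<Sum>j<n. pr n j * gap n j ^ 1 * (w (n - j) - W))" for n
  define e where "e n = (\<Sum>j<n. pr n j / (\<theta> + real j))" for n
  have 0: "e n \<ge> 0" if "n \<ge> 1" for n
    unfolding e_def using theta_pos pr_pos[OF that] by (intro sum_nonneg divide_nonneg_nonneg) (auto simp: less_imp_le)
  have "\<exists>C. \<exists>\<delta>>0. \<forall>n\<ge>1. \<bar>A n\<bar> \<le> C * real n powr - \<delta>"
    unfolding A_def by (rule pr_moment_bound[OF uw]) simp
  moreover have "\<exists>C. \<exists>\<delta>>0. \<forall>n\<ge>1. \<bar>B1 n\<bar> \<le> C * real n powr - \<delta>"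
    unfolding B1_def by (rule pr_moment_bound[OF u]) simp
  moreover have "\<exists>C. \<exists>\<delta>>0. \<forall>n\<ge>1. \<bar>B2 n\<bar> \<le> C * real n powr - \<delta>"
    unfolding B2_def by (rule pr_moment_bound[OF w]) simp
  moreover have "\<exists>C. \<exists>\<delta>>0. \<forall>n\<ge>1. \<bar>e n\<bar> \<le> C * real n powr - \<delta>"
  proof -
    obtain C \<delta> where "\<delta> > 0" and C: "\<And>n. n \<ge> 1 \<Longrightarrow> e n \<le> C * real n powr - \<delta>"
      using sum_pr_over_size unfolding e_def by metis
    then show ?thesis using 0 by (intro exI[of _ C] exI[of _ \<delta>]) (auto simp: abs_of_nonneg)
  qed
  ultimately have *: "\<exists>C. \<exists>\<delta>>0. \<forall>n\<ge>1.
      \<bar>1 * (1 * A n + (- \<theta> * W) * B1 n) + 1 * ((- \<theta> * U) * B2 n + (- \<theta> * U * W) * e n)\<bar> \<le> C * real n powr - \<delta>"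
    by (intro powr_bounds_add)
  have eq: "(\<Sum>j<n. pr n j * ((u (n - j) - \<theta> * U * gap n j) * (w (n - j) - \<theta> * W * gap n j))) - c
      = 1 * (1 * A n + (- \<theta> * W) * B1 n) + 1 * ((- \<theta> * U) * B2 n + (- \<theta> * U * W) * e n)" if n: "n \<ge> 1" for n
  proof -
    \<comment> \<open>Each \<open>u\<close> or \<open>w\<close> that multiplies a \<open>gap\<close>
      is written as its mean plus a deviation; the two means together give the coefficient
      \<open>- 2 * \<theta> * U * W\<close>.\<close>
    have "(\<Sum>j<n. pr n j * ((u (n - j) - \<theta> * U * gap n j) * (w (n - j) - \<theta> * W * gap n j)))
      = (\<Sum>j<n. pr n j * gap n j ^ 0 * (u (n - j) * w (n - j) - c) + c * pr n j
          + (- \<theta> * W) * (pr n j * gap n j ^ 1 * (u (n - j) - U))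
          + (- \<theta> * U) * (pr n j * gap n j ^ 1 * (w (n - j) - W))
          + (- 2 * \<theta> * U * W) * (pr n j * gap n j) + (\<theta>\<^sup>2 * U * W) * (pr n j * gap n j ^ 2))"
      by (intro sum.cong) (auto simp: algebra_simps power2_eq_square)
    also have "\<dots> = A n + c * (\<Sum>j<n. pr n j) + (- \<theta> * W) * B1 n + (- \<theta> * U) * B2 n
        + (- 2 * \<theta> * U * W) * (\<Sum>j<n. pr n j * gap n j) + (\<theta>\<^sup>2 * U * W) * (\<Sum>j<n. pr n j * gap n j ^ 2)"
      unfolding A_def B1_def B2_def sum.distrib sum_distrib_left ..
    also have "\<dots> = A n + c + (- \<theta> * W) * B1 n + (- \<theta> * U) * B2 n
        + ((- 2 * \<theta> * U * W) * (1 / \<theta>) + (\<theta>\<^sup>2 * U * W) * (2 / \<theta>\<^sup>2 - e n / \<theta>))"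
      unfolding sum_pr_1[OF n] sum_pr_gap[OF n] sum_pr_gap_sq[OF n] e_def by simp
    also have "(- 2 * \<theta> * U * W) * (1 / \<theta>) + (\<theta>\<^sup>2 * U * W) * (2 / \<theta>\<^sup>2 - e n / \<theta>) = (- \<theta> * U * W) * e n"
      using theta_pos by (simp add: power2_eq_square field_simps)
    finally show ?thesis by simp
  qed
  obtain C \<delta> where "\<delta> > 0" "\<And>n. n \<ge> 1 \<Longrightarrow>
      \<bar>1 * (1 * A n + (- \<theta> * W) * B1 n) + 1 * ((- \<theta> * U) * B2 n + (- \<theta> * U * W) * e n)\<bar> \<le> C * real n powr - \<delta>"
    using * by blast
  then show ?thesis by (intro exI[of _ C] exI[of _ \<delta>]) (simp add: eq)
qed

end

section \<open>Gaussian averages\<close>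

text \<open>Averaging along one direction at a time keeps degenerate laws in the same framework: a
  Gaussian vector in the plane arises from two such averages, and direction 0 gives the
  identity.\<close>

definition gauss_avg :: "'a::euclidean_space \<Rightarrow> ('a \<Rightarrow> real) \<Rightarrow> 'a \<Rightarrow> real" where
  "gauss_avg a F y = (\<integral>x. F (y + x *\<^sub>R a) \<partial>std_normal_distribution)"

text \<open>The tests are Lipschitz but may be unbounded, so integrability comes from this growth
  class, which Gaussian averages preserve.\<close>

definition linear_growth :: "('a::euclidean_space \<Rightarrow> real) \<Rightarrow> bool" where
  "linear_growth F \<longleftrightarrow> F \<in> borel_measurable borel \<and> (\<exists>A B. \<forall>v. \<bar>F v\<bar> \<le> A + B * norm v)"

interpretation std_normal: real_distribution std_normal_distribution
  by (rule real_dist_normal_dist)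

interpretation std_normal_pair: pair_prob_space std_normal_distribution std_normal_distribution ..

lemma linear_growthE:
  assumes "linear_growth F"
  obtains A B where "A \<ge> 0" "B \<ge> 0" "\<And>v. \<bar>F v\<bar> \<le> A + B * norm v"
proof -
  obtain A B where *: "\<And>v. \<bar>F v\<bar> \<le> A + B * norm v" using assms by (auto simp: linear_growth_def)
  have "\<bar>F v\<bar> \<le> \<bar>A\<bar> + \<bar>B\<bar> * norm v" for v
  proof -
    have "B * norm v \<le> \<bar>B\<bar> * norm v" by (intro mult_right_mono) auto
    then show ?thesis using *[of v] by linarith
  qed
  then show ?thesis using that[of "\<bar>A\<bar>" "\<bar>B\<bar>"] by simp
qed

lemma linear_growth_measurable [measurable_dest]: "linear_growth F \<Longrightarrow> F \<in> borel_measurable borel"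
  by (simp add: linear_growth_def)

lemma linear_growth_bounded:
  "F \<in> borel_measurable borel \<Longrightarrow> (\<And>v. \<bar>F v\<bar> \<le> M) \<Longrightarrow> linear_growth F"
  unfolding linear_growth_def by (intro conjI exI[of _ M] exI[of _ 0]) auto

lemma integrable_std_abs_moment: "integrable std_normal_distribution (\<lambda>x. \<bar>x\<bar> ^ k)"
  by (auto simp: normal_density_nonneg integrable_std_normal_moment_abs integrable_density)

text \<open>The absolute moments are compared with even ones through
  \<open>2 * \<bar>x\<bar> \<le> 1 + x\<^sup>2\<close> and the same inequality multiplied by
  \<open>x\<^sup>2\<close>.\<close>

lemma std_moments:
  "(\<integral>x. x \<partial>std_normal_distribution) = 0" "(\<integral>x. x\<^sup>2 \<partial>std_normal_distribution) = 1"
  "(\<integral>x. \<bar>x\<bar> \<partial>std_normal_distribution) \<le> 1" "(\<integral>x. \<bar>x\<bar> ^ 3 \<partial>std_normal_distribution) \<le> 2"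
proof -
  show "(\<integral>x. x \<partial>std_normal_distribution) = 0"
    using integral_std_normal_distribution_moment_odd[of 1] by simp
  show 2: "(\<integral>x. x\<^sup>2 \<partial>std_normal_distribution) = 1"
    using std_normal_distribution_even_moments(1)[of 1] by simp
  have 4: "(\<integral>x. x ^ 4 \<partial>std_normal_distribution) = 3"
    using std_normal_distribution_even_moments(1)[of 2] by (simp add: fact_numeral)
  have i: "integrable std_normal_distribution (\<lambda>x. x ^ k)" for k
    by (rule integrable_std_normal_distribution_moment)
  have "(\<integral>x. \<bar>x\<bar> \<partial>std_normal_distribution) \<le> (\<integral>x. (1 + x\<^sup>2) / 2 \<partial>std_normal_distribution)"
  proof (rule integral_mono)
    fix x :: real
    show "\<bar>x\<bar> \<le> (1 + x\<^sup>2) / 2" using zero_le_power2[of "\<bar>x\<bar> - 1"] by (simp add: power2_diff)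
  qed (use i[of 2] integrable_std_abs_moment[of 1] in auto)
  also have "\<dots> = 1" using i[of 2] 2 std_normal.prob_space by simp
  finally show "(\<integral>x. \<bar>x\<bar> \<partial>std_normal_distribution) \<le> 1" .
  have "(\<integral>x. \<bar>x\<bar> ^ 3 \<partial>std_normal_distribution) \<le> (\<integral>x. (x\<^sup>2 + x ^ 4) / 2 \<partial>std_normal_distribution)"
  proof (rule integral_mono)
    fix x :: real
    have "0 \<le> x\<^sup>2 * (\<bar>x\<bar> - 1)\<^sup>2" by simp
    also have "\<dots> = x\<^sup>2 * x\<^sup>2 + x\<^sup>2 - 2 * (\<bar>x\<bar>\<^sup>2 * \<bar>x\<bar>)" by (simp add: power2_diff algebra_simps)
    also have "x\<^sup>2 * x\<^sup>2 = x ^ 4" by (simp flip: power_add)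
    also have "\<bar>x\<bar>\<^sup>2 * \<bar>x\<bar> = \<bar>x\<bar> ^ 3" by (simp add: power3_eq_cube power2_eq_square)
    finally show "\<bar>x\<bar> ^ 3 \<le> (x\<^sup>2 + x ^ 4) / 2" by simp
  qed (use i[of 2] i[of 4] integrable_std_abs_moment[of 3] in auto)
  also have "\<dots> = 2" using i[of 2] i[of 4] 2 4 by simp
  finally show "(\<integral>x. \<bar>x\<bar> ^ 3 \<partial>std_normal_distribution) \<le> 2" .
qed

lemma integrable_linear_growth:
  assumes F: "linear_growth F"
  shows "integrable std_normal_distribution (\<lambda>x. F (y + x *\<^sub>R a))"
proof -
  obtain A B where AB: "A \<ge> 0" "B \<ge> 0" "\<And>v. \<bar>F v\<bar> \<le> A + B * norm v" using linear_growthE[OF F] by blast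
  note [measurable] = linear_growth_measurable[OF F]
  show ?thesis
  proof (rule Bochner_Integration.integrable_bound)
    show "integrable std_normal_distribution (\<lambda>x. A + B * norm y + B * norm a * \<bar>x\<bar>)"
      using integrable_std_abs_moment[of 1] by simp
    show "(\<lambda>x. F (y + x *\<^sub>R a)) \<in> borel_measurable std_normal_distribution" by simp
    have "\<bar>F (y + x *\<^sub>R a)\<bar> \<le> A + B * norm y + B * norm a * \<bar>x\<bar>" for x
    proof -
      have "\<bar>F (y + x *\<^sub>R a)\<bar> \<le> A + B * (norm y + \<bar>x\<bar> * norm a)"
        using AB(3)[of "y + x *\<^sub>R a"] AB(2) norm_triangle_ineq[of y "x *\<^sub>R a"]
        by (smt (verit) mult_left_mono norm_scaleR)
      then show ?thesis by (simp add: algebra_simps)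
    qed
    then show "AE x in std_normal_distribution. norm (F (y + x *\<^sub>R a)) \<le> norm (A + B * norm y + B * norm a * \<bar>x\<bar>)"
      using AB by (auto intro: order.trans)
  qed
qed

lemma integrable_pair_abs:
  "integrable (std_normal_distribution \<Otimes>\<^sub>M std_normal_distribution) (\<lambda>z. \<bar>fst z\<bar>)"
  "integrable (std_normal_distribution \<Otimes>\<^sub>M std_normal_distribution) (\<lambda>z. \<bar>snd z\<bar>)"
proof -
  have "distr (std_normal_distribution \<Otimes>\<^sub>M std_normal_distribution) std_normal_distribution fst = std_normal_distribution"
    by (rule std_normal.distr_pair_fst)
  then have "integrable (distr (std_normal_distribution \<Otimes>\<^sub>M std_normal_distribution) std_normal_distribution fst) (\<lambda>x. \<bar>x\<bar>)"
    using integrable_std_abs_moment[of 1] by simp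
  then show 1: "integrable (std_normal_distribution \<Otimes>\<^sub>M std_normal_distribution) (\<lambda>z. \<bar>fst z\<bar>)"
    by (rule integrable_distr[rotated]) simp
  then show "integrable (std_normal_distribution \<Otimes>\<^sub>M std_normal_distribution) (\<lambda>z. \<bar>snd z\<bar>)"
    using std_normal_pair.integrable_product_swap[OF 1] by (simp add: case_prod_unfold)
qed

lemma integrable_pair_linear_growth:
  assumes F: "linear_growth F"
  shows "integrable (std_normal_distribution \<Otimes>\<^sub>M std_normal_distribution)
    (\<lambda>(x, x'). F (y + x *\<^sub>R a + x' *\<^sub>R b))"
proof -
  obtain A B where AB: "A \<ge> 0" "B \<ge> 0" "\<And>v. \<bar>F v\<bar> \<le> A + B * norm v" using linear_growthE[OF F] by blast
  note [measurable] = linear_growth_measurable[OF F]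
  show ?thesis
  proof (rule Bochner_Integration.integrable_bound)
    show "integrable (std_normal_distribution \<Otimes>\<^sub>M std_normal_distribution)
      (\<lambda>z. A + B * norm y + B * norm a * \<bar>fst z\<bar> + B * norm b * \<bar>snd z\<bar>)"
      using integrable_pair_abs by simp
    show "(\<lambda>(x, x'). F (y + x *\<^sub>R a + x' *\<^sub>R b)) \<in> borel_measurable (std_normal_distribution \<Otimes>\<^sub>M std_normal_distribution)"
      by simp
    have "\<bar>F (y + x *\<^sub>R a + x' *\<^sub>R b)\<bar> \<le> A + B * norm y + B * norm a * \<bar>x\<bar> + B * norm b * \<bar>x'\<bar>" for x x'
    proof -
      have "norm (y + x *\<^sub>R a + x' *\<^sub>R b) \<le> norm y + \<bar>x\<bar> * norm a + \<bar>x'\<bar> * norm b"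
        by (metis add_left_mono add_mono norm_scaleR norm_triangle_le norm_triangle_ineq order_refl)
      then have "\<bar>F (y + x *\<^sub>R a + x' *\<^sub>R b)\<bar> \<le> A + B * (norm y + \<bar>x\<bar> * norm a + \<bar>x'\<bar> * norm b)"
        using AB(3)[of "y + x *\<^sub>R a + x' *\<^sub>R b"] AB(2) by (smt (verit) mult_left_mono)
      then show ?thesis by (simp add: algebra_simps)
    qed
    then show "AE z in std_normal_distribution \<Otimes>\<^sub>M std_normal_distribution.
        norm (case z of (x, x') \<Rightarrow> F (y + x *\<^sub>R a + x' *\<^sub>R b))
        \<le> norm (A + B * norm y + B * norm a * \<bar>fst z\<bar> + B * norm b * \<bar>snd z\<bar>)"
      using AB by (auto intro: order.trans)
  qed
qed

lemma gauss_avg_measurable: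
  assumes F: "linear_growth F"
  shows "gauss_avg a F \<in> borel_measurable borel"
proof -
  note [measurable] = linear_growth_measurable[OF F]
  show ?thesis unfolding gauss_avg_def by measurable
qed

lemma gauss_avg_bound:
  assumes "linear_growth F" "\<And>v. \<bar>F v\<bar> \<le> M"
  shows "\<bar>gauss_avg a F y\<bar> \<le> M"
proof -
  have "\<bar>gauss_avg a F y\<bar> \<le> (\<integral>x. \<bar>F (y + x *\<^sub>R a)\<bar> \<partial>std_normal_distribution)"
    unfolding gauss_avg_def by (rule integral_abs_bound)
  also have "\<dots> \<le> (\<integral>x. M \<partial>std_normal_distribution)"
    using integrable_linear_growth[OF assms(1)] assms(2) by (intro integral_mono) auto
  finally show ?thesis using std_normal.prob_space by simp
qed

lemma linear_growth_gauss_avg: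
  assumes F: "linear_growth F"
  shows "linear_growth (gauss_avg a F)"
proof -
  obtain A B where AB: "A \<ge> 0" "B \<ge> 0" "\<And>v. \<bar>F v\<bar> \<le> A + B * norm v" using linear_growthE[OF F] by blast
  have "\<bar>gauss_avg a F y\<bar> \<le> (A + B * norm a) + B * norm y" for y
  proof -
    have "\<bar>gauss_avg a F y\<bar> \<le> (\<integral>x. \<bar>F (y + x *\<^sub>R a)\<bar> \<partial>std_normal_distribution)"
      unfolding gauss_avg_def by (rule integral_abs_bound)
    also have "\<dots> \<le> (\<integral>x. A + B * norm y + B * norm a * \<bar>x\<bar> \<partial>std_normal_distribution)"
    proof (rule integral_mono)
      show "integrable std_normal_distribution (\<lambda>x. \<bar>F (y + x *\<^sub>R a)\<bar>)"
        using integrable_linear_growth[OF F] by simp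
      show "integrable std_normal_distribution (\<lambda>x. A + B * norm y + B * norm a * \<bar>x\<bar>)"
        using integrable_std_abs_moment[of 1] by simp
      show "\<bar>F (y + x *\<^sub>R a)\<bar> \<le> A + B * norm y + B * norm a * \<bar>x\<bar>" for x
      proof -
        have "\<bar>F (y + x *\<^sub>R a)\<bar> \<le> A + B * (norm y + \<bar>x\<bar> * norm a)"
          using AB(3)[of "y + x *\<^sub>R a"] AB(2) norm_triangle_ineq[of y "x *\<^sub>R a"]
          by (smt (verit) mult_left_mono norm_scaleR)
        then show ?thesis by (simp add: algebra_simps)
      qed
    qed
    also have "\<dots> = A + B * norm y + B * norm a * (\<integral>x. \<bar>x\<bar> \<partial>std_normal_distribution)"
      using integrable_std_abs_moment[of 1] std_normal.prob_space by simp
    also have "\<dots> \<le> A + B * norm y + B * norm a * 1"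
      using std_moments(3) AB by (intro add_left_mono mult_left_mono) auto
    finally show ?thesis by simp
  qed
  then show ?thesis using gauss_avg_measurable[OF F] unfolding linear_growth_def by blast
qed

lemma gauss_avg_commute:
  assumes F: "linear_growth F"
  shows "gauss_avg a (gauss_avg b F) = gauss_avg b (gauss_avg a F)"
proof
  fix y
  have "gauss_avg b (gauss_avg a F) y =
    (\<integral>x'. (\<integral>x. F (y + x *\<^sub>R a + x' *\<^sub>R b) \<partial>std_normal_distribution) \<partial>std_normal_distribution)"
    unfolding gauss_avg_def by (simp add: add_ac)
  also have "\<dots> = (\<integral>x. (\<integral>x'. F (y + x *\<^sub>R a + x' *\<^sub>R b) \<partial>std_normal_distribution) \<partial>std_normal_distribution)"
    by (rule std_normal_pair.Fubini_integral[OF integrable_pair_linear_growth[OF F]])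
  also have "\<dots> = gauss_avg a (gauss_avg b F) y" unfolding gauss_avg_def ..
  finally show "gauss_avg a (gauss_avg b F) y = gauss_avg b (gauss_avg a F) y" ..
qed

text \<open>Characteristic functions include the cases \<open>s = 0\<close> and
  \<open>t = 0\<close>, where a summand is a point mass and has no density. They occur at time 0 and
  for degenerate covariances.\<close>

lemma distr_std_normal_sum:
  "distr (std_normal_distribution \<Otimes>\<^sub>M std_normal_distribution) borel (\<lambda>(x, x'). s * x + t * x')
    = distr std_normal_distribution borel (\<lambda>x. sqrt (s\<^sup>2 + t\<^sup>2) * x)" (is "?L = ?R")
proof (rule Levy_uniqueness)
  show "real_distribution ?L" "real_distribution ?R"
    unfolding real_distribution_def real_distribution_axioms_def
    by (auto intro!: std_normal_pair.prob_space_distr std_normal.prob_space_distr)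
  have sc: "(\<integral>x. iexp (u * x) \<partial>std_normal_distribution) = exp (- (complex_of_real u)\<^sup>2 / 2)" for u
    using fun_cong[OF char_std_normal_distribution, of u] by (simp add: char_def exp_of_real[symmetric])
  have "char ?L u = char ?R u" for u
  proof -
    have "char ?L u = (\<integral>z. iexp (u * (case z of (x, x') \<Rightarrow> s * x + t * x')) \<partial>(std_normal_distribution \<Otimes>\<^sub>M std_normal_distribution))"
      unfolding char_def by (subst integral_distr) auto
    also have "\<dots> = (\<integral>z. (case z of (x, x') \<Rightarrow> iexp ((u * s) * x) * iexp ((u * t) * x')) \<partial>(std_normal_distribution \<Otimes>\<^sub>M std_normal_distribution))"
      by (intro Bochner_Integration.integral_cong) (auto simp: exp_add[symmetric] algebra_simps)
    also have "\<dots> = (\<integral>x. (\<integral>x'. iexp ((u * s) * x) * iexp ((u * t) * x') \<partial>std_normal_distribution) \<partial>std_normal_distribution)"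
    proof (rule std_normal_pair.integral_fst[symmetric])
      show "integrable (std_normal_distribution \<Otimes>\<^sub>M std_normal_distribution) (\<lambda>(x, x'). iexp ((u * s) * x) * iexp ((u * t) * x'))"
        by (rule std_normal_pair.P.integrable_const_bound[of _ 1]) (auto simp: norm_mult)
    qed
    also have "\<dots> = (\<integral>x. iexp ((u * s) * x) \<partial>std_normal_distribution) * (\<integral>x'. iexp ((u * t) * x') \<partial>std_normal_distribution)"
      by simp
    also have "\<dots> = exp (- (complex_of_real (u * s))\<^sup>2 / 2) * exp (- (complex_of_real (u * t))\<^sup>2 / 2)"
      unfolding sc ..
    also have "\<dots> = exp (- (complex_of_real (u * sqrt (s\<^sup>2 + t\<^sup>2)))\<^sup>2 / 2)"
    proof -
      have "(complex_of_real (u * sqrt (s\<^sup>2 + t\<^sup>2)))\<^sup>2 = complex_of_real ((u * sqrt (s\<^sup>2 + t\<^sup>2))\<^sup>2)" by simp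
      also have "(u * sqrt (s\<^sup>2 + t\<^sup>2))\<^sup>2 = (u * s)\<^sup>2 + (u * t)\<^sup>2" by (simp add: power_mult_distrib algebra_simps)
      finally have e: "(complex_of_real (u * sqrt (s\<^sup>2 + t\<^sup>2)))\<^sup>2 = (complex_of_real (u * s))\<^sup>2 + (complex_of_real (u * t))\<^sup>2" by simp
      show ?thesis unfolding e exp_add[symmetric] by (simp add: diff_divide_distrib)
    qed
    also have "\<dots> = (\<integral>x. iexp ((u * sqrt (s\<^sup>2 + t\<^sup>2)) * x) \<partial>std_normal_distribution)"
      unfolding sc ..
    also have "\<dots> = char ?R u"
      unfolding char_def by (subst integral_distr) (auto simp: mult_ac)
    finally show ?thesis .
  qed
  then show "char ?L = char ?R" ..
qed

text \<open>Variances add, not standard deviations; this is why directions are scaled by square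
  roots of times.\<close>

lemma gauss_avg_semigroup:
  assumes F: "linear_growth F" and "s \<ge> 0" "t \<ge> 0"
  shows "gauss_avg (sqrt s *\<^sub>R a) (gauss_avg (sqrt t *\<^sub>R a) F) = gauss_avg (sqrt (s + t) *\<^sub>R a) F"
proof
  fix y
  note [measurable] = linear_growth_measurable[OF F]
  have "gauss_avg (sqrt s *\<^sub>R a) (gauss_avg (sqrt t *\<^sub>R a) F) y =
    (\<integral>x. (\<integral>x'. F (y + x *\<^sub>R sqrt s *\<^sub>R a + x' *\<^sub>R sqrt t *\<^sub>R a) \<partial>std_normal_distribution) \<partial>std_normal_distribution)"
    unfolding gauss_avg_def ..
  also have "\<dots> = (\<integral>z. (case z of (x, x') \<Rightarrow> F (y + x *\<^sub>R sqrt s *\<^sub>R a + x' *\<^sub>R sqrt t *\<^sub>R a)) \<partial>(std_normal_distribution \<Otimes>\<^sub>M std_normal_distribution))"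
    by (rule std_normal_pair.integral_fst[OF integrable_pair_linear_growth[OF F]])
  also have "\<dots> = (\<integral>z. F (y + (case z of (x, x') \<Rightarrow> sqrt s * x + sqrt t * x') *\<^sub>R a) \<partial>(std_normal_distribution \<Otimes>\<^sub>M std_normal_distribution))"
    by (intro Bochner_Integration.integral_cong) (auto simp: algebra_simps)
  also have "\<dots> = (\<integral>w. F (y + w *\<^sub>R a) \<partial>distr (std_normal_distribution \<Otimes>\<^sub>M std_normal_distribution) borel (\<lambda>(x, x'). sqrt s * x + sqrt t * x'))"
    by (subst integral_distr) auto
  also have "\<dots> = (\<integral>x. F (y + (sqrt (s + t) * x) *\<^sub>R a) \<partial>std_normal_distribution)"
    unfolding distr_std_normal_sum using assms by (subst integral_distr) auto
  also have "\<dots> = gauss_avg (sqrt (s + t) *\<^sub>R a) F y"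
    unfolding gauss_avg_def by (simp add: mult.commute)
  finally show "gauss_avg (sqrt s *\<^sub>R a) (gauss_avg (sqrt t *\<^sub>R a) F) y = gauss_avg (sqrt (s + t) *\<^sub>R a) F y" .
qed

text \<open>The shift of a standard Gaussian has density \<open>exp (t * x - t\<^sup>2 / 2)\<close> with respect to it; the
  total variation is bounded through the second moment of this density minus \<open>1\<close>.\<close>

lemma gauss_avg_shift:
  assumes F: "F \<in> borel_measurable borel" and M: "\<And>v. \<bar>F v\<bar> \<le> M"
  shows "\<bar>gauss_avg a F (y + t *\<^sub>R a) - gauss_avg a F y\<bar> \<le> 2 * M * \<bar>t\<bar>"
\<comment> \<open>For \<bar>t\<bar> at least 1 the bound on \<open>F\<close> is enough. The density
  argument divides by \<bar>t\<bar> and uses \<open>t\<^sup>2 \<le> 1\<close>.\<close>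
proof (cases "\<bar>t\<bar> < 1 \<and> t \<noteq> 0")
  case False
  have lg: "linear_growth F" using F M by (rule linear_growth_bounded)
  have M0: "M \<ge> 0" using M[of 0] by linarith
  have "\<bar>gauss_avg a F (y + t *\<^sub>R a) - gauss_avg a F y\<bar> \<le> 2 * M" if "t \<noteq> 0"
    using gauss_avg_bound[OF lg M, of a y] gauss_avg_bound[OF lg M, of a "y + t *\<^sub>R a"] by linarith
  moreover have "2 * M \<le> 2 * M * \<bar>t\<bar>" if "t \<noteq> 0" using False that M0 mult_left_mono[of 1 "\<bar>t\<bar>" "2 * M"] by simp
  ultimately show ?thesis by fastforce
next
  case True
  note [measurable] = F
  have M0: "M \<ge> 0" using M[of 0] by linarith
  define q where "q x = exp (t * x - t\<^sup>2 / 2)" for x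
  have tt: "t\<^sup>2 / (2 * \<bar>t\<bar>) = \<bar>t\<bar> / 2"
    using True by (cases "t \<ge> 0") (auto simp: power2_eq_square)
  have [measurable]: "q \<in> borel_measurable borel" unfolding q_def by measurable
  have nd: "normal_density t 1 x = std_normal_density x * q x" for x
  proof -
    have "- (x - t)\<^sup>2 / 2 = - x\<^sup>2 / 2 + (t * x - t\<^sup>2 / 2)" by (simp add: power2_eq_square field_simps)
    then have "exp (- (x - t)\<^sup>2 / 2) = exp (- x\<^sup>2 / 2) * exp (t * x - t\<^sup>2 / 2)" by (metis exp_add)
    then show ?thesis by (simp add: normal_density_def q_def)
  qed
  \<comment> \<open>Completing the square shows that the density \<open>q\<close> has second moment
    \<open>exp (t\<^sup>2)\<close>; hence \<open>q - 1\<close> has second moment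
    \<open>exp (t\<^sup>2) - 1\<close>.\<close>
  have nd2: "std_normal_density x * (q x)\<^sup>2 = exp (t\<^sup>2) * normal_density (2 * t) 1 x" for x
  proof -
    have "t\<^sup>2 + (- (x - 2 * t)\<^sup>2 / 2) = - x\<^sup>2 / 2 + ((t * x - t\<^sup>2 / 2) + (t * x - t\<^sup>2 / 2))"
      by (simp add: power2_eq_square field_simps)
    then have "exp (t\<^sup>2) * exp (- (x - 2 * t)\<^sup>2 / 2) = exp (- x\<^sup>2 / 2) * (q x * q x)"
      unfolding q_def by (metis exp_add)
    then show ?thesis by (simp add: normal_density_def power2_eq_square)
  qed
  have iq: "integrable lborel (\<lambda>x. std_normal_density x * q x)" "(\<integral>x. std_normal_density x * q x \<partial>lborel) = 1"
    using integrable_normal_density[of 1 t] integral_normal_density[of 1 t] unfolding nd[symmetric] by simp_all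
  have iq2: "integrable lborel (\<lambda>x. std_normal_density x * (q x)\<^sup>2)" "(\<integral>x. std_normal_density x * (q x)\<^sup>2 \<partial>lborel) = exp (t\<^sup>2)"
    using integrable_normal_density[of 1 "2 * t"] integral_normal_density[of 1 "2 * t"] unfolding nd2 by simp_all
  have i1: "integrable lborel (\<lambda>x. std_normal_density x)" "(\<integral>x. std_normal_density x \<partial>lborel) = 1" by simp_all
  have bd: "integrable lborel (\<lambda>x. g x * F (y + x *\<^sub>R a))" if "integrable lborel g" for g :: "real \<Rightarrow> real"
  proof (rule Bochner_Integration.integrable_bound)
    show "integrable lborel (\<lambda>x. M * g x)" using that by simp
    show "(\<lambda>x. g x * F (y + x *\<^sub>R a)) \<in> borel_measurable lborel"
      using borel_measurable_integrable[OF that] by measurable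
    show "AE x in lborel. norm (g x * F (y + x *\<^sub>R a)) \<le> norm (M * g x)"
      using M M0 by (auto simp: abs_mult mult.commute[of _ "\<bar>g _\<bar>"] intro!: mult_left_mono)
  qed
  have "gauss_avg a F (y + t *\<^sub>R a) = (\<integral>x. std_normal_density x * F (y + (x + t) *\<^sub>R a) \<partial>lborel)"
    unfolding gauss_avg_def by (subst integral_density) (auto simp: algebra_simps)
  also have "\<dots> = (\<integral>x. std_normal_density (x - t) * F (y + x *\<^sub>R a) \<partial>lborel)"
    by (subst lborel_integral_real_affine[of 1 _ "- t"]) (auto simp: algebra_simps)
  also have "\<dots> = (\<integral>x. (std_normal_density x * q x) * F (y + x *\<^sub>R a) \<partial>lborel)"
  proof -
    have "std_normal_density (x - t) = normal_density t 1 x" for x by (simp add: normal_density_def)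
    then show ?thesis by (simp add: nd)
  qed
  finally have 1: "gauss_avg a F (y + t *\<^sub>R a) = (\<integral>x. (std_normal_density x * q x) * F (y + x *\<^sub>R a) \<partial>lborel)" .
  have 2: "gauss_avg a F y = (\<integral>x. std_normal_density x * F (y + x *\<^sub>R a) \<partial>lborel)"
    unfolding gauss_avg_def by (subst integral_density) auto
  have diff: "gauss_avg a F (y + t *\<^sub>R a) - gauss_avg a F y =
      (\<integral>x. (std_normal_density x * q x) * F (y + x *\<^sub>R a) - std_normal_density x * F (y + x *\<^sub>R a) \<partial>lborel)"
    unfolding 1 2 by (rule Bochner_Integration.integral_diff[OF bd[OF iq(1)] bd[OF i1(1)], symmetric])
  have "\<bar>gauss_avg a F (y + t *\<^sub>R a) - gauss_avg a F y\<bar> \<le>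
      (\<integral>x. \<bar>(std_normal_density x * q x) * F (y + x *\<^sub>R a) - std_normal_density x * F (y + x *\<^sub>R a)\<bar> \<partial>lborel)"
    unfolding diff by (rule integral_abs_bound)
  also have "\<dots> \<le> (\<integral>x. M * ((std_normal_density x * (q x)\<^sup>2 - 2 * (std_normal_density x * q x) + std_normal_density x) / (2 * \<bar>t\<bar>)
      + std_normal_density x * \<bar>t\<bar> / 2) \<partial>lborel)"
  proof (rule integral_mono)
    show "integrable lborel (\<lambda>x. \<bar>(std_normal_density x * q x) * F (y + x *\<^sub>R a) - std_normal_density x * F (y + x *\<^sub>R a)\<bar>)"
      by (rule integrable_abs[OF Bochner_Integration.integrable_diff[OF bd[OF iq(1)] bd[OF i1(1)]]])
    show "integrable lborel (\<lambda>x. M * ((std_normal_density x * (q x)\<^sup>2 - 2 * (std_normal_density x * q x) + std_normal_density x) / (2 * \<bar>t\<bar>)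
      + std_normal_density x * \<bar>t\<bar> / 2))"
      by (rule integrable_mult_right[OF Bochner_Integration.integrable_add[OF integrable_divide[OF
          Bochner_Integration.integrable_add[OF Bochner_Integration.integrable_diff[OF iq2(1)
          integrable_mult_right[OF iq(1)]] i1(1)]] integrable_divide[OF integrable_mult_left[OF i1(1)]]]])
    fix x :: real
    \<comment> \<open>An arithmetic-geometric inequality in place of Cauchy-Schwarz. The weight
      \<bar>t\<bar> matches the size of \<open>q - 1\<close> in mean square, so both terms are of
      order \<bar>t\<bar> after integration.\<close>
    have am: "\<bar>u\<bar> \<le> u\<^sup>2 / (2 * \<bar>t\<bar>) + \<bar>t\<bar> / 2" for u :: real
    proof -
      have "0 \<le> (\<bar>u\<bar> - \<bar>t\<bar>)\<^sup>2" by simp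
      then have "2 * \<bar>t\<bar> * \<bar>u\<bar> \<le> u\<^sup>2 + t\<^sup>2" by (simp add: power2_diff mult_ac)
      then have "\<bar>u\<bar> \<le> (u\<^sup>2 + t\<^sup>2) / (2 * \<bar>t\<bar>)" using True by (simp add: le_divide_eq mult.commute)
      also have "\<dots> = u\<^sup>2 / (2 * \<bar>t\<bar>) + \<bar>t\<bar> / 2"
        by (simp add: add_divide_distrib tt)
      finally show ?thesis .
    qed
    have "\<bar>(std_normal_density x * q x) * F (y + x *\<^sub>R a) - std_normal_density x * F (y + x *\<^sub>R a)\<bar>
        = std_normal_density x * \<bar>q x - 1\<bar> * \<bar>F (y + x *\<^sub>R a)\<bar>"
    proof -
      have "(std_normal_density x * q x) * F (y + x *\<^sub>R a) - std_normal_density x * F (y + x *\<^sub>R a)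
        = std_normal_density x * (q x - 1) * F (y + x *\<^sub>R a)" by (simp add: algebra_simps)
      then show ?thesis by (simp add: abs_mult)
    qed
    also have "\<dots> \<le> std_normal_density x * ((q x - 1)\<^sup>2 / (2 * \<bar>t\<bar>) + \<bar>t\<bar> / 2) * M"
      using M am by (intro mult_mono mult_left_mono) auto
    also have "\<dots> = M * ((std_normal_density x * (q x)\<^sup>2 - 2 * (std_normal_density x * q x) + std_normal_density x) / (2 * \<bar>t\<bar>)
      + std_normal_density x * \<bar>t\<bar> / 2)"
      by (simp add: power2_diff add_divide_distrib diff_divide_distrib algebra_simps)
    finally show "\<bar>(std_normal_density x * q x) * F (y + x *\<^sub>R a) - std_normal_density x * F (y + x *\<^sub>R a)\<bar> \<le> \<dots>" .
  qed
  also have "\<dots> = M * ((exp (t\<^sup>2) - 2 * 1 + 1) / (2 * \<bar>t\<bar>) + 1 * \<bar>t\<bar> / 2)"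
    using iq iq2 i1 by simp
  also have "\<dots> \<le> M * (2 * \<bar>t\<bar>)"
  proof (rule mult_left_mono)
    have "t\<^sup>2 \<le> 1" using True by (simp add: abs_square_le_1)
    then have "exp (t\<^sup>2) \<le> 1 + t\<^sup>2 + (t\<^sup>2)\<^sup>2" by (intro exp_bound) auto
    moreover have "(t\<^sup>2)\<^sup>2 \<le> t\<^sup>2" using \<open>t\<^sup>2 \<le> 1\<close> mult_left_mono[of "t\<^sup>2" 1 "t\<^sup>2"] by (simp add: power2_eq_square)
    ultimately have "exp (t\<^sup>2) - 2 * 1 + 1 \<le> 2 * t\<^sup>2" by simp
    then have "(exp (t\<^sup>2) - 2 * 1 + 1) / (2 * \<bar>t\<bar>) \<le> 2 * t\<^sup>2 / (2 * \<bar>t\<bar>)"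
      using True by (intro divide_right_mono) auto
    also have "\<dots> = \<bar>t\<bar>"
      using tt by simp
    finally show "(exp (t\<^sup>2) - 2 * 1 + 1) / (2 * \<bar>t\<bar>) + 1 * \<bar>t\<bar> / 2 \<le> 2 * \<bar>t\<bar>" by simp
  qed (rule M0)
  finally show ?thesis by simp
qed

text \<open>Derivatives are prescribed along lines, as explicit linear and bilinear forms. In this
  form they pass to Gaussian averages by dominated convergence, with the bounds
  \<open>b\<^sub>1\<close> and \<open>b\<^sub>2\<close> unchanged.\<close>

locale C2_fun =
  fixes b\<^sub>1 b\<^sub>2 :: real and W :: "'a::euclidean_space \<Rightarrow> real"
    and W\<^sub>1 :: "'a \<Rightarrow> 'a \<Rightarrow> real" and W\<^sub>2 :: "'a \<Rightarrow> 'a \<Rightarrow> 'a \<Rightarrow> real"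
  assumes deriv1: "((\<lambda>r. W (y + r *\<^sub>R h)) has_real_derivative W\<^sub>1 (y + r *\<^sub>R h) h) (at r)"
    and deriv2: "((\<lambda>r. W\<^sub>1 (y + r *\<^sub>R k) h) has_real_derivative W\<^sub>2 (y + r *\<^sub>R k) k h) (at r)"
    and meas: "W \<in> borel_measurable borel" "(\<lambda>y. W\<^sub>1 y h) \<in> borel_measurable borel"
      "(\<lambda>y. W\<^sub>2 y k h) \<in> borel_measurable borel"
    and bound1: "\<bar>W\<^sub>1 y h\<bar> \<le> b\<^sub>1 * norm h"
    and bound2: "\<bar>W\<^sub>2 y k h\<bar> \<le> b\<^sub>2 * norm k * norm h"
    and lin1: "linear (W\<^sub>1 y)"
    and lin2: "linear (W\<^sub>2 y k)" "linear (\<lambda>k. W\<^sub>2 y k h)"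
begin

lemma lipschitz: "\<bar>W (y + h) - W y\<bar> \<le> b\<^sub>1 * norm h"
proof -
  have "norm (W (y + 1 *\<^sub>R h) - W (y + 0 *\<^sub>R h)) \<le> b\<^sub>1 * norm h * norm (1 - 0 :: real)"
    by (rule field_differentiable_bound[of UNIV "\<lambda>r. W (y + r *\<^sub>R h)" "\<lambda>r. W\<^sub>1 (y + r *\<^sub>R h) h"])
      (use deriv1 bound1 in auto)
  then show ?thesis by simp
qed

lemma growth: "linear_growth W"
proof -
  have "\<bar>W v\<bar> \<le> \<bar>W 0\<bar> + b\<^sub>1 * norm v" for v using lipschitz[of 0 v] by simp
  then show ?thesis using meas(1) unfolding linear_growth_def by blast
qed

lemma growth1: "linear_growth (\<lambda>y. W\<^sub>1 y h)"
  using meas(2) bound1 by (rule linear_growth_bounded)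

lemma growth2: "linear_growth (\<lambda>y. W\<^sub>2 y k h)"
  using meas(3) bound2 by (rule linear_growth_bounded)

end

text \<open>By the mean value inequality all difference quotients of \<open>F\<close> in direction
  \<open>h\<close> are bounded by \<open>M\<close>, which serves as the dominating function.\<close>

lemma gauss_avg_has_derivative:
  fixes F F' :: "'a::euclidean_space \<Rightarrow> real"
  assumes d: "\<And>y r. ((\<lambda>r. F (y + r *\<^sub>R h)) has_real_derivative F' (y + r *\<^sub>R h)) (at r)"
    and F: "linear_growth F" and F': "F' \<in> borel_measurable borel" and M: "\<And>y. \<bar>F' y\<bar> \<le> M"
  shows "((\<lambda>r. gauss_avg a F (y + r *\<^sub>R h)) has_real_derivative gauss_avg a F' (y + r *\<^sub>R h)) (at r)"
proof -
  note [measurable] = F' linear_growth_measurable[OF F]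
  let ?D = "\<lambda>x s. (F (y + s *\<^sub>R h + x *\<^sub>R a) - F (y + r *\<^sub>R h + x *\<^sub>R a)) / (s - r)"
  have "((\<lambda>s. (gauss_avg a F (y + s *\<^sub>R h) - gauss_avg a F (y + r *\<^sub>R h)) / (s - r))
      \<longlongrightarrow> gauss_avg a F' (y + r *\<^sub>R h)) (at r)"
    unfolding tendsto_at_iff_sequentially comp_def
  proof (intro allI impI)
    fix X :: "nat \<Rightarrow> real"
    assume X: "\<forall>i. X i \<in> UNIV - {r}" "X \<longlonglongrightarrow> r"
    have "(\<lambda>i. \<integral>x. ?D x (X i) \<partial>std_normal_distribution) \<longlonglongrightarrow> (\<integral>x. F' (y + r *\<^sub>R h + x *\<^sub>R a) \<partial>std_normal_distribution)"
    proof (rule integral_dominated_convergence[where w = "\<lambda>_. M"])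
      show "AE x in std_normal_distribution. (\<lambda>i. ?D x (X i)) \<longlonglongrightarrow> F' (y + r *\<^sub>R h + x *\<^sub>R a)"
      proof (rule AE_I2)
        fix x
        have "((\<lambda>s. F ((y + x *\<^sub>R a) + s *\<^sub>R h)) has_real_derivative F' ((y + x *\<^sub>R a) + r *\<^sub>R h)) (at r)"
          by (rule d)
        then have "((\<lambda>s. ?D x s) \<longlongrightarrow> F' (y + r *\<^sub>R h + x *\<^sub>R a)) (at r)"
          unfolding has_field_derivative_iff by (simp add: add_ac)
        then show "(\<lambda>i. ?D x (X i)) \<longlonglongrightarrow> F' (y + r *\<^sub>R h + x *\<^sub>R a)"
          using X unfolding tendsto_at_iff_sequentially comp_def by blast
      qed
      show "AE x in std_normal_distribution. norm (?D x (X i)) \<le> M" for i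
      proof (rule AE_I2)
        fix x
        have "norm (F ((y + x *\<^sub>R a) + X i *\<^sub>R h) - F ((y + x *\<^sub>R a) + r *\<^sub>R h)) \<le> M * norm (X i - r)"
          by (rule field_differentiable_bound[of UNIV "\<lambda>s. F ((y + x *\<^sub>R a) + s *\<^sub>R h)" "\<lambda>s. F' ((y + x *\<^sub>R a) + s *\<^sub>R h)"])
            (use d M in auto)
        then show "norm (?D x (X i)) \<le> M" using X(1) by (simp add: add_ac divide_le_eq)
      qed
    qed auto
    moreover have e: "(\<integral>x. ?D x (X i) \<partial>std_normal_distribution)
        = (gauss_avg a F (y + X i *\<^sub>R h) - gauss_avg a F (y + r *\<^sub>R h)) / (X i - r)" for i
      unfolding gauss_avg_def using integrable_linear_growth[OF F] X(1) by simp
    ultimately have "(\<lambda>i. (gauss_avg a F (y + X i *\<^sub>R h) - gauss_avg a F (y + r *\<^sub>R h)) / (X i - r)) \<longlonglongrightarrow> (\<integral>x. F' (y + r *\<^sub>R h + x *\<^sub>R a) \<partial>std_normal_distribution)"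
      by (simp only: e)
    then show "(\<lambda>i. (gauss_avg a F (y + X i *\<^sub>R h) - gauss_avg a F (y + r *\<^sub>R h)) / (X i - r)) \<longlonglongrightarrow> gauss_avg a F' (y + r *\<^sub>R h)"
      by (simp only: gauss_avg_def[of a F'])
  qed
  then show ?thesis by (simp add: has_field_derivative_iff)
qed

lemma linear_gauss_avg:
  assumes "\<And>y. linear (\<lambda>h. F h y)" "\<And>h. linear_growth (F h)"
  shows "linear (\<lambda>h. gauss_avg a (F h) y)"
proof (rule linearI)
  show "gauss_avg a (F (h + h')) y = gauss_avg a (F h) y + gauss_avg a (F h') y" for h h'
    unfolding gauss_avg_def using integrable_linear_growth[OF assms(2)] linear_add[OF assms(1)] by simp
  show "gauss_avg a (F (r *\<^sub>R h)) y = r *\<^sub>R gauss_avg a (F h) y" for r h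
    unfolding gauss_avg_def using integrable_linear_growth[OF assms(2)] linear_scale[OF assms(1)] by simp
qed

lemma C2_fun_gauss_avg:
  assumes "C2_fun b\<^sub>1 b\<^sub>2 W W\<^sub>1 W\<^sub>2"
  shows "C2_fun b\<^sub>1 b\<^sub>2 (gauss_avg a W) (\<lambda>y h. gauss_avg a (\<lambda>y. W\<^sub>1 y h) y)
    (\<lambda>y k h. gauss_avg a (\<lambda>y. W\<^sub>2 y k h) y)"
proof -
  interpret C2_fun b\<^sub>1 b\<^sub>2 W W\<^sub>1 W\<^sub>2 by fact
  show ?thesis
  proof (rule C2_fun.intro)
    show "((\<lambda>r. gauss_avg a W (y + r *\<^sub>R h)) has_real_derivative gauss_avg a (\<lambda>y. W\<^sub>1 y h) (y + r *\<^sub>R h)) (at r)" for y h r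
      by (rule gauss_avg_has_derivative[OF deriv1 growth meas(2) bound1])
    show "((\<lambda>r. gauss_avg a (\<lambda>y. W\<^sub>1 y h) (y + r *\<^sub>R k)) has_real_derivative gauss_avg a (\<lambda>y. W\<^sub>2 y k h) (y + r *\<^sub>R k)) (at r)" for y k h r
      by (rule gauss_avg_has_derivative[OF deriv2 growth1 meas(3) bound2])
    show "gauss_avg a W \<in> borel_measurable borel" by (rule gauss_avg_measurable[OF growth])
    show "(\<lambda>y. gauss_avg a (\<lambda>y. W\<^sub>1 y h) y) \<in> borel_measurable borel" for h
      by (rule gauss_avg_measurable[OF growth1])
    show "(\<lambda>y. gauss_avg a (\<lambda>y. W\<^sub>2 y k h) y) \<in> borel_measurable borel" for k h
      by (rule gauss_avg_measurable[OF growth2])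
    show "\<bar>gauss_avg a (\<lambda>y. W\<^sub>1 y h) y\<bar> \<le> b\<^sub>1 * norm h" for y h
      by (rule gauss_avg_bound[OF growth1 bound1])
    show "\<bar>gauss_avg a (\<lambda>y. W\<^sub>2 y k h) y\<bar> \<le> b\<^sub>2 * norm k * norm h" for y k h
      by (rule gauss_avg_bound[OF growth2 bound2])
    show "linear (\<lambda>h. gauss_avg a (\<lambda>y. W\<^sub>1 y h) y)" for y
      by (rule linear_gauss_avg[OF lin1 growth1])
    show "linear (\<lambda>h. gauss_avg a (\<lambda>y. W\<^sub>2 y k h) y)" for y k
      by (rule linear_gauss_avg[OF lin2(1) growth2])
    show "linear (\<lambda>k. gauss_avg a (\<lambda>y. W\<^sub>2 y k h) y)" for y h
      by (rule linear_gauss_avg[OF lin2(2) growth2])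
  qed
qed

section \<open>Removing a cycle from an Ewens permutation\<close>

definition cycle_type :: "('a \<Rightarrow> 'a) \<Rightarrow> 'a set \<Rightarrow> nat multiset" where
  "cycle_type \<sigma> S = image_mset card (mset_set (orbit \<sigma> ` S))"

text \<open>The expected effect, up to normalization, of inserting one new point into a permutation of
  cycle type \<open>M\<close>: it becomes a fixed point with weight \<open>\<theta>\<close>, or enters a cycle of length \<open>k\<close> at one
  of \<open>k\<close> places.\<close>

definition insertion_op :: "real \<Rightarrow> (nat multiset \<Rightarrow> real) \<Rightarrow> nat multiset \<Rightarrow> real" where
  "insertion_op \<theta> F M =
     \<theta> * F (add_mset 1 M) + (\<Sum>k\<in>#M. real k * F (add_mset (Suc k) (M - {#k#})))"

text \<open>The Chinese restaurant process in dual form: not the law of the cycle type but the test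
  function evolves, the last inserted point acting first. The value is the sum of \<open>F\<close>
  over the permutations of \<open>n\<close> points, weighted by \<theta> to the number of
  cycles.\<close>

fun cycle_sum :: "real \<Rightarrow> nat \<Rightarrow> (nat multiset \<Rightarrow> real) \<Rightarrow> real" where
  "cycle_sum \<theta> 0 F = F {#}"
| "cycle_sum \<theta> (Suc n) F = cycle_sum \<theta> n (insertion_op \<theta> F)"

text \<open>Composition with the transposition puts the new point \<open>a\<close> immediately
  before \<open>b\<close> in the cycle of \<open>b\<close>: the predecessor of \<open>b\<close> now
  goes to \<open>a\<close>, and \<open>a\<close> goes to \<open>b\<close>. The other cycles are
  untouched.\<close>

lemma orbit_transpose_comp:
  assumes q: "q permutes S" and fin: "finite S" and a: "a \<notin> S" and b: "b \<in> S"
  shows "orbit (Transposition.transpose a b \<circ> q) a = insert a (orbit q b)"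
    and "\<And>x. x \<in> S \<Longrightarrow> b \<in> orbit q x \<Longrightarrow> orbit (Transposition.transpose a b \<circ> q) x = insert a (orbit q b)"
    and "\<And>x. x \<in> S \<Longrightarrow> b \<notin> orbit q x \<Longrightarrow> orbit (Transposition.transpose a b \<circ> q) x = orbit q x"
proof -
  let ?t = "Transposition.transpose a b \<circ> q"
  have pq: "permutation q" using q fin by (auto simp: permutation_permutes)
  have t: "?t permutes insert a S"
    using q b by (intro permutes_compose[OF permutes_imp_permutes_insert] permutes_swap_id) auto
  have pt: "permutation ?t" using t fin permutation_permutes by blast
  have self: "x \<in> orbit ?t x" for x by (rule permutation_self_in_orbit[OF pt])
  have selfq: "x \<in> orbit q x" for x by (rule permutation_self_in_orbit[OF pq])
  have sub: "orbit q x \<subseteq> S" if "x \<in> S" for x using permutes_orbit_subset[OF q that] .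
  have qa: "q a = a" using q a by (simp add: permutes_def)
  have B: "orbit ?t b = insert a (orbit q b)"
  proof
    show "orbit ?t b \<subseteq> insert a (orbit q b)"
    proof
      fix y assume "y \<in> orbit ?t b"
      then show "y \<in> insert a (orbit q b)"
      proof induction
        case base
        then show ?case using selfq[of b] by (auto simp: Transposition.transpose_def intro: orbit.intros)
      next
        case (step y)
        then show ?case using selfq[of b] qa by (auto simp: Transposition.transpose_def intro: orbit.intros)
      qed
    qed
    have st: "q y \<in> orbit ?t b" if y: "y \<in> orbit ?t b" "y \<in> S" for y
    proof (cases "q y = b")
      case False
      have "q y \<noteq> a" using y(2) a permutes_in_image[OF q, of y] by metis
      then have "?t y = q y" using False by (simp add: Transposition.transpose_def)
      then show ?thesis using y(1) orbit.step[of y ?t b] by simp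
    qed (use self in auto)
    have "y \<in> orbit ?t b" if "y \<in> orbit q b" for y
      using that
    proof induction
      case base
      then show ?case using st[OF self b] .
    next
      case (step y)
      then show ?case using st sub[OF b] by blast
    qed
    moreover have "a \<in> orbit ?t b"
    proof -
      \<comment> \<open>The predecessor of \<open>b\<close> is read off from the inductive
        generation of its orbit; it is \<open>b\<close> itself if \<open>b\<close> is fixed.\<close>
      have "\<exists>z. q z = b \<and> z \<in> orbit q b" using selfq[of b]
      proof (cases rule: orbit.cases)
        case base
        then show ?thesis using selfq[of b] by (intro exI[of _ b]) simp
      next
        case (step y)
        then show ?thesis by (intro exI[of _ y]) simp
      qed
      then obtain z where z: "q z = b" "z \<in> orbit q b" by blast
      then have "z \<in> orbit ?t b" using calculation by auto
      moreover have "?t z = a" using z by simp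
      ultimately show ?thesis using orbit.step[of z ?t b] by simp
    qed
    ultimately show "insert a (orbit q b) \<subseteq> orbit ?t b" by auto
  qed
  have eq: "orbit ?t x = orbit ?t b" if "x \<in> orbit ?t b" for x
    using cyclic_on_orbit'[OF pt, of b] that by (rule orbit_cyclic_eq3)
  show "orbit ?t a = insert a (orbit q b)" using eq[of a] B by simp
  show "orbit ?t x = insert a (orbit q b)" if "x \<in> S" "b \<in> orbit q x" for x
  proof -
    have "x \<in> orbit q b" using that selfq orbit_swap by metis
    then show ?thesis using eq[of x] B by simp
  qed
  show "orbit ?t x = orbit q x" if x: "x \<in> S" "b \<notin> orbit q x" for x
  proof (rule orbit_cong[OF selfq])
    fix s assume s: "s \<in> orbit q x"
    then have "q s \<in> orbit q x" by (rule orbit.step)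
    then have "q s \<noteq> b" "q s \<noteq> a" using x sub[OF x(1)] a by auto
    then show "?t s = q s" by (simp add: Transposition.transpose_def)
  qed
qed

section \<open>Cycle types after the insertion of a point\<close>

lemma orbits_disjoint:
  assumes "permutation q" "orbit q x \<noteq> orbit q y"
  shows "orbit q x \<inter> orbit q y = {}"
proof (rule ccontr)
  assume "orbit q x \<inter> orbit q y \<noteq> {}"
  then obtain z where "z \<in> orbit q x" "z \<in> orbit q y" by blast
  then have "orbit q z = orbit q x" "orbit q z = orbit q y"
    using orbit_cyclic_eq3[OF cyclic_on_orbit'[OF assms(1)]] by metis+
  then show False using assms(2) by simp
qed

lemma cycle_type_insert_fixed:
  assumes q: "q permutes S" and fin: "finite S" and a: "a \<notin> S"
  shows "cycle_type q (insert a S) = add_mset 1 (cycle_type q S)"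
    "card (orbit q ` insert a S) = Suc (card (orbit q ` S))"
proof -
  have "orbit q a = {a}" using q a by (simp add: orbit_eq_singleton_iff permutes_def)
  moreover have "{a} \<notin> orbit q ` S" using permutes_orbit_subset[OF q] a by blast
  ultimately show "cycle_type q (insert a S) = add_mset 1 (cycle_type q S)"
    "card (orbit q ` insert a S) = Suc (card (orbit q ` S))"
    using fin by (auto simp: cycle_type_def)
qed

lemma cycle_type_insert_into:
  assumes q: "q permutes S" and fin: "finite S" and a: "a \<notin> S" and b: "b \<in> S"
  shows "cycle_type (Transposition.transpose a b \<circ> q) (insert a S)
      = add_mset (Suc (card (orbit q b))) (cycle_type q S - {#card (orbit q b)#})"
    "card (orbit (Transposition.transpose a b \<circ> q) ` insert a S) = card (orbit q ` S)"
proof -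
  let ?t = "Transposition.transpose a b \<circ> q"
  note o = orbit_transpose_comp[OF q fin a b]
  have pq: "permutation q" using q fin by (auto simp: permutation_permutes)
  have selfq: "x \<in> orbit q x" for x by (rule permutation_self_in_orbit[OF pq])
  have sub: "orbit q x \<subseteq> S" if "x \<in> S" for x using permutes_orbit_subset[OF q that] .
  have iff: "b \<in> orbit q x \<longleftrightarrow> orbit q x = orbit q b" for x
    using selfq orbits_disjoint[OF pq, of x b] by blast
  let ?R = "orbit q ` S - {orbit q b}"
  have im: "orbit ?t ` insert a S = insert (insert a (orbit q b)) ?R"
  proof -
    have "orbit ?t ` S \<subseteq> insert (insert a (orbit q b)) ?R"
    proof (rule image_subsetI)
      fix x assume x: "x \<in> S"
      show "orbit ?t x \<in> insert (insert a (orbit q b)) ?R"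
      proof (cases "b \<in> orbit q x")
        case True
        then show ?thesis using o(2)[OF x] by simp
      next
        case False
        then show ?thesis using o(3)[OF x] iff[of x] x by simp
      qed
    qed
    moreover have "?R \<subseteq> orbit ?t ` S"
    proof
      fix c assume "c \<in> ?R"
      then obtain x where x: "x \<in> S" "c = orbit q x" "orbit q x \<noteq> orbit q b" by auto
      then have "orbit ?t x = c" using o(3) iff by simp
      then show "c \<in> orbit ?t ` S" using x(1) by blast
    qed
    ultimately show ?thesis using o(1) by auto
  qed
  have nin: "insert a (orbit q b) \<notin> ?R" using sub a by blast
  have finb: "finite (orbit q b)" "a \<notin> orbit q b" using sub[OF b] fin a finite_subset by auto
  have mem: "orbit q b \<in> orbit q ` S" using b by simp
  have "mset_set (orbit q ` S) = add_mset (orbit q b) (mset_set ?R)"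
    by (rule mset_set.remove[OF finite_imageI[OF fin] mem])
  then show "cycle_type ?t (insert a S)
      = add_mset (Suc (card (orbit q b))) (cycle_type q S - {#card (orbit q b)#})"
    unfolding cycle_type_def im using nin fin finb by simp
  show "card (orbit ?t ` insert a S) = card (orbit q ` S)"
    unfolding im card.remove[OF finite_imageI[OF fin] mem] using nin fin by simp
qed

text \<open>Points are grouped by cycles: a cycle of length \<open>k\<close> offers \<open>k\<close>
  places for the insertion of a new point.\<close>

lemma sum_orbit_card:
  assumes q: "q permutes S" and fin: "finite S"
  shows "(\<Sum>b\<in>S. g (card (orbit q b))) = (\<Sum>k\<in>#cycle_type q S. real k * g k)"
proof -
  have pq: "permutation q" using q fin by (auto simp: permutation_permutes)
  have "(\<Sum>b\<in>S. g (card (orbit q b))) = (\<Sum>c\<in>orbit q ` S. \<Sum>b\<in>{b\<in>S. orbit q b = c}. g (card (orbit q b)))"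
    by (rule sum.image_gen[OF fin])
  also have "\<dots> = (\<Sum>c\<in>orbit q ` S. real (card c) * g (card c))"
  proof (rule sum.cong[OF refl])
    fix c assume "c \<in> orbit q ` S"
    then obtain x where x: "x \<in> S" "c = orbit q x" by auto
    have "{b\<in>S. orbit q b = c} = c"
    proof
      show "{b\<in>S. orbit q b = c} \<subseteq> c" using permutation_self_in_orbit[OF pq] by auto
      show "c \<subseteq> {b\<in>S. orbit q b = c}"
        using x permutes_orbit_subset[OF q x(1)] orbit_cyclic_eq3[OF cyclic_on_orbit'[OF pq]] by auto
    qed
    then have "(\<Sum>b\<in>{b\<in>S. orbit q b = c}. g (card (orbit q b))) = (\<Sum>b\<in>{b\<in>S. orbit q b = c}. g (card c))"
      by (intro sum.cong) auto
    then show "(\<Sum>b\<in>{b\<in>S. orbit q b = c}. g (card (orbit q b))) = real (card c) * g (card c)"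
      using \<open>{b\<in>S. orbit q b = c} = c\<close> by simp
  qed
  also have "\<dots> = (\<Sum>k\<in>#cycle_type q S. real k * g k)"
    by (simp add: cycle_type_def sum_unfold_sum_mset image_mset.compositionality comp_def)
  finally show ?thesis .
qed

text \<open>Every permutation of \<open>insert a S\<close> is in a unique way a permutation of
  \<open>S\<close> followed by the transposition of \<open>a\<close> with some \<open>b\<close>; the
  choice \<open>b = a\<close> leaves \<open>a\<close> fixed. The induction replaces \<open>F\<close>
  by \<open>insertion_op \<theta> F\<close>, so \<open>F\<close> must be arbitrary.\<close>

lemma sum_permutes_cycle_type:
  assumes "finite S"
  shows "(\<Sum>\<sigma> | \<sigma> permutes S. \<theta> ^ card (orbit \<sigma> ` S) * F (cycle_type \<sigma> S)) = cycle_sum \<theta> (card S) F"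
  using assms
proof (induction S arbitrary: F rule: finite_induct)
  case empty
  have "{\<sigma>. \<sigma> permutes ({} :: 'a set)} = {id}" by auto
  then show ?case by (simp add: cycle_type_def)
next
  case (insert a S)
  have "(\<Sum>\<sigma> | \<sigma> permutes insert a S. \<theta> ^ card (orbit \<sigma> ` insert a S) * F (cycle_type \<sigma> (insert a S)))
      = (\<Sum>b\<in>insert a S. \<Sum>q | q permutes S. \<theta> ^ card (orbit (Transposition.transpose a b \<circ> q) ` insert a S)
            * F (cycle_type (Transposition.transpose a b \<circ> q) (insert a S)))"
    by (rule sum_over_permutations_insert) (use insert in auto)
  also have "\<dots> = (\<Sum>q | q permutes S. \<Sum>b\<in>insert a S. \<theta> ^ card (orbit (Transposition.transpose a b \<circ> q) ` insert a S)
            * F (cycle_type (Transposition.transpose a b \<circ> q) (insert a S)))"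
    by (rule sum.swap)
  also have "\<dots> = (\<Sum>q | q permutes S. \<theta> ^ card (orbit q ` S) * insertion_op \<theta> F (cycle_type q S))"
  proof (rule sum.cong[OF refl])
    fix q assume "q \<in> {q. q permutes S}"
    then have q: "q permutes S" by simp
    have "(\<Sum>b\<in>insert a S. \<theta> ^ card (orbit (Transposition.transpose a b \<circ> q) ` insert a S)
            * F (cycle_type (Transposition.transpose a b \<circ> q) (insert a S)))
        = \<theta> ^ Suc (card (orbit q ` S)) * F (add_mset 1 (cycle_type q S)) +
          (\<Sum>b\<in>S. \<theta> ^ card (orbit q ` S) *
            F (add_mset (Suc (card (orbit q b))) (cycle_type q S - {#card (orbit q b)#})))"
      using insert cycle_type_insert_fixed[OF q insert(1,2)] cycle_type_insert_into[OF q insert(1,2)]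
      by (simp add: comp_def[of id])
    also have "\<dots> = \<theta> ^ card (orbit q ` S) * (\<theta> * F (add_mset 1 (cycle_type q S)) +
          (\<Sum>b\<in>S. F (add_mset (Suc (card (orbit q b))) (cycle_type q S - {#card (orbit q b)#}))))"
      by (simp add: algebra_simps sum_distrib_left)
    also have "\<dots> = \<theta> ^ card (orbit q ` S) * insertion_op \<theta> F (cycle_type q S)"
      unfolding insertion_op_def
      using sum_orbit_card[OF q insert(1), of "\<lambda>k. F (add_mset (Suc k) (cycle_type q S - {#k#}))"] by simp
    finally show "(\<Sum>b\<in>insert a S. \<theta> ^ card (orbit (Transposition.transpose a b \<circ> q) ` insert a S)
            * F (cycle_type (Transposition.transpose a b \<circ> q) (insert a S)))
        = \<theta> ^ card (orbit q ` S) * insertion_op \<theta> F (cycle_type q S)" .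
  qed
  also have "\<dots> = cycle_sum \<theta> (card (insert a S)) F" using insert by simp
  finally show ?case .
qed

section \<open>The recursion over the length of one cycle\<close>

lemma insertion_op_linear:
  "insertion_op \<theta> (\<lambda>M. F M + c * G M) = (\<lambda>M. insertion_op \<theta> F M + c * insertion_op \<theta> G M)"
proof
  fix M
  have "(\<Sum>k\<in>#M. real k * (F (add_mset (Suc k) (M - {#k#})) + c * G (add_mset (Suc k) (M - {#k#}))))
      = (\<Sum>k\<in>#M. real k * F (add_mset (Suc k) (M - {#k#})) + c * (real k * G (add_mset (Suc k) (M - {#k#}))))"
    by (simp add: distrib_left mult.left_commute)
  also have "\<dots> = (\<Sum>k\<in>#M. real k * F (add_mset (Suc k) (M - {#k#})))
      + c * (\<Sum>k\<in>#M. real k * G (add_mset (Suc k) (M - {#k#})))"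
    by (simp add: sum_mset.distrib sum_mset_distrib_left)
  finally show "insertion_op \<theta> (\<lambda>M. F M + c * G M) M = insertion_op \<theta> F M + c * insertion_op \<theta> G M"
    unfolding insertion_op_def by (simp only: distrib_left mult.left_commute[of c] add_ac)
qed

lemma cycle_sum_linear:
  "cycle_sum \<theta> n (\<lambda>M. F M + c * G M) = cycle_sum \<theta> n F + c * cycle_sum \<theta> n G"
proof (induction n arbitrary: F G)
  case (Suc n)
  show ?case unfolding cycle_sum.simps by (subst insertion_op_linear, rule Suc)
qed simp

text \<open>One cycle, of length \<open>m\<close>, is marked: a new point goes to the unmarked part,
  or into the marked cycle at one of its \<open>m\<close> places. This drives the induction for
  \<open>cycle_sum_recursion\<close>.\<close>

lemma insertion_op_add_mset:
  "insertion_op \<theta> F (add_mset m M) =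
     insertion_op \<theta> (\<lambda>M. F (add_mset m M)) M + real m * F (add_mset (Suc m) M)"
proof -
  have "(\<Sum>k\<in>#M. real k * F (add_mset (Suc k) (add_mset m M - {#k#})))
      = (\<Sum>k\<in>#M. real k * F (add_mset m (add_mset (Suc k) (M - {#k#}))))"
  proof (rule arg_cong[where f = sum_mset], rule image_mset_cong)
    fix k assume "k \<in># M"
    then have "add_mset m M - {#k#} = add_mset m (M - {#k#})" by (cases "k = m") auto
    then show "real k * F (add_mset (Suc k) (add_mset m M - {#k#}))
        = real k * F (add_mset m (add_mset (Suc k) (M - {#k#})))" by (simp add: add_mset_commute)
  qed
  then show ?thesis by (simp add: insertion_op_def add_mset_commute)
qed

text \<open>Classifies permutations by the length \<open>n - j\<close> of the cycle through a given
  point; \<open>fact (n - 1) / fact j\<close> is the number of such cycles. The proof stays with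
  test functions: the marked cycle is followed while points are inserted one by one.\<close>

lemma cycle_sum_recursion:
  assumes "n \<ge> 1"
  shows "cycle_sum \<theta> n F =
    (\<Sum>j<n. \<theta> * fact (n - 1) / fact j * cycle_sum \<theta> j (\<lambda>M. F (add_mset (n - j) M)))"
  using assms
proof (induction n arbitrary: F rule: nat_induct_at_least)
  case base
  then show ?case by (simp add: insertion_op_def)
next
  case (Suc n)
  define R where "R i = cycle_sum \<theta> i (\<lambda>M. F (add_mset (Suc n - i) M))" for i
  define c where "c j = \<theta> * fact (n - 1) / fact j" for j
  have "cycle_sum \<theta> (Suc n) F = (\<Sum>j<n. c j * cycle_sum \<theta> j (\<lambda>M. insertion_op \<theta> F (add_mset (n - j) M)))"
    using Suc by (simp add: c_def)
  \<comment> \<open>The new point enlarges the unmarked part to \<open>Suc j\<close> points, or it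
    enters the marked cycle of length \<open>n - j\<close>. In both cases the marked cycle gets the
    length recorded in \<open>R\<close>.\<close>
  also have "\<dots> = (\<Sum>j<n. c j * R (Suc j) + c j * (real n - real j) * R j)"
  proof (rule sum.cong[OF refl])
    fix j assume j: "j \<in> {..<n}"
    then show "c j * cycle_sum \<theta> j (\<lambda>M. insertion_op \<theta> F (add_mset (n - j) M))
        = c j * R (Suc j) + c j * (real n - real j) * R j"
      unfolding insertion_op_add_mset cycle_sum_linear R_def
      by (simp add: algebra_simps of_nat_diff Suc_diff_le)
  qed
  also have "\<dots> = (\<Sum>j<n. c j * R (Suc j)) + (\<Sum>j<Suc n. c j * (real n - real j) * R j)"
    by (simp add: sum.distrib)
  \<comment> \<open>After the shift size \<open>j\<close> carries the factor \<open>real j\<close>.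
    Together with \<open>real n - real j\<close> this makes \<open>real n\<close>, which completes
    the factorial. The terms added at \<open>j = 0\<close> here and at \<open>j = n\<close> before
    have factor 0.\<close>
  also have "(\<Sum>j<n. c j * R (Suc j)) = (\<Sum>j<Suc n. c j * real j * R j)"
  proof -
    have "c (Suc j) * real (Suc j) = c j" for j
      by (simp add: c_def del: of_nat_Suc)
    then show ?thesis unfolding sum.lessThan_Suc_shift by simp
  qed
  also have "\<dots> + (\<Sum>j<Suc n. c j * (real n - real j) * R j) = (\<Sum>j<Suc n. c j * real n * R j)"
    unfolding sum.distrib[symmetric] by (intro sum.cong) (auto simp: algebra_simps)
  also have "\<dots> = (\<Sum>j<Suc n. \<theta> * fact (Suc n - 1) / fact j * R j)"
  proof -
    have "fact n = real n * fact (n - 1)" using Suc by (simp add: fact_reduce)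
    then show ?thesis by (intro sum.cong) (auto simp: c_def)
  qed
  finally show ?case by (simp add: R_def)
qed

lemma w_stat_cycle_type:
  assumes "\<sigma> permutes {1..n}"
  shows "w_stat f x n \<sigma> = (\<Sum>m\<in>#cycle_type \<sigma> {1..n}. Ln (f (x ^ m)))"
proof -
  let ?C = "orbit \<sigma> ` {1..n}"
  have fin: "finite ?C" by simp
  have card: "card c \<in> {1..n}" if c: "c \<in> ?C" for c
  proof -
    obtain y where y: "c = orbit \<sigma> y" "y \<in> {1..n}" using c by (rule imageE)
    then have sub: "c \<subseteq> {1..n}" using permutes_orbit_subset[OF assms] by metis
    then have "card c \<le> card {1..n}" by (intro card_mono) auto
    moreover have "card c > 0" using sub y orbit_nonempty by (metis card_gt_0_iff finite_atLeastAtMost finite_subset)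
    ultimately show ?thesis by auto
  qed
  have "(\<Sum>m\<in>#cycle_type \<sigma> {1..n}. Ln (f (x ^ m))) = (\<Sum>c\<in>?C. Ln (f (x ^ card c)))"
    by (simp add: cycle_type_def sum_unfold_sum_mset image_mset.compositionality comp_def)
  also have "\<dots> = (\<Sum>m=1..n. \<Sum>c\<in>{c\<in>?C. card c = m}. Ln (f (x ^ card c)))"
    by (rule sum.group[symmetric]) (use card in auto)
  also have "\<dots> = (\<Sum>m=1..n. of_nat (cycle_count n m \<sigma>) * Ln (f (x ^ m)))"
    by (intro sum.cong) (auto simp: cycle_count_def cycle_sets_def)
  finally show ?thesis by (simp add: w_stat_def)
qed

lemma integral_ewens_measure:
  assumes "\<theta> > 0"
  shows "(\<integral>\<sigma>. G (w_stat f x n \<sigma>) \<partial>ewens_measure \<theta> n)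
      = cycle_sum \<theta> n (\<lambda>M. G (\<Sum>m\<in>#M. Ln (f (x ^ m)))) / pochhammer \<theta> n"
proof -
  have pos: "pochhammer \<theta> n > 0" using assms by (rule pochhammer_pos)
  have "(\<integral>\<sigma>. G (w_stat f x n \<sigma>) \<partial>ewens_measure \<theta> n)
      = (\<Sum>\<sigma> | \<sigma> permutes {1..n}. (\<theta> ^ card (cycle_sets n \<sigma>) / pochhammer \<theta> n) * G (w_stat f x n \<sigma>))"
    unfolding ewens_measure_def
    using assms pos finite_permutations[of "{1..n}"]
    by (subst lebesgue_integral_point_measure_finite) auto
  also have "\<dots> = (\<Sum>\<sigma> | \<sigma> permutes {1..n}. \<theta> ^ card (orbit \<sigma> ` {1..n}) *
        G (\<Sum>m\<in>#cycle_type \<sigma> {1..n}. Ln (f (x ^ m)))) / pochhammer \<theta> n"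
    unfolding sum_divide_distrib
    by (intro sum.cong) (auto simp: w_stat_cycle_type cycle_sets_def)
  also have "\<dots> = cycle_sum \<theta> n (\<lambda>M. G (\<Sum>m\<in>#M. Ln (f (x ^ m)))) / pochhammer \<theta> n"
    using sum_permutes_cycle_type[of "{1..n}" \<theta> "\<lambda>M. G (\<Sum>m\<in>#M. Ln (f (x ^ m)))"] by simp
  finally show ?thesis .
qed

section \<open>Smoothing in two directions\<close>

text \<open>The heat semigroup at time \<open>s\<close> of a possibly degenerate Gaussian law whose
  covariance is the sum of the rank-one forms of \<alpha> and \<beta>.\<close>

definition gauss2 :: "'a::euclidean_space \<Rightarrow> 'a \<Rightarrow> real \<Rightarrow> ('a \<Rightarrow> real) \<Rightarrow> 'a \<Rightarrow> real" where
  "gauss2 \<alpha> \<beta> s F = gauss_avg (sqrt s *\<^sub>R \<alpha>) (gauss_avg (sqrt s *\<^sub>R \<beta>) F)"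

lemma gauss2_semigroup:
  assumes F: "linear_growth F" and "s \<ge> 0" "t \<ge> 0"
  shows "gauss2 \<alpha> \<beta> s (gauss2 \<alpha> \<beta> t F) = gauss2 \<alpha> \<beta> (s + t) F"
proof -
  have "gauss2 \<alpha> \<beta> s (gauss2 \<alpha> \<beta> t F) =
    gauss_avg (sqrt s *\<^sub>R \<alpha>) (gauss_avg (sqrt t *\<^sub>R \<alpha>) (gauss_avg (sqrt s *\<^sub>R \<beta>) (gauss_avg (sqrt t *\<^sub>R \<beta>) F)))"
    unfolding gauss2_def
    by (subst gauss_avg_commute[of _ "sqrt s *\<^sub>R \<beta>"]) (auto intro: linear_growth_gauss_avg F)
  also have "\<dots> = gauss2 \<alpha> \<beta> (s + t) F"
    unfolding gauss2_def using assms
    by (simp add: gauss_avg_semigroup linear_growth_gauss_avg)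
  finally show ?thesis .
qed

lemma gauss2_0:
  assumes "linear_growth F"
  shows "gauss2 \<alpha> \<beta> 0 F = F"
  unfolding gauss2_def gauss_avg_def using std_normal.prob_space by (simp add: fun_eq_iff)

lemma C2_fun_gauss2:
  assumes "C2_fun b\<^sub>1 b\<^sub>2 W W\<^sub>1 W\<^sub>2"
  shows "C2_fun b\<^sub>1 b\<^sub>2 (gauss2 \<alpha> \<beta> s W) (\<lambda>y h. gauss2 \<alpha> \<beta> s (\<lambda>y. W\<^sub>1 y h) y)
    (\<lambda>y k h. gauss2 \<alpha> \<beta> s (\<lambda>y. W\<^sub>2 y k h) y)"
  unfolding gauss2_def by (rule C2_fun_gauss_avg[OF C2_fun_gauss_avg[OF assms]])

text \<open>At scale \<open>s\<close> the second derivative becomes Lipschitz, with constant of order \<open>1 / sqrt s\<close>, along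
  the directions charged by the Gaussian. These may form a proper subspace. The factor \<open>1 + norm k\<close>
  covers small \<open>s\<close> as well.\<close>

lemma gauss2_modulus:
  assumes F: "F \<in> borel_measurable borel" and M: "\<And>v. \<bar>F v\<bar> \<le> M" and s: "s \<ge> 0"
    and k: "k = p *\<^sub>R \<alpha> + q *\<^sub>R \<beta>" "\<bar>p\<bar> + \<bar>q\<bar> \<le> \<Lambda> * norm k" and \<Lambda>: "\<Lambda> \<ge> 0"
  shows "\<bar>gauss2 \<alpha> \<beta> s F (y + k) - gauss2 \<alpha> \<beta> s F y\<bar> \<le> 4 * (1 + \<Lambda>) * M / sqrt (s + 1) * (1 + norm k)"
proof -
  have lg: "linear_growth F" using F M by (rule linear_growth_bounded)
  have M0: "M \<ge> 0" using M[of 0] by linarith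
  have lga: "linear_growth (gauss_avg a F)" for a by (rule linear_growth_gauss_avg[OF lg])
  have bda: "\<bar>gauss_avg a F v\<bar> \<le> M" for a v by (rule gauss_avg_bound[OF lg M])
  show ?thesis
  proof (cases "s < 1")
    case True
    have b: "\<bar>gauss2 \<alpha> \<beta> s F v\<bar> \<le> M" for v
      unfolding gauss2_def by (rule gauss_avg_bound[OF lga bda])
    have "\<bar>gauss2 \<alpha> \<beta> s F (y + k) - gauss2 \<alpha> \<beta> s F y\<bar> \<le> 2 * M"
      using b[of y] b[of "y + k"] by linarith
    also have "\<dots> \<le> 4 * (1 + \<Lambda>) * M / sqrt (s + 1) * (1 + norm k)"
    proof -
      have "sqrt (s + 1) \<le> 2" using True by (intro real_le_lsqrt) auto
      then have "2 * M * sqrt (s + 1) \<le> 4 * M" using M0 mult_left_mono[of "sqrt (s + 1)" 2 "2 * M"] by simp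
      also have "\<dots> \<le> 4 * M * ((1 + \<Lambda>) * (1 + norm k))"
        using M0 \<Lambda> mult_left_mono[of 1 "(1 + \<Lambda>) * (1 + norm k)" "4 * M"]
        by (simp add: algebra_simps)
      finally show ?thesis using s by (simp add: field_simps)
    qed
    finally show ?thesis .
  next
    case False
    then have s0: "sqrt s > 0" by simp
    have 1: "\<bar>gauss2 \<alpha> \<beta> s F (y + q *\<^sub>R \<beta> + p *\<^sub>R \<alpha>) - gauss2 \<alpha> \<beta> s F (y + q *\<^sub>R \<beta>)\<bar> \<le> 2 * M * \<bar>p / sqrt s\<bar>"
      using gauss_avg_shift[OF gauss_avg_measurable[OF lg] bda, of "sqrt s *\<^sub>R \<alpha>" "sqrt s *\<^sub>R \<beta>" "y + q *\<^sub>R \<beta>" "p / sqrt s"] s0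
      unfolding gauss2_def by simp
    \<comment> \<open>\<open>gauss_avg_shift\<close> acts on the outer average; since the two
      averages commute, \<beta> can be made the outer direction.\<close>
    have 2: "\<bar>gauss2 \<alpha> \<beta> s F (y + q *\<^sub>R \<beta>) - gauss2 \<alpha> \<beta> s F y\<bar> \<le> 2 * M * \<bar>q / sqrt s\<bar>"
      using gauss_avg_shift[OF gauss_avg_measurable[OF lg] bda, of "sqrt s *\<^sub>R \<beta>" "sqrt s *\<^sub>R \<alpha>" y "q / sqrt s"] s0
      unfolding gauss2_def gauss_avg_commute[OF lg, of "sqrt s *\<^sub>R \<alpha>"] by simp
    have "y + q *\<^sub>R \<beta> + p *\<^sub>R \<alpha> = y + k" using k by simp
    then have "\<bar>gauss2 \<alpha> \<beta> s F (y + k) - gauss2 \<alpha> \<beta> s F y\<bar> \<le> 2 * M * \<bar>p / sqrt s\<bar> + 2 * M * \<bar>q / sqrt s\<bar>"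
      using 1 2 by (simp only:)
    also have "\<dots> = 2 * M * (\<bar>p\<bar> + \<bar>q\<bar>) / sqrt s" using s0 by (simp add: algebra_simps add_divide_distrib)
    also have "\<dots> \<le> 2 * M * ((1 + \<Lambda>) * (1 + norm k)) / (sqrt (s + 1) / 2)"
    proof (rule frac_le)
      have "(1 + \<Lambda>) * (1 + norm k) = 1 + \<Lambda> + norm k + \<Lambda> * norm k" by (simp add: algebra_simps)
      then have "\<bar>p\<bar> + \<bar>q\<bar> \<le> (1 + \<Lambda>) * (1 + norm k)" using k(2) \<Lambda> norm_ge_zero[of k] by linarith
      then show "2 * M * (\<bar>p\<bar> + \<bar>q\<bar>) \<le> 2 * M * ((1 + \<Lambda>) * (1 + norm k))"
        using M0 by (intro mult_left_mono) auto
      have "sqrt (s + 1) \<le> sqrt (4 * s)" using False by (intro real_sqrt_le_mono) auto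
      then show "sqrt (s + 1) / 2 \<le> sqrt s" by (simp add: real_sqrt_mult)
    qed (use M0 \<Lambda> s in auto)
    finally show ?thesis by (simp add: field_simps)
  qed
qed

text \<open>A substitute for a bounded third derivative. Translations are confined to
  \<open>R\<close>, because the Gaussian smooths only there, while the directions \<open>h\<close>
  and \<open>h'\<close> stay arbitrary.\<close>

locale C2_modulus = C2_fun b\<^sub>1 b\<^sub>2 W W\<^sub>1 W\<^sub>2
  for b\<^sub>1 b\<^sub>2 and W :: "'a::euclidean_space \<Rightarrow> real" and W\<^sub>1 W\<^sub>2 +
  fixes \<kappa> :: real and R :: "'a set"
  assumes R: "subspace R" and kappa: "\<kappa> \<ge> 0"
    and modulus: "k \<in> R \<Longrightarrow> \<bar>W\<^sub>2 (y + k) h h' - W\<^sub>2 y h h'\<bar> \<le> \<kappa> * (1 + norm k) * norm h * norm h'"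
begin

section \<open>Taylor expansions of Gaussian averages\<close>

lemma taylor1:
  assumes k: "k \<in> R"
  shows "\<bar>W\<^sub>1 (y + k) h - W\<^sub>1 y h - W\<^sub>2 y k h\<bar> \<le> \<kappa> * (1 + norm k) * norm k * norm h"
proof -
  have "norm ((W\<^sub>1 (y + 1 *\<^sub>R k) h - 1 * W\<^sub>2 y k h) - (W\<^sub>1 (y + 0 *\<^sub>R k) h - 0 * W\<^sub>2 y k h))
      \<le> \<kappa> * (1 + norm k) * norm k * norm h * norm (1 - 0 :: real)"
  \<comment> \<open>The linear term is subtracted beforehand, so the mean value inequality sees only
    the change of the second derivative along the segment.\<close>
  proof (rule field_differentiable_bound[of "{0..1}" "\<lambda>r. W\<^sub>1 (y + r *\<^sub>R k) h - r * W\<^sub>2 y k h"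
        "\<lambda>r. W\<^sub>2 (y + r *\<^sub>R k) k h - W\<^sub>2 y k h"])
    fix r :: real assume r: "r \<in> {0..1}"
    have "((\<lambda>r. W\<^sub>1 (y + r *\<^sub>R k) h - r * W\<^sub>2 y k h) has_real_derivative W\<^sub>2 (y + r *\<^sub>R k) k h - 1 * W\<^sub>2 y k h) (at r)"
      by (rule DERIV_diff[OF deriv2 DERIV_cmult_right[OF DERIV_ident]])
    then show "((\<lambda>r. W\<^sub>1 (y + r *\<^sub>R k) h - r * W\<^sub>2 y k h) has_field_derivative W\<^sub>2 (y + r *\<^sub>R k) k h - W\<^sub>2 y k h) (at r within {0..1})"
      by (simp add: has_field_derivative_at_within)
    have "\<bar>W\<^sub>2 (y + r *\<^sub>R k) k h - W\<^sub>2 y k h\<bar> \<le> \<kappa> * (1 + norm (r *\<^sub>R k)) * norm k * norm h"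
      using subspace_scale[OF R k] by (rule modulus)
    also have "\<dots> \<le> \<kappa> * (1 + norm k) * norm k * norm h"
      using r kappa mult_right_mono[of r 1 "norm k"] by (intro mult_right_mono mult_left_mono) auto
    finally show "norm (W\<^sub>2 (y + r *\<^sub>R k) k h - W\<^sub>2 y k h) \<le> \<kappa> * (1 + norm k) * norm k * norm h" by simp
  qed auto
  then show ?thesis by simp
qed

lemma taylor2:
  assumes h: "h \<in> R"
  shows "\<bar>W (y + h) - W y - W\<^sub>1 y h - W\<^sub>2 y h h / 2\<bar> \<le> \<kappa> * (1 + norm h) * (norm h)\<^sup>2 / 2"
proof -
  define D where "D = (\<lambda>(m::nat) r. if m = 0 then W (y + r *\<^sub>R h) else if m = 1 then W\<^sub>1 (y + r *\<^sub>R h) h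
      else W\<^sub>2 (y + r *\<^sub>R h) h h)"
  have "\<exists>t::real. 0 < t \<and> t < 1 \<and> W (y + 1 *\<^sub>R h) = (\<Sum>m<2::nat. (D m 0 / fact m) * 1 ^ m) + (D 2 t / fact 2) * 1 ^ 2"
  proof (rule Maclaurin)
    show "\<forall>m t. m < 2 \<and> 0 \<le> t \<and> t \<le> 1 \<longrightarrow> (D m has_real_derivative D (Suc m) t) (at t)"
    proof (intro allI impI)
      fix m :: nat and t :: real assume "m < 2 \<and> 0 \<le> t \<and> t \<le> 1"
      then consider "m = 0" | "m = 1" by linarith
      then show "(D m has_real_derivative D (Suc m) t) (at t)"
        using deriv1[of y h t] deriv2[of y h h t] by cases (auto simp: D_def)
    qed
  qed (auto simp: D_def)
  then obtain t where t: "0 < t" "t < 1" "W (y + h) = W y + W\<^sub>1 y h + W\<^sub>2 (y + t *\<^sub>R h) h h / 2"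
    by (auto simp: D_def numeral_2_eq_2)
  have "\<bar>W\<^sub>2 (y + t *\<^sub>R h) h h - W\<^sub>2 y h h\<bar> \<le> \<kappa> * (1 + norm (t *\<^sub>R h)) * norm h * norm h"
    using subspace_scale[OF R h] by (rule modulus)
  also have "\<dots> \<le> \<kappa> * (1 + norm h) * norm h * norm h"
    using t kappa mult_right_mono[of t 1 "norm h"] by (intro mult_right_mono mult_left_mono) auto
  finally have *: "\<bar>W\<^sub>2 (y + t *\<^sub>R h) h h - W\<^sub>2 y h h\<bar> \<le> \<kappa> * (1 + norm h) * (norm h)\<^sup>2"
    by (simp add: power2_eq_square mult_ac)
  have e: "W (y + h) - W y - W\<^sub>1 y h - W\<^sub>2 y h h / 2 = (W\<^sub>2 (y + t *\<^sub>R h) h h - W\<^sub>2 y h h) / 2"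
    unfolding t(3) by (simp add: field_simps)
  show ?thesis unfolding e using * by simp
qed

lemma C2_modulus_gauss_avg:
  "C2_modulus b\<^sub>1 b\<^sub>2 (gauss_avg a W) (\<lambda>y h. gauss_avg a (\<lambda>y. W\<^sub>1 y h) y)
    (\<lambda>y k h. gauss_avg a (\<lambda>y. W\<^sub>2 y k h) y) \<kappa> R"
proof (rule C2_modulus.intro[OF C2_fun_gauss_avg[OF C2_fun_axioms]], rule C2_modulus_axioms.intro)
  fix k y h h' assume k: "k \<in> R"
  have i: "integrable std_normal_distribution (\<lambda>x. W\<^sub>2 (v + x *\<^sub>R a) h h')" for v
    by (rule integrable_linear_growth[OF growth2])
  have "\<bar>gauss_avg a (\<lambda>y. W\<^sub>2 y h h') (y + k) - gauss_avg a (\<lambda>y. W\<^sub>2 y h h') y\<bar>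
      = \<bar>\<integral>x. W\<^sub>2 (y + k + x *\<^sub>R a) h h' - W\<^sub>2 (y + x *\<^sub>R a) h h' \<partial>std_normal_distribution\<bar>"
    unfolding gauss_avg_def using i by simp
  also have "\<dots> \<le> (\<integral>x. \<bar>W\<^sub>2 (y + k + x *\<^sub>R a) h h' - W\<^sub>2 (y + x *\<^sub>R a) h h'\<bar> \<partial>std_normal_distribution)"
    by (rule integral_abs_bound)
  also have "\<dots> \<le> (\<integral>x. \<kappa> * (1 + norm k) * norm h * norm h' \<partial>std_normal_distribution)"
  proof (rule integral_mono)
    show "\<bar>W\<^sub>2 (y + k + x *\<^sub>R a) h h' - W\<^sub>2 (y + x *\<^sub>R a) h h'\<bar> \<le> \<kappa> * (1 + norm k) * norm h * norm h'" for x
      using modulus[OF k, of "y + x *\<^sub>R a" h h'] by (simp add: add_ac)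
  qed (use i in auto)
  finally show "\<bar>gauss_avg a (\<lambda>y. W\<^sub>2 y h h') (y + k) - gauss_avg a (\<lambda>y. W\<^sub>2 y h h') y\<bar>
      \<le> \<kappa> * (1 + norm k) * norm h * norm h'"
    using std_normal.prob_space by simp
qed (rule R kappa)+

text \<open>Terms of first order integrate to 0 and the variance is 1, so the average acts to
  leading order as half the second derivative; absolute moments up to order 3 bound the remainders.
  The second and third bounds allow derivatives of the average in place of derivatives of the
  function.\<close>

lemma gauss_avg_expansion:
  assumes a: "a \<in> R"
  shows "\<bar>gauss_avg a W y - W y - W\<^sub>2 y a a / 2\<bar> \<le> \<kappa> * (1 + norm a) * (norm a)\<^sup>2"
    and "\<bar>gauss_avg a (\<lambda>y. W\<^sub>1 y h) y - W\<^sub>1 y h\<bar> \<le> \<kappa> * (1 + norm a) * norm a * norm h"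
    and "\<bar>gauss_avg a (\<lambda>y. W\<^sub>2 y k h) y - W\<^sub>2 y k h\<bar> \<le> \<kappa> * (1 + norm a) * norm k * norm h"
proof -
  have aR: "x *\<^sub>R a \<in> R" for x using subspace_scale[OF R a] .
  note i0 = integrable_linear_growth[OF growth] and i1 = integrable_linear_growth[OF growth1]
    and i2 = integrable_linear_growth[OF growth2]
  have im: "integrable std_normal_distribution (\<lambda>x. \<bar>x\<bar> ^ k)" for k by (rule integrable_std_abs_moment)
  have i: "integrable std_normal_distribution (\<lambda>x. x)" "integrable std_normal_distribution (\<lambda>x. x\<^sup>2)"
     "integrable std_normal_distribution (\<lambda>x. \<bar>x\<bar>)"
    using integrable_std_normal_distribution_moment[of 1] integrable_std_normal_distribution_moment[of 2] im[of 1] by auto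
  have p: "measure std_normal_distribution (space std_normal_distribution) = 1" by (rule std_normal.prob_space)
  have "gauss_avg a W y - W y - W\<^sub>2 y a a / 2
      = (\<integral>x. W (y + x *\<^sub>R a) - W y - x * W\<^sub>1 y a - x\<^sup>2 * (W\<^sub>2 y a a / 2) \<partial>std_normal_distribution)"
    unfolding gauss_avg_def using i0 i std_moments p by simp
  then have "\<bar>gauss_avg a W y - W y - W\<^sub>2 y a a / 2\<bar>
      \<le> (\<integral>x. \<bar>W (y + x *\<^sub>R a) - W y - x * W\<^sub>1 y a - x\<^sup>2 * (W\<^sub>2 y a a / 2)\<bar> \<partial>std_normal_distribution)"
    by (simp add: integral_abs_bound)
  also have "\<dots> \<le> (\<integral>x. \<kappa> * (norm a)\<^sup>2 / 2 * x\<^sup>2 + \<kappa> * (norm a)\<^sup>2 / 2 * norm a * \<bar>x\<bar> ^ 3 \<partial>std_normal_distribution)"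
  proof (rule integral_mono)
    fix x :: real
    have "\<bar>W (y + x *\<^sub>R a) - W y - x * W\<^sub>1 y a - x\<^sup>2 * (W\<^sub>2 y a a / 2)\<bar>
        = \<bar>W (y + x *\<^sub>R a) - W y - W\<^sub>1 y (x *\<^sub>R a) - W\<^sub>2 y (x *\<^sub>R a) (x *\<^sub>R a) / 2\<bar>"
      by (simp add: linear_scale[OF lin1] linear_scale[OF lin2(1)] linear_scale[OF lin2(2)] power2_eq_square)
    also have "\<dots> \<le> \<kappa> * (1 + norm (x *\<^sub>R a)) * (norm (x *\<^sub>R a))\<^sup>2 / 2" by (rule taylor2[OF aR])
    also have "\<dots> = \<kappa> * (norm a)\<^sup>2 / 2 * x\<^sup>2 + \<kappa> * (norm a)\<^sup>2 / 2 * norm a * \<bar>x\<bar> ^ 3"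
    proof -
      have "\<bar>x\<bar> ^ 3 = \<bar>x\<bar> * x\<^sup>2" by (simp add: power3_eq_cube power2_eq_square)
      then show ?thesis by (simp add: power_mult_distrib field_simps)
    qed
    finally show "\<bar>W (y + x *\<^sub>R a) - W y - x * W\<^sub>1 y a - x\<^sup>2 * (W\<^sub>2 y a a / 2)\<bar> \<le> \<dots>" .
  qed (use i0 i im[of 3] in auto)
  also have "\<dots> = \<kappa> * (norm a)\<^sup>2 / 2 * 1 + \<kappa> * (norm a)\<^sup>2 / 2 * norm a * (\<integral>x. \<bar>x\<bar> ^ 3 \<partial>std_normal_distribution)"
    using i im[of 3] std_moments(2) by simp
  also have "\<dots> \<le> \<kappa> * (norm a)\<^sup>2 / 2 * 1 + \<kappa> * (norm a)\<^sup>2 / 2 * norm a * 2"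
    using std_moments(4) kappa by (intro add_left_mono mult_left_mono) auto
  also have "\<dots> \<le> \<kappa> * (1 + norm a) * (norm a)\<^sup>2"
  proof -
    have "0 \<le> \<kappa> * (norm a)\<^sup>2" using kappa by simp
    then show ?thesis by (simp add: algebra_simps)
  qed
  finally show "\<bar>gauss_avg a W y - W y - W\<^sub>2 y a a / 2\<bar> \<le> \<kappa> * (1 + norm a) * (norm a)\<^sup>2" .
  have "gauss_avg a (\<lambda>y. W\<^sub>1 y h) y - W\<^sub>1 y h
      = (\<integral>x. W\<^sub>1 (y + x *\<^sub>R a) h - W\<^sub>1 y h - x * W\<^sub>2 y a h \<partial>std_normal_distribution)"
    unfolding gauss_avg_def using i1 i std_moments p by simp
  then have "\<bar>gauss_avg a (\<lambda>y. W\<^sub>1 y h) y - W\<^sub>1 y h\<bar>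
      \<le> (\<integral>x. \<bar>W\<^sub>1 (y + x *\<^sub>R a) h - W\<^sub>1 y h - x * W\<^sub>2 y a h\<bar> \<partial>std_normal_distribution)"
    by (simp add: integral_abs_bound)
  also have "\<dots> \<le> (\<integral>x. \<kappa> * norm a * norm h * \<bar>x\<bar> + \<kappa> * norm a * norm h * norm a * x\<^sup>2 \<partial>std_normal_distribution)"
  proof (rule integral_mono)
    fix x :: real
    have "\<bar>W\<^sub>1 (y + x *\<^sub>R a) h - W\<^sub>1 y h - x * W\<^sub>2 y a h\<bar>
        = \<bar>W\<^sub>1 (y + x *\<^sub>R a) h - W\<^sub>1 y h - W\<^sub>2 y (x *\<^sub>R a) h\<bar>"
      by (simp add: linear_scale[OF lin2(2)])
    also have "\<dots> \<le> \<kappa> * (1 + norm (x *\<^sub>R a)) * norm (x *\<^sub>R a) * norm h" by (rule taylor1[OF aR])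
    also have "\<dots> = \<kappa> * norm a * norm h * \<bar>x\<bar> + \<kappa> * norm a * norm h * norm a * (\<bar>x\<bar> * \<bar>x\<bar>)"
      by (simp add: algebra_simps)
    finally show "\<bar>W\<^sub>1 (y + x *\<^sub>R a) h - W\<^sub>1 y h - x * W\<^sub>2 y a h\<bar>
        \<le> \<kappa> * norm a * norm h * \<bar>x\<bar> + \<kappa> * norm a * norm h * norm a * x\<^sup>2" by (simp add: power2_eq_square)
  qed (use i1 i in auto)
  also have "\<dots> = \<kappa> * norm a * norm h * (\<integral>x. \<bar>x\<bar> \<partial>std_normal_distribution) + \<kappa> * norm a * norm h * norm a * 1"
    using i std_moments(2) by simp
  also have "\<dots> \<le> \<kappa> * norm a * norm h * 1 + \<kappa> * norm a * norm h * norm a * 1"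
    using std_moments(3) kappa by (intro add_right_mono mult_left_mono) auto
  also have "\<dots> = \<kappa> * (1 + norm a) * norm a * norm h" by (simp add: algebra_simps)
  finally show "\<bar>gauss_avg a (\<lambda>y. W\<^sub>1 y h) y - W\<^sub>1 y h\<bar> \<le> \<kappa> * (1 + norm a) * norm a * norm h" .
  have "gauss_avg a (\<lambda>y. W\<^sub>2 y k h) y - W\<^sub>2 y k h
      = (\<integral>x. W\<^sub>2 (y + x *\<^sub>R a) k h - W\<^sub>2 y k h \<partial>std_normal_distribution)"
    unfolding gauss_avg_def using i2 p by simp
  then have "\<bar>gauss_avg a (\<lambda>y. W\<^sub>2 y k h) y - W\<^sub>2 y k h\<bar>
      \<le> (\<integral>x. \<bar>W\<^sub>2 (y + x *\<^sub>R a) k h - W\<^sub>2 y k h\<bar> \<partial>std_normal_distribution)"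
    by (simp add: integral_abs_bound)
  also have "\<dots> \<le> (\<integral>x. \<kappa> * norm k * norm h + \<kappa> * norm k * norm h * norm a * \<bar>x\<bar> \<partial>std_normal_distribution)"
  proof (rule integral_mono)
    fix x :: real
    have "\<bar>W\<^sub>2 (y + x *\<^sub>R a) k h - W\<^sub>2 y k h\<bar> \<le> \<kappa> * (1 + norm (x *\<^sub>R a)) * norm k * norm h"
      by (rule modulus[OF aR])
    also have "\<dots> = \<kappa> * norm k * norm h + \<kappa> * norm k * norm h * norm a * \<bar>x\<bar>"
      by (simp add: algebra_simps)
    finally show "\<bar>W\<^sub>2 (y + x *\<^sub>R a) k h - W\<^sub>2 y k h\<bar> \<le> \<dots>" .
  qed (use i2 i in auto)
  also have "\<dots> = \<kappa> * norm k * norm h + \<kappa> * norm k * norm h * norm a * (\<integral>x. \<bar>x\<bar> \<partial>std_normal_distribution)"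
    using i p by simp
  also have "\<dots> \<le> \<kappa> * norm k * norm h + \<kappa> * norm k * norm h * norm a * 1"
    using std_moments(3) kappa by (intro add_left_mono mult_left_mono) auto
  also have "\<dots> = \<kappa> * (1 + norm a) * norm k * norm h" by (simp add: algebra_simps)
  finally show "\<bar>gauss_avg a (\<lambda>y. W\<^sub>2 y k h) y - W\<^sub>2 y k h\<bar> \<le> \<kappa> * (1 + norm a) * norm k * norm h" .
qed

text \<open>The two sides differ only in third order: the increment \<open>\<delta>\<close> is compared with a Gaussian of
  variance \<open>s\<close>, and all derivatives are moved from \<open>W\<close> to its Gaussian average.\<close>

lemma gauss2_expansion:
  fixes y :: 'a
  assumes \<alpha>: "\<alpha> \<in> R" and \<beta>: "\<beta> \<in> R" and \<delta>: "\<delta> \<in> R" and s: "s \<ge> 0"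
    and \<rho>: "sqrt s * (norm \<alpha> + norm \<beta>) \<le> \<rho>"
  defines "V \<equiv> \<lambda>k h. gauss2 \<alpha> \<beta> s (\<lambda>y. W\<^sub>2 y k h) y"
  shows "\<bar>W (y + \<delta>) - gauss2 \<alpha> \<beta> s W y
      - (gauss2 \<alpha> \<beta> s (\<lambda>y. W\<^sub>1 y \<delta>) y + V \<delta> \<delta> / 2 - s * (V \<alpha> \<alpha> + V \<beta> \<beta>) / 2)\<bar>
    \<le> 10 * \<kappa> * (1 + \<rho> + norm \<delta>) ^ 3"
proof -
  define a where "a = sqrt s *\<^sub>R \<alpha>"
  define b where "b = sqrt s *\<^sub>R \<beta>"
  have ab: "a \<in> R" "b \<in> R" using \<alpha> \<beta> by (auto simp: a_def b_def intro: subspace_scale[OF R])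
  have \<rho>ab: "norm a + norm b \<le> \<rho>" using \<rho> s by (simp add: a_def b_def distrib_left)
  have \<rho>0: "0 \<le> \<rho>" "norm a \<le> \<rho>" "norm b \<le> \<rho>"
    using \<rho>ab norm_ge_zero[of a] norm_ge_zero[of b] by linarith+
  define U\<^sub>1 where "U\<^sub>1 = (\<lambda>y h. gauss_avg b (\<lambda>y. W\<^sub>1 y h) y)"
  define U\<^sub>2 where "U\<^sub>2 = (\<lambda>y k h. gauss_avg b (\<lambda>y. W\<^sub>2 y k h) y)"
  \<comment> \<open>Averaging along \<open>b\<close> keeps the bounds and the modulus, so the
    expansions apply once more, now along \<open>a\<close>.\<close>
  interpret U: C2_modulus b\<^sub>1 b\<^sub>2 "gauss_avg b W" U\<^sub>1 U\<^sub>2 \<kappa> R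
    unfolding U\<^sub>1_def U\<^sub>2_def by (rule C2_modulus_gauss_avg)
  note eW = gauss_avg_expansion[OF ab(2)] and eU = U.gauss_avg_expansion[OF ab(1)]
  have V: "V k h = gauss_avg a (\<lambda>y. U\<^sub>2 y k h) y" for k h
    by (simp add: V_def gauss2_def a_def b_def U\<^sub>2_def)
  have V1: "gauss2 \<alpha> \<beta> s (\<lambda>y. W\<^sub>1 y h) y = gauss_avg a (\<lambda>y. U\<^sub>1 y h) y" for h
    by (simp add: gauss2_def a_def b_def U\<^sub>1_def)
  have V0: "gauss2 \<alpha> \<beta> s W y = gauss_avg a (gauss_avg b W) y"
    by (simp add: gauss2_def a_def b_def)
  interpret V: C2_fun b\<^sub>1 b\<^sub>2 "gauss2 \<alpha> \<beta> s W" "\<lambda>y h. gauss2 \<alpha> \<beta> s (\<lambda>y. W\<^sub>1 y h) y" "\<lambda>y k h. gauss2 \<alpha> \<beta> s (\<lambda>y. W\<^sub>2 y k h) y"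
    by (rule C2_fun_gauss2[OF C2_fun_axioms])
  define d where "d = norm \<delta>"
  define X where "X = 1 + \<rho> + d"
  have d0: "d \<ge> 0" by (simp add: d_def)
  have X: "1 \<le> X" "1 + \<rho> \<le> X" "\<rho> \<le> X" "d \<le> X" "1 + d \<le> X" using \<rho>0(1) d0 by (auto simp: X_def)
  have sV: "s * (V \<alpha> \<alpha> + V \<beta> \<beta>) = V a a + V b b"
  proof -
    have "V a a = s * V \<alpha> \<alpha>" "V b b = s * V \<beta> \<beta>"
      unfolding V_def a_def b_def using s
      by (simp_all add: linear_scale[OF V.lin2(1)] linear_scale[OF V.lin2(2)] flip: mult.assoc)
    then show ?thesis by (simp add: distrib_left)
  qed
  have two: "\<bar>V k h - W\<^sub>2 y k h\<bar> \<le> 2 * \<kappa> * (1 + \<rho>) * norm k * norm h" for k h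
  proof -
    have "\<kappa> * (1 + norm a) * norm k * norm h \<le> \<kappa> * (1 + \<rho>) * norm k * norm h"
      "\<kappa> * (1 + norm b) * norm k * norm h \<le> \<kappa> * (1 + \<rho>) * norm k * norm h"
      using \<rho>0 kappa by (auto intro!: mult_right_mono mult_left_mono)
    then show ?thesis using eW(3)[where k = k and h = h and y = y] eU(3)[where k = k and h = h and y = y]
      unfolding V U\<^sub>2_def by (simp add: mult.assoc)
  qed
  \<comment> \<open>Every error below is \<kappa> times three factors, each at most
    \<open>X\<close>; this one cubic bound covers all mixed terms.\<close>
  have prod: "\<kappa> * u * v * w \<le> \<kappa> * X ^ 3" if "0 \<le> u" "0 \<le> v" "0 \<le> w" "u \<le> X" "v \<le> X" "w \<le> X" for u v w
  proof -
    have "u * v * w \<le> X * X * X" using that by (intro mult_mono) auto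
    then have "\<kappa> * (u * v * w) \<le> \<kappa> * (X * X * X)" using kappa by (intro mult_left_mono)
    then show ?thesis by (simp add: power3_eq_cube mult.assoc)
  qed
  have t1: "\<bar>W (y + \<delta>) - W y - W\<^sub>1 y \<delta> - W\<^sub>2 y \<delta> \<delta> / 2\<bar> \<le> \<kappa> * X ^ 3 / 2"
    using taylor2[OF \<delta>, of y] prod[of "1 + d" d d] X d0 unfolding d_def[symmetric] by (simp add: power2_eq_square mult.assoc)
  have t2: "\<bar>gauss2 \<alpha> \<beta> s (\<lambda>y. W\<^sub>1 y \<delta>) y - W\<^sub>1 y \<delta>\<bar> \<le> 2 * \<kappa> * X ^ 3"
  proof -
    have 1: "\<kappa> * (1 + norm a) * norm a * norm \<delta> \<le> \<kappa> * X ^ 3"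
      using X \<rho>0 d0 unfolding d_def[symmetric] by (intro prod) auto
    have 2: "\<kappa> * (1 + norm b) * norm b * norm \<delta> \<le> \<kappa> * X ^ 3"
      using X \<rho>0 d0 unfolding d_def[symmetric] by (intro prod) auto
    show ?thesis unfolding V1
      using order.trans[OF eU(2)[where h = \<delta> and y = y] 1] order.trans[OF eW(2)[where h = \<delta> and y = y] 2]
      unfolding U\<^sub>1_def by simp
  qed
  have t3: "\<bar>V \<delta> \<delta> - W\<^sub>2 y \<delta> \<delta>\<bar> \<le> 2 * \<kappa> * X ^ 3"
    using two[of \<delta> \<delta>] prod[of "1 + \<rho>" d d] X d0 \<rho>0 unfolding d_def[symmetric] by (simp add: mult.assoc)
  have t4: "\<bar>V a a - U\<^sub>2 y a a\<bar> \<le> \<kappa> * X ^ 3"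
    unfolding V using order.trans[OF eU(3)[where k = a and h = a and y = y] prod] X \<rho>0 by simp
  have t5: "\<bar>V b b - W\<^sub>2 y b b\<bar> \<le> 2 * \<kappa> * X ^ 3"
  proof -
    have "\<kappa> * (1 + \<rho>) * norm b * norm b \<le> \<kappa> * X ^ 3" using X \<rho>0 by (intro prod) auto
    then show ?thesis using two[of b b] by (simp add: mult.assoc)
  qed
  have t6: "\<bar>gauss_avg a (gauss_avg b W) y - gauss_avg b W y - U\<^sub>2 y a a / 2\<bar> \<le> \<kappa> * X ^ 3"
  proof -
    have "\<kappa> * (1 + norm a) * norm a * norm a \<le> \<kappa> * X ^ 3" using X \<rho>0 by (intro prod) auto
    then show ?thesis using eU(1)[where y = y] by (simp add: power2_eq_square mult.assoc)
  qed
  have t7: "\<bar>gauss_avg b W y - W y - W\<^sub>2 y b b / 2\<bar> \<le> \<kappa> * X ^ 3"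
  proof -
    have "\<kappa> * (1 + norm b) * norm b * norm b \<le> \<kappa> * X ^ 3" using X \<rho>0 by (intro prod) auto
    then show ?thesis using eW(1)[where y = y] by (simp add: power2_eq_square mult.assoc)
  qed
  \<comment> \<open>With the cubic bound hidden in one constant the goal is linear arithmetic in the
    seven errors, which contribute at most \<open>7 * Z\<close> in total.\<close>
  define Z where "Z = \<kappa> * X ^ 3"
  have Z: "Z \<ge> 0" using kappa X(1) by (simp add: Z_def)
  note t = t1 t2 t3 t4 t5 t6 t7
  note t' = t[unfolded mult.assoc Z_def[symmetric]]
  show ?thesis
    using Z t' unfolding sV V0 d_def[symmetric] X_def[symmetric] mult.assoc Z_def[symmetric] by argo
qed

end

section \<open>The Lindeberg argument\<close>

lemma C2_fun_expand_complex:
  fixes W :: "complex \<Rightarrow> real"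
  assumes "C2_fun b\<^sub>1 b\<^sub>2 W W\<^sub>1 W\<^sub>2"
  shows "W\<^sub>1 y h = Re h * W\<^sub>1 y 1 + Im h * W\<^sub>1 y \<i>"
    and "W\<^sub>2 y k h = Re k * Re h * W\<^sub>2 y 1 1 + Re k * Im h * W\<^sub>2 y 1 \<i>
      + Im k * Re h * W\<^sub>2 y \<i> 1 + Im k * Im h * W\<^sub>2 y \<i> \<i>"
proof -
  interpret C2_fun b\<^sub>1 b\<^sub>2 W W\<^sub>1 W\<^sub>2 by fact
  have e: "z = Re z *\<^sub>R 1 + Im z *\<^sub>R \<i>" for z by (simp add: complex_eq_iff)
  have L: "f h = Re h * f 1 + Im h * f \<i>" if "linear f" for f :: "complex \<Rightarrow> real" and h
    by (subst e[of h]) (simp add: linear_add[OF that] linear_scale[OF that])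
  show "W\<^sub>1 y h = Re h * W\<^sub>1 y 1 + Im h * W\<^sub>1 y \<i>" by (rule L[OF lin1])
  show "W\<^sub>2 y k h = Re k * Re h * W\<^sub>2 y 1 1 + Re k * Im h * W\<^sub>2 y 1 \<i>
      + Im k * Re h * W\<^sub>2 y \<i> 1 + Im k * Im h * W\<^sub>2 y \<i> \<i>"
    by (subst L[OF lin2(2)], subst L[OF lin2(1), of _ 1], subst L[OF lin2(1), of _ \<i>])
      (simp add: algebra_simps)
qed

lemma power4_sum3_le:
  fixes a b c :: real
  assumes "a \<ge> 0" "b \<ge> 0" "c \<ge> 0"
  shows "(a + b + c) ^ 4 \<le> 81 * (a ^ 4 + b ^ 4 + c ^ 4)"
proof -
  define m where "m = max a (max b c)"
  have "(a + b + c) ^ 4 \<le> (3 * m) ^ 4" using assms by (intro power_mono) (auto simp: m_def)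
  also have "\<dots> = 81 * m ^ 4" by (simp add: power_mult_distrib)
  also have "m ^ 4 \<le> a ^ 4 + b ^ 4 + c ^ 4"
    using assms by (auto simp: m_def max_def add_nonneg_nonneg)
  finally show ?thesis by simp
qed

context ewens
begin

text \<open>A step bound \<open>\<epsilon>\<close> sums up along the chain of remaining sizes; instead of estimating its Green
  function, the sums are dominated by bounded or slowly growing supersolutions of the recursion.\<close>

lemma recursion_bound:
  assumes d0: "d 0 \<le> 0" and e: "e > 0" and c: "c\<^sub>1 \<ge> 0" "c\<^sub>2 \<ge> 0"
    and rec: "\<And>n. n \<ge> 1 \<Longrightarrow> d n \<le> c\<^sub>1 * real n powr - e + c\<^sub>2 / sqrt (time n + 1) + (\<Sum>j<n. pr n j * d j)"
    and T: "\<And>n. n \<ge> 1 \<Longrightarrow> time n \<le> ln (real n) + T"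
  shows "d n \<le> c\<^sub>1 * (\<theta> * exp (e * T) / e) + 2 * \<theta> * c\<^sub>2 * sqrt (time n + 1)"
proof -
  \<comment> \<open>\<open>\<phi>\<close> will be bounded and concave in time. Its mean decrease
    over a step is at least \<open>K * exp (- e * time n) * e / \<theta>\<close>, and
    \<open>K\<close> is chosen so that this dominates \<open>real n powr - e\<close> when
    \<open>time n \<le> ln (real n) + T\<close>.\<close>
  define K where "K = \<theta> * exp (e * T) / e"
  have K: "K > 0" using theta_pos e by (simp add: K_def)
  define \<phi> where "\<phi> n = K * (1 - exp (- e * time n))" for n
  \<comment> \<open>As \<open>sqrt\<close> is concave, a step of mean duration
    \<open>1 / \<theta>\<close> lowers this function on average by at least
    \<open>1 / sqrt (time n + 1)\<close>, which is the error that depends on the scale.\<close>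
  define \<psi> where "\<psi> n = 2 * \<theta> * sqrt (time n + 1)" for n
  have \<phi>: "real n powr - e + (\<Sum>j<n. pr n j * \<phi> j) \<le> \<phi> n" if n: "n \<ge> 1" for n
  proof -
    have "K * exp (- e * time n) * (e * (1 / \<theta>)) = (\<Sum>j<n. pr n j * (K * exp (- e * time n) * (e * gap n j)))"
      by (simp add: sum_pr_gap[OF n, symmetric] sum_distrib_left mult_ac)
    also have "\<dots> \<le> (\<Sum>j<n. pr n j * (\<phi> n - \<phi> j))"
    proof (intro sum_mono mult_left_mono)
      fix j
      have "exp (- e * time n) * (e * gap n j) \<le> exp (- e * time n) * (exp (e * gap n j) - 1)"
      proof (rule mult_left_mono)
        show "e * gap n j \<le> exp (e * gap n j) - 1" using exp_ge_add_one_self[of "e * gap n j"] by linarith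
      qed simp
      also have "\<dots> = exp (- e * time j) - exp (- e * time n)"
        by (simp add: right_diff_distrib gap_def flip: exp_add)
      finally have "K * (exp (- e * time n) * (e * gap n j)) \<le> K * (exp (- e * time j) - exp (- e * time n))"
        using K by (intro mult_left_mono) auto
      then show "K * exp (- e * time n) * (e * gap n j) \<le> \<phi> n - \<phi> j"
        by (simp add: \<phi>_def algebra_simps)
    qed (use pr_pos[OF n] in \<open>auto simp: less_imp_le\<close>)
    also have "\<dots> = \<phi> n * (\<Sum>j<n. pr n j) - (\<Sum>j<n. pr n j * \<phi> j)"
      by (simp add: sum_subtractf right_diff_distrib sum_distrib_left mult.commute)
    also have "\<dots> = \<phi> n - (\<Sum>j<n. pr n j * \<phi> j)" using sum_pr_1[OF n] by simp
    finally have 1: "K * exp (- e * time n) * (e * (1 / \<theta>)) + (\<Sum>j<n. pr n j * \<phi> j) \<le> \<phi> n" by simp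
    have "real n powr - e = exp (- e * ln (real n))" using n by (simp add: powr_def)
    also have "\<dots> \<le> exp (e * T - e * time n)"
    proof -
      have "e * time n \<le> e * (ln (real n) + T)" using T[OF n] e by (intro mult_left_mono) auto
      then show ?thesis by (simp add: algebra_simps)
    qed
    also have "\<dots> = exp (e * T) * exp (- e * time n)" by (simp flip: exp_add)
    also have "\<dots> = K * exp (- e * time n) * (e * (1 / \<theta>))" using theta_pos e by (simp add: K_def)
    finally show ?thesis using 1 by simp
  qed
  have \<psi>: "1 / sqrt (time n + 1) + (\<Sum>j<n. pr n j * \<psi> j) \<le> \<psi> n" if n: "n \<ge> 1" for n
  proof -
    have s: "sqrt (time n + 1) > 0" using time_nonneg[of n] by simp
    have "1 / sqrt (time n + 1) = (\<Sum>j<n. pr n j * (\<theta> * gap n j / sqrt (time n + 1)))"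
    proof -
      have "(\<Sum>j<n. pr n j * (\<theta> * gap n j / sqrt (time n + 1))) = \<theta> / sqrt (time n + 1) * (\<Sum>j<n. pr n j * gap n j)"
        by (simp add: sum_distrib_left mult_ac)
      then show ?thesis using sum_pr_gap[OF n] theta_pos by simp
    qed
    also have "\<dots> \<le> (\<Sum>j<n. pr n j * (\<psi> n - \<psi> j))"
    proof (intro sum_mono mult_left_mono)
      fix j
      have t0: "time j + 1 \<ge> 0" using time_nonneg[of j] by simp
      have "0 \<le> (sqrt (time n + 1) - sqrt (time j + 1))\<^sup>2" by simp
      also have "\<dots> = (time n + 1) + (time j + 1) - 2 * sqrt (time n + 1) * sqrt (time j + 1)"
        using time_nonneg[of n] t0 by (simp add: power2_diff)
      finally have "gap n j \<le> 2 * (sqrt (time n + 1) - sqrt (time j + 1)) * sqrt (time n + 1)"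
        using time_nonneg[of n] by (simp add: gap_def algebra_simps)
      then have "gap n j / sqrt (time n + 1) \<le> 2 * (sqrt (time n + 1) - sqrt (time j + 1))"
        using s by (simp add: divide_le_eq)
      then have "\<theta> * (gap n j / sqrt (time n + 1)) \<le> \<theta> * (2 * (sqrt (time n + 1) - sqrt (time j + 1)))"
        using theta_pos by (intro mult_left_mono) auto
      then show "\<theta> * gap n j / sqrt (time n + 1) \<le> \<psi> n - \<psi> j" by (simp add: \<psi>_def algebra_simps)
    qed (use pr_pos[OF n] in \<open>auto simp: less_imp_le\<close>)
    also have "\<dots> = \<psi> n * (\<Sum>j<n. pr n j) - (\<Sum>j<n. pr n j * \<psi> j)"
      by (simp add: sum_subtractf right_diff_distrib sum_distrib_left mult.commute)
    also have "\<dots> = \<psi> n - (\<Sum>j<n. pr n j * \<psi> j)" using sum_pr_1[OF n] by simp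
    finally show ?thesis by simp
  qed
  have main: "d n \<le> c\<^sub>1 * \<phi> n + c\<^sub>2 * \<psi> n"
  proof (induction n rule: less_induct)
    case (less n)
    show ?case
    proof (cases "n = 0")
      case True
      have "0 \<le> c\<^sub>2 * \<psi> 0" using c theta_pos by (simp add: \<psi>_def time_def)
      then show ?thesis using True d0 by (simp add: \<phi>_def time_def)
    next
      case False
      then have n: "n \<ge> 1" by simp
      have "(\<Sum>j<n. pr n j * d j) \<le> (\<Sum>j<n. pr n j * (c\<^sub>1 * \<phi> j + c\<^sub>2 * \<psi> j))"
        using less pr_pos[OF n] by (intro sum_mono mult_left_mono) (auto simp: less_imp_le)
      also have "\<dots> = c\<^sub>1 * (\<Sum>j<n. pr n j * \<phi> j) + c\<^sub>2 * (\<Sum>j<n. pr n j * \<psi> j)"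
        by (simp add: sum_distrib_left distrib_left sum.distrib mult_ac)
      finally have "d n \<le> c\<^sub>1 * (real n powr - e + (\<Sum>j<n. pr n j * \<phi> j)) + c\<^sub>2 * (1 / sqrt (time n + 1) + (\<Sum>j<n. pr n j * \<psi> j))"
        using rec[OF n] by (simp add: distrib_left)
      also have "\<dots> \<le> c\<^sub>1 * \<phi> n + c\<^sub>2 * \<psi> n"
        using \<phi>[OF n] \<psi>[OF n] c by (intro add_mono mult_left_mono)
      finally show ?thesis .
    qed
  qed
  also have "c\<^sub>1 * \<phi> n \<le> c\<^sub>1 * K" using c K by (intro mult_left_mono) (auto simp: \<phi>_def)
  finally show ?thesis by (simp add: \<psi>_def K_def mult_ac)
qed


text \<open>The averages \<open>gauss2 \<alpha> \<beta> (time n) G\<close> nearly satisfy the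
  recursion of \<open>A\<close>, and \<open>recursion_bound\<close> sums the defects.
  \<open>h'\<close> is a version of \<open>h\<close> with all values in \<open>R\<close>, where
  second derivatives have a modulus; the difference is paid with the Lipschitz constant
  \<open>b\<^sub>1\<close>. \<open>C\<close> is fixed before \<open>G\<close>, as a supremum over
  tests requires.\<close>

theorem lindeberg:
  fixes h h' :: "nat \<Rightarrow> complex" and \<mu> \<alpha> \<beta> :: complex
  assumes mean: "power_mean (\<lambda>m. Re (h' m)) (Re \<mu>)" "power_mean (\<lambda>m. Im (h' m)) (Im \<mu>)"
    and cov: "power_mean (\<lambda>m. Re (h' m) * Re (h' m)) v\<^sub>r" "power_mean (\<lambda>m. Im (h' m) * Im (h' m)) v\<^sub>i"
      "power_mean (\<lambda>m. Re (h' m) * Im (h' m)) v\<^sub>r\<^sub>i"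
    and fourth: "power_mean (\<lambda>m. cmod (h' m) ^ 4) c4"
    and diff: "power_mean (\<lambda>m. cmod (h m - h' m)) 0"
    and R: "subspace R" "\<alpha> \<in> R" "\<beta> \<in> R" "\<mu> \<in> R" "\<And>m. h' m \<in> R"
    and coord: "\<Lambda> \<ge> 0" "\<And>k. k \<in> R \<Longrightarrow> \<exists>p q. k = p *\<^sub>R \<alpha> + q *\<^sub>R \<beta> \<and> \<bar>p\<bar> + \<bar>q\<bar> \<le> \<Lambda> * norm k"
    and var: "(Re \<alpha>)\<^sup>2 + (Re \<beta>)\<^sup>2 = \<theta> * v\<^sub>r" "(Im \<alpha>)\<^sup>2 + (Im \<beta>)\<^sup>2 = \<theta> * v\<^sub>i"
      "Re \<alpha> * Im \<alpha> + Re \<beta> * Im \<beta> = \<theta> * v\<^sub>r\<^sub>i"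
  shows "\<exists>C\<ge>0. \<forall>b\<^sub>1 b\<^sub>2 G G\<^sub>1 G\<^sub>2 A. b\<^sub>1 \<ge> 0 \<longrightarrow> b\<^sub>2 \<ge> 0 \<longrightarrow> C2_fun b\<^sub>1 b\<^sub>2 G G\<^sub>1 G\<^sub>2 \<longrightarrow> (\<forall>y. A 0 y = G y) \<longrightarrow>
    (\<forall>n\<ge>1. \<forall>y. A n y = (\<Sum>j<n. pr n j * A j (y + h (n - j) - (\<theta> * gap n j) *\<^sub>R \<mu>))) \<longrightarrow>
    (\<forall>n y. \<bar>A n y - gauss2 \<alpha> \<beta> (time n) G y\<bar> \<le> C * (b\<^sub>1 + b\<^sub>2) + C * b\<^sub>2 * sqrt (time n + 1))"
proof -
  \<comment> \<open>The increment minus the drift accumulated during the step. Its mean is small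
    because \<open>\<theta> * gap n j\<close> has mean 1.\<close>
  define \<delta> where "\<delta> n j = h' (n - j) - (\<theta> * gap n j) *\<^sub>R \<mu>" for n j
  have \<delta>R: "\<delta> n j \<in> R" for n j
    unfolding \<delta>_def using R by (intro subspace_diff subspace_scale) auto
  have Re\<delta>: "Re (\<delta> n j) = Re (h' (n - j)) - \<theta> * Re \<mu> * gap n j"
    and Im\<delta>: "Im (\<delta> n j) = Im (h' (n - j)) - \<theta> * Im \<mu> * gap n j" for n j
    by (simp_all add: \<delta>_def)
  obtain T where T: "\<And>n. n \<ge> 1 \<Longrightarrow> \<bar>time n - ln (real n)\<bar> \<le> T" using time_ln by blast
  have bnd: "\<exists>C\<ge>0. \<exists>e>0. \<forall>n\<ge>1. \<bar>f n\<bar> \<le> C * real n powr - e"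
    if f: "\<exists>C. \<exists>e>0. \<forall>n\<ge>1. \<bar>f n\<bar> \<le> C * real n powr - e" for f :: "nat \<Rightarrow> real"
  proof -
    obtain C e where "e > 0" "\<And>n. n \<ge> 1 \<Longrightarrow> \<bar>f n\<bar> \<le> C * real n powr - e" using f by metis
    moreover have "C * real n powr - e \<le> \<bar>C\<bar> * real n powr - e" for n
      by (intro mult_right_mono) auto
    ultimately have "\<bar>C\<bar> \<ge> 0" "e > 0" "\<forall>n\<ge>1. \<bar>f n\<bar> \<le> \<bar>C\<bar> * real n powr - e"
      by (auto intro: order.trans)
    then show ?thesis by blast
  qed
  define m\<^sub>r where "m\<^sub>r n = (\<Sum>j<n. pr n j * Re (\<delta> n j))" for n
  define m\<^sub>i where "m\<^sub>i n = (\<Sum>j<n. pr n j * Im (\<delta> n j))" for n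
  define q\<^sub>r where "q\<^sub>r n = (\<Sum>j<n. pr n j * (Re (\<delta> n j) * Re (\<delta> n j))) - v\<^sub>r" for n
  define q\<^sub>i where "q\<^sub>i n = (\<Sum>j<n. pr n j * (Im (\<delta> n j) * Im (\<delta> n j))) - v\<^sub>i" for n
  define q\<^sub>c where "q\<^sub>c n = (\<Sum>j<n. pr n j * (Re (\<delta> n j) * Im (\<delta> n j))) - v\<^sub>r\<^sub>i" for n
  define r where "r n = (\<Sum>j<n. pr n j * cmod (h (n - j) - h' (n - j)))" for n
  have meanb: "\<exists>C\<ge>0. \<exists>e>0. \<forall>n\<ge>1. \<bar>\<Sum>j<n. pr n j * (u (n - j) - \<theta> * U * gap n j)\<bar> \<le> C * real n powr - e"
    if u: "power_mean u U" for u U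
  proof (rule bnd)
    obtain C e where C: "e > 0" "\<And>n. n \<ge> 1 \<Longrightarrow> \<bar>\<Sum>j<n. pr n j * gap n j ^ 0 * (u (n - j) - U)\<bar> \<le> C * real n powr - e"
      using pr_moment_bound[OF u, of 0] by auto
    have "(\<Sum>j<n. pr n j * (u (n - j) - \<theta> * U * gap n j)) = (\<Sum>j<n. pr n j * gap n j ^ 0 * (u (n - j) - U))"
      if n: "n \<ge> 1" for n
    proof -
      have "(\<Sum>j<n. pr n j * (u (n - j) - \<theta> * U * gap n j))
          = (\<Sum>j<n. pr n j * gap n j ^ 0 * (u (n - j) - U) + U * pr n j - \<theta> * U * (pr n j * gap n j))"
        by (intro sum.cong) (auto simp: algebra_simps)
      also have "\<dots> = (\<Sum>j<n. pr n j * gap n j ^ 0 * (u (n - j) - U)) + U * (\<Sum>j<n. pr n j) - \<theta> * U * (\<Sum>j<n. pr n j * gap n j)"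
        unfolding sum_subtractf sum.distrib sum_distrib_left ..
      finally show ?thesis using sum_pr_1[OF n] sum_pr_gap[OF n] theta_pos by simp
    qed
    then show "\<exists>C. \<exists>e>0. \<forall>n\<ge>1. \<bar>\<Sum>j<n. pr n j * (u (n - j) - \<theta> * U * gap n j)\<bar> \<le> C * real n powr - e"
      using C by (intro exI[of _ C] exI[of _ e]) simp
  qed
  have "\<exists>C\<ge>0. \<exists>e>0. \<forall>n\<ge>1. \<bar>m\<^sub>r n\<bar> \<le> C * real n powr - e"
    using meanb[OF mean(1)] by (simp only: m\<^sub>r_def Re\<delta>)
  then obtain B1 e1 where B1: "B1 \<ge> 0" "e1 > 0" "\<And>n. n \<ge> 1 \<Longrightarrow> \<bar>m\<^sub>r n\<bar> \<le> B1 * real n powr - e1"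
    by blast
  have "\<exists>C\<ge>0. \<exists>e>0. \<forall>n\<ge>1. \<bar>m\<^sub>i n\<bar> \<le> C * real n powr - e"
    using meanb[OF mean(2)] by (simp only: m\<^sub>i_def Im\<delta>)
  then obtain B2 e2 where B2: "B2 \<ge> 0" "e2 > 0" "\<And>n. n \<ge> 1 \<Longrightarrow> \<bar>m\<^sub>i n\<bar> \<le> B2 * real n powr - e2"
    by blast
  have "\<exists>C\<ge>0. \<exists>e>0. \<forall>n\<ge>1. \<bar>q\<^sub>r n\<bar> \<le> C * real n powr - e"
    using bnd[OF pr_covariance_bound[OF mean(1) mean(1) cov(1)]] by (simp only: q\<^sub>r_def Re\<delta>)
  then obtain B3 e3 where B3: "B3 \<ge> 0" "e3 > 0" "\<And>n. n \<ge> 1 \<Longrightarrow> \<bar>q\<^sub>r n\<bar> \<le> B3 * real n powr - e3"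
    by blast
  have "\<exists>C\<ge>0. \<exists>e>0. \<forall>n\<ge>1. \<bar>q\<^sub>i n\<bar> \<le> C * real n powr - e"
    using bnd[OF pr_covariance_bound[OF mean(2) mean(2) cov(2)]] by (simp only: q\<^sub>i_def Im\<delta>)
  then obtain B4 e4 where B4: "B4 \<ge> 0" "e4 > 0" "\<And>n. n \<ge> 1 \<Longrightarrow> \<bar>q\<^sub>i n\<bar> \<le> B4 * real n powr - e4"
    by blast
  have "\<exists>C\<ge>0. \<exists>e>0. \<forall>n\<ge>1. \<bar>q\<^sub>c n\<bar> \<le> C * real n powr - e"
    using bnd[OF pr_covariance_bound[OF mean(1) mean(2) cov(3)]] by (simp only: q\<^sub>c_def Re\<delta> Im\<delta>)
  then obtain B5 e5 where B5: "B5 \<ge> 0" "e5 > 0" "\<And>n. n \<ge> 1 \<Longrightarrow> \<bar>q\<^sub>c n\<bar> \<le> B5 * real n powr - e5"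
    by blast
  have "\<exists>C\<ge>0. \<exists>e>0. \<forall>n\<ge>1. \<bar>r n\<bar> \<le> C * real n powr - e"
    using bnd[OF pr_moment_bound[OF diff, of 0]] by (simp only: r_def power_0 mult_1_right diff_zero le_numeral_extra zero_le_one simp_thms)
  then obtain B6 e6 where B6: "B6 \<ge> 0" "e6 > 0" "\<And>n. n \<ge> 1 \<Longrightarrow> \<bar>r n\<bar> \<le> B6 * real n powr - e6"
    by blast
  obtain B7 e7 where B7: "B7 \<ge> 0" "e7 > 0"
    "\<And>n. n \<ge> 1 \<Longrightarrow> \<bar>\<Sum>j<n. pr n j * (cmod (h' (n - j)) ^ 4 - c4)\<bar> \<le> B7 * real n powr - e7"
    using bnd[OF pr_moment_bound[OF fourth, of 0]] unfolding power_0 mult_1_right by blast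
  define e where "e = Min {e1, e2, e3, e4, e5, e6}"
  have e: "e > 0" "e \<le> e1" "e \<le> e2" "e \<le> e3" "e \<le> e4" "e \<le> e5" "e \<le> e6"
    using B1 B2 B3 B4 B5 B6 by (auto simp: e_def)
  define B where "B = B1 + B2 + B3 + B4 + B5 + B6"
  have small: "\<bar>m\<^sub>r n\<bar> + \<bar>m\<^sub>i n\<bar> + \<bar>q\<^sub>r n\<bar> + \<bar>q\<^sub>i n\<bar> + \<bar>q\<^sub>c n\<bar> + \<bar>r n\<bar> \<le> B * real n powr - e" if n: "n \<ge> 1" for n
  proof -
    have p: "x \<le> b * real n powr - e" if "x \<le> b * real n powr - e'" "e \<le> e'" "b \<ge> 0" for x b e'
      by (rule powr_bound_mono[OF that(1)]) (use that n in auto)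
    show ?thesis
      using p[OF B1(3)[OF n] e(2) B1(1)] p[OF B2(3)[OF n] e(3) B2(1)] p[OF B3(3)[OF n] e(4) B3(1)]
        p[OF B4(3)[OF n] e(5) B4(1)] p[OF B5(3)[OF n] e(6) B5(1)] p[OF B6(3)[OF n] e(7) B6(1)]
      unfolding B_def distrib_right by linarith
  qed
  \<comment> \<open>Fourth moments appear since the cubic remainder is multiplied by
    \<open>1 + gap n j\<close>, the price for expressing the smoothing at \<open>time j\<close>
    through \<open>time n\<close>.\<close>
  define M4 where "M4 = 81 * (1 + fact 4 / \<theta> ^ 4 + (\<bar>c4\<bar> + B7))"
  have M4: "(\<Sum>j<n. pr n j * (1 + gap n j + cmod (h' (n - j))) ^ 4) \<le> M4" if n: "n \<ge> 1" for n
  proof -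
    have "(\<Sum>j<n. pr n j * (1 + gap n j + cmod (h' (n - j))) ^ 4)
        \<le> (\<Sum>j<n. pr n j * (81 * (1 ^ 4 + gap n j ^ 4 + cmod (h' (n - j)) ^ 4)))"
      using pr_pos[OF n] gap_nonneg by (intro sum_mono mult_left_mono power4_sum3_le) (auto simp: less_imp_le)
    also have "\<dots> = 81 * ((\<Sum>j<n. pr n j) + (\<Sum>j<n. pr n j * gap n j ^ 4) + (\<Sum>j<n. pr n j * cmod (h' (n - j)) ^ 4))"
      unfolding sum.distrib[symmetric] sum_distrib_left by (intro sum.cong refl) (simp add: algebra_simps)
    also have "(\<Sum>j<n. pr n j * cmod (h' (n - j)) ^ 4) = (\<Sum>j<n. pr n j * (cmod (h' (n - j)) ^ 4 - c4)) + c4 * (\<Sum>j<n. pr n j)"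
      by (simp add: sum_distrib_left sum.distrib[symmetric] algebra_simps)
    also have "81 * ((\<Sum>j<n. pr n j) + (\<Sum>j<n. pr n j * gap n j ^ 4) + \<dots>) \<le> M4"
    proof -
      have "\<bar>\<Sum>j<n. pr n j * (cmod (h' (n - j)) ^ 4 - c4)\<bar> \<le> B7"
        using B7(3)[OF n] B7(1,2) n powr_mono[of "- e7" 0 "real n"] mult_left_mono[of "real n powr - e7" 1 B7] by simp
      then show ?thesis unfolding M4_def using sum_pr_1[OF n] sum_pr_gap_power[OF n, of 4] by simp
    qed
    finally show ?thesis .
  qed
  have M4_0: "M4 \<ge> 0" using B7(1) theta_pos by (simp add: M4_def)
  define c where "c = 1 + norm \<alpha> + norm \<beta> + \<theta> * norm \<mu>"
  have c: "c \<ge> 1" using theta_pos by (simp add: c_def)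
  define K where "K = 4 * (1 + \<Lambda>)"
  have K: "K \<ge> 0" using coord(1) by (simp add: K_def)
  define C\<^sub>2 where "C\<^sub>2 = 10 * K * c ^ 3 * M4"
  have C\<^sub>2: "C\<^sub>2 \<ge> 0" using K c M4_0 by (simp add: C\<^sub>2_def)
  define C where "C = B * (\<theta> * exp (e * T) / e) + 2 * \<theta> * C\<^sub>2"
  have B0: "B \<ge> 0" using B1 B2 B3 B4 B5 B6 by (simp add: B_def)
  show ?thesis
  proof (rule exI[of _ C], intro conjI allI impI)
    show "C \<ge> 0" using B0 C\<^sub>2 theta_pos e by (simp add: C_def)
    fix b\<^sub>1 b\<^sub>2 G G\<^sub>1 G\<^sub>2 A n y
    assume b: "0 \<le> b\<^sub>1" "0 \<le> b\<^sub>2" and CG: "C2_fun b\<^sub>1 b\<^sub>2 G G\<^sub>1 G\<^sub>2" and A0: "\<forall>y. A 0 y = G y"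
      and An: "\<forall>n\<ge>1. \<forall>y. A n y = (\<Sum>j<n. pr n j * A j (y + h (n - j) - (\<theta> * gap n j) *\<^sub>R \<mu>))"
    interpret G: C2_fun b\<^sub>1 b\<^sub>2 G G\<^sub>1 G\<^sub>2 by fact
    define V where "V j = gauss2 \<alpha> \<beta> (time j) G" for j
    define V\<^sub>1 where "V\<^sub>1 j = (\<lambda>y h. gauss2 \<alpha> \<beta> (time j) (\<lambda>y. G\<^sub>1 y h) y)" for j
    define V\<^sub>2 where "V\<^sub>2 j = (\<lambda>y k h. gauss2 \<alpha> \<beta> (time j) (\<lambda>y. G\<^sub>2 y k h) y)" for j
    have CV: "C2_fun b\<^sub>1 b\<^sub>2 (V j) (V\<^sub>1 j) (V\<^sub>2 j)" for j
      unfolding V_def V\<^sub>1_def V\<^sub>2_def by (rule C2_fun_gauss2[OF CG])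
    define \<kappa> where "\<kappa> j = K * b\<^sub>2 / sqrt (time j + 1)" for j
    have CM: "C2_modulus b\<^sub>1 b\<^sub>2 (V j) (V\<^sub>1 j) (V\<^sub>2 j) (\<kappa> j) R" for j
    proof (rule C2_modulus.intro[OF CV], rule C2_modulus_axioms.intro)
      show "0 \<le> \<kappa> j" using K b time_nonneg by (simp add: \<kappa>_def)
      fix k y h h' assume "k \<in> R"
      then obtain p q where "k = p *\<^sub>R \<alpha> + q *\<^sub>R \<beta>" "\<bar>p\<bar> + \<bar>q\<bar> \<le> \<Lambda> * norm k" using coord(2) by blast
      then have "\<bar>V\<^sub>2 j (y + k) h h' - V\<^sub>2 j y h h'\<bar> \<le> 4 * (1 + \<Lambda>) * (b\<^sub>2 * norm h * norm h') / sqrt (time j + 1) * (1 + norm k)"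
        unfolding V\<^sub>2_def by (rule gauss2_modulus[OF G.meas(3) G.bound2 time_nonneg _ _ coord(1)])
      then show "\<bar>V\<^sub>2 j (y + k) h h' - V\<^sub>2 j y h h'\<bar> \<le> \<kappa> j * (1 + norm k) * norm h * norm h'"
        by (simp add: \<kappa>_def K_def mult_ac)
    qed (rule R)
    have semi: "gauss2 \<alpha> \<beta> (gap n j) (gauss2 \<alpha> \<beta> (time j) F) = gauss2 \<alpha> \<beta> (time n) F"
      if "linear_growth F" "j \<le> n" for F n j
      using gauss2_semigroup[OF that(1) gap_nonneg[OF that(2)] time_nonneg[of j], of \<alpha> \<beta>] by (simp add: gap_def)
    have step: "\<bar>V n y - (\<Sum>j<n. pr n j * V j (y + h (n - j) - (\<theta> * gap n j) *\<^sub>R \<mu>))\<bar>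
        \<le> (b\<^sub>1 + b\<^sub>2) * B * real n powr - e + C\<^sub>2 * b\<^sub>2 / sqrt (time n + 1)" if n: "n \<ge> 1" for n y
    proof -
      interpret Vn: C2_fun b\<^sub>1 b\<^sub>2 "V n" "V\<^sub>1 n" "V\<^sub>2 n" by (rule CV)
      \<comment> \<open>The second-order prediction of
        \<open>V j (y + \<delta> n j) - V n y\<close>: by the semigroup law \<open>V n\<close> is
        \<open>V j\<close> averaged over the further time \<open>gap n j\<close>.\<close>
      define Q where "Q j = V\<^sub>1 n y (\<delta> n j) + V\<^sub>2 n y (\<delta> n j) (\<delta> n j) / 2
          - gap n j * (V\<^sub>2 n y \<alpha> \<alpha> + V\<^sub>2 n y \<beta> \<beta>) / 2" for j
      have t1: "\<bar>V j (y + h (n - j) - (\<theta> * gap n j) *\<^sub>R \<mu>) - V j (y + \<delta> n j)\<bar> \<le> b\<^sub>1 * cmod (h (n - j) - h' (n - j))" for j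
      proof -
        interpret Vj: C2_fun b\<^sub>1 b\<^sub>2 "V j" "V\<^sub>1 j" "V\<^sub>2 j" by (rule CV)
        have "y + h (n - j) - (\<theta> * gap n j) *\<^sub>R \<mu> = (y + \<delta> n j) + (h (n - j) - h' (n - j))" by (simp add: \<delta>_def)
        then show ?thesis using Vj.lipschitz[of "y + \<delta> n j" "h (n - j) - h' (n - j)"] by (simp only:)
      qed
      have t2: "\<bar>V j (y + \<delta> n j) - V n y - Q j\<bar> \<le> 10 * (K * b\<^sub>2 / sqrt (time n + 1)) * c ^ 3 * (1 + gap n j + cmod (h' (n - j))) ^ 4"
        if j: "j < n" for j
      proof -
        interpret Vj: C2_modulus b\<^sub>1 b\<^sub>2 "V j" "V\<^sub>1 j" "V\<^sub>2 j" "\<kappa> j" R by (rule CM)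
        define g where "g = gap n j"
        have g: "g \<ge> 0" using gap_nonneg j by (simp add: g_def)
        define X where "X = 1 + g + cmod (h' (n - j))"
        have X: "X \<ge> 1" "1 + g \<le> X" using g by (auto simp: X_def)
        define \<rho> where "\<rho> = (1 + g) * (norm \<alpha> + norm \<beta>)"
        have sq: "sqrt g \<le> 1 + g" using g by (intro real_le_lsqrt) (auto simp: power2_eq_square algebra_simps)
        have \<rho>: "sqrt g * (norm \<alpha> + norm \<beta>) \<le> \<rho>" unfolding \<rho>_def using sq by (intro mult_right_mono) auto
        have jn: "j \<le> n" using j by simp
        have "\<bar>V j (y + \<delta> n j) - V n y - Q j\<bar> \<le> 10 * \<kappa> j * (1 + \<rho> + norm (\<delta> n j)) ^ 3"
          using Vj.gauss2_expansion[OF R(2,3) \<delta>R g \<rho>, of y n j]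
          unfolding Q_def V_def V\<^sub>1_def V\<^sub>2_def g_def semi[OF G.growth jn] semi[OF G.growth1 jn] semi[OF G.growth2 jn] .
        also have "\<dots> \<le> 10 * ((K * b\<^sub>2 / sqrt (time n + 1)) * (1 + g)) * (c * X) ^ 3"
        proof (intro mult_mono power_mono)
          \<comment> \<open>Going from the scale of \<open>time j\<close> to that of
            \<open>time n\<close> costs at most a factor \<open>1 + g\<close> in the modulus, even
            when \<open>time j\<close> is 0.\<close>
          have "(time n + 1) \<le> (time j + 1) * (1 + g)\<^sup>2"
          proof -
            have "time n = time j + g" by (simp add: g_def gap_def)
            then have "(time j + 1) * (1 + g)\<^sup>2 = (time n + 1) + g + g\<^sup>2 + time j * (2 * g + g\<^sup>2)"
              by (simp add: power2_eq_square algebra_simps)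
            then show ?thesis using g time_nonneg[of j] by simp
          qed
          then have "sqrt (time n + 1) \<le> sqrt (time j + 1) * (1 + g)"
            using g by (metis abs_of_nonneg add_nonneg_nonneg real_sqrt_abs real_sqrt_le_mono real_sqrt_mult zero_le_one)
          then have "1 / sqrt (time j + 1) \<le> (1 + g) / sqrt (time n + 1)"
            using time_nonneg[of j] time_nonneg[of n] by (simp add: field_simps)
          then have "(K * b\<^sub>2) * (1 / sqrt (time j + 1)) \<le> (K * b\<^sub>2) * ((1 + g) / sqrt (time n + 1))"
            using K b by (intro mult_left_mono) auto
          then show "\<kappa> j \<le> K * b\<^sub>2 / sqrt (time n + 1) * (1 + g)" by (simp add: \<kappa>_def)
          have "norm (\<delta> n j) \<le> cmod (h' (n - j)) + g * (\<theta> * norm \<mu>)"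
            unfolding \<delta>_def using norm_triangle_ineq4[of "h' (n - j)" "(\<theta> * gap n j) *\<^sub>R \<mu>"] g theta_pos
            by (simp add: g_def abs_mult mult_ac)
          moreover have "1 + cmod (h' (n - j)) \<le> X" using g by (simp add: X_def)
          moreover have "(1 + g) * (norm \<alpha> + norm \<beta>) \<le> X * (norm \<alpha> + norm \<beta>)"
            using X by (intro mult_right_mono) auto
          moreover have "g * (\<theta> * norm \<mu>) \<le> X * (\<theta> * norm \<mu>)"
            using X theta_pos by (intro mult_right_mono) auto
          moreover have "c * X = X + X * (norm \<alpha> + norm \<beta>) + X * (\<theta> * norm \<mu>)" by (simp add: c_def algebra_simps)
          ultimately show "1 + \<rho> + norm (\<delta> n j) \<le> c * X"
            unfolding \<rho>_def by linarith
          show "0 \<le> 1 + \<rho> + norm (\<delta> n j)" using g by (simp add: \<rho>_def)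
        qed (use Vj.kappa g K b time_nonneg[of n] X c in \<open>auto simp: \<rho>_def\<close>)
        also have "\<dots> = 10 * (K * b\<^sub>2 / sqrt (time n + 1)) * c ^ 3 * ((1 + g) * X ^ 3)"
          by (simp add: power_mult_distrib)
        also have "\<dots> \<le> 10 * (K * b\<^sub>2 / sqrt (time n + 1)) * c ^ 3 * (X * X ^ 3)"
          using X K b c time_nonneg[of n] by (intro mult_left_mono mult_right_mono) auto
        also have "X * X ^ 3 = X ^ 4" by (simp add: power_numeral_reduce)
        finally show ?thesis by (simp add: X_def g_def)
      qed
      have V11: "\<bar>V\<^sub>1 n y 1\<bar> \<le> b\<^sub>1" "\<bar>V\<^sub>1 n y \<i>\<bar> \<le> b\<^sub>1" using Vn.bound1[of y 1] Vn.bound1[of y \<i>] by auto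
      have V22: "\<bar>V\<^sub>2 n y 1 1\<bar> \<le> b\<^sub>2" "\<bar>V\<^sub>2 n y 1 \<i>\<bar> \<le> b\<^sub>2" "\<bar>V\<^sub>2 n y \<i> 1\<bar> \<le> b\<^sub>2" "\<bar>V\<^sub>2 n y \<i> \<i>\<bar> \<le> b\<^sub>2"
        using Vn.bound2[of y 1 1] Vn.bound2[of y 1 \<i>] Vn.bound2[of y \<i> 1] Vn.bound2[of y \<i> \<i>] by auto
      define x11 where "x11 = V\<^sub>2 n y 1 1"
      define x1i where "x1i = V\<^sub>2 n y 1 \<i>"
      define xi1 where "xi1 = V\<^sub>2 n y \<i> 1"
      define xii where "xii = V\<^sub>2 n y \<i> \<i>"
      note exp2 = C2_fun_expand_complex(2)[OF CV, of n y, folded x11_def x1i_def xi1_def xii_def]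
      have ab: "V\<^sub>2 n y \<alpha> \<alpha> + V\<^sub>2 n y \<beta> \<beta> = \<theta> * (v\<^sub>r * x11 + v\<^sub>r\<^sub>i * (x1i + xi1) + v\<^sub>i * xii)"
      proof -
        have "V\<^sub>2 n y \<alpha> \<alpha> + V\<^sub>2 n y \<beta> \<beta> = ((Re \<alpha>)\<^sup>2 + (Re \<beta>)\<^sup>2) * x11
            + (Re \<alpha> * Im \<alpha> + Re \<beta> * Im \<beta>) * (x1i + xi1) + ((Im \<alpha>)\<^sup>2 + (Im \<beta>)\<^sup>2) * xii"
          unfolding exp2[of \<alpha> \<alpha>] exp2[of \<beta> \<beta>] by (simp add: power2_eq_square algebra_simps)
        then show ?thesis unfolding var by (simp add: algebra_simps)
      qed
      \<comment> \<open>In the mean the quadratic terms cancel: the second moments of an increment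
        are close to \<open>v\<^sub>r\<close>, \<open>v\<^sub>r\<^sub>i\<close>,
        \<open>v\<^sub>i\<close>, and the Gaussian accumulates \<theta> times these per unit of time
        over a mean time \<open>1 / \<theta>\<close>. Only the defects remain.\<close>
      have sQ: "(\<Sum>j<n. pr n j * Q j) = m\<^sub>r n * V\<^sub>1 n y 1 + m\<^sub>i n * V\<^sub>1 n y \<i>
          + (q\<^sub>r n * x11 + q\<^sub>c n * (x1i + xi1) + q\<^sub>i n * xii) / 2"
      proof -
        define S where "S = v\<^sub>r * x11 + v\<^sub>r\<^sub>i * (x1i + xi1) + v\<^sub>i * xii"
        have "(\<Sum>j<n. pr n j * Q j) = (\<Sum>j<n. V\<^sub>1 n y 1 * (pr n j * Re (\<delta> n j)) + V\<^sub>1 n y \<i> * (pr n j * Im (\<delta> n j))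
            + x11 / 2 * (pr n j * (Re (\<delta> n j) * Re (\<delta> n j))) + (x1i + xi1) / 2 * (pr n j * (Re (\<delta> n j) * Im (\<delta> n j)))
            + xii / 2 * (pr n j * (Im (\<delta> n j) * Im (\<delta> n j))) - \<theta> * S / 2 * (pr n j * gap n j))"
        proof (rule sum.cong[OF refl])
          fix j
          show "pr n j * Q j = V\<^sub>1 n y 1 * (pr n j * Re (\<delta> n j)) + V\<^sub>1 n y \<i> * (pr n j * Im (\<delta> n j))
            + x11 / 2 * (pr n j * (Re (\<delta> n j) * Re (\<delta> n j))) + (x1i + xi1) / 2 * (pr n j * (Re (\<delta> n j) * Im (\<delta> n j)))
            + xii / 2 * (pr n j * (Im (\<delta> n j) * Im (\<delta> n j))) - \<theta> * S / 2 * (pr n j * gap n j)"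
            unfolding Q_def ab S_def[symmetric] exp2[of "\<delta> n j" "\<delta> n j"] C2_fun_expand_complex(1)[OF CV, of n y "\<delta> n j"]
            by (simp add: field_simps)
        qed
        also have "\<dots> = V\<^sub>1 n y 1 * m\<^sub>r n + V\<^sub>1 n y \<i> * m\<^sub>i n + x11 / 2 * (q\<^sub>r n + v\<^sub>r) + (x1i + xi1) / 2 * (q\<^sub>c n + v\<^sub>r\<^sub>i)
            + xii / 2 * (q\<^sub>i n + v\<^sub>i) - \<theta> * S / 2 * (1 / \<theta>)"
          unfolding sum_subtractf sum.distrib sum_distrib_left[symmetric] sum_pr_gap[OF n]
          by (simp add: m\<^sub>r_def m\<^sub>i_def q\<^sub>r_def q\<^sub>c_def q\<^sub>i_def)
        also have "\<theta> * S / 2 * (1 / \<theta>) = S / 2" using theta_pos by simp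
        finally show ?thesis unfolding S_def by (simp add: field_simps)
      qed
      have sQ': "\<bar>\<Sum>j<n. pr n j * Q j\<bar> + b\<^sub>1 * \<bar>r n\<bar> \<le> (b\<^sub>1 + b\<^sub>2) * B * real n powr - e"
      proof -
        have ml: "\<bar>u * v\<bar> \<le> \<bar>u\<bar> * w" if "\<bar>v\<bar> \<le> w" for u v w :: real
          unfolding abs_mult using that by (intro mult_left_mono) auto
        have "\<bar>\<Sum>j<n. pr n j * Q j\<bar> \<le> \<bar>m\<^sub>r n\<bar> * b\<^sub>1 + \<bar>m\<^sub>i n\<bar> * b\<^sub>1 + (\<bar>q\<^sub>r n\<bar> * b\<^sub>2 + \<bar>q\<^sub>c n\<bar> * (2 * b\<^sub>2) + \<bar>q\<^sub>i n\<bar> * b\<^sub>2) / 2"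
        proof -
          have "\<bar>x1i + xi1\<bar> \<le> 2 * b\<^sub>2" using V22 unfolding x1i_def xi1_def by linarith
          note v = this
          have tri: "\<bar>A + B + (C + D + E) / 2\<bar> \<le> a + b + (c + d + e) / 2"
            if "\<bar>A\<bar> \<le> a" "\<bar>B\<bar> \<le> b" "\<bar>C\<bar> \<le> c" "\<bar>D\<bar> \<le> d" "\<bar>E\<bar> \<le> e" for A B C D E a b c d e :: real
            using that by argo
          show ?thesis unfolding sQ
            by (rule tri[OF ml[OF V11(1)] ml[OF V11(2)] ml[OF V22(1)[folded x11_def]] ml[OF v] ml[OF V22(4)[folded xii_def]]])
        qed
        also have "\<dots> + b\<^sub>1 * \<bar>r n\<bar> \<le> (b\<^sub>1 + b\<^sub>2) * (\<bar>m\<^sub>r n\<bar> + \<bar>m\<^sub>i n\<bar> + \<bar>q\<^sub>r n\<bar> + \<bar>q\<^sub>i n\<bar> + \<bar>q\<^sub>c n\<bar> + \<bar>r n\<bar>)"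
        proof -
          have p: "0 \<le> b\<^sub>1 * \<bar>u\<bar>" "0 \<le> b\<^sub>2 * \<bar>u\<bar>" for u using b by auto
          show ?thesis
            using p[of "m\<^sub>r n"] p[of "m\<^sub>i n"] p[of "q\<^sub>r n"] p[of "q\<^sub>i n"] p[of "q\<^sub>c n"] p[of "r n"]
            by (simp add: algebra_simps)
        qed
        also have "\<dots> \<le> (b\<^sub>1 + b\<^sub>2) * (B * real n powr - e)" using small[OF n] b by (intro mult_left_mono) auto
        finally show ?thesis by (simp add: mult.assoc)
      qed
      define E where "E j = V j (y + h (n - j) - (\<theta> * gap n j) *\<^sub>R \<mu>) - V n y - Q j" for j
      have "(\<Sum>j<n. pr n j * V j (y + h (n - j) - (\<theta> * gap n j) *\<^sub>R \<mu>)) = (\<Sum>j<n. pr n j * E j + V n y * pr n j + pr n j * Q j)"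
        by (intro sum.cong) (auto simp: E_def algebra_simps)
      also have "\<dots> = (\<Sum>j<n. pr n j * E j) + V n y * 1 + (\<Sum>j<n. pr n j * Q j)"
        unfolding sum.distrib sum_distrib_left[symmetric] sum_pr_1[OF n] ..
      finally have eq: "V n y - (\<Sum>j<n. pr n j * V j (y + h (n - j) - (\<theta> * gap n j) *\<^sub>R \<mu>))
          = - (\<Sum>j<n. pr n j * E j) - (\<Sum>j<n. pr n j * Q j)" by simp
      have "\<bar>\<Sum>j<n. pr n j * E j\<bar> \<le> (\<Sum>j<n. pr n j * (b\<^sub>1 * cmod (h (n - j) - h' (n - j))
          + 10 * (K * b\<^sub>2 / sqrt (time n + 1)) * c ^ 3 * (1 + gap n j + cmod (h' (n - j))) ^ 4))"
      proof (rule order.trans[OF sum_abs sum_mono])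
        fix j assume "j \<in> {..<n}"
        then have j: "j < n" by simp
        have "\<bar>E j\<bar> \<le> b\<^sub>1 * cmod (h (n - j) - h' (n - j))
          + 10 * (K * b\<^sub>2 / sqrt (time n + 1)) * c ^ 3 * (1 + gap n j + cmod (h' (n - j))) ^ 4"
          using t1[of j] t2[OF j] unfolding E_def by linarith
        then show "\<bar>pr n j * E j\<bar> \<le> pr n j * (b\<^sub>1 * cmod (h (n - j) - h' (n - j))
          + 10 * (K * b\<^sub>2 / sqrt (time n + 1)) * c ^ 3 * (1 + gap n j + cmod (h' (n - j))) ^ 4)"
          unfolding abs_mult using pr_pos[OF n, of j] by (simp add: mult_left_mono)
      qed
      also have "\<dots> = b\<^sub>1 * r n + 10 * (K * b\<^sub>2 / sqrt (time n + 1)) * c ^ 3 * (\<Sum>j<n. pr n j * (1 + gap n j + cmod (h' (n - j))) ^ 4)"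
        unfolding r_def by (simp only: distrib_left sum.distrib sum_distrib_left mult_ac)
      also have "\<dots> \<le> b\<^sub>1 * \<bar>r n\<bar> + 10 * (K * b\<^sub>2 / sqrt (time n + 1)) * c ^ 3 * M4"
        using M4[OF n] K b c time_nonneg[of n] by (intro add_mono mult_left_mono) auto
      also have "10 * (K * b\<^sub>2 / sqrt (time n + 1)) * c ^ 3 * M4 = C\<^sub>2 * b\<^sub>2 / sqrt (time n + 1)"
        by (simp add: C\<^sub>2_def)
      finally show ?thesis unfolding eq using sQ' by linarith
    qed
    \<comment> \<open>A real supremum is meaningful only over a bounded set, so boundedness in
      \<open>y\<close> is proved in the same induction as the recursive inequality.\<close>
    define D where "D n = (SUP y. \<bar>A n y - V n y\<bar>)" for n
    have ind: "\<bar>A n y - V n y\<bar> \<le> D n \<and> bdd_above (range (\<lambda>y. \<bar>A n y - V n y\<bar>)) \<and>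
        (n \<ge> 1 \<longrightarrow> D n \<le> ((b\<^sub>1 + b\<^sub>2) * B) * real n powr - e + (C\<^sub>2 * b\<^sub>2) / sqrt (time n + 1) + (\<Sum>j<n. pr n j * D j))" for n y
    proof (induction n arbitrary: y rule: less_induct)
      case (less n)
      show ?case
      proof (cases "n = 0")
        case True
        have "V 0 = G" unfolding V_def using gauss2_0[OF G.growth] by (simp add: time_def)
        then show ?thesis using True A0 by (simp add: D_def)
      next
        case False
        then have n: "n \<ge> 1" by simp
        have bound: "\<bar>A n y - V n y\<bar> \<le> ((b\<^sub>1 + b\<^sub>2) * B) * real n powr - e + (C\<^sub>2 * b\<^sub>2) / sqrt (time n + 1) + (\<Sum>j<n. pr n j * D j)" for y
        proof -
          define z where "z j = y + h (n - j) - (\<theta> * gap n j) *\<^sub>R \<mu>" for j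
          have "A n y - V n y = (\<Sum>j<n. pr n j * (A j (z j) - V j (z j))) - (V n y - (\<Sum>j<n. pr n j * V j (z j)))"
            using An n by (simp add: z_def right_diff_distrib sum_subtractf)
          moreover have "\<bar>\<Sum>j<n. pr n j * (A j (z j) - V j (z j))\<bar> \<le> (\<Sum>j<n. pr n j * D j)"
          proof (rule order.trans[OF sum_abs sum_mono])
            fix j assume "j \<in> {..<n}"
            then have "\<bar>A j (z j) - V j (z j)\<bar> \<le> D j" using less by blast
            then show "\<bar>pr n j * (A j (z j) - V j (z j))\<bar> \<le> pr n j * D j"
              unfolding abs_mult using pr_pos[OF n, of j] by (simp add: mult_left_mono)
          qed
          moreover have "\<bar>V n y - (\<Sum>j<n. pr n j * V j (z j))\<bar> \<le> (b\<^sub>1 + b\<^sub>2) * B * real n powr - e + C\<^sub>2 * b\<^sub>2 / sqrt (time n + 1)"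
            unfolding z_def by (rule step[OF n])
          ultimately show ?thesis by linarith
        qed
        have bdd: "bdd_above (range (\<lambda>y. \<bar>A n y - V n y\<bar>))" using bound by (intro bdd_aboveI2) 
        moreover have "\<bar>A n y - V n y\<bar> \<le> D n" unfolding D_def using bdd by (rule cSUP_upper[rotated]) simp
        moreover have "D n \<le> ((b\<^sub>1 + b\<^sub>2) * B) * real n powr - e + (C\<^sub>2 * b\<^sub>2) / sqrt (time n + 1) + (\<Sum>j<n. pr n j * D j)"
          unfolding D_def by (rule cSUP_least) (use bound in \<open>auto simp: D_def\<close>)
        ultimately show ?thesis by blast
      qed
    qed
    have "D n \<le> ((b\<^sub>1 + b\<^sub>2) * B) * (\<theta> * exp (e * T) / e) + 2 * \<theta> * (C\<^sub>2 * b\<^sub>2) * sqrt (time n + 1)"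
    proof (rule recursion_bound)
      have "V 0 = G" unfolding V_def using gauss2_0[OF G.growth] by (simp add: time_def)
      then show "D 0 \<le> 0" using A0 by (simp add: D_def)
      show "time n \<le> ln (real n) + T" if "n \<ge> 1" for n using T[OF that] by linarith
    qed (use ind b B0 C\<^sub>2 e in auto)
    also have "\<dots> \<le> C * (b\<^sub>1 + b\<^sub>2) + C * b\<^sub>2 * sqrt (time n + 1)"
    proof (rule add_mono)
      have "0 \<le> 2 * \<theta> * C\<^sub>2" using C\<^sub>2 theta_pos by simp
      then have "B * (\<theta> * exp (e * T) / e) \<le> C" by (simp add: C_def)
      then have "B * (\<theta> * exp (e * T) / e) * (b\<^sub>1 + b\<^sub>2) \<le> C * (b\<^sub>1 + b\<^sub>2)" using b by (intro mult_right_mono) auto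
      then show "((b\<^sub>1 + b\<^sub>2) * B) * (\<theta> * exp (e * T) / e) \<le> C * (b\<^sub>1 + b\<^sub>2)" by (simp add: mult_ac)
      have "0 \<le> B * (\<theta> * exp (e * T) / e)" using B0 theta_pos e by simp
      then have "2 * \<theta> * C\<^sub>2 \<le> C" by (simp add: C_def)
      then have "2 * \<theta> * C\<^sub>2 * (b\<^sub>2 * sqrt (time n + 1)) \<le> C * (b\<^sub>2 * sqrt (time n + 1))"
        using b time_nonneg[of n] by (intro mult_right_mono) auto
      then show "2 * \<theta> * (C\<^sub>2 * b\<^sub>2) * sqrt (time n + 1) \<le> C * b\<^sub>2 * sqrt (time n + 1)" by (simp add: mult_ac)
    qed
    finally show "\<bar>A n y - gauss2 \<alpha> \<beta> (time n) G y\<bar> \<le> C * (b\<^sub>1 + b\<^sub>2) + C * b\<^sub>2 * sqrt (time n + 1)"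
      using ind[of n y] unfolding V_def by linarith
  qed
qed

end

section \<open>Complex Gaussian variables\<close>

text \<open>Reduces statements on a joint law to the one-dimensional uniqueness theorem: with \<open>w\<close> a
  function of a second variable, the hypothesis follows from the joint characteristic function.\<close>

lemma weighted_Levy_uniqueness:
  fixes X w :: "'w \<Rightarrow> real"
  assumes M: "prob_space M" and X: "X \<in> borel_measurable M" and w: "w \<in> borel_measurable M"
    and wb: "\<And>\<omega>. 0 \<le> w \<omega>" "\<And>\<omega>. w \<omega> \<le> B" and w1: "(\<integral>\<omega>. w \<omega> \<partial>M) = 1"
    and eq: "\<And>a. (\<integral>\<omega>. w \<omega> *\<^sub>R iexp (a * X \<omega>) \<partial>M) = (\<integral>\<omega>. iexp (a * X \<omega>) \<partial>M)"
    and A: "A \<in> sets borel"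
  shows "(\<integral>\<omega>. w \<omega> * indicator A (X \<omega>) \<partial>M) = (\<integral>\<omega>. indicator A (X \<omega>) \<partial>M)"
proof -
  interpret prob_space M by fact
  note [measurable] = X w A
  have iw: "integrable M w"
    by (rule integrable_const_bound[of _ B]) (use wb in \<open>auto simp: abs_of_nonneg\<close>)
  \<comment> \<open>Under the law reweighted by \<open>w\<close>, the assumed equality of integrals
    becomes the equality of two characteristic functions of \<open>X\<close>.\<close>
  define N where "N = density M (\<lambda>\<omega>. ennreal (w \<omega>))"
  have "emeasure N (space N) = (\<integral>\<^sup>+\<omega>. ennreal (w \<omega>) \<partial>M)"
    unfolding N_def by (subst emeasure_density) (auto intro!: nn_integral_cong)
  also have "\<dots> = ennreal (\<integral>\<omega>. w \<omega> \<partial>M)" by (rule nn_integral_eq_integral[OF iw]) (use wb in auto)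
  finally interpret N: prob_space N by (intro prob_spaceI) (simp add: w1)
  have XN: "X \<in> borel_measurable N" by (simp add: N_def)
  have "distr N borel X = distr M borel X"
  proof (rule Levy_uniqueness)
    show "real_distribution (distr N borel X)" "real_distribution (distr M borel X)"
      unfolding real_distribution_def real_distribution_axioms_def
      by (auto intro!: N.prob_space_distr prob_space_distr XN)
    have "char (distr N borel X) a = char (distr M borel X) a" for a
    proof -
      have "char (distr N borel X) a = (\<integral>\<omega>. iexp (a * X \<omega>) \<partial>N)"
        unfolding char_def by (subst integral_distr[OF XN]) auto
      also have "\<dots> = (\<integral>\<omega>. w \<omega> *\<^sub>R iexp (a * X \<omega>) \<partial>M)"
        unfolding N_def by (rule integral_density) (use wb in auto)
      also have "\<dots> = char (distr M borel X) a"
        unfolding eq char_def by (subst integral_distr) auto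
      finally show ?thesis .
    qed
    then show "char (distr N borel X) = char (distr M borel X)" ..
  qed
  then have "(\<integral>x. indicator A x \<partial>distr N borel X) = (\<integral>x. indicator A x \<partial>distr M borel X :: real)" by simp
  then have "(\<integral>\<omega>. indicator A (X \<omega>) \<partial>N) = (\<integral>\<omega>. indicator A (X \<omega>) \<partial>M :: real)"
    unfolding integral_distr[OF XN borel_measurable_indicator[OF A]] integral_distr[OF X borel_measurable_indicator[OF A]] .
  moreover have "(\<integral>\<omega>. indicator A (X \<omega>) \<partial>N) = (\<integral>\<omega>. w \<omega> *\<^sub>R indicator A (X \<omega>) \<partial>M :: real)"
    unfolding N_def by (rule integral_density) (use wb in auto)
  ultimately show ?thesis by simp
qed

text \<open>Independence follows from one-dimensional uniqueness used twice: for \<open>X\<close>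
  under weights made from \<open>cos (b * Y \<omega>)\<close> and
  \<open>sin (b * Y \<omega>)\<close>, then for \<open>Y\<close> under the weight
  \<open>indicator A (X \<omega>)\<close>. The joint characteristic function is even in
  \<open>b\<close>, which separates the cosine from the sine.\<close>

lemma distr_pair_of_char:
  fixes X Y :: "'w \<Rightarrow> real"
  assumes M: "prob_space M" and X: "X \<in> borel_measurable M" and Y: "Y \<in> borel_measurable M"
    and char: "\<And>a b. (\<integral>\<omega>. iexp (a * X \<omega> + b * Y \<omega>) \<partial>M) = of_real (exp (- (a\<^sup>2 * u / 2)) * exp (- (b\<^sup>2 * v / 2)))"
  shows "distr M (borel \<Otimes>\<^sub>M borel) (\<lambda>\<omega>. (X \<omega>, Y \<omega>)) = distr M borel X \<Otimes>\<^sub>M distr M borel Y"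
proof -
  interpret prob_space M by fact
  note [measurable] = X Y
  define \<phi> where "\<phi> a = complex_of_real (exp (- (a\<^sup>2 * u / 2)))" for a
  define \<psi> where "\<psi> b = exp (- (b\<^sup>2 * v / 2))" for b
  have ii: "integrable M (\<lambda>\<omega>. iexp (a * X \<omega> + b * Y \<omega>))" for a b
    by (rule integrable_const_bound[of _ 1]) auto
  have cX: "(\<integral>\<omega>. iexp (a * X \<omega>) \<partial>M) = \<phi> a" for a using char[of a 0] by (simp add: \<phi>_def)
  have cY: "(\<integral>\<omega>. iexp (b * Y \<omega>) \<partial>M) = complex_of_real (\<psi> b)" for b using char[of 0 b] by (simp add: \<psi>_def)
  have ccos: "(\<integral>\<omega>. cos (b * Y \<omega>) *\<^sub>R iexp (a * X \<omega>) \<partial>M) = \<psi> b *\<^sub>R \<phi> a" for a b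
  proof -
    have "(\<integral>\<omega>. cos (b * Y \<omega>) *\<^sub>R iexp (a * X \<omega>) \<partial>M)
        = (\<integral>\<omega>. (iexp (a * X \<omega> + b * Y \<omega>) + iexp (a * X \<omega> + (- b) * Y \<omega>)) / 2 \<partial>M)"
      by (intro Bochner_Integration.integral_cong)
        (auto simp: complex_eq_iff Re_exp Im_exp cos_add cos_diff sin_add sin_diff)
    also have "\<dots> = ((\<integral>\<omega>. iexp (a * X \<omega> + b * Y \<omega>) \<partial>M) + (\<integral>\<omega>. iexp (a * X \<omega> + (- b) * Y \<omega>) \<partial>M)) / 2"
      using ii[of a b] ii[of a "- b"] by (simp only: integral_divide_zero Bochner_Integration.integral_add)
    also have "\<dots> = \<psi> b *\<^sub>R \<phi> a"
      unfolding char by (simp add: \<phi>_def \<psi>_def scaleR_conv_of_real)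
    finally show ?thesis .
  qed
  have csin: "(\<integral>\<omega>. sin (b * Y \<omega>) *\<^sub>R iexp (a * X \<omega>) \<partial>M) = 0" for a b
  proof -
    have "(\<integral>\<omega>. sin (b * Y \<omega>) *\<^sub>R iexp (a * X \<omega>) \<partial>M)
        = (\<integral>\<omega>. (iexp (a * X \<omega> + b * Y \<omega>) - iexp (a * X \<omega> + (- b) * Y \<omega>)) / (2 * \<i>) \<partial>M)"
      by (intro Bochner_Integration.integral_cong)
        (auto simp: complex_eq_iff Re_exp Im_exp cos_add cos_diff sin_add sin_diff)
    also have "\<dots> = ((\<integral>\<omega>. iexp (a * X \<omega> + b * Y \<omega>) \<partial>M) - (\<integral>\<omega>. iexp (a * X \<omega> + (- b) * Y \<omega>) \<partial>M)) / (2 * \<i>)"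
      using ii[of a b] ii[of a "- b"] by (simp only: integral_divide_zero Bochner_Integration.integral_diff)
    also have "\<dots> = 0" unfolding char by simp
    finally show ?thesis .
  qed
  have icos: "integrable M (\<lambda>\<omega>. cos (b * Y \<omega>))" and isin: "integrable M (\<lambda>\<omega>. sin (b * Y \<omega>))" for b
    by (rule integrable_const_bound[of _ 1]; simp)+
  have ie: "integrable M (\<lambda>\<omega>. iexp (a * X \<omega>))" for a using ii[of a 0] by simp
  have iecos: "integrable M (\<lambda>\<omega>. cos (b * Y \<omega>) *\<^sub>R iexp (a * X \<omega>))" and iesin: "integrable M (\<lambda>\<omega>. sin (b * Y \<omega>) *\<^sub>R iexp (a * X \<omega>))" for a b
    by (rule integrable_const_bound[of _ 1]; simp)+
  have Ecos: "(\<integral>\<omega>. cos (b * Y \<omega>) \<partial>M) = \<psi> b" for b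
  proof -
    have "complex_of_real (\<integral>\<omega>. cos (b * Y \<omega>) \<partial>M) = complex_of_real (\<psi> b)"
      using ccos[of b 0] icos[of b] by (simp add: \<phi>_def scaleR_conv_of_real)
    then show ?thesis by (simp only: of_real_eq_iff)
  qed
  have Esin: "(\<integral>\<omega>. sin (b * Y \<omega>) \<partial>M) = 0" for b
  proof -
    have "complex_of_real (\<integral>\<omega>. sin (b * Y \<omega>) \<partial>M) = 0"
      using csin[of b 0] isin[of b] by (simp add: scaleR_conv_of_real)
    then show ?thesis by simp
  qed
  have psi: "\<psi> b > 0" for b by (simp add: \<psi>_def)
  have iind: "integrable M (\<lambda>\<omega>. indicator A (X \<omega>) :: real)" if "A \<in> sets borel" for A
    using that by (intro integrable_const_bound[of _ 1]) (auto simp: indicator_def)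
  have Acos: "(\<integral>\<omega>. cos (b * Y \<omega>) * indicator A (X \<omega>) \<partial>M) = \<psi> b * (\<integral>\<omega>. indicator A (X \<omega>) \<partial>M)"
    and Asin: "(\<integral>\<omega>. sin (b * Y \<omega>) * indicator A (X \<omega>) \<partial>M) = 0" if A: "A \<in> sets borel" for A b
  proof -
    note [measurable] = A
    have i: "integrable M (\<lambda>\<omega>. cos (b * Y \<omega>) * indicator A (X \<omega>))" "integrable M (\<lambda>\<omega>. sin (b * Y \<omega>) * indicator A (X \<omega>))"
      by (rule integrable_const_bound[of _ 1]; simp add: abs_mult mult_le_one indicator_def)+
    \<comment> \<open>Adding 1 makes the weight nonnegative, and \<open>1 + \<psi> b\<close>
      normalizes it. The sine has mean 0, so there \<open>1 + sin (b * Y \<omega>)\<close> is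
      normalized already.\<close>
    have "(\<integral>\<omega>. ((1 + cos (b * Y \<omega>)) / (1 + \<psi> b)) * indicator A (X \<omega>) \<partial>M) = (\<integral>\<omega>. indicator A (X \<omega>) \<partial>M)"
    proof (rule weighted_Levy_uniqueness[OF M X _ _ _ _ _ A, where B = 2])
      show "(1 + cos (b * Y \<omega>)) / (1 + \<psi> b) \<le> 2" for \<omega>
      proof -
        have "1 + cos (b * Y \<omega>) \<le> 1 + 1" by (rule add_left_mono[OF cos_le_one])
        also have "\<dots> \<le> 2 * (1 + \<psi> b)" using psi[of b] by simp
        finally have "1 + cos (b * Y \<omega>) \<le> 2 * (1 + \<psi> b)" .
        then show ?thesis using psi[of b] by (simp add: pos_divide_le_eq add_pos_pos)
      qed
      show "0 \<le> (1 + cos (b * Y \<omega>)) / (1 + \<psi> b)" for \<omega>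
      proof -
        have "0 \<le> 1 + cos (b * Y \<omega>)" using cos_ge_minus_one[of "b * Y \<omega>"] by linarith
        then show ?thesis using psi[of b] by simp
      qed
      show "(\<integral>\<omega>. (1 + cos (b * Y \<omega>)) / (1 + \<psi> b) \<partial>M) = 1"
        using icos[of b] Ecos[of b] psi[of b] prob_space by simp
      show "(\<integral>\<omega>. ((1 + cos (b * Y \<omega>)) / (1 + \<psi> b)) *\<^sub>R iexp (a * X \<omega>) \<partial>M) = (\<integral>\<omega>. iexp (a * X \<omega>) \<partial>M)" for a
      proof -
        have "(\<integral>\<omega>. ((1 + cos (b * Y \<omega>)) / (1 + \<psi> b)) *\<^sub>R iexp (a * X \<omega>) \<partial>M)
            = (\<integral>\<omega>. (1 / (1 + \<psi> b)) *\<^sub>R (iexp (a * X \<omega>) + cos (b * Y \<omega>) *\<^sub>R iexp (a * X \<omega>)) \<partial>M)"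
          by (intro Bochner_Integration.integral_cong)
            (auto simp: scaleR_conv_of_real add_divide_distrib algebra_simps)
        also have "\<dots> = (1 / (1 + \<psi> b)) *\<^sub>R ((\<integral>\<omega>. iexp (a * X \<omega>) \<partial>M) + (\<integral>\<omega>. cos (b * Y \<omega>) *\<^sub>R iexp (a * X \<omega>) \<partial>M))"
          using ie[of a] iecos[of b a] by (simp only: integral_scaleR_right Bochner_Integration.integral_add)
        also have "\<dots> = (1 / (1 + \<psi> b)) *\<^sub>R ((1 + \<psi> b) *\<^sub>R \<phi> a)"
          unfolding cX ccos by (simp add: scaleR_add_left)
        also have "\<dots> = \<phi> a" using psi[of b] by simp
        finally show ?thesis unfolding cX .
      qed
    qed measurable
    also have "(\<integral>\<omega>. ((1 + cos (b * Y \<omega>)) / (1 + \<psi> b)) * indicator A (X \<omega>) \<partial>M)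
        = (\<integral>\<omega>. (indicator A (X \<omega>) + cos (b * Y \<omega>) * indicator A (X \<omega>)) / (1 + \<psi> b) \<partial>M)"
      by (intro Bochner_Integration.integral_cong) (auto simp: algebra_simps)
    also have "\<dots> = ((\<integral>\<omega>. indicator A (X \<omega>) \<partial>M) + (\<integral>\<omega>. cos (b * Y \<omega>) * indicator A (X \<omega>) \<partial>M)) / (1 + \<psi> b)"
      using i(1) iind[OF A] by simp
    finally show "(\<integral>\<omega>. cos (b * Y \<omega>) * indicator A (X \<omega>) \<partial>M) = \<psi> b * (\<integral>\<omega>. indicator A (X \<omega>) \<partial>M)"
      using psi[of b] by (simp add: field_simps)
    have "(\<integral>\<omega>. (1 + sin (b * Y \<omega>)) * indicator A (X \<omega>) \<partial>M) = (\<integral>\<omega>. indicator A (X \<omega>) \<partial>M)"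
    proof (rule weighted_Levy_uniqueness[OF M X _ _ _ _ _ A, where B = 2])
      show "1 + sin (b * Y \<omega>) \<le> 2" for \<omega> using sin_le_one[of "b * Y \<omega>"] by linarith
      show "0 \<le> 1 + sin (b * Y \<omega>)" for \<omega> using sin_ge_minus_one[of "b * Y \<omega>"] by linarith
      show "(\<integral>\<omega>. 1 + sin (b * Y \<omega>) \<partial>M) = 1"
        using isin[of b] Esin[of b] prob_space by simp
      show "(\<integral>\<omega>. (1 + sin (b * Y \<omega>)) *\<^sub>R iexp (a * X \<omega>) \<partial>M) = (\<integral>\<omega>. iexp (a * X \<omega>) \<partial>M)" for a
        unfolding scaleR_add_left scaleR_one using ie[of a] iesin[of b a] csin[of b a]
        by (simp only: Bochner_Integration.integral_add) simp
    qed measurable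
    also have "(\<integral>\<omega>. (1 + sin (b * Y \<omega>)) * indicator A (X \<omega>) \<partial>M)
        = (\<integral>\<omega>. indicator A (X \<omega>) + sin (b * Y \<omega>) * indicator A (X \<omega>) \<partial>M)"
      by (intro Bochner_Integration.integral_cong) (auto simp: algebra_simps)
    also have "\<dots> = (\<integral>\<omega>. indicator A (X \<omega>) \<partial>M) + (\<integral>\<omega>. sin (b * Y \<omega>) * indicator A (X \<omega>) \<partial>M)"
      using i(2) iind[OF A] by simp
    finally show "(\<integral>\<omega>. sin (b * Y \<omega>) * indicator A (X \<omega>) \<partial>M) = 0" by simp
  qed
  have AB: "(\<integral>\<omega>. indicator A (X \<omega>) * indicator B (Y \<omega>) \<partial>M)
      = (\<integral>\<omega>. indicator A (X \<omega>) \<partial>M) * (\<integral>\<omega>. indicator B (Y \<omega>) \<partial>M :: real)"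
    if A: "A \<in> sets borel" and B: "B \<in> sets borel" for A B
  proof -
    note [measurable] = A B
    define P where "P = (\<integral>\<omega>. indicator A (X \<omega>) \<partial>M :: real)"
    have P0: "P \<ge> 0" unfolding P_def by (intro Bochner_Integration.integral_nonneg) auto
    show ?thesis
    proof (cases "P = 0")
      case True
      have "(\<integral>\<omega>. indicator A (X \<omega>) * indicator B (Y \<omega>) \<partial>M) \<le> P"
        unfolding P_def
        by (intro integral_mono iind[OF A] integrable_const_bound[of _ 1]) (auto simp: indicator_def)
      moreover have "0 \<le> (\<integral>\<omega>. indicator A (X \<omega>) * indicator B (Y \<omega>) \<partial>M :: real)"
        by (intro Bochner_Integration.integral_nonneg) auto
      ultimately show ?thesis using True unfolding P_def[symmetric] by simp
    next
      case False
      then have P: "P > 0" using P0 by simp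
      have "(\<integral>\<omega>. (indicator A (X \<omega>) / P) * indicator B (Y \<omega>) \<partial>M) = (\<integral>\<omega>. indicator B (Y \<omega>) \<partial>M)"
      proof (rule weighted_Levy_uniqueness[OF M Y _ _ _ _ _ B, where B = "1 / P"])
        show "indicator A (X \<omega>) / P \<le> 1 / P" "0 \<le> indicator A (X \<omega>) / P" for \<omega>
          using P by (auto simp: indicator_def)
        show "(\<integral>\<omega>. indicator A (X \<omega>) / P \<partial>M) = 1" using P by (simp add: P_def)
        show "(\<integral>\<omega>. (indicator A (X \<omega>) / P) *\<^sub>R iexp (b * Y \<omega>) \<partial>M) = (\<integral>\<omega>. iexp (b * Y \<omega>) \<partial>M)" for b
        proof -
          have ic: "integrable M (\<lambda>\<omega>. complex_of_real (cos (b * Y \<omega>) * indicator A (X \<omega>)))"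
            "integrable M (\<lambda>\<omega>. complex_of_real (sin (b * Y \<omega>) * indicator A (X \<omega>)))"
            by (rule integrable_const_bound[of _ 1]; simp add: norm_mult abs_mult mult_le_one indicator_def)+
          have "(\<integral>\<omega>. (indicator A (X \<omega>) / P) *\<^sub>R iexp (b * Y \<omega>) \<partial>M)
              = (\<integral>\<omega>. (complex_of_real (cos (b * Y \<omega>) * indicator A (X \<omega>))
                  + \<i> * complex_of_real (sin (b * Y \<omega>) * indicator A (X \<omega>))) / of_real P \<partial>M)"
            by (intro Bochner_Integration.integral_cong)
              (auto simp: complex_eq_iff Re_exp Im_exp indicator_def)
          also have "\<dots> = ((\<integral>\<omega>. complex_of_real (cos (b * Y \<omega>) * indicator A (X \<omega>)) \<partial>M)
                  + \<i> * (\<integral>\<omega>. complex_of_real (sin (b * Y \<omega>) * indicator A (X \<omega>)) \<partial>M)) / of_real P"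
            using ic by (simp only: integral_divide_zero Bochner_Integration.integral_add integrable_mult_right integral_mult_right_zero)
          also have "\<dots> = complex_of_real (\<psi> b)"
            unfolding integral_complex_of_real Acos[OF A] Asin[OF A] P_def[symmetric] using P by simp
          finally show ?thesis unfolding cY .
        qed
      qed measurable
      moreover have "(\<integral>\<omega>. (indicator A (X \<omega>) / P) * indicator B (Y \<omega>) \<partial>M)
          = (\<integral>\<omega>. indicator A (X \<omega>) * indicator B (Y \<omega>) \<partial>M) / P"
        by (simp add: integral_divide_zero[symmetric] del: integral_divide_zero)
      ultimately show ?thesis unfolding P_def[symmetric] using P by (simp add: field_simps)
    qed
  qed
  interpret DX: prob_space "distr M borel X" by (rule prob_space_distr[OF X])
  interpret DY: prob_space "distr M borel Y" by (rule prob_space_distr[OF Y])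
  show ?thesis
  proof (rule pair_measure_eqI[symmetric])
    show "sigma_finite_measure (distr M borel X)" "sigma_finite_measure (distr M borel Y)" by unfold_locales
    show "sets (distr M borel X \<Otimes>\<^sub>M distr M borel Y) = sets (distr M (borel \<Otimes>\<^sub>M borel) (\<lambda>\<omega>. (X \<omega>, Y \<omega>)))"
      by (simp cong: sets_pair_measure_cong)
    fix A B assume "A \<in> sets (distr M borel X)" "B \<in> sets (distr M borel Y)"
    then have A[measurable]: "A \<in> sets borel" and B[measurable]: "B \<in> sets borel" by auto
    have e: "emeasure M (S \<inter> space M) = ennreal (\<integral>\<omega>. indicator S \<omega> \<partial>M)" if "S \<inter> space M \<in> sets M" for S
      using that by (simp add: emeasure_eq_measure Int_commute)
    have 1: "emeasure (distr M borel X) A = ennreal (\<integral>\<omega>. indicator A (X \<omega>) \<partial>M)"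
      using e[of "X -` A"] by (simp add: emeasure_distr indicator_def vimage_def)
    have 2: "emeasure (distr M borel Y) B = ennreal (\<integral>\<omega>. indicator B (Y \<omega>) \<partial>M)"
      using e[of "Y -` B"] by (simp add: emeasure_distr indicator_def vimage_def)
    have "emeasure (distr M (borel \<Otimes>\<^sub>M borel) (\<lambda>\<omega>. (X \<omega>, Y \<omega>))) (A \<times> B)
        = emeasure M ((\<lambda>\<omega>. (X \<omega>, Y \<omega>)) -` (A \<times> B) \<inter> space M)"
      by (rule emeasure_distr) auto
    also have "\<dots> = ennreal (\<integral>\<omega>. indicator ((\<lambda>\<omega>. (X \<omega>, Y \<omega>)) -` (A \<times> B)) \<omega> \<partial>M)"
      by (rule e) measurable
    also have "(\<lambda>\<omega>. indicator ((\<lambda>\<omega>. (X \<omega>, Y \<omega>)) -` (A \<times> B)) \<omega>) = (\<lambda>\<omega>. indicator A (X \<omega>) * indicator B (Y \<omega>) :: real)"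
      by (auto simp: indicator_def fun_eq_iff)
    also have "ennreal (\<integral>\<omega>. indicator A (X \<omega>) * indicator B (Y \<omega>) \<partial>M)
        = emeasure (distr M borel X) A * emeasure (distr M borel Y) B"
      unfolding AB[OF A B] 1 2 by (simp add: ennreal_mult')
    finally show "emeasure (distr M borel X) A * emeasure (distr M borel Y) B
      = emeasure (distr M (borel \<Otimes>\<^sub>M borel) (\<lambda>\<omega>. (X \<omega>, Y \<omega>))) (A \<times> B)" ..
  qed
qed

section \<open>Laws and moments of Gaussian vectors\<close>

lemma gaussian_real_distr:
  assumes M: "prob_space M" and g: "gaussian_real M X \<mu> \<sigma>"
  shows "\<sigma> \<ge> 0" "distr M borel X = distr std_normal_distribution borel (\<lambda>x. \<mu> + \<sigma> * x)"
proof -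
  interpret prob_space M by fact
  have X[measurable]: "X \<in> borel_measurable M" using g by (simp add: gaussian_real_def)
  show "\<sigma> \<ge> 0" using g by (auto simp: gaussian_real_def split: if_splits)
  show "distr M borel X = distr std_normal_distribution borel (\<lambda>x. \<mu> + \<sigma> * x)"
  proof (cases "\<sigma> = 0")
    case True
    then have "AE \<omega> in M. X \<omega> = \<mu>" using g by (simp add: gaussian_real_def)
    then have "distr M borel X = distr M borel (\<lambda>_. \<mu>)" by (intro distr_cong_AE) auto
    also have "\<dots> = return borel \<mu>" by (simp add: distr_const)
    also have "\<dots> = distr std_normal_distribution borel (\<lambda>_. \<mu>)" by (simp add: std_normal.distr_const)
    finally show ?thesis using True by simp
  next
    case False
    then have \<sigma>: "\<sigma> > 0" and "distributed M lborel X (normal_density \<mu> \<sigma>)"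
      using g by (auto simp: gaussian_real_def)
    then have "distributed M lborel (\<lambda>\<omega>. (X \<omega> - \<mu>) / \<sigma>) std_normal_density"
      using normal_standard_normal_convert[OF \<sigma>] by simp
    then have "distr M lborel (\<lambda>\<omega>. (X \<omega> - \<mu>) / \<sigma>) = std_normal_distribution"
      by (simp add: distributed_def)
    then have "distr std_normal_distribution borel (\<lambda>x. \<mu> + \<sigma> * x)
        = distr (distr M lborel (\<lambda>\<omega>. (X \<omega> - \<mu>) / \<sigma>)) borel (\<lambda>x. \<mu> + \<sigma> * x)" by simp
    also have "\<dots> = distr M borel X"
      by (subst distr_distr) (use \<sigma> in \<open>auto simp: comp_def\<close>)
    finally show ?thesis ..
  qed
qed


lemma square_affine: "(a + b * x)\<^sup>2 = a\<^sup>2 + 2 * a * b * x + b\<^sup>2 * x\<^sup>2" for a b x :: real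
  by (simp add: power2_eq_square algebra_simps)

lemma affine_normal_moments:
  fixes \<mu> \<sigma> :: real
  assumes M: "prob_space M" and U: "distr M borel U = distr std_normal_distribution borel (\<lambda>x. \<mu> + \<sigma> * x)"
    and mU: "U \<in> borel_measurable M"
  shows "integrable M U" "integrable M (\<lambda>\<omega>. (U \<omega>)\<^sup>2)" "(\<integral>\<omega>. U \<omega> \<partial>M) = \<mu>"
    "(\<integral>\<omega>. (U \<omega>)\<^sup>2 \<partial>M) = \<mu>\<^sup>2 + \<sigma>\<^sup>2"
proof -
  have m: "integrable std_normal_distribution (\<lambda>x. x)" "integrable std_normal_distribution (\<lambda>x. x\<^sup>2)"
    using integrable_std_normal_distribution_moment[of 1] integrable_std_normal_distribution_moment[of 2] by auto
  have sq: "(\<mu> + \<sigma> * x)\<^sup>2 = \<mu>\<^sup>2 + 2 * \<mu> * \<sigma> * x + \<sigma>\<^sup>2 * x\<^sup>2" for x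
    by (rule square_affine)
  have a: "(\<lambda>x. \<mu> + \<sigma> * x) \<in> borel_measurable std_normal_distribution" by simp
  have i: "integrable std_normal_distribution (\<lambda>x. \<mu> + \<sigma> * x)" using m(1) by simp
  have i2: "integrable std_normal_distribution (\<lambda>x. (\<mu> + \<sigma> * x)\<^sup>2)" unfolding sq using m by simp
  have id: "(\<lambda>x::real. x) \<in> borel_measurable borel" "(\<lambda>x::real. x\<^sup>2) \<in> borel_measurable borel" by simp_all
  show "integrable M U"
    using i unfolding integrable_distr_eq[OF a id(1), symmetric] integrable_distr_eq[OF mU id(1), symmetric] U .
  show "integrable M (\<lambda>\<omega>. (U \<omega>)\<^sup>2)"
    using i2 unfolding integrable_distr_eq[OF a id(2), symmetric] integrable_distr_eq[OF mU id(2), symmetric] U .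
  have "(\<integral>\<omega>. U \<omega> \<partial>M) = (\<integral>x. \<mu> + \<sigma> * x \<partial>std_normal_distribution)"
    unfolding integral_distr[OF mU id(1), symmetric] integral_distr[OF a id(1), symmetric] U ..
  also have "\<dots> = \<mu>" using m(1) std_moments(1) std_normal.prob_space by simp
  finally show "(\<integral>\<omega>. U \<omega> \<partial>M) = \<mu>" .
  have "(\<integral>\<omega>. (U \<omega>)\<^sup>2 \<partial>M) = (\<integral>x. (\<mu> + \<sigma> * x)\<^sup>2 \<partial>std_normal_distribution)"
    unfolding integral_distr[OF mU id(2), symmetric] integral_distr[OF a id(2), symmetric] U ..
  also have "\<dots> = \<mu>\<^sup>2 + \<sigma>\<^sup>2" unfolding sq using m std_moments(1,2) std_normal.prob_space by simp
  finally show "(\<integral>\<omega>. (U \<omega>)\<^sup>2 \<partial>M) = \<mu>\<^sup>2 + \<sigma>\<^sup>2" .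
qed

text \<open>Subtracting from the imaginary part its regression on the real part leaves a variable
  independent of the real part; \<alpha> and \<beta> are the columns of the resulting Cholesky
  factor. If \<open>va = 0\<close> then also \<open>e = 0\<close>, and division by 0 yields the
  required value 0.\<close>

lemma centered_complex_gaussian_expectation:
  fixes F :: "complex \<Rightarrow> real"
  assumes G: "centered_complex_gaussian M Z va vb e" and F: "linear_growth F"
  defines "\<alpha> \<equiv> Complex (sqrt va) (e / sqrt va)" and "\<beta> \<equiv> Complex 0 (sqrt (vb - e\<^sup>2 / va))"
  shows "va \<ge> 0" "vb \<ge> 0" "va = 0 \<Longrightarrow> e = 0" "e\<^sup>2 / va \<le> vb" "(\<integral>\<omega>. F (Z \<omega>) \<partial>M) = gauss2 \<alpha> \<beta> 1 F 0"
proof -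
  have gv: "gaussian_vector M Z" using G by (simp add: centered_complex_gaussian_def)
  then interpret prob_space M by (simp add: gaussian_vector_def)
  have M: "prob_space M" by unfold_locales
  have Z[measurable]: "Z \<in> borel_measurable M" using gv by (simp add: gaussian_vector_def)
  note [measurable] = linear_growth_measurable[OF F]
  define X where "X \<omega> = Re (Z \<omega>)" for \<omega>
  define Y where "Y \<omega> = Im (Z \<omega>)" for \<omega>
  have [measurable]: "X \<in> borel_measurable M" "Y \<in> borel_measurable M" unfolding X_def Y_def by measurable
  have inner: "Z \<omega> \<bullet> Complex a b = a * X \<omega> + b * Y \<omega>" for a b \<omega>
    by (simp add: inner_complex_def X_def Y_def mult.commute)
  have law: "\<exists>\<mu> \<sigma>. distr M borel (\<lambda>\<omega>. a * X \<omega> + b * Y \<omega>) = distr std_normal_distribution borel (\<lambda>x. \<mu> + \<sigma> * x)" for a b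
  proof -
    obtain \<mu> \<sigma> where "gaussian_real M (\<lambda>\<omega>. Z \<omega> \<bullet> Complex a b) \<mu> \<sigma>"
      using gv unfolding gaussian_vector_def by blast
    then show ?thesis using gaussian_real_distr(2)[OF M] unfolding inner by blast
  qed
  note moments = affine_normal_moments[OF M]
  have iX: "integrable M X" "integrable M (\<lambda>\<omega>. (X \<omega>)\<^sup>2)"
    using law[of 1 0] moments[of X] by auto
  have iY: "integrable M Y" "integrable M (\<lambda>\<omega>. (Y \<omega>)\<^sup>2)"
    using law[of 0 1] moments[of Y] by auto
  have iXY: "integrable M (\<lambda>\<omega>. X \<omega> * Y \<omega>)"
  proof (rule Bochner_Integration.integrable_bound)
    show "integrable M (\<lambda>\<omega>. (X \<omega>)\<^sup>2 + (Y \<omega>)\<^sup>2)" using iX iY by simp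
    have "\<bar>x * y\<bar> \<le> x\<^sup>2 + y\<^sup>2" for x y :: real
    proof -
      have "2 * \<bar>x * y\<bar> \<le> x\<^sup>2 + y\<^sup>2" using zero_le_power2[of "\<bar>x\<bar> - \<bar>y\<bar>"] by (simp add: power2_diff abs_mult)
      then show ?thesis by linarith
    qed
    then show "AE \<omega> in M. norm (X \<omega> * Y \<omega>) \<le> norm ((X \<omega>)\<^sup>2 + (Y \<omega>)\<^sup>2)" by auto
  qed measurable
  have E0: "expectation X = 0" "expectation Y = 0"
    and E2: "expectation (\<lambda>\<omega>. (X \<omega>)\<^sup>2) = va" "expectation (\<lambda>\<omega>. (Y \<omega>)\<^sup>2) = vb" "expectation (\<lambda>\<omega>. X \<omega> * Y \<omega>) = e"
  proof -
    have 0: "expectation (\<lambda>\<omega>. Re (Z \<omega>)) = 0" "expectation (\<lambda>\<omega>. Im (Z \<omega>)) = 0"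
      using G by (simp_all add: centered_complex_gaussian_def)
    then show "expectation X = 0" "expectation Y = 0" unfolding X_def Y_def by simp_all
    have "covariance M (\<lambda>\<omega>. Re (Z \<omega>)) (\<lambda>\<omega>. Re (Z \<omega>)) = va" "covariance M (\<lambda>\<omega>. Im (Z \<omega>)) (\<lambda>\<omega>. Im (Z \<omega>)) = vb"
      "covariance M (\<lambda>\<omega>. Re (Z \<omega>)) (\<lambda>\<omega>. Im (Z \<omega>)) = e"
      using G by (simp_all add: centered_complex_gaussian_def)
    then show "expectation (\<lambda>\<omega>. (X \<omega>)\<^sup>2) = va" "expectation (\<lambda>\<omega>. (Y \<omega>)\<^sup>2) = vb" "expectation (\<lambda>\<omega>. X \<omega> * Y \<omega>) = e"
      unfolding covariance_def 0 X_def Y_def by (simp_all add: power2_eq_square)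
  qed
  define q where "q a b = a\<^sup>2 * va + 2 * a * b * e + b\<^sup>2 * vb" for a b
  have q: "q a b \<ge> 0" "distr M borel (\<lambda>\<omega>. a * X \<omega> + b * Y \<omega>) = distr std_normal_distribution borel (\<lambda>x. sqrt (q a b) * x)" for a b
  proof -
    obtain \<mu> \<sigma> where l: "distr M borel (\<lambda>\<omega>. a * X \<omega> + b * Y \<omega>) = distr std_normal_distribution borel (\<lambda>x. \<mu> + \<sigma> * x)"
      using law by blast
    have \<mu>: "\<mu> = 0" using moments(3)[OF l] iX iY E0 by simp
    have sq: "(a * X \<omega> + b * Y \<omega>)\<^sup>2 = a\<^sup>2 * (X \<omega>)\<^sup>2 + 2 * a * b * (X \<omega> * Y \<omega>) + b\<^sup>2 * (Y \<omega>)\<^sup>2" for \<omega>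
      by (simp add: power2_eq_square algebra_simps)
    have \<sigma>: "\<sigma>\<^sup>2 = q a b"
      using moments(4)[OF l] iX iY iXY E2 unfolding sq \<mu> q_def by simp
    then show "q a b \<ge> 0" by (metis zero_le_power2)
    \<comment> \<open>The moments determine only \<open>\<sigma>\<^sup>2\<close>. The law of a sum
      with second coefficient 0 replaces \<sigma> by \<open>sqrt (\<sigma>\<^sup>2)\<close>.\<close>
    have "distr std_normal_distribution borel (\<lambda>x. \<sigma> * x) = distr std_normal_distribution borel (\<lambda>x. sqrt (\<sigma>\<^sup>2 + 0\<^sup>2) * x)"
    proof -
      have "distr (std_normal_distribution \<Otimes>\<^sub>M std_normal_distribution) borel (\<lambda>(x, x'). \<sigma> * x + 0 * x')
          = distr (distr (std_normal_distribution \<Otimes>\<^sub>M std_normal_distribution) std_normal_distribution fst) borel (\<lambda>x. \<sigma> * x)"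
        by (subst distr_distr) (auto simp: comp_def case_prod_unfold)
      then show ?thesis unfolding distr_std_normal_sum std_normal.distr_pair_fst by simp
    qed
    then show "distr M borel (\<lambda>\<omega>. a * X \<omega> + b * Y \<omega>) = distr std_normal_distribution borel (\<lambda>x. sqrt (q a b) * x)"
      unfolding l \<mu> \<sigma>[symmetric] by simp
  qed
  have char: "expectation (\<lambda>\<omega>. iexp (a * X \<omega> + b * Y \<omega>)) = of_real (exp (- (q a b / 2)))" for a b
  proof -
    have "expectation (\<lambda>\<omega>. iexp (a * X \<omega> + b * Y \<omega>)) = (\<integral>x. iexp x \<partial>distr M borel (\<lambda>\<omega>. a * X \<omega> + b * Y \<omega>))"
      by (subst integral_distr) auto
    also have "\<dots> = (\<integral>x. iexp (sqrt (q a b) * x) \<partial>std_normal_distribution)"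
      unfolding q(2) by (subst integral_distr) auto
    also have "\<dots> = of_real (exp (- (sqrt (q a b))\<^sup>2 / 2))"
      using fun_cong[OF char_std_normal_distribution, of "sqrt (q a b)"] by (simp add: char_def)
    finally show ?thesis using q(1)[of a b] by simp
  qed
  show va: "va \<ge> 0" using q(1)[of 1 0] by (simp add: q_def)
  show "vb \<ge> 0" using q(1)[of 0 1] by (simp add: q_def)
  show e0: "e = 0" if "va = 0"
  proof (rule ccontr)
    assume "e \<noteq> 0"
    \<comment> \<open>With \<open>va = 0\<close> the value \<open>q a 1\<close> is affine in
      \<open>a\<close> with slope \<open>2 * e\<close>, so this \<open>a\<close> makes a variance
      negative.\<close>
    have "q (- (vb + 1) / (2 * e)) 1 = - 1" using that \<open>e \<noteq> 0\<close> by (simp add: q_def field_simps)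
    then show False using q(1)[of "- (vb + 1) / (2 * e)" 1] by simp
  qed
  define c where "c = e / va"
  define s2 where "s2 = vb - e\<^sup>2 / va"
  \<comment> \<open>Completing the square diagonalizes the form: \<open>c\<close> is the regression
    coefficient and \<open>s2\<close> the residual variance.\<close>
  have qc: "q (a - b * c) b = a\<^sup>2 * va + b\<^sup>2 * s2" for a b
  proof (cases "va = 0")
    case True
    then show ?thesis using e0 by (simp add: q_def c_def s2_def)
  next
    case False
    then have "va * c = e" "e\<^sup>2 / va = c * e" by (simp_all add: c_def power2_eq_square)
    then have "q (a - b * c) b = a\<^sup>2 * va - 2 * a * b * (va * c) + b\<^sup>2 * c * (va * c) + 2 * a * b * e - 2 * b\<^sup>2 * c * e + b\<^sup>2 * vb"
      by (simp add: q_def power2_eq_square algebra_simps)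
    also have "\<dots> = a\<^sup>2 * va + b\<^sup>2 * s2" unfolding s2_def \<open>va * c = e\<close> \<open>e\<^sup>2 / va = c * e\<close> by (simp add: power2_eq_square algebra_simps)
    finally show ?thesis .
  qed
  have s2: "s2 \<ge> 0" using q(1)[of "0 - 1 * c" 1] unfolding qc by simp
  then show "e\<^sup>2 / va \<le> vb" by (simp add: s2_def)
  define Y' where "Y' \<omega> = Y \<omega> - c * X \<omega>" for \<omega>
  have [measurable]: "Y' \<in> borel_measurable M" unfolding Y'_def by measurable
  have lX: "distr M borel X = distr std_normal_distribution borel (\<lambda>x. sqrt va * x)"
    using q(2)[of 1 0] by (simp add: q_def)
  have lY: "distr M borel Y' = distr std_normal_distribution borel (\<lambda>x. sqrt s2 * x)"
  proof -
    have "(\<lambda>\<omega>. (0 - 1 * c) * X \<omega> + 1 * Y \<omega>) = Y'" by (auto simp: Y'_def)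
    then show ?thesis using q(2)[of "0 - 1 * c" 1] unfolding qc by simp
  qed
  have "distr M (borel \<Otimes>\<^sub>M borel) (\<lambda>\<omega>. (X \<omega>, Y' \<omega>)) = distr M borel X \<Otimes>\<^sub>M distr M borel Y'"
  proof (rule distr_pair_of_char[OF M])
    fix a b
    have "a * X \<omega> + b * Y' \<omega> = (a - b * c) * X \<omega> + b * Y \<omega>" for \<omega> by (simp add: Y'_def algebra_simps)
    then have "expectation (\<lambda>\<omega>. iexp (a * X \<omega> + b * Y' \<omega>)) = of_real (exp (- (q (a - b * c) b / 2)))"
      using char[of "a - b * c" b] by simp
    also have "exp (- (q (a - b * c) b / 2)) = exp (- (a\<^sup>2 * va / 2)) * exp (- (b\<^sup>2 * s2 / 2))"
      unfolding qc by (simp add: add_divide_distrib flip: exp_add)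
    finally show "expectation (\<lambda>\<omega>. iexp (a * X \<omega> + b * Y' \<omega>)) = of_real (exp (- (a\<^sup>2 * va / 2)) * exp (- (b\<^sup>2 * s2 / 2)))" .
  qed measurable
  also have "\<dots> = distr (std_normal_distribution \<Otimes>\<^sub>M std_normal_distribution) (borel \<Otimes>\<^sub>M borel) (\<lambda>(x, y). (sqrt va * x, sqrt s2 * y))"
    unfolding lX lY
    by (rule pair_measure_distr) (auto intro!: prob_space_imp_sigma_finite std_normal.prob_space_distr)
  finally have joint: "distr M (borel \<Otimes>\<^sub>M borel) (\<lambda>\<omega>. (X \<omega>, Y' \<omega>))
      = distr (std_normal_distribution \<Otimes>\<^sub>M std_normal_distribution) (borel \<Otimes>\<^sub>M borel) (\<lambda>(x, y). (sqrt va * x, sqrt s2 * y))" .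
  define H where "H = (\<lambda>(x, y). F (Complex x (c * x + y)))"
  have [measurable]: "H \<in> borel_measurable (borel \<Otimes>\<^sub>M borel)"
    unfolding H_def Complex_eq by measurable
  have "(\<integral>\<omega>. F (Z \<omega>) \<partial>M) = (\<integral>\<omega>. H (X \<omega>, Y' \<omega>) \<partial>M)"
    by (simp add: H_def Y'_def X_def Y_def)
  also have "\<dots> = (\<integral>z. H z \<partial>distr M (borel \<Otimes>\<^sub>M borel) (\<lambda>\<omega>. (X \<omega>, Y' \<omega>)))"
    by (subst integral_distr) auto
  also have "\<dots> = (\<integral>z. H (case z of (x, y) \<Rightarrow> (sqrt va * x, sqrt s2 * y)) \<partial>(std_normal_distribution \<Otimes>\<^sub>M std_normal_distribution))"
    unfolding joint by (subst integral_distr) auto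
  also have "\<dots> = (\<integral>z. (case z of (x, y) \<Rightarrow> F (0 + x *\<^sub>R \<alpha> + y *\<^sub>R \<beta>)) \<partial>(std_normal_distribution \<Otimes>\<^sub>M std_normal_distribution))"
  proof -
    have "c * sqrt va = e / sqrt va"
      using va by (cases "va = 0") (simp_all add: c_def real_div_sqrt field_simps)
    then have cx: "c * (sqrt va * x) = x * (e / sqrt va)" for x by (metis mult.assoc mult.commute)
    have "Complex (sqrt va * x) (c * (sqrt va * x) + sqrt s2 * y) = 0 + x *\<^sub>R \<alpha> + y *\<^sub>R \<beta>" for x y
      unfolding cx \<alpha>_def \<beta>_def s2_def by (simp add: complex_eq_iff)
    then show ?thesis by (simp add: H_def case_prod_unfold)
  qed
  also have "\<dots> = (\<integral>x. (\<integral>y. F (0 + x *\<^sub>R \<alpha> + y *\<^sub>R \<beta>) \<partial>std_normal_distribution) \<partial>std_normal_distribution)"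
    by (rule std_normal_pair.integral_fst[OF integrable_pair_linear_growth[OF F], symmetric])
  also have "\<dots> = gauss2 \<alpha> \<beta> 1 F 0" by (simp add: gauss2_def gauss_avg_def)
  finally show "(\<integral>\<omega>. F (Z \<omega>) \<partial>M) = gauss2 \<alpha> \<beta> 1 F 0" .
qed

section \<open>Test functions\<close>

lemma C2_fun_scale:
  assumes "C2_fun b\<^sub>1 b\<^sub>2 W W\<^sub>1 W\<^sub>2" and c: "c \<ge> 0"
  shows "C2_fun (c * b\<^sub>1) (c\<^sup>2 * b\<^sub>2) (\<lambda>y. W (c *\<^sub>R y)) (\<lambda>y h. c * W\<^sub>1 (c *\<^sub>R y) h)
    (\<lambda>y k h. c\<^sup>2 * W\<^sub>2 (c *\<^sub>R y) k h)"
proof -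
  interpret C2_fun b\<^sub>1 b\<^sub>2 W W\<^sub>1 W\<^sub>2 by fact
  note [measurable] = meas
  show ?thesis
  proof (rule C2_fun.intro)
    fix y h k :: 'a and r :: real
    have e: "c *\<^sub>R (y + r *\<^sub>R h) = c *\<^sub>R y + r *\<^sub>R (c *\<^sub>R h)" for r h by (simp add: algebra_simps)
    show "((\<lambda>r. W (c *\<^sub>R (y + r *\<^sub>R h))) has_real_derivative c * W\<^sub>1 (c *\<^sub>R (y + r *\<^sub>R h)) h) (at r)"
      using deriv1[of "c *\<^sub>R y" "c *\<^sub>R h" r] unfolding e linear_scale[OF lin1] by simp
    have "((\<lambda>r. c * W\<^sub>1 (c *\<^sub>R (y + r *\<^sub>R k)) h) has_real_derivative c * (c * W\<^sub>2 (c *\<^sub>R (y + r *\<^sub>R k)) k h)) (at r)"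
      using DERIV_cmult[OF deriv2[of "c *\<^sub>R y" "c *\<^sub>R k" h r], of c] unfolding e linear_scale[OF lin2(2)] by simp
    then show "((\<lambda>r. c * W\<^sub>1 (c *\<^sub>R (y + r *\<^sub>R k)) h) has_real_derivative c\<^sup>2 * W\<^sub>2 (c *\<^sub>R (y + r *\<^sub>R k)) k h) (at r)"
      by (simp add: power2_eq_square mult.assoc)
    show "\<bar>c * W\<^sub>1 (c *\<^sub>R y) h\<bar> \<le> c * b\<^sub>1 * norm h"
      using mult_left_mono[OF bound1[of "c *\<^sub>R y" h] c] c by (simp add: abs_mult mult.assoc)
    show "\<bar>c\<^sup>2 * W\<^sub>2 (c *\<^sub>R y) k h\<bar> \<le> c\<^sup>2 * b\<^sub>2 * norm k * norm h"
      using mult_left_mono[OF bound2[of "c *\<^sub>R y" k h], of "c\<^sup>2"] by (simp add: abs_mult mult.assoc)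
    show "linear (\<lambda>h. c * W\<^sub>1 (c *\<^sub>R y) h)"
      using linear_compose_scale_right[OF lin1[of "c *\<^sub>R y"], of c] by simp
    show "linear (\<lambda>h. c\<^sup>2 * W\<^sub>2 (c *\<^sub>R y) k h)"
      using linear_compose_scale_right[OF lin2(1)[of "c *\<^sub>R y" k], of "c\<^sup>2"] by simp
    show "linear (\<lambda>k. c\<^sup>2 * W\<^sub>2 (c *\<^sub>R y) k h)"
      using linear_compose_scale_right[OF lin2(2)[of "c *\<^sub>R y" h], of "c\<^sup>2"] by simp
  qed measurable
qed

lemma deriv_bound_le_1D:
  assumes "deriv_bound k g \<le> 1" "bs \<in> lists Basis" "length bs = k"
  shows "\<bar>iter_partial_deriv bs g u\<bar> \<le> 1"
proof -
  have "ennreal \<bar>iter_partial_deriv bs g u\<bar> \<le> deriv_bound k g"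
    unfolding deriv_bound_def using assms(2,3)
    by (intro SUP_upper2[of u] SUP_upper2[of bs]) auto
  then show ?thesis using assms(1) by (metis ennreal_le_1 order.trans)
qed

text \<open>The test class bounds partial derivatives in the coordinates. A derivative in a general
  direction combines two of them, so each order of differentiation loses a factor 2; this gives the
  constants 2 and 4.\<close>

lemma C2_fun_weak_wasserstein_test:
  fixes g :: "complex \<Rightarrow> real"
  assumes "g \<in> weak_wasserstein_tests"
  shows "\<exists>g\<^sub>1 g\<^sub>2. C2_fun 2 4 g g\<^sub>1 g\<^sub>2"
proof -
  have sm: "smooth g" and b1: "deriv_bound 1 g \<le> 1" and b2: "deriv_bound 2 g \<le> 1"
    using assms by (auto simp: weak_wasserstein_tests_def)
  have B: "(1::complex) \<in> Basis" "\<i> \<in> Basis" by (auto simp: Basis_complex_def)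
  define D where "D c = partial_deriv c g" for c
  define DD where "DD c d = partial_deriv c (partial_deriv d g)" for c d
  have d0: "g differentiable (at u)" for u
    using sm[unfolded smooth_def, rule_format, of "[]"] by (simp add: iter_partial_deriv_def)
  have d1: "D c differentiable (at u)" if "c \<in> Basis" for c u
    using sm[unfolded smooth_def, rule_format, of "[c]"] that by (simp add: iter_partial_deriv_def D_def)
  have d2: "DD c d differentiable (at u)" if "c \<in> Basis" "d \<in> Basis" for c d u
    using sm[unfolded smooth_def, rule_format, of "[c, d]"] that by (simp add: iter_partial_deriv_def DD_def)
  have bd1: "\<bar>D c u\<bar> \<le> 1" if "c \<in> Basis" for c u
    using deriv_bound_le_1D[OF b1, of "[c]" u] that by (simp add: iter_partial_deriv_def D_def)
  have bd2: "\<bar>DD c d u\<bar> \<le> 1" if "c \<in> Basis" "d \<in> Basis" for c d u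
    using deriv_bound_le_1D[OF b2, of "[c, d]" u] that by (simp add: iter_partial_deriv_def DD_def)
  have meas: "F \<in> borel_measurable borel" if "\<And>u. F differentiable (at u)" for F :: "complex \<Rightarrow> real"
    using that by (intro borel_measurable_continuous_onI differentiable_imp_continuous_on)
      (auto simp: differentiable_on_def intro: differentiable_at_withinI)
  have expand: "frechet_derivative F (at u) h = Re h * partial_deriv 1 F u + Im h * partial_deriv \<i> F u"
    if "F differentiable (at u)" for F :: "complex \<Rightarrow> real" and u h
  proof -
    have l: "linear (frechet_derivative F (at u))" by (rule linear_frechet_derivative[OF that])
    have "h = Re h *\<^sub>R 1 + Im h *\<^sub>R \<i>" by (simp add: complex_eq_iff)
    then have "frechet_derivative F (at u) h = frechet_derivative F (at u) (Re h *\<^sub>R 1 + Im h *\<^sub>R \<i>)" by simp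
    also have "\<dots> = Re h * partial_deriv 1 F u + Im h * partial_deriv \<i> F u"
      unfolding linear_add[OF l] linear_scale[OF l] partial_deriv_def by simp
    finally show ?thesis .
  qed
  have along: "((\<lambda>r. F (y + r *\<^sub>R h)) has_real_derivative
      Re h * partial_deriv 1 F (y + r *\<^sub>R h) + Im h * partial_deriv \<i> F (y + r *\<^sub>R h)) (at r)"
    if F: "\<And>u. F differentiable (at u)" for F :: "complex \<Rightarrow> real" and y h r
  proof -
    have "((\<lambda>r. y + r *\<^sub>R h) has_derivative (\<lambda>t. t *\<^sub>R h)) (at r)"
      by (auto intro!: derivative_eq_intros)
    moreover have "(F has_derivative frechet_derivative F (at (y + r *\<^sub>R h))) (at (y + r *\<^sub>R h))"
      using F frechet_derivative_works by blast
    ultimately have "((\<lambda>r. F (y + r *\<^sub>R h)) has_derivative (\<lambda>t. frechet_derivative F (at (y + r *\<^sub>R h)) (t *\<^sub>R h))) (at r)"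
      using has_derivative_compose by blast
    moreover have "(\<lambda>t. frechet_derivative F (at (y + r *\<^sub>R h)) (t *\<^sub>R h))
        = (*) (Re h * partial_deriv 1 F (y + r *\<^sub>R h) + Im h * partial_deriv \<i> F (y + r *\<^sub>R h))"
      by (auto simp: expand[OF F] algebra_simps)
    ultimately show ?thesis by (simp add: has_field_derivative_def)
  qed
  have lin: "linear (\<lambda>h. Re h * p + Im h * q)" for p q :: real
    by (rule linearI) (auto simp: algebra_simps)
  have two: "\<bar>Re h * p + Im h * q\<bar> \<le> 2 * K * norm h" if "\<bar>p\<bar> \<le> K" "\<bar>q\<bar> \<le> K" for h :: complex and p q K
  proof -
    have "\<bar>Re h * p\<bar> \<le> norm h * K" "\<bar>Im h * q\<bar> \<le> norm h * K"
      unfolding abs_mult using that abs_Re_le_cmod[of h] abs_Im_le_cmod[of h] by (intro mult_mono; simp)+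
    moreover have "2 * K * norm h = norm h * K + norm h * K" by simp
    ultimately show ?thesis by linarith
  qed
  define g\<^sub>1 where "g\<^sub>1 y h = Re h * D 1 y + Im h * D \<i> y" for y h
  define g\<^sub>2 where "g\<^sub>2 y k h = Re h * (Re k * DD 1 1 y + Im k * DD \<i> 1 y) + Im h * (Re k * DD 1 \<i> y + Im k * DD \<i> \<i> y)" for y k h
  have "C2_fun 2 4 g g\<^sub>1 g\<^sub>2"
  proof (rule C2_fun.intro)
    fix y h k :: complex and r :: real
    show "((\<lambda>r. g (y + r *\<^sub>R h)) has_real_derivative g\<^sub>1 (y + r *\<^sub>R h) h) (at r)"
      using along[OF d0] by (simp add: g\<^sub>1_def D_def)
    show "((\<lambda>r. g\<^sub>1 (y + r *\<^sub>R k) h) has_real_derivative g\<^sub>2 (y + r *\<^sub>R k) k h) (at r)"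
      unfolding g\<^sub>1_def g\<^sub>2_def DD_def
      by (intro DERIV_add DERIV_cmult) (use along[OF d1[OF B(1)]] along[OF d1[OF B(2)]] in \<open>simp_all add: D_def\<close>)
    show "g \<in> borel_measurable borel" by (rule meas[OF d0])
    have [measurable]: "D 1 \<in> borel_measurable borel" "D \<i> \<in> borel_measurable borel"
      by (rule meas, rule d1, rule B)+
    show "(\<lambda>y. g\<^sub>1 y h) \<in> borel_measurable borel" unfolding g\<^sub>1_def by measurable
    have [measurable]: "DD 1 1 \<in> borel_measurable borel" "DD 1 \<i> \<in> borel_measurable borel"
      "DD \<i> 1 \<in> borel_measurable borel" "DD \<i> \<i> \<in> borel_measurable borel"
      by (rule meas, rule d2; rule B)+
    show "(\<lambda>y. g\<^sub>2 y k h) \<in> borel_measurable borel" unfolding g\<^sub>2_def by measurable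
    show "\<bar>g\<^sub>1 y h\<bar> \<le> 2 * norm h" unfolding g\<^sub>1_def using two[of "D 1 y" 1 "D \<i> y" h] bd1 B by simp
    have "\<bar>g\<^sub>2 y k h\<bar> \<le> 2 * (2 * 1 * norm k) * norm h"
      unfolding g\<^sub>2_def by (intro two bd2 B)
    then show "\<bar>g\<^sub>2 y k h\<bar> \<le> 4 * norm k * norm h" by simp
    show "linear (g\<^sub>1 y)" "linear (g\<^sub>2 y k)" unfolding g\<^sub>1_def g\<^sub>2_def by (rule lin)+
    show "linear (\<lambda>k. g\<^sub>2 y k h)" unfolding g\<^sub>2_def by (rule linearI) (auto simp: algebra_simps)
  qed
  then show ?thesis by blast
qed

text \<open>Both averages are realized with the same normal variable, so the Lipschitz constant
  controls their difference. Through \<open>gauss2_scale_lipschitz\<close> this exchanges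
  \<open>time n\<close> for \<open>ln (real n)\<close>.\<close>

lemma gauss_avg_scale_lipschitz:
  assumes "C2_fun b\<^sub>1 b\<^sub>2 W W\<^sub>1 W\<^sub>2" and b: "b\<^sub>1 \<ge> 0"
  shows "\<bar>gauss_avg (s *\<^sub>R a) W y - gauss_avg (t *\<^sub>R a) W y\<bar> \<le> b\<^sub>1 * norm a * \<bar>s - t\<bar>"
proof -
  interpret C2_fun b\<^sub>1 b\<^sub>2 W W\<^sub>1 W\<^sub>2 by fact
  have i: "integrable std_normal_distribution (\<lambda>x. W (y + x *\<^sub>R u *\<^sub>R a))" for u
    by (rule integrable_linear_growth[OF growth])
  have i1: "integrable std_normal_distribution (\<lambda>x. \<bar>x\<bar>)" using integrable_std_abs_moment[of 1] by simp
  have "\<bar>gauss_avg (s *\<^sub>R a) W y - gauss_avg (t *\<^sub>R a) W y\<bar>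
      = \<bar>\<integral>x. W (y + x *\<^sub>R s *\<^sub>R a) - W (y + x *\<^sub>R t *\<^sub>R a) \<partial>std_normal_distribution\<bar>"
    unfolding gauss_avg_def by (subst Bochner_Integration.integral_diff[OF i i]) simp
  also have "\<dots> \<le> (\<integral>x. \<bar>W (y + x *\<^sub>R s *\<^sub>R a) - W (y + x *\<^sub>R t *\<^sub>R a)\<bar> \<partial>std_normal_distribution)"
    by (rule integral_abs_bound)
  also have "\<dots> \<le> (\<integral>x. b\<^sub>1 * norm a * \<bar>s - t\<bar> * \<bar>x\<bar> \<partial>std_normal_distribution)"
  proof (rule integral_mono)
    fix x :: real
    have "y + x *\<^sub>R s *\<^sub>R a = (y + x *\<^sub>R t *\<^sub>R a) + (x * (s - t)) *\<^sub>R a" by (simp add: algebra_simps)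
    then show "\<bar>W (y + x *\<^sub>R s *\<^sub>R a) - W (y + x *\<^sub>R t *\<^sub>R a)\<bar> \<le> b\<^sub>1 * norm a * \<bar>s - t\<bar> * \<bar>x\<bar>"
      using lipschitz[of "y + x *\<^sub>R t *\<^sub>R a" "(x * (s - t)) *\<^sub>R a"] by (simp add: abs_mult mult_ac add.assoc)
  qed (use i i1 in \<open>auto intro!: integrable_abs Bochner_Integration.integrable_diff\<close>)
  also have "\<dots> = b\<^sub>1 * norm a * \<bar>s - t\<bar> * (\<integral>x. \<bar>x\<bar> \<partial>std_normal_distribution)" by simp
  also have "\<dots> \<le> b\<^sub>1 * norm a * \<bar>s - t\<bar> * 1"
    using std_moments(3) b by (intro mult_left_mono) auto
  finally show ?thesis by simp
qed

lemma gauss2_scale_lipschitz: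
  assumes "C2_fun b\<^sub>1 b\<^sub>2 W W\<^sub>1 W\<^sub>2" and b: "b\<^sub>1 \<ge> 0"
  shows "\<bar>gauss2 \<alpha> \<beta> s W y - gauss2 \<alpha> \<beta> t W y\<bar> \<le> b\<^sub>1 * (norm \<alpha> + norm \<beta>) * \<bar>sqrt s - sqrt t\<bar>"
proof -
  interpret C2_fun b\<^sub>1 b\<^sub>2 W W\<^sub>1 W\<^sub>2 by fact
  define U where "U u = gauss_avg (sqrt u *\<^sub>R \<beta>) W" for u
  have lgU: "linear_growth (U u)" for u unfolding U_def by (rule linear_growth_gauss_avg[OF growth])
  have 1: "\<bar>gauss_avg (sqrt s *\<^sub>R \<alpha>) (U s) y - gauss_avg (sqrt t *\<^sub>R \<alpha>) (U s) y\<bar> \<le> b\<^sub>1 * norm \<alpha> * \<bar>sqrt s - sqrt t\<bar>"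
    unfolding U_def by (rule gauss_avg_scale_lipschitz[OF C2_fun_gauss_avg[OF assms(1)] b])
  have d: "gauss_avg (sqrt t *\<^sub>R \<alpha>) (U s) y - gauss_avg (sqrt t *\<^sub>R \<alpha>) (U t) y = gauss_avg (sqrt t *\<^sub>R \<alpha>) (\<lambda>v. U s v - U t v) y"
    unfolding gauss_avg_def[of "sqrt t *\<^sub>R \<alpha>"]
    by (rule Bochner_Integration.integral_diff[symmetric]; rule integrable_linear_growth[OF lgU])
  have b': "\<bar>U s v - U t v\<bar> \<le> b\<^sub>1 * norm \<beta> * \<bar>sqrt s - sqrt t\<bar>" for v
    unfolding U_def by (rule gauss_avg_scale_lipschitz[OF assms])
  have "(\<lambda>v. U s v - U t v) \<in> borel_measurable borel"
    using linear_growth_measurable[OF lgU[of s]] linear_growth_measurable[OF lgU[of t]] by measurable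
  then have 2: "\<bar>gauss_avg (sqrt t *\<^sub>R \<alpha>) (U s) y - gauss_avg (sqrt t *\<^sub>R \<alpha>) (U t) y\<bar> \<le> b\<^sub>1 * norm \<beta> * \<bar>sqrt s - sqrt t\<bar>"
    unfolding d by (rule gauss_avg_bound[OF linear_growth_bounded b']) (rule b')
  show ?thesis using 1 2 unfolding gauss2_def U_def[symmetric] by (simp add: algebra_simps)
qed

section \<open>Rotation of the circle\<close>

lemma dist_to_int_le: "dist_to_int y \<le> \<bar>y - of_int n\<bar>"
proof -
  have f: "0 \<le> frac y" "frac y < 1" "y = of_int \<lfloor>y\<rfloor> + frac y" using frac_lt_1[of y] by (simp_all add: frac_def)
  show ?thesis
  proof (cases "n \<le> \<lfloor>y\<rfloor>")
    case True
    then have "real_of_int n \<le> of_int \<lfloor>y\<rfloor>" by simp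
    then show ?thesis using f unfolding dist_to_int_def by linarith
  next
    case False
    then have "of_int \<lfloor>y\<rfloor> + 1 \<le> real_of_int n" by linarith
    then show ?thesis using f unfolding dist_to_int_def by linarith
  qed
qed

lemma dist_to_int_attained: "dist_to_int y = \<bar>y - of_int \<lfloor>y\<rfloor>\<bar> \<or> dist_to_int y = \<bar>y - of_int (\<lfloor>y\<rfloor> + 1)\<bar>"
proof -
  have "frac y = y - of_int \<lfloor>y\<rfloor>" "0 \<le> frac y" "frac y < 1" using frac_lt_1[of y] by (simp_all add: frac_def)
  then show ?thesis unfolding dist_to_int_def by (auto simp: min_def)
qed

text \<open>The integer 7 serves as an upper bound of \<open>2 * pi\<close>, here and in the
  Lipschitz bound for \<open>circle_dist\<close>.\<close>

lemma norm_cis_diff_le: "cmod (cis (2 * pi * s) - cis (2 * pi * s')) \<le> 7 * \<bar>s - s'\<bar>"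
proof -
  have "cmod (cis (2 * pi * s) - cis (2 * pi * s')) \<le> \<bar>2 * pi * s - 2 * pi * s'\<bar>"
  proof -
    have "cis (2 * pi * s) - cis (2 * pi * s') = cis (2 * pi * s') * (cis (2 * pi * s - 2 * pi * s') - 1)"
      by (simp add: right_diff_distrib cis_mult)
    then have "cmod (cis (2 * pi * s) - cis (2 * pi * s')) = cmod (iexp (2 * pi * s - 2 * pi * s') - 1)"
      by (simp add: norm_mult cis_conv_exp)
    also have "\<dots> \<le> \<bar>2 * pi * s - 2 * pi * s'\<bar>"
      using iexp_approx1[of "2 * pi * s - 2 * pi * s'" 0] by simp
    finally show ?thesis .
  qed
  also have "\<dots> = 2 * pi * \<bar>s - s'\<bar>" by (simp add: abs_mult right_diff_distrib[symmetric] mult.assoc)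
  also have "\<dots> \<le> 7 * \<bar>s - s'\<bar>" using pi_approx(2) by (intro mult_right_mono) auto
  finally show ?thesis .
qed

text \<open>The chord has length \<open>2 * \<bar>sin (pi * y)\<bar>\<close>, and this sine is at
  least the distance of \<open>y\<close> to the nearest integer.\<close>

lemma norm_cis_minus_1_ge: "dist_to_int y \<le> cmod (cis (2 * pi * y) - 1)"
proof -
  \<comment> \<open>For arguments up to 2 the cubic Taylor bound keeps a third of the linear term,
    and \<open>pi / 3\<close> exceeds 1.\<close>
  have half: "r \<le> sin (pi * r)" if "0 \<le> r" "r \<le> 1 / 2" for r
  proof -
    have "pi * r \<le> 4 * (1 / 2)" using that pi_less_4 by (intro mult_mono) auto
    then have x: "0 \<le> pi * r" "pi * r \<le> 2" using that by auto
    have "\<bar>sin (pi * r) - pi * r\<bar> \<le> inverse (fact 3) * \<bar>pi * r\<bar> ^ 3"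
      using Maclaurin_sin_bound[of "pi * r" 3] by (simp add: sin_coeff_def numeral_3_eq_3)
    also have "\<dots> = (pi * r) * (pi * r)\<^sup>2 / 6" using x by (simp add: fact_numeral power3_eq_cube power2_eq_square)
    also have "\<dots> \<le> (pi * r) * 2\<^sup>2 / 6" using x by (intro divide_right_mono mult_left_mono power_mono) auto
    also have "\<dots> = (pi * r) * (2 / 3)" by simp
    finally have "(pi * r) / 3 \<le> sin (pi * r)" by linarith
    moreover have "r \<le> (pi * r) / 3" using that pi_approx mult_right_mono[of 3 pi r] by simp
    ultimately show ?thesis by linarith
  qed
  have f: "0 \<le> frac y" "frac y < 1" by (auto simp: frac_lt_1)
  have s: "dist_to_int y \<le> sin (pi * frac y)"
  proof (cases "frac y \<le> 1 / 2")
    case True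
    then show ?thesis using half[of "frac y"] f unfolding dist_to_int_def by linarith
  next
    case False
    then have "1 - frac y \<le> sin (pi * (1 - frac y))" using half[of "1 - frac y"] f by linarith
    also have "sin (pi * (1 - frac y)) = sin (pi * frac y)" by (simp add: right_diff_distrib)
    finally show ?thesis unfolding dist_to_int_def by linarith
  qed
  have "cis (2 * pi * y) = cis (2 * pi * frac y)"
  proof -
    have "2 * pi * y = 2 * pi * frac y + 2 * pi * of_int \<lfloor>y\<rfloor>" by (simp add: frac_def algebra_simps)
    then have "cis (2 * pi * y) = cis (2 * pi * frac y) * cis (2 * pi * of_int \<lfloor>y\<rfloor>)" by (metis cis_mult)
    moreover have "cis (2 * pi * of_int \<lfloor>y\<rfloor>) = 1" by (simp add: cis_multiple_2pi)
    ultimately show ?thesis by simp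
  qed
  moreover have "cmod (cis (2 * pi * frac y) - 1) \<ge> 2 * sin (pi * frac y)"
  proof -
    have "cis (2 * pi * frac y) - 1 = cis (pi * frac y) * (cis (pi * frac y) - cis (- (pi * frac y)))"
      by (simp add: right_diff_distrib cis_mult mult_2 algebra_simps)
    also have "cis (pi * frac y) - cis (- (pi * frac y)) = 2 * \<i> * sin (pi * frac y)"
      by (simp add: complex_eq_iff)
    finally have "cmod (cis (2 * pi * frac y) - 1) = \<bar>2 * sin (pi * frac y)\<bar>"
      by (simp add: norm_mult)
    then show ?thesis by linarith
  qed
  moreover have "sin (pi * frac y) \<ge> 0" using s f unfolding dist_to_int_def by (smt (verit) min_def)
  ultimately show ?thesis using s by simp
qed

section \<open>Sums along a rotation by a nearly rational angle\<close>

lemma periodic_of_int: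
  fixes \<psi> :: "real \<Rightarrow> 'a"
  assumes "\<And>s. \<psi> (s + 1) = \<psi> s"
  shows "\<psi> (s + of_int n) = \<psi> s"
proof (induction n rule: int_induct[where k = 0])
  case (step1 i)
  then show ?case using assms[of "s + of_int i"] by (simp add: add_ac)
next
  case (step2 i)
  then show ?case using assms[of "s + of_int (i - 1)"] by (simp add: add_ac)
qed simp

text \<open>Multiplication by \<open>p\<close> permutes the residues modulo \<open>q\<close>, so the
  points visit every grid point once. The starting point survives only as an offset smaller than
  \<open>1 / q\<close>.\<close>

lemma periodic_grid_sum:
  fixes \<psi> :: "real \<Rightarrow> real" and q :: nat and p :: int
  assumes per: "\<And>s. \<psi> (s + 1) = \<psi> s" and q: "q \<ge> 1" and cop: "coprime p (int q)"
  shows "(\<Sum>i<q. \<psi> (s + real i * of_int p / real q)) = (\<Sum>r<q. \<psi> (frac (s * real q) / real q + real r / real q))"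
proof -
  define c where "c = \<lfloor>s * real q\<rfloor>"
  define s1 where "s1 = frac (s * real q) / real q"
  define f where "f i = nat ((c + int i * p) mod int q)" for i
  have s: "s = s1 + of_int c / real q"
    using q by (simp add: s1_def c_def frac_def field_simps)
  have "inj_on f {..<q}"
  proof (rule inj_onI)
    fix i j assume ij: "i \<in> {..<q}" "j \<in> {..<q}" "f i = f j"
    have "(c + int i * p) mod int q = (c + int j * p) mod int q"
      using ij(3) q unfolding f_def by (metis Euclidean_Rings.pos_mod_sign eq_nat_nat_iff of_nat_0_less_iff less_le_trans zero_less_one)
    then have "int q dvd (int i - int j) * p" by (simp add: mod_eq_dvd_iff left_diff_distrib)
    then have "int q dvd int i - int j" using cop by (simp add: coprime_dvd_mult_left_iff coprime_commute)
    moreover have "\<bar>int i - int j\<bar> < int q" using ij by auto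
    ultimately have "int i - int j = 0" using zdvd_imp_le by (metis abs_ge_zero abs_le_zero_iff dvd_abs_iff not_le zero_less_abs_iff)
    then show "i = j" by simp
  qed
  moreover have "f ` {..<q} \<subseteq> {..<q}" using q by (auto simp: f_def nat_less_iff)
  ultimately have bij: "bij_betw f {..<q} {..<q}"
    by (simp add: bij_betw_def card_image card_subset_eq)
  have "\<psi> (s + real i * of_int p / real q) = \<psi> (s1 + real (f i) / real q)" for i
  proof -
    define n where "n = c + int i * p"
    have "s + real i * of_int p / real q = s1 + of_int n / real q"
      by (subst s) (simp add: n_def add_divide_distrib)
    also have "real_of_int n = of_int (n mod int q) + of_int (n div int q) * real q"
      by (metis mod_mult_div_eq of_int_add of_int_mult of_int_of_nat_eq mult.commute)
    also have "s1 + (of_int (n mod int q) + of_int (n div int q) * real q) / real q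
        = s1 + of_int (n mod int q) / real q + of_int (n div int q)"
      using q by (simp add: add_divide_distrib)
    also have "real_of_int (n mod int q) = real (f i)" using q by (simp add: f_def n_def)
    finally show ?thesis using periodic_of_int[of \<psi>, OF per] by metis
  qed
  then have "(\<Sum>i<q. \<psi> (s + real i * of_int p / real q)) = (\<Sum>i<q. \<psi> (s1 + real (f i) / real q))" by simp
  also have "\<dots> = (\<Sum>r<q. \<psi> (s1 + real r / real q))" by (rule sum.reindex_bij_betw[OF bij])
  finally show ?thesis by (simp add: s1_def)
qed

text \<open>The Lipschitz bound is assumed only up to the distance \<epsilon>, since the truncated
  functions below satisfy it only at the scale \<open>1 / q\<close>.\<close>

lemma continuous_of_small_scale_lipschitz:
  fixes \<psi> :: "real \<Rightarrow> real"
  assumes "\<epsilon> > 0" and lip: "\<And>s s'. \<bar>s - s'\<bar> \<le> \<epsilon> \<Longrightarrow> \<bar>\<psi> s - \<psi> s'\<bar> \<le> \<Lambda> * \<bar>s - s'\<bar>"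
  shows "continuous_on A \<psi>"
proof (rule continuous_on_subset[OF _ subset_UNIV], rule continuous_onI)
  fix s e :: real assume e: "e > 0"
  define d where "d = min \<epsilon> (e / (\<bar>\<Lambda>\<bar> + 1))"
  have d: "d > 0" "d \<le> \<epsilon>" "d \<le> e / (\<bar>\<Lambda>\<bar> + 1)" using assms(1) e by (auto simp: d_def)
  show "\<exists>d>0. \<forall>s'\<in>UNIV. dist s' s < d \<longrightarrow> dist (\<psi> s') (\<psi> s) \<le> e"
  proof (intro exI[of _ d] conjI ballI impI)
    fix s' assume "dist s' s < d"
    then have s': "\<bar>s' - s\<bar> < d" by (simp add: dist_real_def)
    have "\<bar>\<psi> s' - \<psi> s\<bar> \<le> \<Lambda> * \<bar>s' - s\<bar>" using s' d by (intro lip) simp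
    also have "\<dots> \<le> (\<bar>\<Lambda>\<bar> + 1) * d" using s' by (intro mult_mono) auto
    also have "\<dots> \<le> e" using d(3) by (simp add: field_simps)
    finally show "dist (\<psi> s') (\<psi> s) \<le> e" by (simp add: dist_real_def)
  qed (rule d)
qed

text \<open>Within a cell of length \<open>1 / q\<close> the sampled value differs from the function
  by at most \<open>\<Lambda> / q\<close>. Multiplied by \<open>q\<close>, the integral over a cell
  inherits this error, and the \<open>q\<close> cells add up to \<Lambda>.\<close>

lemma riemann_sum_error:
  fixes \<psi> :: "real \<Rightarrow> real"
  assumes q: "q \<ge> (1::nat)" and lip: "\<And>s s'. \<bar>s - s'\<bar> \<le> 1 / real q \<Longrightarrow> \<bar>\<psi> s - \<psi> s'\<bar> \<le> \<Lambda> * \<bar>s - s'\<bar>"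
    and \<Lambda>: "\<Lambda> \<ge> 0" and s1: "0 \<le> s1" "s1 \<le> 1 / real q"
  shows "\<bar>(\<Sum>r<q. \<psi> (s1 + real r / real q)) - real q * integral {0..1} \<psi>\<bar> \<le> \<Lambda>"
proof -
  have cont: "continuous_on A \<psi>" for A
    by (rule continuous_of_small_scale_lipschitz[OF _ lip]) (use q in auto)
  have int: "\<psi> integrable_on {a..b}" for a b by (rule integrable_continuous_real[OF cont])
  have split: "integral {0..real n / real q} \<psi> = (\<Sum>r<n. integral {real r / real q..real (Suc r) / real q} \<psi>)" for n
  proof (induction n)
    case (Suc n)
    have "integral {0..real n / real q} \<psi> + integral {real n / real q..real (Suc n) / real q} \<psi> = integral {0..real (Suc n) / real q} \<psi>"
      by (rule Henstock_Kurzweil_Integration.integral_combine[OF _ _ int]) (auto simp: divide_right_mono)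
    then show ?case using Suc by simp
  qed simp
  have cell: "\<bar>\<psi> (s1 + real r / real q) - real q * integral {real r / real q..real (Suc r) / real q} \<psi>\<bar> \<le> \<Lambda> / real q" for r
  proof -
    define a where "a = real r / real q"
    define b where "b = real (Suc r) / real q"
    define v where "v = \<psi> (s1 + a)"
    have ab: "b - a = 1 / real q" by (simp add: a_def b_def diff_divide_distrib[symmetric])
    have le: "a \<le> b" using ab q by (metis diff_ge_0_iff_ge of_nat_0_le_iff zero_le_divide_1_iff)
    have "norm (integral {a..b} (\<lambda>u. v - \<psi> u)) \<le> (\<Lambda> / real q) * (b - a)"
    proof (rule integral_bound[OF le])
      show "continuous_on {a..b} (\<lambda>u. v - \<psi> u)" by (intro continuous_intros cont)
      fix u assume "u \<in> {a..b}"
      then have u: "\<bar>(s1 + a) - u\<bar> \<le> 1 / real q" using s1 ab by auto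
      have "\<bar>v - \<psi> u\<bar> \<le> \<Lambda> * \<bar>(s1 + a) - u\<bar>" unfolding v_def by (rule lip[OF u])
      also have "\<dots> \<le> \<Lambda> * (1 / real q)" using u \<Lambda> by (intro mult_left_mono)
      finally show "norm (v - \<psi> u) \<le> \<Lambda> / real q" by simp
    qed
    also have "integral {a..b} (\<lambda>u. v - \<psi> u) = v * (b - a) - integral {a..b} \<psi>"
      using le int by (subst Henstock_Kurzweil_Integration.integral_diff) auto
    finally have "\<bar>v * (1 / real q) - integral {a..b} \<psi>\<bar> \<le> \<Lambda> / real q * (1 / real q)" unfolding ab by simp
    then have "real q * \<bar>v * (1 / real q) - integral {a..b} \<psi>\<bar> \<le> real q * (\<Lambda> / real q * (1 / real q))"
      by (rule mult_left_mono) simp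
    also have "real q * (\<Lambda> / real q * (1 / real q)) = \<Lambda> / real q" using q by simp
    also have "real q * \<bar>v * (1 / real q) - integral {a..b} \<psi>\<bar> = \<bar>real q * (v * (1 / real q) - integral {a..b} \<psi>)\<bar>"
      by (simp add: abs_mult)
    also have "real q * (v * (1 / real q) - integral {a..b} \<psi>) = v - real q * integral {a..b} \<psi>"
      using q by (simp add: right_diff_distrib)
    finally show ?thesis by (simp add: a_def b_def v_def)
  qed
  have "integral {0..1} \<psi> = (\<Sum>r<q. integral {real r / real q..real (Suc r) / real q} \<psi>)"
    using split[of q] q by simp
  then have "(\<Sum>r<q. \<psi> (s1 + real r / real q)) - real q * integral {0..1} \<psi>
      = (\<Sum>r<q. \<psi> (s1 + real r / real q) - real q * integral {real r / real q..real (Suc r) / real q} \<psi>)"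
    by (simp add: sum_subtractf sum_distrib_left)
  also have "\<bar>\<dots>\<bar> \<le> (\<Sum>r<q. \<Lambda> / real q)"
    by (rule order.trans[OF sum_abs sum_mono[OF cell]])
  also have "\<dots> = \<Lambda>" using q by simp
  finally show ?thesis .
qed

text \<open>A rational approximation \<open>p / q\<close> of \<open>t\<close> makes every block of \<open>q\<close> consecutive points a small
  perturbation of an equally spaced grid, whatever its starting point.\<close>

lemma rotation_sum_error:
  fixes \<psi> :: "real \<Rightarrow> real" and p :: int
  assumes per: "\<And>s. \<psi> (s + 1) = \<psi> s" and q: "q \<ge> (1::nat)" and cop: "coprime p (int q)"
    and approx: "\<bar>real q * t - of_int p\<bar> \<le> 1 / real q"
    and lip: "\<And>s s'. \<bar>s - s'\<bar> \<le> 1 / real q \<Longrightarrow> \<bar>\<psi> s - \<psi> s'\<bar> \<le> \<Lambda> * \<bar>s - s'\<bar>"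
    and \<Lambda>: "\<Lambda> \<ge> 0" and M: "\<And>s. \<bar>\<psi> s\<bar> \<le> M"
  shows "\<bar>(\<Sum>m=1..k. \<psi> (real m * t)) - real k * integral {0..1} \<psi>\<bar> \<le> 2 * \<Lambda> * real k / real q + 2 * real q * M"
proof -
  define I where "I = integral {0..1} \<psi>"
  have cont: "continuous_on A \<psi>" for A
    by (rule continuous_of_small_scale_lipschitz[OF _ lip]) (use q in auto)
  have I: "\<bar>I\<bar> \<le> M"
    using integral_bound[of 0 1 \<psi> M] cont M unfolding I_def by auto
  \<comment> \<open>One \<Lambda> pays for replacing \<open>t\<close> by \<open>p / q\<close>, which
    moves each of the \<open>q\<close> points by at most \<open>1 / q\<close>; the other pays for
    the Riemann sum.\<close>
  have block: "\<bar>(\<Sum>i<q. \<psi> (s + real i * t)) - real q * I\<bar> \<le> 2 * \<Lambda>" for s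
  proof -
    have "\<bar>\<psi> (s + real i * t) - \<psi> (s + real i * of_int p / real q)\<bar> \<le> \<Lambda> / real q" if i: "i < q" for i
    proof -
      have "\<bar>t - of_int p / real q\<bar> * real q = \<bar>real q * t - of_int p\<bar>"
      proof -
        have "real q * t - of_int p = real q * (t - of_int p / real q)" using q by (simp add: right_diff_distrib)
        then show ?thesis by (simp add: abs_mult)
      qed
      then have "real i * \<bar>t - of_int p / real q\<bar> \<le> 1 / real q"
        using approx i mult_right_mono[of "real i" "real q" "\<bar>t - of_int p / real q\<bar>"] by (simp add: mult.commute)
      moreover have "(s + real i * t) - (s + real i * of_int p / real q) = real i * (t - of_int p / real q)"
        by (simp add: right_diff_distrib)
      ultimately have d: "\<bar>(s + real i * t) - (s + real i * of_int p / real q)\<bar> \<le> 1 / real q" by (simp add: abs_mult)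
      have "\<bar>\<psi> (s + real i * t) - \<psi> (s + real i * of_int p / real q)\<bar> \<le> \<Lambda> * \<bar>(s + real i * t) - (s + real i * of_int p / real q)\<bar>"
        by (rule lip[OF d])
      also have "\<dots> \<le> \<Lambda> * (1 / real q)" using d \<Lambda> by (rule mult_left_mono)
      finally show ?thesis by simp
    qed
    then have "\<bar>\<Sum>i<q. \<psi> (s + real i * t) - \<psi> (s + real i * of_int p / real q)\<bar> \<le> (\<Sum>i<q. \<Lambda> / real q)"
      by (intro order.trans[OF sum_abs sum_mono]) auto
    also have "\<dots> = \<Lambda>" using q by simp
    finally have 1: "\<bar>(\<Sum>i<q. \<psi> (s + real i * t)) - (\<Sum>i<q. \<psi> (s + real i * of_int p / real q))\<bar> \<le> \<Lambda>"
      by (simp add: sum_subtractf)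
    have "\<bar>(\<Sum>r<q. \<psi> (frac (s * real q) / real q + real r / real q)) - real q * I\<bar> \<le> \<Lambda>"
      unfolding I_def
      by (rule riemann_sum_error[OF q lip \<Lambda>]) (auto simp: divide_right_mono less_imp_le[OF frac_lt_1])
    then show ?thesis using 1 unfolding periodic_grid_sum[of \<psi>, OF per q cop] by linarith
  qed
  have blocks: "\<bar>(\<Sum>m=1..b * q. \<psi> (real m * t)) - real (b * q) * I\<bar> \<le> real b * (2 * \<Lambda>)" for b
  proof (induction b)
    case (Suc b)
    have "(\<Sum>m=1..Suc b * q. \<psi> (real m * t)) = (\<Sum>m=1..b * q. \<psi> (real m * t)) + (\<Sum>m=b * q + 1..b * q + q. \<psi> (real m * t))"
      using sum.ub_add_nat[of 1 "b * q" "\<lambda>m. \<psi> (real m * t)" q] by (simp add: add.commute)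
    also have "(\<Sum>m=b * q + 1..b * q + q. \<psi> (real m * t)) = (\<Sum>i<q. \<psi> (real (b * q + 1) * t + real i * t))"
      by (rule sum.reindex_bij_witness[of _ "\<lambda>i. b * q + 1 + i" "\<lambda>m. m - (b * q + 1)"]) (auto simp: algebra_simps)
    finally show ?case using Suc block[of "real (b * q + 1) * t"] by (simp add: algebra_simps)
  qed simp
  define b where "b = k div q"
  have k: "k = b * q + k mod q" by (simp add: b_def)
  have "(\<Sum>m=1..k. \<psi> (real m * t)) = (\<Sum>m=1..b * q. \<psi> (real m * t)) + (\<Sum>m=b * q + 1..b * q + k mod q. \<psi> (real m * t))"
    by (subst k) (rule sum.ub_add_nat, simp)
  \<comment> \<open>Fewer than \<open>q\<close> points are left over. They and the matching share of
    the integral are bounded trivially, which accounts for \<open>2 * real q * M\<close>.\<close>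
  moreover have "\<bar>\<Sum>m=b * q + 1..b * q + k mod q. \<psi> (real m * t)\<bar> \<le> real q * M"
  proof -
    have "\<bar>\<Sum>m=b * q + 1..b * q + k mod q. \<psi> (real m * t)\<bar> \<le> (\<Sum>m=b * q + 1..b * q + k mod q. M)"
      by (rule order.trans[OF sum_abs sum_mono[OF M]])
    also have "\<dots> = real (k mod q) * M" by simp
    also have "\<dots> \<le> real q * M"
      using q M[of 0] by (intro mult_right_mono) (auto simp: less_imp_le)
    finally show ?thesis .
  qed
  moreover have "real k * I = real (b * q) * I + real (k mod q) * I" by (subst k) (simp add: distrib_right)
  moreover have "\<bar>real (k mod q) * I\<bar> \<le> real q * M"
    unfolding abs_mult using q I by (intro mult_mono) (auto simp: less_imp_le)
  moreover have "real b * (2 * \<Lambda>) \<le> 2 * \<Lambda> * real k / real q"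
  proof -
    have "b * q \<le> k" by (simp add: b_def)
    then have "real b * real q \<le> real k" by (metis of_nat_le_iff of_nat_mult)
    then have "real b \<le> real k / real q" using q by (simp add: le_divide_eq)
    then have "real b * (2 * \<Lambda>) \<le> real k / real q * (2 * \<Lambda>)" using \<Lambda> by (intro mult_right_mono) auto
    then show ?thesis by (simp add: mult_ac)
  qed
  ultimately show ?thesis using blocks[of b] unfolding I_def by linarith
qed

section \<open>Functions with weak singularities on the circle\<close>

lemma integrable_abs_powr_singularity:
  fixes v :: real
  shows "set_integrable lborel {0..1} (\<lambda>s. \<bar>s - v\<bar> powr (- 1 / 2))"
proof -
  \<comment> \<open>A translated and a reflected copy of the singularity at 0 cover the two sides of
    \<open>v\<close>; every point of \<open>{0..1}\<close> is within distance \<open>c\<close> of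
    \<open>v\<close>.\<close>
  define c where "c = 1 + \<bar>v\<bar>"
  have c: "c \<ge> 0" by (simp add: c_def)
  have "(\<lambda>x::real. x powr (- 1 / 2)) absolutely_integrable_on {0..c}"
    by (rule nonnegative_absolutely_integrable_1[OF integrable_on_powr_from_0]) (use c in auto)
  then have "integrable lebesgue (\<lambda>x. indicator {0..c} x * x powr (- 1 / 2))"
    by (simp add: set_integrable_def)
  then have 1: "integrable lborel (\<lambda>x. indicator {0..c} x * x powr (- 1 / 2))"
    by (subst (asm) integrable_completion) auto
  have 2: "integrable lborel (\<lambda>x. indicator {0..c} (- v + 1 * x) * (- v + 1 * x) powr (- 1 / 2))"
    using lborel_integrable_real_affine[OF 1, of 1 "- v"] by simp
  have 3: "integrable lborel (\<lambda>x. indicator {0..c} (v + (- 1) * x) * (v + (- 1) * x) powr (- 1 / 2))"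
    using lborel_integrable_real_affine[OF 1, of "- 1" v] by simp
  show ?thesis unfolding set_integrable_def
  proof (rule Bochner_Integration.integrable_bound[OF Bochner_Integration.integrable_add[OF 2 3]])
    show "AE x in lborel. norm (indicator {0..1} x *\<^sub>R \<bar>x - v\<bar> powr (- 1 / 2)) \<le>
        norm (indicator {0..c} (- v + 1 * x) * (- v + 1 * x) powr (- 1 / 2) + indicator {0..c} (v + (- 1) * x) * (v + (- 1) * x) powr (- 1 / 2))"
      by (rule AE_I2) (auto simp: indicator_def c_def abs_if)
  qed measurable
qed

text \<open>Chordal distance, read in the angular coordinate. Since \<open>infdist\<close> to the
  empty set is 0, exceptional sets are kept nonempty.\<close>

definition circle_dist :: "complex set \<Rightarrow> real \<Rightarrow> real" where
  "circle_dist Z s = infdist (cis (2 * pi * s)) Z"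

lemma circle_dist_nonneg: "circle_dist Z s \<ge> 0"
  by (simp add: circle_dist_def infdist_nonneg)

lemma circle_dist_lipschitz: "\<bar>circle_dist Z s - circle_dist Z s'\<bar> \<le> 7 * \<bar>s - s'\<bar>"
  unfolding circle_dist_def
  using infdist_triangle_abs[of "cis (2 * pi * s)" Z "cis (2 * pi * s')"] norm_cis_diff_le[of s s']
  by (simp add: dist_norm)

lemma cis_period: "cis (2 * pi * (s + 1)) = cis (2 * pi * s)"
  by (simp add: distrib_left cis_mult[symmetric])

lemma circle_dist_period: "circle_dist Z (s + 1) = circle_dist Z s"
  unfolding circle_dist_def cis_period ..

lemma circle_dist_le_2:
  assumes "Z \<noteq> {}" "Z \<subseteq> sphere 0 1"
  shows "circle_dist Z s \<le> 2"
proof -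
  obtain z where z: "z \<in> Z" using assms(1) by blast
  then have "cmod z = 1" using assms(2) by auto
  then have "dist (cis (2 * pi * s)) z \<le> 2"
    using norm_triangle_ineq4[of "cis (2 * pi * s)" z] by (simp add: dist_norm)
  then show ?thesis unfolding circle_dist_def using infdist_le2[OF z] by blast
qed

text \<open>The points of \<open>Z\<close> are lifted to the real line, where the chordal distance
  dominates an ordinary distance. Negative powers can then be integrated one singularity at a
  time.\<close>

lemma circle_dist_points:
  assumes Z: "finite Z" "Z \<noteq> {}" "Z \<subseteq> sphere 0 1"
  obtains V where "finite V" "\<And>s. s \<in> {0..1} \<Longrightarrow> \<exists>v\<in>V. \<bar>s - v\<bar> \<le> circle_dist Z s"
proof -
  define u where "u z = (Arg z) / (2 * pi)" for z
  have u: "cis (2 * pi * u z) = z" if "z \<in> Z" for z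
  proof -
    have "z \<noteq> 0" "cmod z = 1" using that Z(3) by auto
    then show ?thesis using cis_Arg[of z] by (simp add: u_def sgn_eq)
  qed
  have ub: "\<bar>u z\<bar> \<le> 1" for z
    using Arg_bounded[of z] pi_gt_zero unfolding u_def by (auto simp: abs_le_iff field_simps)
  \<comment> \<open>The angles lie in \<open>{-1..1}\<close> and \<open>s\<close> in
    \<open>{0..1}\<close>, so few integer translates can be nearest; the range leaves room for
    \<open>n + 1\<close>.\<close>
  define V where "V = (\<lambda>(z, j). u z + real_of_int j) ` (Z \<times> {- 3..3})"
  show ?thesis
  proof (rule that)
    show "finite V" using Z(1) by (simp add: V_def)
    fix s :: real assume s: "s \<in> {0..1}"
    have "compact Z" using Z(1) by (rule finite_imp_compact)
    then obtain z where z: "z \<in> Z" "circle_dist Z s = dist (cis (2 * pi * s)) z"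
      unfolding circle_dist_def using infdist_attains_inf[of Z "cis (2 * pi * s)"] Z(2) compact_imp_closed by metis
    have "dist_to_int (s - u z) \<le> cmod (cis (2 * pi * (s - u z)) - 1)" by (rule norm_cis_minus_1_ge)
    also have "\<dots> = cmod (cis (2 * pi * u z) * (cis (2 * pi * (s - u z)) - 1))" by (simp add: norm_mult)
    also have "cis (2 * pi * u z) * (cis (2 * pi * (s - u z)) - 1) = cis (2 * pi * s) - z"
    proof -
      have "cis (2 * pi * u z) * cis (2 * pi * (s - u z)) = cis (2 * pi * s)" by (simp add: cis_mult algebra_simps)
      then show ?thesis by (simp add: right_diff_distrib u[OF z(1)])
    qed
    finally have le: "dist_to_int (s - u z) \<le> circle_dist Z s" using z(2) by (simp add: dist_norm)
    define n where "n = \<lfloor>s - u z\<rfloor>"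
    have n: "- 2 \<le> n" "n \<le> 2" using s ub[of z] unfolding n_def by (auto simp: le_floor_iff floor_le_iff abs_le_iff)
    have in_V: "u z + real_of_int j \<in> V" if "- 3 \<le> j" "j \<le> 3" for j
      unfolding V_def using z(1) that by (intro image_eqI[of _ _ "(z, j)"]) auto
    have nV: "u z + real_of_int n \<in> V" "u z + real_of_int (n + 1) \<in> V"
      using in_V[of n] in_V[of "n + 1"] n by simp_all
    have "\<bar>s - (u z + real_of_int n)\<bar> \<le> circle_dist Z s \<or> \<bar>s - (u z + real_of_int (n + 1))\<bar> \<le> circle_dist Z s"
      using dist_to_int_attained[of "s - u z"] le unfolding n_def diff_diff_eq by argo
    then show "\<exists>v\<in>V. \<bar>s - v\<bar> \<le> circle_dist Z s" using nV by blast
  qed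
qed

lemma integrable_circle_dist_powr:
  assumes Z: "finite Z" "Z \<noteq> {}" "Z \<subseteq> sphere 0 1"
  shows "set_integrable lborel {0..1} (\<lambda>s. circle_dist Z s powr (- 1 / 2))"
    and "AE s in lborel. s \<in> {0..1} \<longrightarrow> circle_dist Z s > 0"
    and "finite {s\<in>{0..1}. circle_dist Z s = 0}"
proof -
  obtain V where V: "finite V" "\<And>s. s \<in> {0..1} \<Longrightarrow> \<exists>v\<in>V. \<bar>s - v\<bar> \<le> circle_dist Z s"
    using circle_dist_points[OF Z] by blast
  have sub: "{s\<in>{0..1}. circle_dist Z s = 0} \<subseteq> V" using V(2) by fastforce
  show fin: "finite {s\<in>{0..1}. circle_dist Z s = 0}" using finite_subset[OF sub V(1)] .
  have nV: "AE s in lborel. s \<notin> V"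
    using V(1) by (intro AE_not_in finite_imp_null_set_lborel)
  then show "AE s in lborel. s \<in> {0..1} \<longrightarrow> circle_dist Z s > 0"
  proof eventually_elim
    case (elim s)
    then show ?case using sub circle_dist_nonneg[of Z s] by fastforce
  qed
  have cont: "continuous_on UNIV (circle_dist Z)"
    by (rule continuous_of_small_scale_lipschitz[of 1 _ 7]) (auto intro: circle_dist_lipschitz)
  have [measurable]: "circle_dist Z \<in> borel_measurable borel" by (rule borel_measurable_continuous_onI[OF cont])
  have "integrable lborel (\<lambda>s. \<Sum>v\<in>V. indicator {0..1} s *\<^sub>R \<bar>s - v\<bar> powr (- 1 / 2))"
    using integrable_abs_powr_singularity by (intro Bochner_Integration.integrable_sum) (simp add: set_integrable_def)
  then show "set_integrable lborel {0..1} (\<lambda>s. circle_dist Z s powr (- 1 / 2))"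
    unfolding set_integrable_def
  proof (rule Bochner_Integration.integrable_bound)
    show "AE s in lborel. norm (indicator {0..1} s *\<^sub>R circle_dist Z s powr (- 1 / 2))
        \<le> norm (\<Sum>v\<in>V. indicator {0..1} s *\<^sub>R \<bar>s - v\<bar> powr (- 1 / 2))"
      using nV
    proof eventually_elim
      case (elim s)
      show ?case
      proof (cases "s \<in> {0..1}")
        case True
        then obtain v where v: "v \<in> V" "\<bar>s - v\<bar> \<le> circle_dist Z s" using V(2) by blast
        then have "circle_dist Z s powr (- 1 / 2) \<le> \<bar>s - v\<bar> powr (- 1 / 2)"
          using elim by (intro powr_mono2') auto
        also have "\<dots> \<le> (\<Sum>v\<in>V. \<bar>s - v\<bar> powr (- 1 / 2))" using V(1) v(1) by (intro member_le_sum) auto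
        finally show ?thesis using True by simp
      qed simp
    qed
  qed measurable
qed

text \<open>The orbit of \<open>x\<close> may approach \<open>Z\<close> or hit it, so the growth along the orbit is a separate
  requirement.\<close>

definition circle_tame :: "complex set \<Rightarrow> complex \<Rightarrow> (complex \<Rightarrow> real) \<Rightarrow> bool" where
  "circle_tame Z x \<phi> \<longleftrightarrow>
     (\<forall>\<eta>>0. \<exists>C. \<forall>s. circle_dist Z s > 0 \<longrightarrow> \<bar>\<phi> (cis (2 * pi * s))\<bar> \<le> C * circle_dist Z s powr - \<eta>) \<and>
     (\<exists>C A. \<forall>\<rho>>0. \<forall>s s'. s \<le> s' \<longrightarrow> (\<forall>u\<in>{s..s'}. circle_dist Z u \<ge> \<rho>) \<longrightarrow>
        \<bar>\<phi> (cis (2 * pi * s)) - \<phi> (cis (2 * pi * s'))\<bar> \<le> C * (1 + 1 / \<rho>) ^ A * \<bar>s - s'\<bar>) \<and>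
     (\<forall>\<eta>>0. \<exists>B. \<forall>m\<ge>1. \<bar>\<phi> (x ^ m)\<bar> \<le> B * real m powr \<eta>)"

lemma circle_tame_bound:
  assumes "circle_tame Z x \<phi>" "\<eta> > 0"
  obtains C where "C \<ge> 0" "\<And>s. circle_dist Z s > 0 \<Longrightarrow> \<bar>\<phi> (cis (2 * pi * s))\<bar> \<le> C * circle_dist Z s powr - \<eta>"
proof -
  obtain C where C: "\<And>s. circle_dist Z s > 0 \<Longrightarrow> \<bar>\<phi> (cis (2 * pi * s))\<bar> \<le> C * circle_dist Z s powr - \<eta>"
    using assms unfolding circle_tame_def by blast
  have "\<bar>\<phi> (cis (2 * pi * s))\<bar> \<le> \<bar>C\<bar> * circle_dist Z s powr - \<eta>" if "circle_dist Z s > 0" for s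
    using C[OF that] by (meson abs_ge_self mult_right_mono order_trans powr_ge_zero)
  then show ?thesis using that[of "\<bar>C\<bar>"] by simp
qed

lemma circle_tame_bound_off:
  assumes "circle_tame Z x \<phi>"
  obtains C where "C \<ge> 0" "\<And>s \<rho>. 0 < \<rho> \<Longrightarrow> \<rho> \<le> circle_dist Z s \<Longrightarrow> \<bar>\<phi> (cis (2 * pi * s))\<bar> \<le> C * (1 + 1 / \<rho>)"
proof -
  obtain C where C: "C \<ge> 0" "\<And>s. circle_dist Z s > 0 \<Longrightarrow> \<bar>\<phi> (cis (2 * pi * s))\<bar> \<le> C * circle_dist Z s powr - 1"
    using circle_tame_bound[OF assms zero_less_one] by blast
  have "\<bar>\<phi> (cis (2 * pi * s))\<bar> \<le> C * (1 + 1 / \<rho>)" if r: "0 < \<rho>" "\<rho> \<le> circle_dist Z s" for s \<rho>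
  proof -
    have "\<bar>\<phi> (cis (2 * pi * s))\<bar> \<le> C * circle_dist Z s powr - 1" using r by (intro C) simp
    also have "circle_dist Z s powr - 1 = 1 / circle_dist Z s" using r by (simp add: powr_minus_divide)
    also have "C * (1 / circle_dist Z s) \<le> C * (1 + 1 / \<rho>)"
    proof (rule mult_left_mono[OF _ C(1)])
      have "1 / circle_dist Z s \<le> 1 / \<rho>" using r by (intro divide_left_mono) auto
      then show "1 / circle_dist Z s \<le> 1 + 1 / \<rho>" by simp
    qed
    finally show ?thesis .
  qed
  then show ?thesis using that C(1) by blast
qed

lemma circle_tame_lipschitz:
  assumes "circle_tame Z x \<phi>"
  obtains C A where "C \<ge> 0" "\<And>\<rho> s s'. \<rho> > 0 \<Longrightarrow> s \<le> s' \<Longrightarrow> (\<And>u. u \<in> {s..s'} \<Longrightarrow> circle_dist Z u \<ge> \<rho>) \<Longrightarrow>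
     \<bar>\<phi> (cis (2 * pi * s)) - \<phi> (cis (2 * pi * s'))\<bar> \<le> C * (1 + 1 / \<rho>) ^ A * \<bar>s - s'\<bar>"
proof -
  obtain C A where C: "\<forall>\<rho>>0. \<forall>s s'. s \<le> s' \<longrightarrow> (\<forall>u\<in>{s..s'}. circle_dist Z u \<ge> \<rho>) \<longrightarrow>
        \<bar>\<phi> (cis (2 * pi * s)) - \<phi> (cis (2 * pi * s'))\<bar> \<le> C * (1 + 1 / \<rho>) ^ A * \<bar>s - s'\<bar>"
    using assms unfolding circle_tame_def by (elim conjE exE) (rule that)
  have "\<bar>\<phi> (cis (2 * pi * s)) - \<phi> (cis (2 * pi * s'))\<bar> \<le> \<bar>C\<bar> * (1 + 1 / \<rho>) ^ A * \<bar>s - s'\<bar>"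
    if r: "\<rho> > 0" "s \<le> s'" "\<And>u. u \<in> {s..s'} \<Longrightarrow> circle_dist Z u \<ge> \<rho>" for \<rho> s s'
  proof -
    have "\<bar>\<phi> (cis (2 * pi * s)) - \<phi> (cis (2 * pi * s'))\<bar> \<le> C * (1 + 1 / \<rho>) ^ A * \<bar>s - s'\<bar>" using C r by simp
    also have "\<dots> \<le> \<bar>C\<bar> * (1 + 1 / \<rho>) ^ A * \<bar>s - s'\<bar>" using r(1) by (intro mult_right_mono) auto
    finally show ?thesis .
  qed
  then show ?thesis using that[of "\<bar>C\<bar>" A] by simp
qed

lemma circle_tame_mult:
  assumes f: "circle_tame Z x \<phi>" and g: "circle_tame Z x \<psi>"
  shows "circle_tame Z x (\<lambda>z. \<phi> z * \<psi> z)"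
  unfolding circle_tame_def
proof (intro conjI allI impI)
  fix \<eta> :: real assume \<eta>: "\<eta> > 0"
  then have \<eta>2: "\<eta> / 2 > 0" by simp
  obtain C where C: "C \<ge> 0" "\<And>s. circle_dist Z s > 0 \<Longrightarrow> \<bar>\<phi> (cis (2 * pi * s))\<bar> \<le> C * circle_dist Z s powr - (\<eta> / 2)"
    using circle_tame_bound[OF f \<eta>2] by blast
  obtain D where D: "D \<ge> 0" "\<And>s. circle_dist Z s > 0 \<Longrightarrow> \<bar>\<psi> (cis (2 * pi * s))\<bar> \<le> D * circle_dist Z s powr - (\<eta> / 2)"
    using circle_tame_bound[OF g \<eta>2] by blast
  show "\<exists>C. \<forall>s. circle_dist Z s > 0 \<longrightarrow> \<bar>\<phi> (cis (2 * pi * s)) * \<psi> (cis (2 * pi * s))\<bar> \<le> C * circle_dist Z s powr - \<eta>"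
  proof (intro exI[of _ "C * D"] allI impI)
    fix s assume s: "circle_dist Z s > 0"
    have "\<bar>\<phi> (cis (2 * pi * s)) * \<psi> (cis (2 * pi * s))\<bar> \<le> (C * circle_dist Z s powr - (\<eta> / 2)) * (D * circle_dist Z s powr - (\<eta> / 2))"
      unfolding abs_mult using C(2)[OF s] D(2)[OF s] C(1) by (intro mult_mono) auto
    also have "\<dots> = C * D * (circle_dist Z s powr - (\<eta> / 2) * circle_dist Z s powr - (\<eta> / 2))" by simp
    also have "circle_dist Z s powr - (\<eta> / 2) * circle_dist Z s powr - (\<eta> / 2) = circle_dist Z s powr - \<eta>"
      by (simp flip: powr_add)
    finally show "\<bar>\<phi> (cis (2 * pi * s)) * \<psi> (cis (2 * pi * s))\<bar> \<le> C * D * circle_dist Z s powr - \<eta>" .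
  qed
  obtain C where C: "\<And>m. m \<ge> 1 \<Longrightarrow> \<bar>\<phi> (x ^ m)\<bar> \<le> C * real m powr (\<eta> / 2)"
    using f \<eta>2 unfolding circle_tame_def by blast
  obtain D where D: "\<And>m. m \<ge> 1 \<Longrightarrow> \<bar>\<psi> (x ^ m)\<bar> \<le> D * real m powr (\<eta> / 2)"
    using g \<eta>2 unfolding circle_tame_def by blast
  show "\<exists>B. \<forall>m\<ge>1. \<bar>\<phi> (x ^ m) * \<psi> (x ^ m)\<bar> \<le> B * real m powr \<eta>"
  proof (intro exI[of _ "C * D"] allI impI)
    fix m :: nat assume m: "m \<ge> 1"
    have "\<bar>\<phi> (x ^ m) * \<psi> (x ^ m)\<bar> \<le> (C * real m powr (\<eta> / 2)) * (D * real m powr (\<eta> / 2))"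
      unfolding abs_mult using C[OF m] D[OF m] by (intro mult_mono) (auto intro: order.trans[OF abs_ge_zero])
    also have "\<dots> = C * D * (real m powr (\<eta> / 2) * real m powr (\<eta> / 2))" by simp
    also have "real m powr (\<eta> / 2) * real m powr (\<eta> / 2) = real m powr \<eta>" by (simp flip: powr_add)
    finally show "\<bar>\<phi> (x ^ m) * \<psi> (x ^ m)\<bar> \<le> C * D * real m powr \<eta>" .
  qed
next
  obtain C\<^sub>1 where C1: "C\<^sub>1 \<ge> 0" "\<And>s \<rho>. 0 < \<rho> \<Longrightarrow> \<rho> \<le> circle_dist Z s \<Longrightarrow> \<bar>\<phi> (cis (2 * pi * s))\<bar> \<le> C\<^sub>1 * (1 + 1 / \<rho>)"
    using circle_tame_bound_off[OF f] by blast
  obtain C\<^sub>2 where C2: "C\<^sub>2 \<ge> 0" "\<And>s \<rho>. 0 < \<rho> \<Longrightarrow> \<rho> \<le> circle_dist Z s \<Longrightarrow> \<bar>\<psi> (cis (2 * pi * s))\<bar> \<le> C\<^sub>2 * (1 + 1 / \<rho>)"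
    using circle_tame_bound_off[OF g] by blast
  obtain C\<^sub>3 A where C3: "C\<^sub>3 \<ge> 0" "\<And>\<rho> s s'. \<rho> > 0 \<Longrightarrow> s \<le> s' \<Longrightarrow> (\<And>u. u \<in> {s..s'} \<Longrightarrow> circle_dist Z u \<ge> \<rho>) \<Longrightarrow>
     \<bar>\<phi> (cis (2 * pi * s)) - \<phi> (cis (2 * pi * s'))\<bar> \<le> C\<^sub>3 * (1 + 1 / \<rho>) ^ A * \<bar>s - s'\<bar>"
    using circle_tame_lipschitz[OF f] by blast
  obtain C\<^sub>4 B where C4: "C\<^sub>4 \<ge> 0" "\<And>\<rho> s s'. \<rho> > 0 \<Longrightarrow> s \<le> s' \<Longrightarrow> (\<And>u. u \<in> {s..s'} \<Longrightarrow> circle_dist Z u \<ge> \<rho>) \<Longrightarrow>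
     \<bar>\<psi> (cis (2 * pi * s)) - \<psi> (cis (2 * pi * s'))\<bar> \<le> C\<^sub>4 * (1 + 1 / \<rho>) ^ B * \<bar>s - s'\<bar>"
    using circle_tame_lipschitz[OF g] by blast
  show "\<exists>C A. \<forall>\<rho>>0. \<forall>s s'. s \<le> s' \<longrightarrow> (\<forall>u\<in>{s..s'}. circle_dist Z u \<ge> \<rho>) \<longrightarrow>
      \<bar>\<phi> (cis (2 * pi * s)) * \<psi> (cis (2 * pi * s)) - \<phi> (cis (2 * pi * s')) * \<psi> (cis (2 * pi * s'))\<bar> \<le> C * (1 + 1 / \<rho>) ^ A * \<bar>s - s'\<bar>"
  \<comment> \<open>In the product rule one function is estimated by its size, which costs one power
    of \<open>1 + 1 / \<rho>\<close>, and the other by its Lipschitz bound; \<open>A + B\<close>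
    majorizes both exponents.\<close>
  proof (rule exI[of _ "C\<^sub>1 * C\<^sub>4 + C\<^sub>2 * C\<^sub>3"], rule exI[of _ "Suc (A + B)"], intro allI impI)
    fix \<rho> s s' :: real assume r: "\<rho> > 0" "s \<le> s'" "\<forall>u\<in>{s..s'}. circle_dist Z u \<ge> \<rho>"
    define y where "y = 1 + 1 / \<rho>"
    have y: "y \<ge> 1" using r by (simp add: y_def)
    define u where "u = cis (2 * pi * s)"
    define u' where "u' = cis (2 * pi * s')"
    have b1: "\<bar>\<phi> u\<bar> \<le> C\<^sub>1 * y" unfolding u_def y_def using r by (intro C1) auto
    have b2: "\<bar>\<psi> u'\<bar> \<le> C\<^sub>2 * y" unfolding u'_def y_def using r by (intro C2) auto
    have yA: "y ^ A \<le> y ^ (A + B)" "y ^ B \<le> y ^ (A + B)" using y by (auto intro: power_increasing)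
    have b3: "\<bar>\<phi> u - \<phi> u'\<bar> \<le> C\<^sub>3 * y ^ (A + B) * \<bar>s - s'\<bar>"
    proof -
      have "\<bar>\<phi> u - \<phi> u'\<bar> \<le> C\<^sub>3 * y ^ A * \<bar>s - s'\<bar>" unfolding u_def u'_def y_def using r by (intro C3(2)) auto
      also have "\<dots> \<le> C\<^sub>3 * y ^ (A + B) * \<bar>s - s'\<bar>" using yA C3(1) by (intro mult_right_mono mult_left_mono) auto
      finally show ?thesis .
    qed
    have b4: "\<bar>\<psi> u - \<psi> u'\<bar> \<le> C\<^sub>4 * y ^ (A + B) * \<bar>s - s'\<bar>"
    proof -
      have "\<bar>\<psi> u - \<psi> u'\<bar> \<le> C\<^sub>4 * y ^ B * \<bar>s - s'\<bar>" unfolding u_def u'_def y_def using r by (intro C4(2)) auto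
      also have "\<dots> \<le> C\<^sub>4 * y ^ (A + B) * \<bar>s - s'\<bar>" using yA C4(1) by (intro mult_right_mono mult_left_mono) auto
      finally show ?thesis .
    qed
    have "\<phi> u * \<psi> u - \<phi> u' * \<psi> u' = \<phi> u * (\<psi> u - \<psi> u') + \<psi> u' * (\<phi> u - \<phi> u')" by (simp add: algebra_simps)
    then have "\<bar>\<phi> u * \<psi> u - \<phi> u' * \<psi> u'\<bar> \<le> \<bar>\<phi> u\<bar> * \<bar>\<psi> u - \<psi> u'\<bar> + \<bar>\<psi> u'\<bar> * \<bar>\<phi> u - \<phi> u'\<bar>"
      by (metis abs_mult abs_triangle_ineq)
    also have "\<dots> \<le> (C\<^sub>1 * y) * (C\<^sub>4 * y ^ (A + B) * \<bar>s - s'\<bar>) + (C\<^sub>2 * y) * (C\<^sub>3 * y ^ (A + B) * \<bar>s - s'\<bar>)"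
      using b1 b2 b3 b4 C1(1) C2(1) y by (intro add_mono mult_mono) auto
    also have "\<dots> = (C\<^sub>1 * C\<^sub>4 + C\<^sub>2 * C\<^sub>3) * y ^ Suc (A + B) * \<bar>s - s'\<bar>" by (simp add: algebra_simps)
    finally show "\<bar>\<phi> u * \<psi> u - \<phi> u' * \<psi> u'\<bar> \<le> (C\<^sub>1 * C\<^sub>4 + C\<^sub>2 * C\<^sub>3) * y ^ Suc (A + B) * \<bar>s - s'\<bar>" .
  qed
qed

lemma circle_tame_continuous_on:
  assumes \<phi>: "circle_tame Z x \<phi>"
  shows "open {s. circle_dist Z s > 0}"
    and "continuous_on {s. circle_dist Z s > 0} (\<lambda>s. \<phi> (cis (2 * pi * s)))"
proof -
  obtain L A where L: "L \<ge> 0" "\<And>\<rho> s s'. \<rho> > 0 \<Longrightarrow> s \<le> s' \<Longrightarrow> (\<And>u. u \<in> {s..s'} \<Longrightarrow> circle_dist Z u \<ge> \<rho>) \<Longrightarrow>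
     \<bar>\<phi> (cis (2 * pi * s)) - \<phi> (cis (2 * pi * s'))\<bar> \<le> L * (1 + 1 / \<rho>) ^ A * \<bar>s - s'\<bar>"
    using circle_tame_lipschitz[OF \<phi>] by blast
  define h where "h s = \<phi> (cis (2 * pi * s))" for s
  have cont_d: "continuous_on UNIV (circle_dist Z)"
    by (rule continuous_of_small_scale_lipschitz[of 1 _ 7]) (auto intro: circle_dist_lipschitz)
  define U where "U = {s. circle_dist Z s > 0}"
  have U: "open U" unfolding U_def by (rule open_Collect_less[OF continuous_on_const cont_d])
  have c: "continuous_on U h"
  proof (rule continuous_onI)
    fix s e :: real assume s: "s \<in> U" and e: "e > 0"
    define \<rho> where "\<rho> = circle_dist Z s / 2"
    have \<rho>: "\<rho> > 0" using s by (simp add: \<rho>_def U_def)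
    define K where "K = L * (1 + 1 / \<rho>) ^ A"
    have K: "K \<ge> 0" using L(1) \<rho> by (simp add: K_def)
    define d where "d = min (\<rho> / 7) (e / (K + 1))"
    have d: "d > 0" "d \<le> \<rho> / 7" "d \<le> e / (K + 1)"
      unfolding d_def by (use \<rho> e K in simp) (rule min.cobounded1, rule min.cobounded2)
    show "\<exists>d>0. \<forall>s'\<in>U. dist s' s < d \<longrightarrow> dist (h s') (h s) \<le> e"
    proof (intro exI[of _ d] conjI ballI impI)
      fix s' assume "dist s' s < d"
      then have s': "\<bar>s' - s\<bar> < d" by (simp add: dist_real_def)
      have far: "circle_dist Z u \<ge> \<rho>" if "\<bar>u - s\<bar> < d" for u
      proof -
        have "7 * \<bar>u - s\<bar> \<le> \<rho>" using that d by simp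
        then show ?thesis using circle_dist_lipschitz[of Z u s] unfolding \<rho>_def by linarith
      qed
      have "\<bar>h s' - h s\<bar> \<le> K * \<bar>s' - s\<bar>"
      proof (cases "s' \<le> s")
        case True
        then show ?thesis unfolding h_def K_def using s' by (intro L(2)[OF \<rho>] far) auto
      next
        case False
        then have "\<bar>h s - h s'\<bar> \<le> K * \<bar>s - s'\<bar>" unfolding h_def K_def using s' by (intro L(2)[OF \<rho>] far) auto
        then show ?thesis by (simp add: abs_minus_commute)
      qed
      also have "\<dots> \<le> (K + 1) * d" using s' K by (intro mult_mono) auto
      also have "\<dots> \<le> e" using d(3) K by (simp add: field_simps)
      finally show "dist (h s') (h s) \<le> e" by (simp add: dist_real_def)
    qed (rule d)
  qed
  show "open {s. circle_dist Z s > 0}" using U by (simp add: U_def)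
  show "continuous_on {s. circle_dist Z s > 0} (\<lambda>s. \<phi> (cis (2 * pi * s)))" using c by (simp add: U_def h_def)
qed

lemma circle_tame_set_integrable:
  assumes Z: "finite Z" "Z \<noteq> {}" "Z \<subseteq> sphere 0 1" and \<phi>: "circle_tame Z x \<phi>"
  shows "set_integrable lborel {0..1} (\<lambda>s. \<phi> (cis (2 * pi * s)))"
proof -
  have h: "(1 / 2 :: real) > 0" by simp
  obtain C where C: "C \<ge> 0" "\<And>s. circle_dist Z s > 0 \<Longrightarrow> \<bar>\<phi> (cis (2 * pi * s))\<bar> \<le> C * circle_dist Z s powr - (1 / 2)"
    using circle_tame_bound[OF \<phi> h] by blast
  define h where "h s = \<phi> (cis (2 * pi * s))" for s
  define U where "U = {s. circle_dist Z s > 0}"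
  have U: "open U" unfolding U_def by (rule circle_tame_continuous_on(1)[OF \<phi>])
  have "continuous_on U h" unfolding U_def h_def by (rule circle_tame_continuous_on(2)[OF \<phi>])
  then have mU: "(\<lambda>s. indicator U s *\<^sub>R h s) \<in> borel_measurable borel"
    by (rule borel_measurable_continuous_on_indicator[OF borel_open[OF U]])
  \<comment> \<open>On \<open>Z\<close> the values are arbitrary, so measurability comes from
    continuity off \<open>Z\<close> and a change at finitely many parameters.\<close>
  have meas: "(\<lambda>s. indicator {0..1} s *\<^sub>R h s) \<in> borel_measurable lborel"
  proof (rule measurable_discrete_difference[where X = "{s\<in>{0..1}. circle_dist Z s = 0}"])
    show "(\<lambda>s. indicator {0..1} s *\<^sub>R (indicator U s *\<^sub>R h s)) \<in> borel_measurable lborel" using mU by measurable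
    show "countable {s\<in>{0..1}. circle_dist Z s = 0}" using integrable_circle_dist_powr(3)[OF Z] by (rule countable_finite)
    show "indicator {0..1} s *\<^sub>R (indicator U s *\<^sub>R h s) = indicator {0..1} s *\<^sub>R h s"
      if "s \<notin> {s\<in>{0..1}. circle_dist Z s = 0}" for s
      using that circle_dist_nonneg[of Z s] by (auto simp: indicator_def U_def)
  qed auto
  have "set_integrable lborel {0..1} (\<lambda>s. C * circle_dist Z s powr (- 1 / 2))"
    using integrable_circle_dist_powr(1)[OF Z] by (rule set_integrable_mult_right)
  then show ?thesis
    unfolding set_integrable_def
  proof (rule Bochner_Integration.integrable_bound)
    show "(\<lambda>s. indicator {0..1} s *\<^sub>R \<phi> (cis (2 * pi * s))) \<in> borel_measurable lborel" using meas by (simp add: h_def)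
    show "AE s in lborel. norm (indicator {0..1} s *\<^sub>R \<phi> (cis (2 * pi * s)))
        \<le> norm (indicator {0..1} s *\<^sub>R (C * circle_dist Z s powr (- 1 / 2)))"
      using integrable_circle_dist_powr(2)[OF Z]
    proof eventually_elim
      case (elim s)
      then show ?case using C by (auto simp: indicator_def abs_mult)
    qed
  qed
qed

text \<open>Dirichlet's theorem yields a denominator \<open>q\<close> of size at most about
  \<open>sqrt k\<close>, and finite type forces \<open>q\<close> above a power of \<open>k\<close>.
  The function is cut off at distance \<rho> from \<open>Z\<close>. The far part has a Lipschitz
  constant polynomial in \<open>1 / \<rho>\<close>, to which \<open>rotation_sum_error\<close>
  applies. The near part is rarely visited, by the same estimate for the cutoff itself, and grows
  slowly along the orbit.\<close>

lemma circle_tame_power_mean: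
  assumes Z: "finite Z" "Z \<noteq> {}" "Z \<subseteq> sphere 0 1" and x: "finite_type x" and \<phi>: "circle_tame Z x \<phi>"
  shows "power_mean (\<lambda>m. \<phi> (x ^ m)) (LINT s:{0..1}|lborel. \<phi> (cis (2 * pi * s)))"
proof -
  obtain t K \<gamma> where t: "x = cis (2 * pi * t)" and K: "K > 0" and \<gamma>: "\<gamma> > 0"
    and type: "\<And>m::int. m \<noteq> 0 \<Longrightarrow> dist_to_int (of_int m * t) > K / \<bar>of_int m\<bar> powr \<gamma>"
    using x unfolding finite_type_def by blast
  have xm: "x ^ m = cis (2 * pi * (real m * t))" for m
    unfolding t Complex.DeMoivre by (simp add: mult_ac)
  define h where "h s = \<phi> (cis (2 * pi * s))" for s
  define d where "d s = circle_dist Z s" for s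
  have d0: "d s \<ge> 0" for s unfolding d_def by (rule circle_dist_nonneg)
  have dl: "\<bar>d s - d s'\<bar> \<le> 7 * \<bar>s - s'\<bar>" for s s' unfolding d_def by (rule circle_dist_lipschitz)
  have dp: "d (s + 1) = d s" for s unfolding d_def by (rule circle_dist_period)
  have hp: "h (s + 1) = h s" for s unfolding h_def cis_period ..
  obtain C1 where C1: "C1 \<ge> 0" "\<And>s \<rho>. 0 < \<rho> \<Longrightarrow> \<rho> \<le> d s \<Longrightarrow> \<bar>h s\<bar> \<le> C1 * (1 + 1 / \<rho>)"
    using circle_tame_bound_off[OF \<phi>] unfolding h_def d_def by blast
  obtain L A where L: "L \<ge> 0" "\<And>\<rho> s s'. \<rho> > 0 \<Longrightarrow> s \<le> s' \<Longrightarrow> (\<And>u. u \<in> {s..s'} \<Longrightarrow> d u \<ge> \<rho>) \<Longrightarrow>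
     \<bar>h s - h s'\<bar> \<le> L * (1 + 1 / \<rho>) ^ A * \<bar>s - s'\<bar>"
    using circle_tame_lipschitz[OF \<phi>] unfolding h_def d_def by blast
  have q4: "(1 / 4 :: real) > 0" by simp
  obtain C4 where C4: "C4 \<ge> 0" "\<And>s. d s > 0 \<Longrightarrow> \<bar>h s\<bar> \<le> C4 * d s powr - (1 / 4)"
    using circle_tame_bound[OF \<phi> q4] unfolding h_def d_def by blast
  have hi: "set_integrable lborel {0..1} h" unfolding h_def by (rule circle_tame_set_integrable[OF Z \<phi>])
  have di: "set_integrable lborel {0..1} (\<lambda>s. d s powr (- 1 / 2))" "AE s in lborel. s \<in> {0..1} \<longrightarrow> d s > 0"
    unfolding d_def by (rule integrable_circle_dist_powr[OF Z])+
  define I where "I = (LINT s:{0..1}|lborel. d s powr (- 1 / 2))"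
  have I: "I \<ge> 0" unfolding I_def set_lebesgue_integral_def by (intro Bochner_Integration.integral_nonneg) auto
  \<comment> \<open>Finite type makes \<open>q\<close> at least of order
    \<open>real k powr (1 / (2 * \<gamma>))\<close>; \<mu> is this exponent, capped at 1/2.\<close>
  define \<mu> where "\<mu> = min (1 / (2 * \<gamma>)) (1 / 2)"
  define K' where "K' = K powr (1 / \<gamma>)"
  \<comment> \<open>With \<rho> of order \<open>real k powr - \<epsilon>\<close>, the error
    \<open>\<Lambda> / q\<close> per point is of order
    \<open>real k powr (\<epsilon> * (real A + 2) - \<mu>)\<close>. This \<epsilon> pushes the
    exponent below \<open>- \<mu> / 2\<close>, and the smaller \<eta> leaves room for the growth
    along the orbit.\<close>
  define \<epsilon> where "\<epsilon> = \<mu> / (2 * (real A + 3))"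
  define \<eta> where "\<eta> = \<epsilon> / 8"
  have \<mu>: "\<mu> > 0" "\<mu> \<le> 1 / (2 * \<gamma>)" "\<mu> \<le> 1 / 2" using \<gamma> unfolding \<mu>_def by auto
  have K': "K' > 0" using K by (simp add: K'_def)
  have \<epsilon>: "\<epsilon> > 0" "(real A + 3) * \<epsilon> = \<mu> / 2" using \<mu> by (auto simp: \<epsilon>_def field_simps)
  have A\<epsilon>: "real A * \<epsilon> \<ge> 0" using \<epsilon> by simp
  have \<epsilon>3: "real A * \<epsilon> + 3 * \<epsilon> = \<mu> / 2" using \<epsilon>(2) by (simp add: distrib_right)
  have \<eta>: "\<eta> > 0" using \<epsilon> by (simp add: \<eta>_def)
  obtain B where B: "\<And>m. m \<ge> 1 \<Longrightarrow> \<bar>h (real m * t)\<bar> \<le> B * real m powr \<eta>"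
    using \<phi> \<eta> unfolding circle_tame_def xm h_def by blast
  \<comment> \<open>Chosen so that \<open>7 * (1 / real q) \<le> \<rho>\<close>: moving the angle by
    \<open>1 / q\<close> changes the distance to \<open>Z\<close> by at most \<rho>.\<close>
  define c0 where "c0 = 7 / K'"
  have c0: "c0 > 0" using K' by (simp add: c0_def)
  define Y where "Y = 1 + 1 / c0"
  have Y: "Y \<ge> 1" using c0 by (simp add: Y_def)
  define D1 where "D1 = 2 * ((L + 7 * C1) * Y ^ (A + 2)) / K'"
  define D2 where "D2 = 4 * C1 * Y"
  define D3 where "D3 = \<bar>B\<bar> * (I * sqrt (3 * c0))"
  define D4 where "D4 = \<bar>B\<bar> * (14 / c0 / K')"
  define D5 where "D5 = \<bar>B\<bar> * 4"
  define D6 where "D6 = C4 * (3 * c0) powr (1 / 4) * I"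
  have Dpos: "D1 \<ge> 0" "D2 \<ge> 0" "D3 \<ge> 0" "D4 \<ge> 0" "D5 \<ge> 0" "D6 \<ge> 0"
    using L(1) C1(1) C4(1) Y K' c0 I by (auto simp: D1_def D2_def D3_def D4_def D5_def D6_def)
  have main: "\<bar>(\<Sum>m=1..k. h (real m * t)) - real k * (LINT s:{0..1}|lborel. h s)\<bar>
      \<le> (D1 + D2 + D3 + D4 + D5 + D6) * real k powr (1 - \<eta>)" if k: "k \<ge> 1" for k
  proof -
    define N where "N = nat \<lceil>sqrt (real k)\<rceil>"
    have sk: "sqrt (real k) \<ge> 1" using k by simp
    have N: "sqrt (real k) \<le> real N" "real N \<le> 2 * sqrt (real k)" "N > 0"
      unfolding N_def using sk by linarith+
    obtain p q' where pq: "coprime p q'" "0 < q'" "q' \<le> int N" "\<bar>of_int q' * t - of_int p\<bar> < 1 / real N"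
      using Dirichlet_approx_coprime[OF N(3), of t] by metis
    define q where "q = nat q'"
    have q': "q' = int q" using pq(2) by (simp add: q_def)
    have q: "q \<ge> 1" "q \<le> N" using pq(2,3) q' by auto
    have q2: "real q \<le> 2 * real k powr (1 / 2)" using q(2) N(2) by (simp add: powr_half_sqrt)
    have approx: "\<bar>real q * t - of_int p\<bar> \<le> 1 / real q"
    proof -
      have "\<bar>real q * t - of_int p\<bar> \<le> 1 / real N" using pq(4) q' by simp
      also have "\<dots> \<le> 1 / real q" using q by (intro divide_left_mono) auto
      finally show ?thesis .
    qed
    \<comment> \<open>Dirichlet keeps the distance of \<open>q * t\<close> to the integers below
      \<open>1 / N\<close>, while finite type keeps it above
      \<open>K / real q powr \<gamma>\<close>.\<close>
    have qlow: "K' * real k powr \<mu> \<le> real q"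
    proof -
      have "K / real q powr \<gamma> < 1 / real N"
        using type[of "int q"] q(1) dist_to_int_le[of "real q * t" p] pq(4) q' by simp
      then have "K * real N < real q powr \<gamma>" using q(1) N(3) by (simp add: field_simps)
      moreover have "K * real k powr (1 / 2) \<le> K * real N" using N(1) K by (simp add: powr_half_sqrt)
      ultimately have "K * real k powr (1 / 2) \<le> real q powr \<gamma>" by linarith
      then have "(K * real k powr (1 / 2)) powr (1 / \<gamma>) \<le> (real q powr \<gamma>) powr (1 / \<gamma>)"
        using K \<gamma> by (intro powr_mono2) auto
      then have "K' * real k powr (1 / (2 * \<gamma>)) \<le> real q"
        using K \<gamma> q(1) by (simp add: powr_mult powr_powr K'_def)
      moreover have "K' * real k powr \<mu> \<le> K' * real k powr (1 / (2 * \<gamma>))"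
        using K' k \<mu> by (intro mult_left_mono powr_mono) auto
      ultimately show ?thesis by linarith
    qed
    have qinv: "1 / real q \<le> real k powr - \<mu> / K'"
    proof -
      have "1 / real q \<le> 1 / (K' * real k powr \<mu>)"
        using qlow q(1) K' k by (intro divide_left_mono) auto
      then show ?thesis by (simp add: powr_minus_divide mult.commute)
    qed
    define \<rho> where "\<rho> = c0 * real k powr - \<epsilon>"
    have \<rho>: "\<rho> > 0" using c0 k by (simp add: \<rho>_def)
    have q\<rho>: "7 * (1 / real q) \<le> \<rho>"
    proof -
      have "7 * (1 / real q) \<le> 7 * (real k powr - \<mu> / K')" using qinv by simp
      also have "\<dots> = c0 * real k powr - \<mu>" by (simp add: c0_def)
      also have "\<dots> \<le> c0 * real k powr - \<epsilon>"
        using c0 k A\<epsilon> \<epsilon> \<epsilon>3 by (intro mult_left_mono powr_mono) auto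
      finally show ?thesis by (simp add: \<rho>_def)
    qed
    define y where "y = 1 + 1 / \<rho>"
    have y: "1 \<le> y" "1 / \<rho> \<le> y" using \<rho> by (auto simp: y_def)
    have r1: "1 / \<rho> = 1 / c0 * real k powr \<epsilon>" using k by (simp add: \<rho>_def powr_minus_divide)
    have yY: "y \<le> Y * real k powr \<epsilon>"
    proof -
      have "1 \<le> real k powr \<epsilon>" using k \<epsilon> by (simp add: ge_one_powr_ge_zero)
      then show ?thesis unfolding y_def Y_def r1 by (simp add: algebra_simps)
    qed
    \<comment> \<open>The cutoff vanishes up to \<open>2 * \<rho>\<close> instead of \<rho>. A
      segment of length at most \<open>1 / q\<close> with an endpoint beyond
      \<open>2 * \<rho>\<close> then stays at distance at least \<rho> from
      \<open>Z\<close>.\<close>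
    define \<tau> where "\<tau> s = max 0 (min 1 (d s / \<rho> - 2))" for s
    have \<tau>: "0 \<le> \<tau> s" "\<tau> s \<le> 1" for s by (auto simp: \<tau>_def)
    have \<tau>0: "\<tau> s = 0" if "d s \<le> 2 * \<rho>" for s
    proof -
      have "d s / \<rho> \<le> 2" using that \<rho> by (simp add: divide_le_eq)
      then show ?thesis by (simp add: \<tau>_def)
    qed
    have \<tau>1: "\<tau> s = 1" if "d s \<ge> 3 * \<rho>" for s
    proof -
      have "d s / \<rho> \<ge> 3" using that \<rho> by (simp add: le_divide_eq)
      then show ?thesis by (simp add: \<tau>_def)
    qed
    have \<tau>l: "\<bar>\<tau> s - \<tau> s'\<bar> \<le> 7 / \<rho> * \<bar>s - s'\<bar>" for s s'
    proof -
      have "\<bar>\<tau> s - \<tau> s'\<bar> \<le> \<bar>(d s / \<rho> - 2) - (d s' / \<rho> - 2)\<bar>" unfolding \<tau>_def by linarith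
      also have "\<dots> = \<bar>d s - d s'\<bar> / \<rho>" using \<rho> by (simp add: diff_divide_distrib[symmetric])
      also have "\<dots> \<le> 7 * \<bar>s - s'\<bar> / \<rho>" using dl \<rho> by (intro divide_right_mono) auto
      finally show ?thesis by simp
    qed
    define \<psi>1 where "\<psi>1 s = h s * \<tau> s" for s
    define \<psi>2 where "\<psi>2 s = 1 - \<tau> s" for s
    have p1: "\<psi>1 (s + 1) = \<psi>1 s" and p2: "\<psi>2 (s + 1) = \<psi>2 s" for s
      by (simp_all add: \<psi>1_def \<psi>2_def \<tau>_def hp dp)
    define \<Lambda> where "\<Lambda> = L * y ^ A + 7 / \<rho> * (C1 * y)"
    have \<Lambda>: "\<Lambda> \<ge> 0" using L(1) C1(1) y \<rho> by (simp add: \<Lambda>_def)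
    have l1: "\<bar>\<psi>1 s - \<psi>1 s'\<bar> \<le> \<Lambda> * \<bar>s - s'\<bar>" if ss: "\<bar>s - s'\<bar> \<le> 1 / real q" for s s'
    proof (cases "d s \<le> 2 * \<rho> \<and> d s' \<le> 2 * \<rho>")
      case True
      then show ?thesis using \<tau>0 \<Lambda> by (simp add: \<psi>1_def)
    next
      case False
      have far: "d u \<ge> \<rho>" if "u \<in> {min s s'..max s s'}" for u
      proof -
        have "\<bar>u - s\<bar> \<le> 1 / real q" "\<bar>u - s'\<bar> \<le> 1 / real q" using that ss by (auto simp: min_def max_def split: if_splits)
        then have "7 * \<bar>u - s\<bar> \<le> 7 * (1 / real q)" "7 * \<bar>u - s'\<bar> \<le> 7 * (1 / real q)" by simp_all
        then have "7 * \<bar>u - s\<bar> \<le> \<rho>" "7 * \<bar>u - s'\<bar> \<le> \<rho>" using q\<rho> by (meson order_trans)+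
        then have "d u \<ge> d s - \<rho>" "d u \<ge> d s' - \<rho>" using dl[of u s] dl[of u s'] by linarith+
        then show ?thesis using False by linarith
      qed
      have hl: "\<bar>h s - h s'\<bar> \<le> L * y ^ A * \<bar>s - s'\<bar>"
      proof (cases "s \<le> s'")
        case True
        then show ?thesis unfolding y_def using far by (intro L(2)[OF \<rho>]) auto
      next
        case False
        then have "\<bar>h s' - h s\<bar> \<le> L * y ^ A * \<bar>s' - s\<bar>" unfolding y_def using far by (intro L(2)[OF \<rho>]) auto
        then show ?thesis by (simp add: abs_minus_commute)
      qed
      have hb: "\<bar>h s\<bar> \<le> C1 * y" unfolding y_def using far by (intro C1(2)[OF \<rho>]) auto
      have "\<psi>1 s - \<psi>1 s' = h s * (\<tau> s - \<tau> s') + \<tau> s' * (h s - h s')" by (simp add: \<psi>1_def algebra_simps)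
      then have "\<bar>\<psi>1 s - \<psi>1 s'\<bar> \<le> \<bar>h s\<bar> * \<bar>\<tau> s - \<tau> s'\<bar> + \<bar>\<tau> s'\<bar> * \<bar>h s - h s'\<bar>"
        by (metis abs_mult abs_triangle_ineq)
      also have "\<dots> \<le> (C1 * y) * (7 / \<rho> * \<bar>s - s'\<bar>) + 1 * (L * y ^ A * \<bar>s - s'\<bar>)"
        using hb hl \<tau>l[of s s'] \<tau>[of s'] C1(1) y by (intro add_mono mult_mono) auto
      also have "\<dots> = \<Lambda> * \<bar>s - s'\<bar>" by (simp add: \<Lambda>_def algebra_simps)
      finally show ?thesis .
    qed
    have m1: "\<bar>\<psi>1 s\<bar> \<le> C1 * y" for s
    proof (cases "d s \<le> 2 * \<rho>")
      case True
      then show ?thesis using \<tau>0 C1(1) y by (simp add: \<psi>1_def)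
    next
      case False
      then have "\<bar>h s\<bar> \<le> C1 * y" unfolding y_def using \<rho> by (intro C1(2)[OF \<rho>]) auto
      then have "\<bar>h s\<bar> * \<bar>\<tau> s\<bar> \<le> (C1 * y) * 1" using \<tau>[of s] C1(1) y by (intro mult_mono) auto
      then show ?thesis by (simp add: \<psi>1_def abs_mult)
    qed
    have l2: "\<bar>\<psi>2 s - \<psi>2 s'\<bar> \<le> 7 / \<rho> * \<bar>s - s'\<bar>" for s s'
      using \<tau>l[of s' s] by (simp add: \<psi>2_def abs_minus_commute)
    have m2: "\<bar>\<psi>2 s\<bar> \<le> 1" "0 \<le> \<psi>2 s" for s using \<tau>[of s] by (auto simp: \<psi>2_def)
    have cop: "coprime p (int q)" using pq(1) q' by simp
    have e1: "\<bar>(\<Sum>m=1..k. \<psi>1 (real m * t)) - real k * integral {0..1} \<psi>1\<bar> \<le> 2 * \<Lambda> * real k / real q + 2 * real q * (C1 * y)"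
      by (rule rotation_sum_error[of \<psi>1, OF p1 q(1) cop approx l1 \<Lambda> m1])
    have e2: "\<bar>(\<Sum>m=1..k. \<psi>2 (real m * t)) - real k * integral {0..1} \<psi>2\<bar> \<le> 2 * (7 / \<rho>) * real k / real q + 2 * real q * 1"
      by (rule rotation_sum_error[of \<psi>2, OF p2 q(1) cop approx l2 _ m2(1)]) (use \<rho> in auto)
    have qp: "1 / real q > 0" using q by simp
    have c1: "set_integrable lborel {0..1} \<psi>1" "set_integrable lborel {0..1} \<psi>2"
      by (rule borel_integrable_atLeastAtMost', rule continuous_of_small_scale_lipschitz[OF qp l1], assumption)
        (rule borel_integrable_atLeastAtMost', rule continuous_of_small_scale_lipschitz[OF qp l2])
    \<comment> \<open>A Markov-type bound: the complement of the cutoff is at most 1 and vanishes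
      beyond \<open>3 * \<rho>\<close>, so every positive power of \<open>3 * \<rho> / d s\<close>
      dominates it.\<close>
    have near: "\<psi>2 s \<le> (3 * \<rho>) powr e * d s powr - e" if "d s > 0" "e > 0" for s e
    proof (cases "d s \<ge> 3 * \<rho>")
      case True
      then show ?thesis using \<tau>1 by (simp add: \<psi>2_def)
    next
      case False
      have "1 \<le> (3 * \<rho> / d s) powr e" using False that \<rho> by (intro ge_one_powr_ge_zero) auto
      also have "\<dots> = (3 * \<rho>) powr e * d s powr - e" by (simp add: powr_divide powr_minus_divide)
      finally show ?thesis using m2(1)[of s] by linarith
    qed
    have i2: "integral {0..1} \<psi>2 \<le> (3 * \<rho>) powr (1 / 2) * I"
    proof -
      have "integral {0..1} \<psi>2 = (LINT s:{0..1}|lborel. \<psi>2 s)" by (rule set_borel_integral_eq_integral(2)[OF c1(2), symmetric])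
      also have "\<dots> \<le> (LINT s:{0..1}|lborel. (3 * \<rho>) powr (1 / 2) * d s powr (- 1 / 2))"
      proof (rule set_integral_mono_AE[OF c1(2)])
        show "set_integrable lborel {0..1} (\<lambda>s. (3 * \<rho>) powr (1 / 2) * d s powr (- 1 / 2))"
          using di(1) by (rule set_integrable_mult_right)
        show "AE s\<in>{0..1} in lborel. \<psi>2 s \<le> (3 * \<rho>) powr (1 / 2) * d s powr (- 1 / 2)"
          using di(2)
        proof eventually_elim
          case (elim s)
          then show ?case using near[of s "1 / 2"] by auto
        qed
      qed
      also have "\<dots> = (3 * \<rho>) powr (1 / 2) * I" unfolding I_def by simp
      finally show ?thesis .
    qed
    define J where "J = (LINT s:{0..1}|lborel. h s * \<psi>2 s)"
    have h2: "(\<lambda>s. h s * \<psi>2 s) = (\<lambda>s. h s - \<psi>1 s)" by (auto simp: \<psi>1_def \<psi>2_def algebra_simps)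
    have hi2: "set_integrable lborel {0..1} (\<lambda>s. h s * \<psi>2 s)" unfolding h2 by (rule set_integral_diff[OF hi c1(1)])
    have split: "(LINT s:{0..1}|lborel. h s) = integral {0..1} \<psi>1 + J"
      unfolding J_def h2 using set_integral_diff(2)[OF hi c1(1)] set_borel_integral_eq_integral(2)[OF c1(1)] by simp
    \<comment> \<open>One power \<open>- (1 / 4)\<close> of the distance comes from the size of
      \<open>h\<close> and one from \<open>near\<close>; their product is the integrable power
      \<open>- 1 / 2\<close>, and a power of \<rho> is gained.\<close>
    have J: "\<bar>J\<bar> \<le> C4 * (3 * \<rho>) powr (1 / 4) * I"
    proof -
      have "\<bar>J\<bar> \<le> (LINT s:{0..1}|lborel. \<bar>h s * \<psi>2 s\<bar>)"
        unfolding J_def using set_integral_norm_bound[OF hi2] by simp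
      also have "\<dots> \<le> (LINT s:{0..1}|lborel. C4 * (3 * \<rho>) powr (1 / 4) * d s powr (- 1 / 2))"
      proof (rule set_integral_mono_AE)
        show "set_integrable lborel {0..1} (\<lambda>s. \<bar>h s * \<psi>2 s\<bar>)" using set_integrable_norm[OF hi2] by simp
        show "set_integrable lborel {0..1} (\<lambda>s. C4 * (3 * \<rho>) powr (1 / 4) * d s powr (- 1 / 2))"
          using di(1) by (rule set_integrable_mult_right)
        show "AE s\<in>{0..1} in lborel. \<bar>h s * \<psi>2 s\<bar> \<le> C4 * (3 * \<rho>) powr (1 / 4) * d s powr (- 1 / 2)"
          using di(2)
        proof eventually_elim
          case (elim s)
          show ?case
          proof
            assume "s \<in> {0..1}"
            then have ds: "d s > 0" using elim by simp
            have "\<bar>h s * \<psi>2 s\<bar> \<le> (C4 * d s powr - (1 / 4)) * ((3 * \<rho>) powr (1 / 4) * d s powr - (1 / 4))"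
              unfolding abs_mult using C4(2)[OF ds] near[OF ds q4] m2(2)[of s] C4(1) by (intro mult_mono) auto
            also have "\<dots> = C4 * (3 * \<rho>) powr (1 / 4) * (d s powr - (1 / 4) * d s powr - (1 / 4))" by simp
            also have "d s powr - (1 / 4) * d s powr - (1 / 4) = d s powr (- 1 / 2)" by (simp flip: powr_add)
            finally show "\<bar>h s * \<psi>2 s\<bar> \<le> C4 * (3 * \<rho>) powr (1 / 4) * d s powr (- 1 / 2)" .
          qed
        qed
      qed
      also have "\<dots> = C4 * (3 * \<rho>) powr (1 / 4) * I" unfolding I_def by simp
      finally show ?thesis .
    qed
    \<comment> \<open>Near \<open>Z\<close> the values along the orbit are bounded by the growth
      clause, and the number of visits by the sum of \<open>\<psi>2\<close>.\<close>
    have near_sum: "\<bar>\<Sum>m=1..k. h (real m * t) * \<psi>2 (real m * t)\<bar> \<le> \<bar>B\<bar> * real k powr \<eta> * (\<Sum>m=1..k. \<psi>2 (real m * t))"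
      unfolding sum_distrib_left
    proof (rule order.trans[OF sum_abs sum_mono])
      fix m assume m: "m \<in> {1..k}"
      have "\<bar>h (real m * t)\<bar> \<le> B * real m powr \<eta>" using B m by simp
      also have "\<dots> \<le> \<bar>B\<bar> * real k powr \<eta>" using m \<eta> by (intro mult_mono powr_mono2) auto
      finally show "\<bar>h (real m * t) * \<psi>2 (real m * t)\<bar> \<le> \<bar>B\<bar> * real k powr \<eta> * \<psi>2 (real m * t)"
        unfolding abs_mult using m2(2)[of "real m * t"] by (simp add: mult_right_mono)
    qed
    have k1: "x * real k powr e \<le> x * real k powr (1 - \<eta>)" if "x \<ge> 0" "e \<le> 1 - \<eta>" for x e
      using that k by (intro mult_left_mono powr_mono) auto
    have pw: "real k * real k powr e = real k powr (1 + e)" for e using k by (simp add: powr_add)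
    have pk: "real k powr a * real k powr b = real k powr (a + b)" for a b by (simp add: powr_add)
    have T1: "2 * \<Lambda> * real k / real q \<le> D1 * real k powr (1 - \<eta>)"
    proof -
      have "\<Lambda> \<le> (L + 7 * C1) * y ^ (A + 2)"
      proof -
        have 1: "L * y ^ A \<le> L * y ^ (A + 2)" using y L(1) by (intro mult_left_mono power_increasing) auto
        have "1 / \<rho> * y \<le> y * y" using y by (intro mult_right_mono) auto
        also have "\<dots> \<le> y ^ (A + 2)" using y power_increasing[of 2 "A + 2" y] by (simp add: power2_eq_square)
        finally have "(7 * C1) * (1 / \<rho> * y) \<le> (7 * C1) * y ^ (A + 2)"
          using C1(1) by (intro mult_left_mono) auto
        moreover have "7 / \<rho> * (C1 * y) = (7 * C1) * (1 / \<rho> * y)" by simp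
        ultimately show ?thesis unfolding \<Lambda>_def distrib_right using 1 by linarith
      qed
      also have "\<dots> \<le> (L + 7 * C1) * (Y * real k powr \<epsilon>) ^ (A + 2)"
        using yY y L(1) C1(1) by (intro mult_left_mono power_mono) auto
      also have "(Y * real k powr \<epsilon>) ^ (A + 2) = Y ^ (A + 2) * real k powr (\<epsilon> * (real A + 2))"
      proof -
        have "(real k powr \<epsilon>) ^ (A + 2) = (real k powr \<epsilon>) powr real (A + 2)"
          using k by (intro powr_realpow[symmetric]) simp
        also have "\<dots> = real k powr (\<epsilon> * (real A + 2))" unfolding powr_powr by (simp add: add.commute)
        finally show ?thesis unfolding power_mult_distrib by simp
      qed
      finally have l: "\<Lambda> \<le> (L + 7 * C1) * (Y ^ (A + 2) * real k powr (\<epsilon> * (real A + 2)))" .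
      have "2 * \<Lambda> * real k / real q = 2 * \<Lambda> * real k * (1 / real q)" by simp
      also have "\<dots> \<le> 2 * ((L + 7 * C1) * (Y ^ (A + 2) * real k powr (\<epsilon> * (real A + 2)))) * real k * (real k powr - \<mu> / K')"
        using l qinv \<Lambda> by (intro mult_mono) auto
      also have "\<dots> = D1 * (real k * (real k powr (\<epsilon> * (real A + 2)) * real k powr - \<mu>))"
        by (simp add: D1_def)
      also have "\<dots> = D1 * real k powr (1 + (\<epsilon> * (real A + 2) + - \<mu>))" unfolding pk pw ..
      also have "\<dots> \<le> D1 * real k powr (1 - \<eta>)"
        using \<epsilon>3 \<epsilon>(1) \<mu> A\<epsilon> by (intro k1 Dpos) (simp add: \<eta>_def algebra_simps)
      finally show ?thesis .
    qed
    have T2: "2 * real q * (C1 * y) \<le> D2 * real k powr (1 - \<eta>)"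
    proof -
      have "2 * real q * (C1 * y) \<le> 2 * (2 * real k powr (1 / 2)) * (C1 * (Y * real k powr \<epsilon>))"
        using q2 yY y C1(1) by (intro mult_mono mult_left_mono) auto
      also have "\<dots> = D2 * (real k powr (1 / 2) * real k powr \<epsilon>)" by (simp add: D2_def)
      also have "\<dots> = D2 * real k powr (1 / 2 + \<epsilon>)" unfolding pk ..
      also have "\<dots> \<le> D2 * real k powr (1 - \<eta>)"
        using \<epsilon>3 \<epsilon>(1) \<mu> A\<epsilon> by (intro k1 Dpos) (unfold \<eta>_def, linarith)
      finally show ?thesis .
    qed
    have T3: "\<bar>B\<bar> * real k powr \<eta> * (real k * ((3 * \<rho>) powr (1 / 2) * I)) \<le> D3 * real k powr (1 - \<eta>)"
    proof -
      have r: "(3 * \<rho>) powr (1 / 2) = sqrt (3 * c0) * real k powr (- \<epsilon> * (1 / 2))"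
        unfolding \<rho>_def using c0 by (simp add: powr_mult powr_powr powr_half_sqrt real_sqrt_mult)
      have "\<bar>B\<bar> * real k powr \<eta> * (real k * ((3 * \<rho>) powr (1 / 2) * I)) = D3 * (real k * (real k powr \<eta> * real k powr (- \<epsilon> * (1 / 2))))"
        unfolding r by (simp add: D3_def)
      also have "\<dots> = D3 * real k powr (1 + (\<eta> + - \<epsilon> * (1 / 2)))" unfolding pk pw ..
      also have "\<dots> \<le> D3 * real k powr (1 - \<eta>)" using \<epsilon> by (intro k1 Dpos) (unfold \<eta>_def, linarith)
      finally show ?thesis .
    qed
    have T4: "\<bar>B\<bar> * real k powr \<eta> * (2 * (7 / \<rho>) * real k / real q) \<le> D4 * real k powr (1 - \<eta>)"
    proof -
      have "\<bar>B\<bar> * real k powr \<eta> * (2 * (7 / \<rho>) * real k / real q) = \<bar>B\<bar> * real k powr \<eta> * (14 * (1 / \<rho>) * real k) * (1 / real q)" by simp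
      also have "\<dots> \<le> \<bar>B\<bar> * real k powr \<eta> * (14 * (1 / \<rho>) * real k) * (real k powr - \<mu> / K')"
        using qinv \<rho> by (intro mult_left_mono) auto
      also have "\<dots> = D4 * (real k * (real k powr \<eta> * (real k powr \<epsilon> * real k powr - \<mu>)))"
        unfolding r1 by (simp add: D4_def)
      also have "\<dots> = D4 * real k powr (1 + (\<eta> + (\<epsilon> + - \<mu>)))" unfolding pk pw ..
      also have "\<dots> \<le> D4 * real k powr (1 - \<eta>)" using \<epsilon>3 \<epsilon>(1) A\<epsilon> \<mu> by (intro k1 Dpos) (unfold \<eta>_def, linarith)
      finally show ?thesis .
    qed
    have T5: "\<bar>B\<bar> * real k powr \<eta> * (2 * real q * 1) \<le> D5 * real k powr (1 - \<eta>)"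
    proof -
      have "\<bar>B\<bar> * real k powr \<eta> * (2 * real q * 1) \<le> \<bar>B\<bar> * real k powr \<eta> * (2 * (2 * real k powr (1 / 2)) * 1)"
        using q2 by (intro mult_left_mono) auto
      also have "\<dots> = D5 * (real k powr \<eta> * real k powr (1 / 2))" by (simp add: D5_def)
      also have "\<dots> = D5 * real k powr (\<eta> + 1 / 2)" unfolding pk ..
      also have "\<dots> \<le> D5 * real k powr (1 - \<eta>)" using \<epsilon>3 \<epsilon>(1) A\<epsilon> \<mu> by (intro k1 Dpos) (unfold \<eta>_def, linarith)
      finally show ?thesis .
    qed
    have T6: "real k * \<bar>J\<bar> \<le> D6 * real k powr (1 - \<eta>)"
    proof -
      have r: "(3 * \<rho>) powr (1 / 4) = (3 * c0) powr (1 / 4) * real k powr (- \<epsilon> * (1 / 4))"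
        unfolding \<rho>_def using c0 by (simp add: powr_mult powr_powr mult.assoc[symmetric])
      have "real k * \<bar>J\<bar> \<le> real k * (C4 * (3 * \<rho>) powr (1 / 4) * I)" using J by (intro mult_left_mono) auto
      also have "\<dots> = D6 * (real k * real k powr (- \<epsilon> * (1 / 4)))" unfolding r by (simp add: D6_def)
      also have "\<dots> = D6 * real k powr (1 + - \<epsilon> * (1 / 4))" unfolding pw ..
      also have "\<dots> \<le> D6 * real k powr (1 - \<eta>)" using \<epsilon> by (intro k1 Dpos) (unfold \<eta>_def, linarith)
      finally show ?thesis .
    qed
    have "(\<Sum>m=1..k. h (real m * t)) = (\<Sum>m=1..k. \<psi>1 (real m * t)) + (\<Sum>m=1..k. h (real m * t) * \<psi>2 (real m * t))"
      unfolding sum.distrib[symmetric] by (intro sum.cong) (auto simp: \<psi>1_def \<psi>2_def algebra_simps)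
    then have eq: "(\<Sum>m=1..k. h (real m * t)) - real k * (LINT s:{0..1}|lborel. h s)
        = ((\<Sum>m=1..k. \<psi>1 (real m * t)) - real k * integral {0..1} \<psi>1)
          + (\<Sum>m=1..k. h (real m * t) * \<psi>2 (real m * t)) - real k * J"
      unfolding split by (simp add: algebra_simps)
    have s2: "(\<Sum>m=1..k. \<psi>2 (real m * t)) \<le> real k * ((3 * \<rho>) powr (1 / 2) * I) + 2 * (7 / \<rho>) * real k / real q + 2 * real q * 1"
      using e2 mult_left_mono[OF i2, of "real k"] by linarith
    have "\<bar>B\<bar> * real k powr \<eta> * (\<Sum>m=1..k. \<psi>2 (real m * t)) \<le>
        \<bar>B\<bar> * real k powr \<eta> * (real k * ((3 * \<rho>) powr (1 / 2) * I) + 2 * (7 / \<rho>) * real k / real q + 2 * real q * 1)"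
      using s2 by (intro mult_left_mono) auto
    also have "\<dots> \<le> D3 * real k powr (1 - \<eta>) + D4 * real k powr (1 - \<eta>) + D5 * real k powr (1 - \<eta>)"
      unfolding distrib_left using T3 T4 T5 by linarith
    finally have ns: "\<bar>\<Sum>m=1..k. h (real m * t) * \<psi>2 (real m * t)\<bar> \<le> D3 * real k powr (1 - \<eta>) + D4 * real k powr (1 - \<eta>) + D5 * real k powr (1 - \<eta>)"
      using near_sum by linarith
    have "\<bar>real k * J\<bar> = real k * \<bar>J\<bar>" by (simp add: abs_mult)
    then show ?thesis unfolding eq distrib_right using e1 T1 T2 T6 ns by linarith
  qed
  show ?thesis
    unfolding power_mean_def
  proof (intro conjI)
    have "\<eta> \<le> 1" using \<epsilon>3 \<epsilon>(1) A\<epsilon> \<mu> unfolding \<eta>_def by linarith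
    then show "\<exists>\<delta>>0. \<delta> \<le> 1 \<and> (\<exists>C. \<forall>k\<ge>1. \<bar>(\<Sum>m=1..k. \<phi> (x ^ m)) - real k * (LINT s:{0..1}|lborel. \<phi> (cis (2 * pi * s)))\<bar> \<le> C * real k powr (1 - \<delta>))"
      using main \<eta> unfolding xm h_def by blast
    show "\<forall>\<eta>>0. \<exists>B. \<forall>m\<ge>1. \<bar>\<phi> (x ^ m)\<bar> \<le> B * real m powr \<eta>" using \<phi> unfolding circle_tame_def by blast
  qed
qed

lemma circle_tame_lincomb:
  assumes f: "circle_tame Z x \<phi>" and g: "circle_tame Z x \<psi>"
  shows "circle_tame Z x (\<lambda>z. u * \<phi> z + v * \<psi> z)"
  unfolding circle_tame_def
proof (intro conjI allI impI)
  fix \<eta> :: real assume \<eta>: "\<eta> > 0"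
  obtain C where C: "C \<ge> 0" "\<And>s. circle_dist Z s > 0 \<Longrightarrow> \<bar>\<phi> (cis (2 * pi * s))\<bar> \<le> C * circle_dist Z s powr - \<eta>"
    using circle_tame_bound[OF f \<eta>] by blast
  obtain D where D: "D \<ge> 0" "\<And>s. circle_dist Z s > 0 \<Longrightarrow> \<bar>\<psi> (cis (2 * pi * s))\<bar> \<le> D * circle_dist Z s powr - \<eta>"
    using circle_tame_bound[OF g \<eta>] by blast
  have tri: "\<bar>u * p + v * q\<bar> \<le> (\<bar>u\<bar> * P + \<bar>v\<bar> * Q) * w" if "\<bar>p\<bar> \<le> P * w" "\<bar>q\<bar> \<le> Q * w" for p q P Q w :: real
  proof -
    have "\<bar>u * p + v * q\<bar> \<le> \<bar>u\<bar> * \<bar>p\<bar> + \<bar>v\<bar> * \<bar>q\<bar>" by (metis abs_mult abs_triangle_ineq)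
    also have "\<dots> \<le> \<bar>u\<bar> * (P * w) + \<bar>v\<bar> * (Q * w)" using that by (intro add_mono mult_left_mono) auto
    finally show ?thesis by (simp add: algebra_simps)
  qed
  show "\<exists>C. \<forall>s. circle_dist Z s > 0 \<longrightarrow> \<bar>u * \<phi> (cis (2 * pi * s)) + v * \<psi> (cis (2 * pi * s))\<bar> \<le> C * circle_dist Z s powr - \<eta>"
    using tri C(2) D(2) by blast
  obtain C where C: "\<And>m. m \<ge> 1 \<Longrightarrow> \<bar>\<phi> (x ^ m)\<bar> \<le> C * real m powr \<eta>"
    using f \<eta> unfolding circle_tame_def by blast
  obtain D where D: "\<And>m. m \<ge> 1 \<Longrightarrow> \<bar>\<psi> (x ^ m)\<bar> \<le> D * real m powr \<eta>"
    using g \<eta> unfolding circle_tame_def by blast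
  show "\<exists>B. \<forall>m\<ge>1. \<bar>u * \<phi> (x ^ m) + v * \<psi> (x ^ m)\<bar> \<le> B * real m powr \<eta>"
    using tri C D by blast
next
  obtain C\<^sub>3 A where C3: "C\<^sub>3 \<ge> 0" "\<And>\<rho> s s'. \<rho> > 0 \<Longrightarrow> s \<le> s' \<Longrightarrow> (\<And>u. u \<in> {s..s'} \<Longrightarrow> circle_dist Z u \<ge> \<rho>) \<Longrightarrow>
     \<bar>\<phi> (cis (2 * pi * s)) - \<phi> (cis (2 * pi * s'))\<bar> \<le> C\<^sub>3 * (1 + 1 / \<rho>) ^ A * \<bar>s - s'\<bar>"
    using circle_tame_lipschitz[OF f] by blast
  obtain C\<^sub>4 B where C4: "C\<^sub>4 \<ge> 0" "\<And>\<rho> s s'. \<rho> > 0 \<Longrightarrow> s \<le> s' \<Longrightarrow> (\<And>u. u \<in> {s..s'} \<Longrightarrow> circle_dist Z u \<ge> \<rho>) \<Longrightarrow>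
     \<bar>\<psi> (cis (2 * pi * s)) - \<psi> (cis (2 * pi * s'))\<bar> \<le> C\<^sub>4 * (1 + 1 / \<rho>) ^ B * \<bar>s - s'\<bar>"
    using circle_tame_lipschitz[OF g] by blast
  show "\<exists>C A. \<forall>\<rho>>0. \<forall>s s'. s \<le> s' \<longrightarrow> (\<forall>u\<in>{s..s'}. circle_dist Z u \<ge> \<rho>) \<longrightarrow>
      \<bar>(u * \<phi> (cis (2 * pi * s)) + v * \<psi> (cis (2 * pi * s))) - (u * \<phi> (cis (2 * pi * s')) + v * \<psi> (cis (2 * pi * s')))\<bar>
        \<le> C * (1 + 1 / \<rho>) ^ A * \<bar>s - s'\<bar>"
  proof (rule exI[of _ "\<bar>u\<bar> * C\<^sub>3 + \<bar>v\<bar> * C\<^sub>4"], rule exI[of _ "A + B"], intro allI impI)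
    fix \<rho> s s' :: real assume r: "\<rho> > 0" "s \<le> s'" "\<forall>u\<in>{s..s'}. circle_dist Z u \<ge> \<rho>"
    define y where "y = 1 + 1 / \<rho>"
    have y: "y \<ge> 1" using r by (simp add: y_def)
    have yA: "y ^ A \<le> y ^ (A + B)" "y ^ B \<le> y ^ (A + B)" using y by (auto intro: power_increasing)
    define p where "p = \<phi> (cis (2 * pi * s)) - \<phi> (cis (2 * pi * s'))"
    define q where "q = \<psi> (cis (2 * pi * s)) - \<psi> (cis (2 * pi * s'))"
    have "\<bar>p\<bar> \<le> C\<^sub>3 * y ^ A * \<bar>s - s'\<bar>" unfolding p_def y_def using r by (intro C3(2)) auto
    also have "\<dots> \<le> C\<^sub>3 * y ^ (A + B) * \<bar>s - s'\<bar>" using yA C3(1) by (intro mult_right_mono mult_left_mono) auto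
    finally have b3: "\<bar>p\<bar> \<le> C\<^sub>3 * y ^ (A + B) * \<bar>s - s'\<bar>" .
    have "\<bar>q\<bar> \<le> C\<^sub>4 * y ^ B * \<bar>s - s'\<bar>" unfolding q_def y_def using r by (intro C4(2)) auto
    also have "\<dots> \<le> C\<^sub>4 * y ^ (A + B) * \<bar>s - s'\<bar>" using yA C4(1) by (intro mult_right_mono mult_left_mono) auto
    finally have b4: "\<bar>q\<bar> \<le> C\<^sub>4 * y ^ (A + B) * \<bar>s - s'\<bar>" .
    have "\<bar>u * p + v * q\<bar> \<le> \<bar>u\<bar> * \<bar>p\<bar> + \<bar>v\<bar> * \<bar>q\<bar>" by (metis abs_mult abs_triangle_ineq)
    also have "\<dots> \<le> \<bar>u\<bar> * (C\<^sub>3 * y ^ (A + B) * \<bar>s - s'\<bar>) + \<bar>v\<bar> * (C\<^sub>4 * y ^ (A + B) * \<bar>s - s'\<bar>)"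
      using b3 b4 by (intro add_mono mult_left_mono) auto
    also have "\<dots> = (\<bar>u\<bar> * C\<^sub>3 + \<bar>v\<bar> * C\<^sub>4) * y ^ (A + B) * \<bar>s - s'\<bar>" by (simp add: algebra_simps)
    finally show "\<bar>(u * \<phi> (cis (2 * pi * s)) + v * \<psi> (cis (2 * pi * s))) - (u * \<phi> (cis (2 * pi * s')) + v * \<psi> (cis (2 * pi * s')))\<bar>
        \<le> (\<bar>u\<bar> * C\<^sub>3 + \<bar>v\<bar> * C\<^sub>4) * (1 + 1 / \<rho>) ^ (A + B) * \<bar>s - s'\<bar>"
      by (simp add: p_def q_def y_def right_diff_distrib algebra_simps)
  qed
qed

text \<open>Off \<open>Z\<close> the function is continuous, so a nonzero value would persist on an
  interval and make the integral positive. It will be applied to linear forms in the null space of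
  the covariance.\<close>

lemma circle_tame_eq_0:
  assumes Z: "finite Z" "Z \<noteq> {}" "Z \<subseteq> sphere 0 1" and \<phi>: "circle_tame Z x \<phi>"
    and int: "(LINT s:{0..1}|lborel. \<phi> (cis (2 * pi * s)) * \<phi> (cis (2 * pi * s))) = 0" and s: "circle_dist Z s > 0"
  shows "\<phi> (cis (2 * pi * s)) = 0"
proof (rule ccontr)
  define h where "h s = \<phi> (cis (2 * pi * s))" for s
  assume "\<phi> (cis (2 * pi * s)) \<noteq> 0"
  define s0 where "s0 = frac s"
  have per: "cis (2 * pi * s) = cis (2 * pi * s0)"
    using periodic_of_int[of "\<lambda>s. cis (2 * pi * s)" s0 "\<lfloor>s\<rfloor>", OF cis_period] by (simp add: s0_def frac_def)
  have h0: "h s0 \<noteq> 0" "circle_dist Z s0 > 0"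
    using \<open>\<phi> (cis (2 * pi * s)) \<noteq> 0\<close> s unfolding h_def circle_dist_def per by auto
  have s01: "0 \<le> s0" "s0 < 1" using frac_lt_1[of s] by (auto simp: s0_def)
  define U where "U = {s. circle_dist Z s > 0}"
  have U: "open U" unfolding U_def by (rule circle_tame_continuous_on(1)[OF \<phi>])
  have ch: "continuous_on U h" unfolding U_def h_def by (rule circle_tame_continuous_on(2)[OF \<phi>])
  have "open (U \<inter> h -` (- {0}))" using continuous_open_preimage[OF ch U] by (simp add: open_Compl)
  then obtain e where e: "e > 0" "\<And>u. \<bar>u - s0\<bar> < e \<Longrightarrow> h u \<noteq> 0"
    using h0 unfolding open_dist U_def dist_real_def by fastforce
  have i: "set_integrable lborel {0..1} (\<lambda>s. h s * h s)"
    unfolding h_def by (rule circle_tame_set_integrable[OF Z circle_tame_mult[OF \<phi> \<phi>]])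
  have "AE s in lborel. indicator {0..1} s *\<^sub>R (h s * h s) = 0"
    using integral_nonneg_eq_0_iff_AE[OF i[unfolded set_integrable_def]] int
    by (simp add: set_lebesgue_integral_def h_def)
  then have ae: "AE s in lborel. s \<in> {0..1} \<longrightarrow> h s = 0"
    by eventually_elim (auto simp: indicator_def split: if_splits)
  \<comment> \<open>The interval extends to the right of \<open>s0\<close>, which is less than 1, so
    it has positive length inside \<open>{0..1}\<close> even if \<open>s0\<close> is 0.\<close>
  define b where "b = min 1 (s0 + e)"
  have b: "s0 < b" "b \<le> 1" "b \<le> s0 + e" using s01 e by (auto simp: b_def)
  have "AE s in lborel. s \<notin> {s0<..<b}"
    using ae
  proof eventually_elim
    case (elim u)
    show ?case
    proof
      assume u: "u \<in> {s0<..<b}"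
      then have "h u \<noteq> 0" using b by (intro e) auto
      moreover have "u \<in> {0..1}" using u b s01 by auto
      ultimately show False using elim by blast
    qed
  qed
  moreover have "(AE s in lborel. s \<notin> {s0<..<b}) \<longleftrightarrow> emeasure lborel {s0<..<b} = 0"
    by (rule AE_iff_measurable) auto
  ultimately have "emeasure lborel {s0<..<b} = 0" by blast
  then show False using b(1) by simp
qed

section \<open>Stability of power means\<close>

lemma power_mean_lincomb:
  assumes "power_mean H \<mu>" "power_mean G \<nu>"
  shows "power_mean (\<lambda>m. a * H m + b * G m) (a * \<mu> + b * \<nu>)"
  unfolding power_mean_def
proof (intro conjI allI impI)
  obtain \<delta> C where 1: "\<delta> > 0" "\<delta> \<le> 1" "\<And>k. k \<ge> 1 \<Longrightarrow> \<bar>(\<Sum>m=1..k. H m) - real k * \<mu>\<bar> \<le> C * real k powr (1 - \<delta>)"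
    using assms(1) by (auto simp: power_mean_def)
  obtain \<delta>' C' where 2: "\<delta>' > 0" "\<delta>' \<le> 1" "\<And>k. k \<ge> 1 \<Longrightarrow> \<bar>(\<Sum>m=1..k. G m) - real k * \<nu>\<bar> \<le> C' * real k powr (1 - \<delta>')"
    using assms(2) by (auto simp: power_mean_def)
  define e where "e = min \<delta> \<delta>'"
  have e: "e > 0" "e \<le> 1" using 1 2 by (auto simp: e_def)
  have "\<bar>(\<Sum>m=1..k. a * H m + b * G m) - real k * (a * \<mu> + b * \<nu>)\<bar> \<le> (\<bar>a\<bar> * \<bar>C\<bar> + \<bar>b\<bar> * \<bar>C'\<bar>) * real k powr (1 - e)"
    if k: "k \<ge> 1" for k
  proof -
    have A: "\<bar>(\<Sum>m=1..k. H m) - real k * \<mu>\<bar> \<le> \<bar>C\<bar> * real k powr (1 - e)"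
    proof -
      have "C * real k powr (1 - \<delta>) \<le> \<bar>C\<bar> * real k powr (1 - e)"
        using k by (intro mult_mono powr_mono) (auto simp: e_def)
      then show ?thesis using 1(3)[OF k] by linarith
    qed
    have B: "\<bar>(\<Sum>m=1..k. G m) - real k * \<nu>\<bar> \<le> \<bar>C'\<bar> * real k powr (1 - e)"
    proof -
      have "C' * real k powr (1 - \<delta>') \<le> \<bar>C'\<bar> * real k powr (1 - e)"
        using k by (intro mult_mono powr_mono) (auto simp: e_def)
      then show ?thesis using 2(3)[OF k] by linarith
    qed
    have "(\<Sum>m=1..k. a * H m + b * G m) - real k * (a * \<mu> + b * \<nu>)
        = a * ((\<Sum>m=1..k. H m) - real k * \<mu>) + b * ((\<Sum>m=1..k. G m) - real k * \<nu>)"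
      by (simp add: sum.distrib sum_distrib_left algebra_simps)
    also have "\<bar>\<dots>\<bar> \<le> \<bar>a\<bar> * \<bar>(\<Sum>m=1..k. H m) - real k * \<mu>\<bar> + \<bar>b\<bar> * \<bar>(\<Sum>m=1..k. G m) - real k * \<nu>\<bar>"
      by (metis abs_mult abs_triangle_ineq)
    also have "\<dots> \<le> \<bar>a\<bar> * (\<bar>C\<bar> * real k powr (1 - e)) + \<bar>b\<bar> * (\<bar>C'\<bar> * real k powr (1 - e))"
      using A B by (intro add_mono mult_left_mono) auto
    finally show ?thesis by (simp add: algebra_simps)
  qed
  then show "\<exists>\<delta>>0. \<delta> \<le> 1 \<and> (\<exists>C. \<forall>k\<ge>1. \<bar>(\<Sum>m=1..k. a * H m + b * G m) - real k * (a * \<mu> + b * \<nu>)\<bar> \<le> C * real k powr (1 - \<delta>))"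
    using e by blast
  fix \<eta> :: real assume "\<eta> > 0"
  then obtain B B' where B: "\<And>m. m \<ge> 1 \<Longrightarrow> \<bar>H m\<bar> \<le> B * real m powr \<eta>" "\<And>m. m \<ge> 1 \<Longrightarrow> \<bar>G m\<bar> \<le> B' * real m powr \<eta>"
    using assms unfolding power_mean_def by blast
  have "\<bar>a * H m + b * G m\<bar> \<le> (\<bar>a\<bar> * B + \<bar>b\<bar> * B') * real m powr \<eta>" if m: "m \<ge> 1" for m
  proof -
    have "\<bar>a * H m + b * G m\<bar> \<le> \<bar>a\<bar> * \<bar>H m\<bar> + \<bar>b\<bar> * \<bar>G m\<bar>" by (metis abs_mult abs_triangle_ineq)
    also have "\<dots> \<le> \<bar>a\<bar> * (B * real m powr \<eta>) + \<bar>b\<bar> * (B' * real m powr \<eta>)"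
      using B m by (intro add_mono mult_left_mono) auto
    finally show ?thesis by (simp add: algebra_simps)
  qed
  then show "\<exists>B. \<forall>m\<ge>1. \<bar>a * H m + b * G m\<bar> \<le> B * real m powr \<eta>" by blast
qed

lemma power_mean_bounded_sums:
  assumes "\<And>k. \<bar>(\<Sum>m=1..k. H m) - real k * \<mu>\<bar> \<le> C" "\<And>m. m \<ge> 1 \<Longrightarrow> \<bar>H m\<bar> \<le> B"
  shows "power_mean H \<mu>"
  unfolding power_mean_def
proof (intro conjI allI impI)
  have "\<bar>(\<Sum>m=1..k. H m) - real k * \<mu>\<bar> \<le> C * real k powr (1 - 1)" if "k \<ge> 1" for k
    using assms(1)[of k] that by simp
  then show "\<exists>\<delta>>0. \<delta> \<le> 1 \<and> (\<exists>C. \<forall>k\<ge>1. \<bar>(\<Sum>m=1..k. H m) - real k * \<mu>\<bar> \<le> C * real k powr (1 - \<delta>))"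
    by (intro exI[of _ 1]) auto
  fix \<eta> :: real assume \<eta>: "\<eta> > 0"
  have "\<bar>H m\<bar> \<le> \<bar>B\<bar> * real m powr \<eta>" if m: "m \<ge> 1" for m
  proof -
    have "1 \<le> real m powr \<eta>" using m \<eta> by (simp add: ge_one_powr_ge_zero)
    then have "\<bar>B\<bar> * 1 \<le> \<bar>B\<bar> * real m powr \<eta>" by (intro mult_left_mono) auto
    then show ?thesis using assms(2)[OF m] by linarith
  qed
  then show "\<exists>B. \<forall>m\<ge>1. \<bar>H m\<bar> \<le> B * real m powr \<eta>" by blast
qed

lemma power_mean_finite_support:
  assumes "finite S" "\<And>m. m \<notin> S \<Longrightarrow> H m = 0"
  shows "power_mean H 0"
proof (rule power_mean_bounded_sums)
  show "\<bar>(\<Sum>m=1..k. H m) - real k * 0\<bar> \<le> (\<Sum>m\<in>S. \<bar>H m\<bar>)" for k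
  proof -
    have "\<bar>\<Sum>m=1..k. H m\<bar> \<le> (\<Sum>m=1..k. \<bar>H m\<bar>)" by (rule sum_abs)
    also have "\<dots> = (\<Sum>m\<in>{1..k} \<inter> S. \<bar>H m\<bar>)"
      using assms(2) by (intro sum.mono_neutral_right) auto
    also have "\<dots> \<le> (\<Sum>m\<in>S. \<bar>H m\<bar>)" using assms(1) by (intro sum_mono2) auto
    finally show ?thesis by simp
  qed
  show "\<bar>H m\<bar> \<le> (\<Sum>m\<in>S. \<bar>H m\<bar>)" for m
  proof (cases "m \<in> S")
    case True
    then show ?thesis using assms(1) by (intro member_le_sum) auto
  next
    case False
    then show ?thesis using assms(2) by (simp add: sum_nonneg)
  qed
qed

lemma power_mean_cong_finite:
  assumes "power_mean H \<mu>" "finite S" "\<And>m. m \<notin> S \<Longrightarrow> G m = H m"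
  shows "power_mean G \<mu>"
proof -
  have "power_mean (\<lambda>m. G m - H m) 0" by (rule power_mean_finite_support[OF assms(2)]) (simp add: assms(3))
  from power_mean_lincomb[OF this assms(1), of 1 1] show ?thesis by simp
qed

text \<open>Complete periods contribute exactly their mean, so the error stems from at most one
  incomplete period.\<close>

lemma power_mean_periodic:
  fixes H :: "nat \<Rightarrow> real"
  assumes p: "p \<ge> 1" and per: "\<And>m. H (m + p) = H m"
  shows "power_mean H ((\<Sum>m=1..p. H m) / real p)"
proof -
  define \<mu> where "\<mu> = (\<Sum>m=1..p. H m) / real p"
  define S where "S = (\<Sum>m=1..p. \<bar>H m\<bar>)"
  \<comment> \<open>Sums start at index 1, hence representatives modulo \<open>p\<close> are taken
    in \<open>{1..p}\<close>.\<close>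
  have red: "H m = H ((m - 1) mod p + 1)" if "m \<ge> 1" for m
  proof -
    have "H (i + p * j) = H i" for i j
    proof (induction j)
      case (Suc j)
      then show ?case using per[of "i + p * j"] by (simp add: add_ac)
    qed simp
    from this[of "(m - 1) mod p + 1" "(m - 1) div p"] show ?thesis using that by (simp add: add.commute add.left_commute)
  qed
  have bound: "\<bar>H m\<bar> \<le> S" if "m \<ge> 1" for m
  proof -
    have "(m - 1) mod p + 1 \<in> {1..p}" using p by (simp add: Suc_leI)
    then have "\<bar>H ((m - 1) mod p + 1)\<bar> \<le> S" unfolding S_def by (intro member_le_sum) auto
    then show ?thesis using red[OF that] by simp
  qed
  have blocks: "(\<Sum>m=1..b * p. H m) = real (b * p) * \<mu>" for b
  proof (induction b)
    case (Suc b)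
    have "(\<Sum>m=1..Suc b * p. H m) = (\<Sum>m=1..b * p. H m) + (\<Sum>m=b * p + 1..b * p + p. H m)"
      using sum.ub_add_nat[of 1 "b * p" H p] by (simp add: add.commute)
    also have "(\<Sum>m=b * p + 1..b * p + p. H m) = (\<Sum>m=1..p. H m)"
    proof (rule sum.reindex_bij_witness[of _ "\<lambda>i. b * p + i" "\<lambda>m. m - b * p"])
      fix m assume m: "m \<in> {b * p + 1..b * p + p}"
      have "H (i + b * p) = H i" for i
      proof (induction b)
        case (Suc b)
        then show ?case using per[of "i + b * p"] by (simp add: add_ac)
      qed simp
      from this[of "m - b * p"] show "H (m - b * p) = H m" using m by simp
    qed auto
    also have "\<dots> = real p * \<mu>" using p by (simp add: \<mu>_def)
    finally show ?case using Suc by (simp add: algebra_simps)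
  qed simp
  have "\<mu> \<le> S \<and> - S \<le> \<mu>"
  proof -
    have "\<bar>\<Sum>m=1..p. H m\<bar> \<le> S" unfolding S_def by (rule sum_abs)
    moreover have "S \<ge> 0" unfolding S_def by (intro sum_nonneg) auto
    moreover have "S * 1 \<le> S * real p" using p \<open>S \<ge> 0\<close> by (intro mult_left_mono) auto
    ultimately show ?thesis using p unfolding \<mu>_def by (auto simp: divide_le_eq le_divide_eq abs_le_iff)
  qed
  then have mu: "\<bar>\<mu>\<bar> \<le> S" by linarith
  have "\<bar>(\<Sum>m=1..k. H m) - real k * \<mu>\<bar> \<le> real p * S + real p * S" for k
  proof -
    define b where "b = k div p"
    have k: "k = b * p + k mod p" by (simp add: b_def)
    have "(\<Sum>m=1..k. H m) = (\<Sum>m=1..b * p. H m) + (\<Sum>m=b * p + 1..b * p + k mod p. H m)"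
      by (subst k) (rule sum.ub_add_nat, simp)
    moreover have "real k * \<mu> = real (b * p) * \<mu> + real (k mod p) * \<mu>" by (subst k) (simp add: distrib_right)
    ultimately have "(\<Sum>m=1..k. H m) - real k * \<mu> = (\<Sum>m=b * p + 1..b * p + k mod p. H m) - real (k mod p) * \<mu>"
      using blocks[of b] by simp
    moreover have "\<bar>\<Sum>m=b * p + 1..b * p + k mod p. H m\<bar> \<le> real p * S"
    proof -
      have "\<bar>\<Sum>m=b * p + 1..b * p + k mod p. H m\<bar> \<le> (\<Sum>m=b * p + 1..b * p + k mod p. S)"
        by (rule order.trans[OF sum_abs sum_mono]) (use bound in auto)
      also have "\<dots> = real (k mod p) * S" by simp
      also have "\<dots> \<le> real p * S" using p mu by (intro mult_right_mono) (auto simp: less_imp_le)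
      finally show ?thesis .
    qed
    moreover have "\<bar>real (k mod p) * \<mu>\<bar> \<le> real p * S"
      unfolding abs_mult using p mu by (intro mult_mono) (auto simp: less_imp_le)
    ultimately show ?thesis by linarith
  qed
  then have "power_mean H \<mu>" using bound by (rule power_mean_bounded_sums)
  then show ?thesis by (simp add: \<mu>_def)
qed

section \<open>Logarithms of analytic functions on the circle\<close>

text \<open>Once the power belonging to the first nonzero coefficient is factored out, the remaining
  series is continuous and nonzero at the center, so half of that coefficient bounds it from below
  nearby. The exponent \<open>k\<close> is the order of vanishing; a positive order forces a zero at
  the center.\<close>

lemma power_series_dichotomy:
  fixes G :: "real \<Rightarrow> complex" and c :: "nat \<Rightarrow> complex"
  assumes r: "r > 0" and G: "\<And>t. \<bar>t - t\<^sub>0\<bar> < r \<Longrightarrow> (\<lambda>k. c k * of_real (t - t\<^sub>0) ^ k) sums G t"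
  shows "(\<exists>e>0. \<forall>t. \<bar>t - t\<^sub>0\<bar> < e \<longrightarrow> G t = 0) \<or>
    (\<exists>k e m. e > 0 \<and> m > 0 \<and> (k = 0 \<or> G t\<^sub>0 = 0) \<and> (\<forall>t. \<bar>t - t\<^sub>0\<bar> < e \<longrightarrow> m * \<bar>t - t\<^sub>0\<bar> ^ k \<le> cmod (G t)))"
proof (cases "\<forall>k. c k = 0")
  case True
  have "G t = 0" if "\<bar>t - t\<^sub>0\<bar> < r" for t
    using G[OF that] True sums_unique2[OF _ sums_zero] by simp
  then show ?thesis using r by blast
next
  case False
  define k where "k = (LEAST k. c k \<noteq> 0)"
  have ck: "c k \<noteq> 0" unfolding k_def using False LeastI_ex[of "\<lambda>k. c k \<noteq> 0"] by blast
  have cl: "c j = 0" if "j < k" for j using not_less_Least[of j "\<lambda>k. c k \<noteq> 0"] that unfolding k_def by blast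
  define K where "K = complex_of_real (r / 2)"
  have K: "norm K = r / 2" "K \<noteq> 0" using r by (auto simp: K_def)
  have "summable (\<lambda>n. c n * K ^ n)"
    using sums_summable[OF G[of "t\<^sub>0 + r / 2"]] r by (simp add: K_def)
  then have "summable (\<lambda>n. c (n + k) * K ^ (n + k))" by (rule summable_ignore_initial_segment)
  then have "summable (\<lambda>n. (c (n + k) * K ^ n) * K ^ k)" by (simp add: power_add mult.assoc)
  from summable_mult2[OF this, of "inverse (K ^ k)"] have sK: "summable (\<lambda>n. c (n + k) * K ^ n)"
    using K(2) by (simp add: mult.assoc)
  define S where "S x = (\<Sum>n. c (n + k) * x ^ n)" for x :: complex
  have "isCont S 0" unfolding S_def by (rule isCont_powser[OF sK]) (use K r in simp)
  moreover have S0: "S 0 = c k" unfolding S_def using powser_zero[of "\<lambda>n. c (n + k)"] by simp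
  ultimately have "(S \<longlongrightarrow> c k) (at 0)" by (simp add: isCont_def)
  then obtain d where d: "d > 0" "\<And>x. x \<noteq> 0 \<Longrightarrow> norm x < d \<Longrightarrow> dist (S x) (c k) < cmod (c k) / 2"
    unfolding LIM_def using ck by (metis diff_zero dist_norm half_gt_zero zero_less_norm_iff)
  have Gt: "G t = of_real (t - t\<^sub>0) ^ k * S (of_real (t - t\<^sub>0))" if t: "\<bar>t - t\<^sub>0\<bar> < r / 2" for t
  proof -
    define x where "x = complex_of_real (t - t\<^sub>0)"
    have nx: "norm x < norm K" using t K unfolding x_def norm_of_real by simp
    have su: "summable (\<lambda>n. c (n + k) * x ^ n)" by (rule powser_inside[OF sK nx])
    have sG: "(\<lambda>n. c n * x ^ n) sums G t" unfolding x_def using t r by (intro G) simp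
    have "(\<lambda>n. c (n + k) * x ^ (n + k)) sums (G t - (\<Sum>i<k. c i * x ^ i))"
      by (rule sums_split_initial_segment[OF sG])
    then have "(\<lambda>n. c (n + k) * x ^ (n + k)) sums G t" using cl by simp
    moreover have "(\<lambda>n. x ^ k * (c (n + k) * x ^ n)) sums (x ^ k * S x)"
      unfolding S_def by (rule sums_mult[OF summable_sums[OF su]])
    moreover have "(\<lambda>n. x ^ k * (c (n + k) * x ^ n)) = (\<lambda>n. c (n + k) * x ^ (n + k))"
      by (auto simp: power_add)
    ultimately show ?thesis unfolding x_def[symmetric] using sums_unique2 by metis
  qed
  define e where "e = min d (r / 2)"
  have e: "e > 0" "e \<le> d" "e \<le> r / 2" using d r by (auto simp: e_def)
  have low: "cmod (c k) / 2 * \<bar>t - t\<^sub>0\<bar> ^ k \<le> cmod (G t)" if t: "\<bar>t - t\<^sub>0\<bar> < e" for t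
  proof -
    have "cmod (c k) / 2 \<le> cmod (S (of_real (t - t\<^sub>0)))"
    proof (cases "t = t\<^sub>0")
      case True
      then show ?thesis by (simp add: S0)
    next
      case False
      then have "dist (S (of_real (t - t\<^sub>0))) (c k) < cmod (c k) / 2" using t e False by (intro d(2)) (simp_all del: of_real_diff)
      then show ?thesis using norm_triangle_ineq2[of "c k" "S (of_real (t - t\<^sub>0))"] by (simp add: dist_norm norm_minus_commute)
    qed
    then have "cmod (c k) / 2 * \<bar>t - t\<^sub>0\<bar> ^ k \<le> cmod (S (of_real (t - t\<^sub>0))) * \<bar>t - t\<^sub>0\<bar> ^ k"
      by (rule mult_right_mono) simp
    also have "\<dots> = cmod (G t)"
      using Gt[of t] t e by (simp add: norm_mult norm_power mult.commute flip: of_real_diff)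
    finally show ?thesis .
  qed
  have "k = 0 \<or> G t\<^sub>0 = 0" using Gt[of t\<^sub>0] r by auto
  then show ?thesis using low e(1) ck by (intro disjI2 exI[of _ k] exI[of _ e] exI[of _ "cmod (c k) / 2"]) auto
qed

lemma power_series_vector_derivative:
  fixes G :: "real \<Rightarrow> complex" and c :: "nat \<Rightarrow> complex"
  assumes r: "r > 0" and G: "\<And>t. \<bar>t - t\<^sub>0\<bar> < r \<Longrightarrow> (\<lambda>k. c k * of_real (t - t\<^sub>0) ^ k) sums G t"
  shows "\<exists>e>0. \<exists>B. \<forall>t. \<bar>t - t\<^sub>0\<bar> < e \<longrightarrow> (\<exists>D. (G has_vector_derivative D) (at t) \<and> cmod D \<le> B)"
proof -
  define K where "K = complex_of_real (r / 2)"
  have K: "norm K = r / 2" using r by (auto simp: K_def)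
  have sK: "summable (\<lambda>n. c n * K ^ n)"
    using sums_summable[OF G[of "t\<^sub>0 + r / 2"]] r by (simp add: K_def)
  define S where "S x = (\<Sum>n. c n * x ^ n)" for x :: complex
  define S' where "S' x = (\<Sum>n. diffs c n * x ^ n)" for x :: complex
  have S: "(S has_field_derivative S' x) (at x)" if "norm x < norm K" for x
    unfolding S_def[abs_def] S'_def by (rule termdiffs_strong[OF sK that])
  have "summable (\<lambda>n. diffs c n * (K / 2) ^ n)"
  proof (rule termdiff_converges[of _ "norm K"])
    show "norm (K / 2) < norm K" using r K by (simp add: norm_divide)
    show "summable (\<lambda>n. c n * y ^ n)" if "norm y < norm K" for y using powser_inside[OF sK that] .
  qed
  then have "isCont S' 0" unfolding S'_def
    by (rule isCont_powser) (use r in \<open>simp add: norm_divide K_def del: of_real_divide\<close>)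
  then have "(S' \<longlongrightarrow> S' 0) (at 0)" by (simp add: isCont_def)
  then obtain d where d: "d > 0" "\<And>x. x \<noteq> 0 \<Longrightarrow> norm x < d \<Longrightarrow> dist (S' x) (S' 0) < 1"
    unfolding LIM_def by (metis diff_zero dist_norm zero_less_one)
  define e where "e = min d (r / 2)"
  have e: "e > 0" "e \<le> d" "e \<le> r / 2" using d r by (auto simp: e_def)
  have "\<exists>D. (G has_vector_derivative D) (at t) \<and> cmod D \<le> cmod (S' 0) + 1" if t: "\<bar>t - t\<^sub>0\<bar> < e" for t
  proof (intro exI conjI)
    have GS: "G u = S (of_real (u - t\<^sub>0))" if "\<bar>u - t\<^sub>0\<bar> < r" for u
      unfolding S_def using sums_unique[OF G[OF that]] by simp
    have "((\<lambda>u. of_real (u - t\<^sub>0)) has_vector_derivative 1) (at t)"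
      using has_vector_derivative_of_real[of "\<lambda>u. u - t\<^sub>0" 1 "at t"]
      by (auto intro!: derivative_eq_intros simp del: of_real_diff)
    then have "((S \<circ> (\<lambda>u. of_real (u - t\<^sub>0))) has_vector_derivative (1 * S' (of_real (t - t\<^sub>0)))) (at t)"
      by (rule field_vector_diff_chain_at[OF _ S]) (use t e K in \<open>simp del: of_real_diff\<close>)
    then have "((\<lambda>u. S (of_real (u - t\<^sub>0))) has_vector_derivative S' (of_real (t - t\<^sub>0))) (at t)"
      by (simp add: comp_def)
    moreover have "eventually (\<lambda>u. u \<in> ball t\<^sub>0 r) (nhds t)"
      using t e by (intro eventually_nhds_in_open) (auto simp: dist_real_def)
    then have "eventually (\<lambda>u. G u = S (of_real (u - t\<^sub>0))) (nhds t)"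
      by eventually_elim (use GS in \<open>auto simp: dist_real_def abs_minus_commute\<close>)
    ultimately show "(G has_vector_derivative S' (of_real (t - t\<^sub>0))) (at t)"
      by (subst has_vector_derivative_cong_ev[where g = "\<lambda>u. S (of_real (u - t\<^sub>0))"]) (auto simp del: of_real_diff dest: eventually_nhds_x_imp_x)
    show "cmod (S' (of_real (t - t\<^sub>0))) \<le> cmod (S' 0) + 1"
    proof (cases "t = t\<^sub>0")
      case False
      then have "dist (S' (of_real (t - t\<^sub>0))) (S' 0) < 1" using t e by (intro d(2)) (simp_all del: of_real_diff)
      then show ?thesis using norm_triangle_ineq2[of "S' (of_real (t - t\<^sub>0))" "S' 0"] by (simp add: dist_norm)
    qed simp
  qed
  then show ?thesis using e(1) by blast
qed

section \<open>From local expansions to the whole circle\<close>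

lemma unit_interval_finite_cover:
  fixes e :: "real \<Rightarrow> real"
  assumes "\<And>t. e t > 0"
  shows "\<exists>T. finite T \<and> (\<forall>s\<in>{0..1}. \<exists>t\<in>T. \<bar>s - t\<bar> < e t)"
proof -
  have "{0..1} \<subseteq> (\<Union>t\<in>{0..1}. ball t (e t))" using assms by auto
  then obtain T where "T \<subseteq> {0..1}" "finite T" "{0..1} \<subseteq> (\<Union>t\<in>T. ball t (e t))"
    using compactE_image[of "{0..1::real}" "{0..1}" "\<lambda>t. ball t (e t)"] by auto
  then show ?thesis by (intro exI[of _ T]) (fastforce simp: dist_real_def abs_minus_commute)
qed

lemma Ln_lipschitz_along:
  fixes G :: "real \<Rightarrow> complex"
  assumes "s \<le> s'" and D: "\<And>u. u \<in> {s..s'} \<Longrightarrow> \<exists>D. (G has_vector_derivative D) (at u) \<and> cmod D \<le> \<Lambda>"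
    and br: "\<And>u. u \<in> {s..s'} \<Longrightarrow> G u \<notin> \<real>\<^sub>\<le>\<^sub>0" and low: "\<And>u. u \<in> {s..s'} \<Longrightarrow> \<kappa> \<le> cmod (G u)" and \<kappa>: "\<kappa> > 0"
  shows "cmod (Ln (G s) - Ln (G s')) \<le> \<Lambda> / \<kappa> * \<bar>s - s'\<bar>"
proof -
  obtain D where D: "\<And>u. u \<in> {s..s'} \<Longrightarrow> (G has_vector_derivative D u) (at u)" "\<And>u. u \<in> {s..s'} \<Longrightarrow> cmod (D u) \<le> \<Lambda>"
    using D by metis
  have "norm (Ln (G s) - Ln (G s')) \<le> \<Lambda> / \<kappa> * norm (s - s')"
  proof (rule differentiable_bound[where f' = "\<lambda>u h. h *\<^sub>R (D u * inverse (G u))" and S = "{s..s'}"])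
    fix u assume u: "u \<in> {s..s'}"
    have "((Ln \<circ> G) has_vector_derivative (D u * inverse (G u))) (at u within {s..s'})"
      by (rule field_vector_diff_chain_within[OF has_vector_derivative_at_within[OF D(1)[OF u]]])
        (use has_field_derivative_Ln[OF br[OF u]] in \<open>simp add: has_field_derivative_at_within\<close>)
    then show "((\<lambda>u. Ln (G u)) has_derivative (\<lambda>h. h *\<^sub>R (D u * inverse (G u)))) (at u within {s..s'})"
      by (simp add: has_vector_derivative_def comp_def)
    have "cmod (D u * inverse (G u)) = cmod (D u) / cmod (G u)" by (simp add: norm_mult norm_inverse divide_inverse)
    also have "\<dots> \<le> \<Lambda> / \<kappa>" using D(2)[OF u] low[OF u] \<kappa> by (intro frac_le) (auto intro: order.trans[OF norm_ge_zero])
    finally have b: "cmod (D u * inverse (G u)) \<le> \<Lambda> / \<kappa>" .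
    show "onorm (\<lambda>h. h *\<^sub>R (D u * inverse (G u))) \<le> \<Lambda> / \<kappa>"
    proof (rule onorm_bound)
      show "0 \<le> \<Lambda> / \<kappa>" using b norm_ge_zero order.trans by blast
      show "norm (v *\<^sub>R (D u * inverse (G u))) \<le> \<Lambda> / \<kappa> * norm v" for v :: real
        using mult_left_mono[OF b, of "\<bar>v\<bar>"] by (simp only: norm_scaleR real_norm_def abs_ge_zero mult.commute)
    qed
  qed (use assms(1) in auto)
  then show ?thesis by simp
qed

lemma analytic_circle_derivative_bound:
  assumes f: "real_analytic_on_circle f"
  obtains \<Lambda> where "\<Lambda> \<ge> 0"
    "\<And>s. \<exists>D. ((\<lambda>s. f (cis (2 * pi * s))) has_vector_derivative D) (at s) \<and> cmod D \<le> \<Lambda>"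
proof -
  define F where "F s = f (cis (2 * pi * s))" for s
  have per: "F (s + of_int j) = F s" for s j
    by (rule periodic_of_int) (simp add: F_def cis_period)
  have "\<exists>e>0. \<exists>B. \<forall>s. \<bar>s - t\<bar> < e \<longrightarrow> (\<exists>D. (F has_vector_derivative D) (at s) \<and> cmod D \<le> B)" for t
  proof -
    obtain r c where "r > 0" "\<And>s. \<bar>s - t\<bar> < r \<Longrightarrow> (\<lambda>k. c k * of_real (s - t) ^ k) sums F s"
      using f unfolding real_analytic_on_circle_def F_def by blast
    then show ?thesis by (rule power_series_vector_derivative)
  qed
  then obtain e B where e: "\<And>t. e t > 0"
    and B: "\<And>t s. \<bar>s - t\<bar> < e t \<Longrightarrow> \<exists>D. (F has_vector_derivative D) (at s) \<and> cmod D \<le> B t"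
    by metis
  obtain T where T: "finite T" "\<And>s. s \<in> {0..1} \<Longrightarrow> \<exists>t\<in>T. \<bar>s - t\<bar> < e t"
    using unit_interval_finite_cover[of e, OF e] by blast
  define \<Lambda> where "\<Lambda> = (\<Sum>t\<in>T. \<bar>B t\<bar>)"
  have unit: "\<exists>D. (F has_vector_derivative D) (at s) \<and> cmod D \<le> \<Lambda>" if s: "s \<in> {0..1}" for s
  proof -
    obtain t where t: "t \<in> T" "\<bar>s - t\<bar> < e t" using T(2) s by blast
    then obtain D where D: "(F has_vector_derivative D) (at s)" "cmod D \<le> B t" using B by blast
    have "\<bar>B t\<bar> \<le> \<Lambda>" unfolding \<Lambda>_def by (rule member_le_sum[OF t(1)]) (use T(1) in auto)
    then show ?thesis using D by force
  qed
  have "\<exists>D. (F has_vector_derivative D) (at s) \<and> cmod D \<le> \<Lambda>" for s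
  proof -
    have "frac s \<in> {0..1}" using frac_lt_1[of s] by (simp add: less_imp_le)
    then obtain D where D: "(F has_vector_derivative D) (at (frac s))" "cmod D \<le> \<Lambda>" using unit by blast
    have "((F \<circ> (\<lambda>u. u - of_int \<lfloor>s\<rfloor>)) has_vector_derivative (1 *\<^sub>R D)) (at s)"
      by (rule vector_diff_chain_at) (use D(1) in \<open>auto simp: frac_def intro!: derivative_eq_intros\<close>)
    moreover have "F \<circ> (\<lambda>u. u - of_int \<lfloor>s\<rfloor>) = F"
      using per[of _ "- \<lfloor>s\<rfloor>"] by (auto simp: fun_eq_iff)
    ultimately show ?thesis using D(2) by auto
  qed
  moreover have "\<Lambda> \<ge> 0" unfolding \<Lambda>_def by (rule sum_nonneg) auto
  ultimately show ?thesis using that[of \<Lambda>] unfolding F_def by blast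
qed

lemma circle_point: assumes "z \<in> sphere 0 1" obtains s where "z = cis (2 * pi * s)" "s \<in> {0..1}"
proof -
  have "z = cis (Arg z)" using cis_Arg[of z] assms by (force simp: sgn_eq)
  then have "z = cis (2 * pi * (Arg z / (2 * pi)))" by simp
  also have "\<dots> = cis (2 * pi * frac (Arg z / (2 * pi)))"
    using periodic_of_int[of "\<lambda>s. cis (2 * pi * s)" "frac (Arg z / (2 * pi))" "\<lfloor>Arg z / (2 * pi)\<rfloor>", OF cis_period]
    by (simp add: frac_def)
  finally show ?thesis using that frac_lt_1 by (metis atLeastAtMost_iff frac_ge_0 less_imp_le)
qed

text \<open>The set of points near which the function vanishes identically is open and closed.\<close>

lemma analytic_circle_zeros:
  assumes f: "real_analytic_on_circle f" and nz: "z\<^sub>0 \<in> sphere 0 1" "f z\<^sub>0 \<noteq> 0"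
  shows "finite {z \<in> sphere 0 1. f z = 0}"
    and "{z \<in> sphere 0 1. f z = 0} \<subseteq> Z \<Longrightarrow> Z \<noteq> {} \<Longrightarrow> Z \<subseteq> sphere 0 1 \<Longrightarrow>
      \<exists>c N. c > 0 \<and> (\<forall>s. c * circle_dist Z s ^ N \<le> cmod (f (cis (2 * pi * s))))"
proof -
  define F where "F s = f (cis (2 * pi * s))" for s
  have per: "F (s + of_int j) = F s" for s j
    by (rule periodic_of_int) (simp add: F_def cis_period)
  define E where "E = {t. \<exists>e>0. \<forall>s. \<bar>s - t\<bar> < e \<longrightarrow> F s = 0}"
  have dich: "t \<in> E \<or> (\<exists>k e m. e > 0 \<and> m > 0 \<and> (k = 0 \<or> F t = 0) \<and> (\<forall>s. \<bar>s - t\<bar> < e \<longrightarrow> m * \<bar>s - t\<bar> ^ k \<le> cmod (F s)))" for t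
  proof -
    obtain r c where "r > 0" "\<And>s. \<bar>s - t\<bar> < r \<Longrightarrow> (\<lambda>k. c k * of_real (s - t) ^ k) sums F s"
      using f unfolding real_analytic_on_circle_def F_def by blast
    from power_series_dichotomy[OF this] show ?thesis unfolding E_def by blast
  qed
  have "open E"
    unfolding open_dist
  proof
    fix t assume "t \<in> E"
    then obtain e where e: "e > 0" "\<And>s. \<bar>s - t\<bar> < e \<Longrightarrow> F s = 0" unfolding E_def by blast
    have "u \<in> E" if u: "dist u t < e / 2" for u
    proof -
      have "F s = 0" if "\<bar>s - u\<bar> < e / 2" for s
        using that u abs_triangle_ineq[of "s - u" "u - t"] by (intro e(2)) (simp add: dist_real_def)
      then show ?thesis unfolding E_def using e(1) by (intro CollectI exI[of _ "e / 2"]) auto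
    qed
    then show "\<exists>e>0. \<forall>y. dist y t < e \<longrightarrow> y \<in> E" using e(1) by (intro exI[of _ "e / 2"]) auto
  qed
  moreover have "open (- E)"
    unfolding open_dist
  proof
    fix t assume "t \<in> - E"
    then obtain k e m where *: "e > 0" "m > 0" "\<And>s. \<bar>s - t\<bar> < e \<Longrightarrow> m * \<bar>s - t\<bar> ^ k \<le> cmod (F s)"
      using dich[of t] by blast
    have "u \<notin> E" if u: "dist u t < e" for u
    proof
      assume uE: "u \<in> E"
      then have "u \<noteq> t" using \<open>t \<in> - E\<close> by blast
      then have "m * \<bar>u - t\<bar> ^ k > 0" using *(2) by simp
      then have "F u \<noteq> 0" using *(3)[of u] u by (auto simp: dist_real_def)
      moreover obtain e' where "e' > 0" "\<And>s. \<bar>s - u\<bar> < e' \<Longrightarrow> F s = 0" using uE unfolding E_def by blast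
      then have "F u = 0" by simp
      ultimately show False by blast
    qed
    then show "\<exists>e>0. \<forall>y. dist y t < e \<longrightarrow> y \<in> - E" using *(1) by auto
  qed
  ultimately have "E = {} \<or> E = UNIV" using clopen[of E] by (simp add: closed_def)
  moreover have "E \<noteq> UNIV"
  proof
    assume "E = UNIV"
    have "F s = 0" for s
    proof -
      obtain e' where "e' > 0" "\<And>u. \<bar>u - s\<bar> < e' \<Longrightarrow> F u = 0"
        using \<open>E = UNIV\<close> unfolding E_def by blast
      then show ?thesis by simp
    qed
    moreover obtain s where "z\<^sub>0 = cis (2 * pi * s)" using circle_point[OF nz(1)] by blast
    ultimately show False using nz(2) unfolding F_def by blast
  qed
  ultimately have "E = {}" by blast
  then have "\<exists>e k m. e > 0 \<and> m > 0 \<and> (k = 0 \<or> F t = 0) \<and> (\<forall>s. \<bar>s - t\<bar> < e \<longrightarrow> m * \<bar>s - t\<bar> ^ k \<le> cmod (F s))" for t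
    using dich[of t] by blast
  then obtain e k m where e: "\<And>t. e t > 0" and m: "\<And>t. m t > 0"
    and k: "\<And>t. k t = (0::nat) \<or> F t = 0" and low: "\<And>t s. \<bar>s - t\<bar> < e t \<Longrightarrow> m t * \<bar>s - t\<bar> ^ k t \<le> cmod (F s)"
    by metis
  obtain T where T: "finite T" "\<And>s. s \<in> {0..1} \<Longrightarrow> \<exists>t\<in>T. \<bar>s - t\<bar> < e t"
    using unit_interval_finite_cover[of e, OF e] by blast
  have "{z \<in> sphere 0 1. f z = 0} \<subseteq> (\<lambda>t. cis (2 * pi * t)) ` T"
  proof
    fix z assume z: "z \<in> {z \<in> sphere 0 1. f z = 0}"
    then obtain s where s: "z = cis (2 * pi * s)" "s \<in> {0..1}" using circle_point by blast
    then obtain t where t: "t \<in> T" "\<bar>s - t\<bar> < e t" using T(2) by blast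
    have "m t * \<bar>s - t\<bar> ^ k t \<le> 0" using low[OF t(2)] z s by (simp add: F_def)
    then have "\<bar>s - t\<bar> ^ k t \<le> 0" using m[of t] by (simp add: mult_le_0_iff)
    then have "\<not> 0 < \<bar>s - t\<bar>" using zero_less_power[of "\<bar>s - t\<bar>" "k t"] by linarith
    then have "s = t" by simp
    then show "z \<in> (\<lambda>t. cis (2 * pi * t)) ` T" using s t by blast
  qed
  then show "finite {z \<in> sphere 0 1. f z = 0}" using T(1) finite_subset by blast
  assume Z: "{z \<in> sphere 0 1. f z = 0} \<subseteq> Z" "Z \<noteq> {}" "Z \<subseteq> sphere 0 1"
  \<comment> \<open>Finitely many local bounds merge into one: as \<open>circle_dist Z s / 7\<close>
    is at most 1, raising each exponent to the largest order only weakens the bound.\<close>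
  define N where "N = Max (k ` T)"
  define c where "c = Min (m ` T)"
  have "T \<noteq> {}" using T(2)[of 0] by auto
  then have c: "c > 0" "\<And>t. t \<in> T \<Longrightarrow> c \<le> m t" unfolding c_def using T(1) m by auto
  have N: "k t \<le> N" if "t \<in> T" for t unfolding N_def using T(1) that by auto
  have unit: "c * (circle_dist Z s / 7) ^ N \<le> cmod (F s)" if s: "s \<in> {0..1}" for s
  proof -
    obtain t where t: "t \<in> T" "\<bar>s - t\<bar> < e t" using T(2) s by blast
    have d: "0 \<le> circle_dist Z s / 7" "circle_dist Z s / 7 \<le> 1"
      using circle_dist_nonneg[of Z s] circle_dist_le_2[OF Z(2,3), of s] by auto
    have "(circle_dist Z s / 7) ^ N \<le> (circle_dist Z s / 7) ^ k t"
      by (rule power_decreasing[OF N[OF t(1)] d])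
    also have "\<dots> \<le> \<bar>s - t\<bar> ^ k t"
    \<comment> \<open>A positive order means that \<open>t\<close> gives a zero, hence a point of
      \<open>Z\<close>; then \<open>circle_dist Z s\<close> is at most
      \<open>7 * \<bar>s - t\<bar>\<close>.\<close>
    proof (cases "k t = 0")
      case False
      then have "cis (2 * pi * t) \<in> Z" using k[of t] Z(1) by (auto simp: F_def)
      then have "circle_dist Z t = 0" unfolding circle_dist_def by simp
      then have "circle_dist Z s \<le> 7 * \<bar>s - t\<bar>" using circle_dist_lipschitz[of Z s t] by simp
      then show ?thesis using d(1) by (intro power_mono) auto
    qed simp
    finally have "c * (circle_dist Z s / 7) ^ N \<le> m t * \<bar>s - t\<bar> ^ k t"
      using c(1) c(2)[OF t(1)] d(1) by (intro mult_mono) auto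
    then show ?thesis using low[OF t(2)] by linarith
  qed
  have "c / 7 ^ N * circle_dist Z s ^ N \<le> cmod (F s)" for s
  proof -
    have "frac s \<in> {0..1}" using frac_lt_1[of s] by (simp add: less_imp_le)
    moreover have "circle_dist Z (frac s) = circle_dist Z s" "F (frac s) = F s"
      using per[of "frac s" "\<lfloor>s\<rfloor>"] periodic_of_int[of "circle_dist Z" "frac s" "\<lfloor>s\<rfloor>", OF circle_dist_period]
      by (simp_all add: frac_def)
    ultimately show ?thesis using unit[of "frac s"] by (simp add: power_divide)
  qed
  then show "\<exists>c N. c > 0 \<and> (\<forall>s. c * circle_dist Z s ^ N \<le> cmod (f (cis (2 * pi * s))))"
    using c(1) unfolding F_def by (intro exI[of _ "c / 7 ^ N"] exI[of _ N]) auto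
qed

text \<open>If \<open>z ^ v = 1\<close>, the distance from \<open>x ^ m\<close> to \<open>z\<close>
  is at least the distance from \<open>x ^ (m * v)\<close> to 1 divided by \<open>v\<close>, and
  finite type bounds the latter from below. The finitely many orders \<open>v\<close> affect only
  the constant.\<close>

lemma finite_type_orbit_dist:
  assumes x: "finite_type x" and Z: "finite Z" "Z \<noteq> {}" "Z \<subseteq> sphere 0 1" "\<And>z. z \<in> Z \<Longrightarrow> root_of_unity z"
  obtains K \<gamma> where "K > 0" "\<gamma> > 0" "\<And>m. m \<ge> 1 \<Longrightarrow> K / real m powr \<gamma> \<le> infdist (x ^ m) Z"
proof -
  obtain t K \<gamma> where xt: "x = cis (2 * pi * t)" and K: "K > 0" "\<gamma> > 0"
    and type: "\<And>m::int. m \<noteq> 0 \<Longrightarrow> dist_to_int (of_int m * t) > K / \<bar>of_int m\<bar> powr \<gamma>"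
    using x unfolding finite_type_def by blast
  have nx: "cmod x = 1" by (simp add: xt)
  have "\<exists>v\<ge>1. z ^ v = 1" if "z \<in> Z" for z using Z(4)[OF that] unfolding root_of_unity_def by blast
  then obtain v where v: "\<And>z. z \<in> Z \<Longrightarrow> v z \<ge> (1::nat)" "\<And>z. z \<in> Z \<Longrightarrow> z ^ v z = 1" by metis
  define K' where "K' = Min ((\<lambda>z. K / (real (v z) powr \<gamma> * real (v z))) ` Z)"
  have K'0: "K' > 0" unfolding K'_def using Z(1,2) K v(1) by (auto simp: Suc_le_eq)
  have K'le: "K' \<le> K / (real (v z) powr \<gamma> * real (v z))" if "z \<in> Z" for z
    unfolding K'_def by (rule Min_le) (use Z(1) that in auto)
  have "K' / real m powr \<gamma> \<le> dist (x ^ m) z" if m: "m \<ge> 1" and z: "z \<in> Z" for m z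
  proof -
    have vz: "v z \<ge> 1" by (rule v(1)[OF z])
    have "K / real (m * v z) powr \<gamma> < dist_to_int (real (m * v z) * t)"
      using type[of "int (m * v z)"] m vz by simp
    also have "\<dots> \<le> cmod (cis (2 * pi * (real (m * v z) * t)) - 1)" by (rule norm_cis_minus_1_ge)
    also have "cis (2 * pi * (real (m * v z) * t)) = x ^ (m * v z)"
      unfolding xt Complex.DeMoivre by (simp add: mult_ac)
    also have "cmod (x ^ (m * v z) - 1) = cmod ((x ^ m) ^ v z - z ^ v z)" using v(2)[OF z] by (simp add: power_mult)
    also have "\<dots> \<le> real (v z) * cmod (x ^ m - z)"
      by (rule norm_power_diff) (use nx Z(3) z in \<open>auto simp: norm_power\<close>)
    finally have "K / (real m powr \<gamma> * real (v z) powr \<gamma>) < real (v z) * dist (x ^ m) z"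
      by (simp add: powr_mult dist_norm)
    then have "K / (real m powr \<gamma> * real (v z) powr \<gamma>) / real (v z) < dist (x ^ m) z"
      using vz by (subst pos_divide_less_eq) (simp_all add: mult.commute)
    moreover have "K' / real m powr \<gamma> \<le> K / (real (v z) powr \<gamma> * real (v z)) / real m powr \<gamma>"
      by (rule divide_right_mono[OF K'le[OF z]]) simp
    ultimately show ?thesis by (simp add: mult_ac)
  qed
  then have "K' / real m powr \<gamma> \<le> infdist (x ^ m) Z" if "m \<ge> 1" for m
    using that Z(2) unfolding infdist_def by (auto intro: cINF_greatest)
  then show ?thesis using that K'0 K(2) by blast
qed

text \<open>Where the function stays on the negative real axis, the logarithm is continued along its negative.\<close>

lemma circle_tame_Ln:
  assumes f: "real_analytic_on_circle f"
    and Z: "Z \<noteq> {}" "Z \<subseteq> sphere 0 1"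
    and low: "c > 0" "\<And>s. c * circle_dist Z s ^ N \<le> cmod (f (cis (2 * pi * s)))"
    and orbit: "K > 0" "\<gamma> > 0" "\<And>m. m \<ge> 1 \<Longrightarrow> K / real m powr \<gamma> \<le> cmod (f (x ^ m))"
    and x: "x \<in> sphere 0 1"
    and branch: "\<And>s s'. s \<le> s' \<Longrightarrow> (\<And>u. u \<in> {s..s'} \<Longrightarrow> circle_dist Z u > 0) \<Longrightarrow>
      (\<forall>u\<in>{s..s'}. f (cis (2 * pi * u)) \<notin> \<real>\<^sub>\<le>\<^sub>0) \<or>
      (\<forall>u\<in>{s..s'}. - f (cis (2 * pi * u)) \<notin> \<real>\<^sub>\<le>\<^sub>0 \<and> Ln (f (cis (2 * pi * u))) = Ln (- f (cis (2 * pi * u))) + \<i> * pi)"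
  shows "circle_tame Z x (\<lambda>z. Re (Ln (f z)))" and "circle_tame Z x (\<lambda>z. Im (Ln (f z)))"
proof -
  define F where "F s = f (cis (2 * pi * s))" for s
  obtain \<Lambda> where \<Lambda>: "\<Lambda> \<ge> 0" "\<And>s. \<exists>D. (F has_vector_derivative D) (at s) \<and> cmod D \<le> \<Lambda>"
    using analytic_circle_derivative_bound[OF f] unfolding F_def by blast
  have "continuous_on {0..1} F"
  proof (rule continuous_at_imp_continuous_on, rule ballI)
    show "isCont F s" for s using \<Lambda>(2)[of s] has_vector_derivative_continuous by blast
  qed
  then have "bounded (F ` {0..1})" by (intro compact_imp_bounded compact_continuous_image) simp_all
  then obtain B0 where B0: "\<And>y. y \<in> F ` {0..1} \<Longrightarrow> cmod y \<le> B0"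
    unfolding bounded_iff by blast
  define B where "B = max B0 1"
  have B: "B > 0" by (simp add: B_def)
  have fB: "cmod (f z) \<le> B" if z: "z \<in> sphere 0 1" for z
  proof -
    obtain s where "z = cis (2 * pi * s)" "s \<in> {0..1}" using circle_point[OF z] by blast
    then have "cmod (f z) \<le> B0" using B0 by (auto simp: F_def)
    then show ?thesis by (simp add: B_def)
  qed
  have Ln_bound: "cmod (Ln z) \<le> \<bar>ln l\<bar> + \<bar>ln B\<bar> + pi" if z: "0 < l" "l \<le> cmod z" "cmod z \<le> B" for z l
  proof -
    have z0: "z \<noteq> 0" using z by auto
    have "ln l \<le> ln (cmod z)" using z by (intro ln_mono) auto
    moreover have "ln (cmod z) \<le> ln B" using z by (intro ln_mono) auto
    ultimately have "\<bar>ln (cmod z)\<bar> \<le> \<bar>ln l\<bar> + \<bar>ln B\<bar>" by linarith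
    moreover have "\<bar>Im (Ln z)\<bar> \<le> pi" using mpi_less_Im_Ln[OF z0] Im_Ln_le_pi[OF z0] by linarith
    ultimately show ?thesis using cmod_le[of "Ln z"] z0 by simp
  qed
  \<comment> \<open>A logarithm is bounded by any negative power of the distance. The factors
    \<open>2 powr \<eta>\<close> are there because the distance can exceed 1, up to the value
    2.\<close>
  define C where "C \<eta> = (\<bar>ln c\<bar> + \<bar>ln B\<bar> + pi) * 2 powr \<eta> + real N * (1 / \<eta> + ln 2 * 2 powr \<eta>)" for \<eta>
  have growth: "cmod (Ln (F s)) \<le> C \<eta> * circle_dist Z s powr - \<eta>" if \<eta>: "\<eta> > 0" and s: "circle_dist Z s > 0" for \<eta> s
  proof -
    define d where "d = circle_dist Z s"
    have d: "0 < d" "d \<le> 2" using s circle_dist_le_2[OF Z] by (auto simp: d_def)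
    have "d powr \<eta> \<le> 2 powr \<eta>" using d \<eta> by (intro powr_mono2) auto
    then have one: "1 \<le> 2 powr \<eta> * d powr - \<eta>" using d by (simp add: powr_minus field_simps)
    have "- ln d \<le> d powr - \<eta> / \<eta>"
    proof (cases "d \<le> 1")
      case True
      have "ln (1 / d) \<le> (1 / d) powr \<eta> / \<eta>" by (rule ln_powr_bound) (use d True \<eta> in auto)
      then show ?thesis using d by (simp add: ln_div powr_divide powr_minus_divide)
    next
      case False
      then have "- ln d \<le> 0" by simp
      also have "0 \<le> d powr - \<eta> / \<eta>" using \<eta> by simp
      finally show ?thesis .
    qed
    moreover have "ln d \<le> ln 2" using d by (intro ln_mono) auto
    moreover have "ln 2 \<le> ln 2 * (2 powr \<eta> * d powr - \<eta>)" using mult_left_mono[OF one, of "ln 2"] by simp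
    moreover have "0 \<le> d powr - \<eta> / \<eta>" "0 \<le> ln 2 * (2 powr \<eta> * d powr - \<eta>)" using \<eta> by simp_all
    ultimately have lnd: "\<bar>ln d\<bar> \<le> d powr - \<eta> / \<eta> + ln 2 * (2 powr \<eta> * d powr - \<eta>)" by linarith
    have "cmod (Ln (F s)) \<le> \<bar>ln (c * d ^ N)\<bar> + \<bar>ln B\<bar> + pi"
      by (rule Ln_bound) (use low(1) low(2)[of s] d fB in \<open>auto simp: F_def d_def\<close>)
    also have "ln (c * d ^ N) = ln c + real N * ln d" using low(1) d by (simp add: ln_mult ln_realpow)
    also have "\<bar>ln c + real N * ln d\<bar> + \<bar>ln B\<bar> + pi \<le> (\<bar>ln c\<bar> + \<bar>ln B\<bar> + pi) + real N * \<bar>ln d\<bar>"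
      using abs_triangle_ineq[of "ln c" "real N * ln d"] by (simp add: abs_mult)
    also have "\<dots> \<le> (\<bar>ln c\<bar> + \<bar>ln B\<bar> + pi) * (2 powr \<eta> * d powr - \<eta>) + real N * (d powr - \<eta> / \<eta> + ln 2 * (2 powr \<eta> * d powr - \<eta>))"
      using mult_left_mono[OF one, of "\<bar>ln c\<bar> + \<bar>ln B\<bar> + pi"] mult_left_mono[OF lnd, of "real N"] by simp
    also have "\<dots> = C \<eta> * d powr - \<eta>" by (simp add: C_def algebra_simps)
    finally show ?thesis by (simp add: d_def)
  qed
  have lip: "cmod (Ln (F s) - Ln (F s')) \<le> \<Lambda> / c * (1 + 1 / \<rho>) ^ N * \<bar>s - s'\<bar>"
    if \<rho>: "\<rho> > 0" and s: "s \<le> s'" and far: "\<And>u. u \<in> {s..s'} \<Longrightarrow> circle_dist Z u \<ge> \<rho>" for \<rho> s s'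
  proof -
    have low': "c * \<rho> ^ N \<le> cmod (F u)" if u: "u \<in> {s..s'}" for u
    proof -
      have "c * \<rho> ^ N \<le> c * circle_dist Z u ^ N" using low(1) \<rho> far[OF u] by (intro mult_left_mono power_mono) auto
      then show ?thesis using low(2)[of u] by (simp add: F_def)
    qed
    have pos: "c * \<rho> ^ N > 0" using low(1) \<rho> by simp
    have "cmod (Ln (F s) - Ln (F s')) \<le> \<Lambda> / (c * \<rho> ^ N) * \<bar>s - s'\<bar>"
      using branch[OF s] far \<rho>
    proof (elim meta_impE disjE)
      show "\<And>u. u \<in> {s..s'} \<Longrightarrow> 0 < circle_dist Z u" using far \<rho> by force
    next
      assume "\<forall>u\<in>{s..s'}. f (cis (2 * pi * u)) \<notin> \<real>\<^sub>\<le>\<^sub>0"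
      then have "F u \<notin> \<real>\<^sub>\<le>\<^sub>0" if "u \<in> {s..s'}" for u using that by (simp add: F_def)
      from Ln_lipschitz_along[OF s \<Lambda>(2) this low' pos] show ?thesis by simp
    next
      assume *: "\<forall>u\<in>{s..s'}. - f (cis (2 * pi * u)) \<notin> \<real>\<^sub>\<le>\<^sub>0 \<and> Ln (f (cis (2 * pi * u))) = Ln (- f (cis (2 * pi * u))) + \<i> * pi"
      have "\<exists>D. ((\<lambda>u. - F u) has_vector_derivative D) (at u) \<and> cmod D \<le> \<Lambda>" for u
        using \<Lambda>(2)[of u] has_vector_derivative_minus by (metis norm_minus_cancel)
      moreover have "- F u \<notin> \<real>\<^sub>\<le>\<^sub>0" if "u \<in> {s..s'}" for u using that * by (simp add: F_def)
      moreover have "c * \<rho> ^ N \<le> cmod (- F u)" if "u \<in> {s..s'}" for u using low'[OF that] by simp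
      ultimately have "cmod (Ln (- F s) - Ln (- F s')) \<le> \<Lambda> / (c * \<rho> ^ N) * \<bar>s - s'\<bar>"
        by (rule Ln_lipschitz_along[OF s _ _ _ pos])
      \<comment> \<open>The constant \<open>\<i> * pi\<close> is the same at both ends and cancels
        in the difference.\<close>
      then show ?thesis using * s by (simp add: F_def)
    qed
    also have "\<Lambda> / (c * \<rho> ^ N) = \<Lambda> / c * (1 / \<rho>) ^ N" by (simp add: divide_inverse power_inverse)
    also have "\<Lambda> / c * (1 / \<rho>) ^ N * \<bar>s - s'\<bar> \<le> \<Lambda> / c * (1 + 1 / \<rho>) ^ N * \<bar>s - s'\<bar>"
      using \<Lambda>(1) low(1) \<rho> by (intro mult_right_mono mult_left_mono power_mono) auto
    finally show ?thesis .
  qed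
  define D where "D \<eta> = \<bar>ln K\<bar> + \<bar>ln B\<bar> + pi + \<gamma> / \<eta>" for \<eta>
  have orb: "cmod (Ln (f (x ^ m))) \<le> D \<eta> * real m powr \<eta>" if \<eta>: "\<eta> > 0" and m: "m \<ge> 1" for \<eta> m
  proof -
    have one: "1 \<le> real m powr \<eta>" using m \<eta> by (intro ge_one_powr_ge_zero) auto
    have lnm: "0 \<le> ln (real m)" "ln (real m) \<le> real m powr \<eta> / \<eta>" using m \<eta> ln_powr_bound[of "real m" \<eta>] by auto
    have "x ^ m \<in> sphere 0 1" using x by (simp add: norm_power)
    then have "cmod (Ln (f (x ^ m))) \<le> \<bar>ln (K / real m powr \<gamma>)\<bar> + \<bar>ln B\<bar> + pi"
      using orbit(1) orbit(3)[OF m] m fB by (intro Ln_bound) auto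
    also have "ln (K / real m powr \<gamma>) = ln K - \<gamma> * ln (real m)" using orbit(1) m by (simp add: ln_div ln_powr)
    also have "\<bar>ln K - \<gamma> * ln (real m)\<bar> + \<bar>ln B\<bar> + pi \<le> (\<bar>ln K\<bar> + \<bar>ln B\<bar> + pi) + \<gamma> * ln (real m)"
      using abs_triangle_ineq4[of "ln K" "\<gamma> * ln (real m)"] orbit(2) lnm(1) by (simp add: abs_mult)
    also have "\<dots> \<le> (\<bar>ln K\<bar> + \<bar>ln B\<bar> + pi) * real m powr \<eta> + \<gamma> * (real m powr \<eta> / \<eta>)"
      using mult_left_mono[OF one, of "\<bar>ln K\<bar> + \<bar>ln B\<bar> + pi"] mult_left_mono[OF lnm(2), of \<gamma>] orbit(2) by simp
    also have "\<dots> = D \<eta> * real m powr \<eta>" by (simp add: D_def algebra_simps)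
    finally show ?thesis .
  qed
  have tame: "circle_tame Z x (\<lambda>z. p (Ln (f z)))"
    if p: "\<And>z. \<bar>p z\<bar> \<le> cmod z" "\<And>z w. p z - p w = p (z - w)" for p :: "complex \<Rightarrow> real"
    unfolding circle_tame_def
  proof (intro conjI allI impI)
    show "\<exists>C. \<forall>s. circle_dist Z s > 0 \<longrightarrow> \<bar>p (Ln (f (cis (2 * pi * s))))\<bar> \<le> C * circle_dist Z s powr - \<eta>" if "\<eta> > 0" for \<eta>
      using growth[OF that] p(1) order.trans unfolding F_def by blast
    show "\<exists>C A. \<forall>\<rho>>0. \<forall>s s'. s \<le> s' \<longrightarrow> (\<forall>u\<in>{s..s'}. circle_dist Z u \<ge> \<rho>) \<longrightarrow>
        \<bar>p (Ln (f (cis (2 * pi * s)))) - p (Ln (f (cis (2 * pi * s'))))\<bar> \<le> C * (1 + 1 / \<rho>) ^ A * \<bar>s - s'\<bar>"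
    proof (intro exI allI impI)
      fix \<rho> s s' :: real
      assume "\<rho> > 0" "s \<le> s'" "\<forall>u\<in>{s..s'}. circle_dist Z u \<ge> \<rho>"
      then have "cmod (Ln (F s) - Ln (F s')) \<le> \<Lambda> / c * (1 + 1 / \<rho>) ^ N * \<bar>s - s'\<bar>" using lip by blast
      then show "\<bar>p (Ln (f (cis (2 * pi * s)))) - p (Ln (f (cis (2 * pi * s'))))\<bar> \<le> \<Lambda> / c * (1 + 1 / \<rho>) ^ N * \<bar>s - s'\<bar>"
        unfolding p(2) F_def by (rule order.trans[OF p(1)])
    qed
    show "\<exists>B. \<forall>m\<ge>1. \<bar>p (Ln (f (x ^ m)))\<bar> \<le> B * real m powr \<eta>" if "\<eta> > 0" for \<eta>
      using orb[OF that] p(1) order.trans by blast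
  qed
  show "circle_tame Z x (\<lambda>z. Re (Ln (f z)))" "circle_tame Z x (\<lambda>z. Im (Ln (f z)))"
    by (rule tame; simp add: abs_Re_le_cmod abs_Im_le_cmod)+
qed

text \<open>\<open>Ln\<close> can jump only where \<open>f\<close> meets the closed negative axis,
  hence at zeros of \<open>Im f\<close>. These are finite in number unless \<open>f\<close> is real
  on the circle, and then \<open>f\<close> keeps its sign between its zeros, so each arc has one
  branch. The added points of \<open>Z\<close> may fail to be roots of unity; the orbit is kept away
  from \<open>Z0\<close> only, which controls the logarithm because it is large only near zeros of
  \<open>f\<close>.\<close>

lemma analytic_tame:
  assumes f: "real_analytic_on_circle f" and x: "\<not> root_of_unity x" "finite_type x" "x \<in> sphere 0 1"
    and zeros: "\<forall>z\<in>sphere 0 1. f z = 0 \<longrightarrow> root_of_unity z"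
  obtains Z where "finite Z" "Z \<noteq> {}" "Z \<subseteq> sphere 0 1" "{z \<in> sphere 0 1. f z = 0} \<subseteq> Z"
    "circle_tame Z x (\<lambda>z. Re (Ln (f z)))" "circle_tame Z x (\<lambda>z. Im (Ln (f z)))"
proof -
  have fx: "f x \<noteq> 0" using zeros x by blast
  define Zf where "Zf = {z \<in> sphere 0 1. f z = 0}"
  note Zfin = analytic_circle_zeros(1)[OF f x(3) fx, folded Zf_def]
  note Zlow = analytic_circle_zeros(2)[OF f x(3) fx, folded Zf_def]
  \<comment> \<open>The point 1 keeps the set nonempty and is itself a root of unity.\<close>
  define Z0 where "Z0 = insert 1 Zf"
  have Z0: "finite Z0" "Z0 \<noteq> {}" "Z0 \<subseteq> sphere 0 1" "\<And>z. z \<in> Z0 \<Longrightarrow> root_of_unity z"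
    using Zfin zeros by (auto simp: Z0_def Zf_def root_of_unity_def)
  obtain K \<gamma> where K: "K > 0" "\<gamma> > 0" "\<And>m. m \<ge> 1 \<Longrightarrow> K / real m powr \<gamma> \<le> infdist (x ^ m) Z0"
    using finite_type_orbit_dist[OF x(2) Z0] by blast
  obtain c0 N0 where c0: "c0 > 0" "\<And>s. c0 * circle_dist Z0 s ^ N0 \<le> cmod (f (cis (2 * pi * s)))"
    using Zlow[of Z0] Z0 by (auto simp: Z0_def)
  obtain t where xt: "x = cis (2 * pi * t)" using circle_point[OF x(3)] by blast
  \<comment> \<open>The summand 1 keeps the exponent positive when \<open>N0\<close> is 0.\<close>
  have orbit: "(c0 * K ^ N0) / real m powr (\<gamma> * real N0 + 1) \<le> cmod (f (x ^ m))" if m: "m \<ge> 1" for m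
  proof -
    have xm: "x ^ m = cis (2 * pi * (real m * t))" unfolding xt Complex.DeMoivre by (simp add: mult_ac)
    have "(c0 * K ^ N0) / real m powr (\<gamma> * real N0 + 1) \<le> (c0 * K ^ N0) / real m powr (\<gamma> * real N0)"
      using c0(1) K(1) m by (intro divide_left_mono powr_mono) auto
    also have "\<dots> = c0 * (K / real m powr \<gamma>) ^ N0"
      using m by (simp add: power_divide powr_powr[symmetric] powr_realpow)
    also have "\<dots> \<le> c0 * infdist (x ^ m) Z0 ^ N0"
      using c0(1) K(1) K(3)[OF m] by (intro mult_left_mono power_mono) auto
    also have "\<dots> \<le> cmod (f (x ^ m))" using c0(2)[of "real m * t"] unfolding circle_dist_def xm .
    finally show ?thesis .
  qed
  \<comment> \<open>Collects all that is independent of the branch, so the two cases below supply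
    only a set \<open>Z\<close> and the alternative for \<open>Ln\<close>.\<close>
  have tame: ?thesis
    if Z: "finite Z" "Z0 \<subseteq> Z" "Z \<subseteq> sphere 0 1"
      and branch: "\<And>s s'. s \<le> s' \<Longrightarrow> (\<And>u. u \<in> {s..s'} \<Longrightarrow> cis (2 * pi * u) \<notin> Z) \<Longrightarrow>
      (\<forall>u\<in>{s..s'}. f (cis (2 * pi * u)) \<notin> \<real>\<^sub>\<le>\<^sub>0) \<or>
      (\<forall>u\<in>{s..s'}. - f (cis (2 * pi * u)) \<notin> \<real>\<^sub>\<le>\<^sub>0 \<and> Ln (f (cis (2 * pi * u))) = Ln (- f (cis (2 * pi * u))) + \<i> * pi)" for Z
  proof -
    have Zne: "Z \<noteq> {}" using Z(2) by (auto simp: Z0_def)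
    obtain c N where c: "c > 0" "\<And>s. c * circle_dist Z s ^ N \<le> cmod (f (cis (2 * pi * s)))"
      using Zlow[OF _ Zne Z(3)] Z(2) by (auto simp: Z0_def)
    have off: "cis (2 * pi * u) \<notin> Z" if "circle_dist Z u > 0" for u
      using that unfolding circle_dist_def by auto
    have pos: "c0 * K ^ N0 > 0" "\<gamma> * real N0 + 1 > 0" using c0(1) K by (simp_all add: add_nonneg_pos)
    have br: "(\<forall>u\<in>{s..s'}. f (cis (2 * pi * u)) \<notin> \<real>\<^sub>\<le>\<^sub>0) \<or>
      (\<forall>u\<in>{s..s'}. - f (cis (2 * pi * u)) \<notin> \<real>\<^sub>\<le>\<^sub>0 \<and> Ln (f (cis (2 * pi * u))) = Ln (- f (cis (2 * pi * u))) + \<i> * pi)"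
      if "s \<le> s'" "\<And>u. u \<in> {s..s'} \<Longrightarrow> circle_dist Z u > 0" for s s'
      by (rule branch[OF that(1)]) (use that(2) off in blast)
    note tame = circle_tame_Ln[OF f Zne Z(3) c pos orbit x(3) br]
    show ?thesis by (rule \<open>\<And>Z. \<lbrakk>finite Z; Z \<noteq> {}; Z \<subseteq> sphere 0 1; {z \<in> sphere 0 1. f z = 0} \<subseteq> Z; circle_tame Z x (\<lambda>z. Re (Ln (f z))); circle_tame Z x (\<lambda>z. Im (Ln (f z)))\<rbrakk> \<Longrightarrow> thesis\<close>[OF Z(1) Zne Z(3) _ tame]) (use Z(2) in \<open>auto simp: Z0_def Zf_def\<close>)
  qed
  show ?thesis
  proof (cases "\<forall>z\<in>sphere 0 1. Im (f z) = 0")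
    case True
    define R where "R u = Re (f (cis (2 * pi * u)))" for u
    have fR: "f (cis (2 * pi * u)) = of_real (R u)" for u
      using True by (auto simp: complex_eq_iff R_def)
    have contR: "continuous_on A R" for A
    proof (rule continuous_at_imp_continuous_on, rule ballI)
      fix u
      obtain \<Lambda> where "\<And>s. \<exists>D. ((\<lambda>s. f (cis (2 * pi * s))) has_vector_derivative D) (at s) \<and> cmod D \<le> \<Lambda>"
        using analytic_circle_derivative_bound[OF f] by blast
      then have "isCont (\<lambda>s. f (cis (2 * pi * s))) u" using has_vector_derivative_continuous by blast
      then show "isCont R u" unfolding R_def by (rule isCont_Re)
    qed
    show ?thesis
    proof (rule tame)
      fix s s' :: real assume s: "s \<le> s'" and off: "\<And>u. u \<in> {s..s'} \<Longrightarrow> cis (2 * pi * u) \<notin> Z0"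
      have nz: "R u \<noteq> 0" if "u \<in> {s..s'}" for u
        using off[OF that] fR[of u] by (auto simp: Z0_def Zf_def)
      show "(\<forall>u\<in>{s..s'}. f (cis (2 * pi * u)) \<notin> \<real>\<^sub>\<le>\<^sub>0) \<or>
        (\<forall>u\<in>{s..s'}. - f (cis (2 * pi * u)) \<notin> \<real>\<^sub>\<le>\<^sub>0 \<and> Ln (f (cis (2 * pi * u))) = Ln (- f (cis (2 * pi * u))) + \<i> * pi)"
      proof (cases "R s > 0")
        case True
        have pos: "R u > 0" if u: "u \<in> {s..s'}" for u
        proof (rule ccontr)
          assume "\<not> R u > 0"
          then obtain w where "s \<le> w" "w \<le> u" "R w = 0"
            using IVT2'[of R u 0 s] True u contR by (auto simp: not_less)
          then show False using nz[of w] u by auto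
        qed
        have "f (cis (2 * pi * u)) \<notin> \<real>\<^sub>\<le>\<^sub>0" if u: "u \<in> {s..s'}" for u
          using pos[OF u] unfolding fR by (simp add: complex_nonpos_Reals_iff)
        then show ?thesis by blast
      next
        case False
        have neg: "R u < 0" if u: "u \<in> {s..s'}" for u
        proof (rule ccontr)
          assume "\<not> R u < 0"
          then obtain w where "s \<le> w" "w \<le> u" "R w = 0"
            using IVT'[of R s 0 u] False u contR by (auto simp: not_less)
          then show False using nz[of w] u by auto
        qed
        then have "- f (cis (2 * pi * u)) \<notin> \<real>\<^sub>\<le>\<^sub>0 \<and> Ln (f (cis (2 * pi * u))) = Ln (- f (cis (2 * pi * u))) + \<i> * pi"
          if u: "u \<in> {s..s'}" for u
          using neg[OF u] Ln_minus[of "- f (cis (2 * pi * u))"] unfolding fR by (auto simp: complex_nonpos_Reals_iff)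
        then show ?thesis by blast
      qed
    qed (use Z0 in auto)
  next
    case False
    \<comment> \<open>\<open>Im f\<close> is again real analytic and not identically 0 on the
      circle, so it has finitely many zeros there. They include the zeros of \<open>f\<close> and
      all points where \<open>f\<close> lies on the slit of the logarithm.\<close>
    define g where "g z = complex_of_real (Im (f z))" for z
    have g: "real_analytic_on_circle g"
      unfolding real_analytic_on_circle_def
    proof
      fix t\<^sub>0
      obtain r c where r: "r > 0" and *: "\<And>t. \<bar>t - t\<^sub>0\<bar> < r \<Longrightarrow> (\<lambda>k. c k * of_real (t - t\<^sub>0) ^ k) sums f (cis (2 * pi * t))"
        using f unfolding real_analytic_on_circle_def by blast
      have "(\<lambda>k. complex_of_real (Im (c k)) * of_real (t - t\<^sub>0) ^ k) sums g (cis (2 * pi * t))" if "\<bar>t - t\<^sub>0\<bar> < r" for t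
      proof -
        have "(\<lambda>k. Im (c k * of_real (t - t\<^sub>0) ^ k)) sums Im (f (cis (2 * pi * t)))"
          using *[OF that] by (rule sums_Im)
        moreover have "Im (c k * of_real (t - t\<^sub>0) ^ k) = Im (c k) * (t - t\<^sub>0) ^ k" for k
          by (simp del: of_real_diff flip: of_real_power)
        ultimately have "(\<lambda>k. Im (c k) * (t - t\<^sub>0) ^ k) sums Im (f (cis (2 * pi * t)))" by simp
        then have "(\<lambda>k. complex_of_real (Im (c k) * (t - t\<^sub>0) ^ k)) sums g (cis (2 * pi * t))"
          unfolding g_def by (rule sums_of_real)
        then show ?thesis by simp
      qed
      then show "\<exists>r>0. \<exists>c. \<forall>t. \<bar>t - t\<^sub>0\<bar> < r \<longrightarrow> (\<lambda>k. c k * of_real (t - t\<^sub>0) ^ k) sums g (cis (2 * pi * t))"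
        using r by (intro exI[of _ r] conjI exI[of _ "\<lambda>k. complex_of_real (Im (c k))"]) auto
    qed
    obtain z\<^sub>1 where z1: "z\<^sub>1 \<in> sphere 0 1" "g z\<^sub>1 \<noteq> 0" using False by (auto simp: g_def)
    note fin = analytic_circle_zeros(1)[OF g z1]
    show ?thesis
    proof (rule tame)
      show "finite (insert 1 {z \<in> sphere 0 1. g z = 0})" using fin by simp
      show "Z0 \<subseteq> insert 1 {z \<in> sphere 0 1. g z = 0}" by (auto simp: Z0_def Zf_def g_def)
      fix s s' :: real assume off: "\<And>u. u \<in> {s..s'} \<Longrightarrow> cis (2 * pi * u) \<notin> insert 1 {z \<in> sphere 0 1. g z = 0}"
      have "f (cis (2 * pi * u)) \<notin> \<real>\<^sub>\<le>\<^sub>0" if "u \<in> {s..s'}" for u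
        using off[OF that] by (auto simp: g_def complex_nonpos_Reals_iff)
      then show "(\<forall>u\<in>{s..s'}. f (cis (2 * pi * u)) \<notin> \<real>\<^sub>\<le>\<^sub>0) \<or>
        (\<forall>u\<in>{s..s'}. - f (cis (2 * pi * u)) \<notin> \<real>\<^sub>\<le>\<^sub>0 \<and> Ln (f (cis (2 * pi * u))) = Ln (- f (cis (2 * pi * u))) + \<i> * pi)"
        by blast
    qed auto
  qed
qed

section \<open>The rate of convergence\<close>

text \<open>\<open>U\<close> spans the null space of the covariance form, so \<open>R\<close> is the support of the Gaussian vector.\<close>

lemma gaussian_axes:
  fixes va vb e :: real
  assumes "va \<ge> 0" "va = 0 \<longrightarrow> e = 0" "e\<^sup>2 / va \<le> vb"
  defines "\<alpha> \<equiv> Complex (sqrt va) (e / sqrt va)" and "\<beta> \<equiv> Complex 0 (sqrt (vb - e\<^sup>2 / va))"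
  shows "(Re \<alpha>)\<^sup>2 + (Re \<beta>)\<^sup>2 = va" "(Im \<alpha>)\<^sup>2 + (Im \<beta>)\<^sup>2 = vb" "Re \<alpha> * Im \<alpha> + Re \<beta> * Im \<beta> = e"
    and "\<exists>U R \<Lambda>. finite U \<and> (\<forall>(u, v)\<in>U. u\<^sup>2 * va + 2 * u * v * e + v\<^sup>2 * vb = 0) \<and>
      R = {k. \<forall>(u, v)\<in>U. u * Re k + v * Im k = 0} \<and> subspace R \<and> \<alpha> \<in> R \<and> \<beta> \<in> R \<and> \<Lambda> \<ge> 0 \<and>
      (\<forall>k\<in>R. \<exists>p q. k = p *\<^sub>R \<alpha> + q *\<^sub>R \<beta> \<and> \<bar>p\<bar> + \<bar>q\<bar> \<le> \<Lambda> * norm k)"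
proof -
  define \<sigma> where "\<sigma> = sqrt va"
  define \<tau> where "\<tau> = sqrt (vb - e\<^sup>2 / va)"
  have \<alpha>: "Re \<alpha> = \<sigma>" "Im \<alpha> = e / \<sigma>" and \<beta>: "Re \<beta> = 0" "Im \<beta> = \<tau>"
    by (simp_all add: \<alpha>_def \<beta>_def \<sigma>_def \<tau>_def)
  have \<sigma>: "\<sigma> \<ge> 0" "\<sigma>\<^sup>2 = va" and \<tau>: "\<tau> \<ge> 0" "\<tau>\<^sup>2 = vb - e\<^sup>2 / va"
    using assms(1,3) by (simp_all add: \<sigma>_def \<tau>_def)
  have e0: "e = 0" if "\<sigma> = 0" using that assms(2) \<sigma>(2) by simp
  show "(Re \<alpha>)\<^sup>2 + (Re \<beta>)\<^sup>2 = va" "(Im \<alpha>)\<^sup>2 + (Im \<beta>)\<^sup>2 = vb" "Re \<alpha> * Im \<alpha> + Re \<beta> * Im \<beta> = e"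
    unfolding \<alpha> \<beta> using \<sigma> \<tau> e0 by (auto simp: power_divide)
  define R where "R U = {k. \<forall>(u, v)\<in>U. u * Re k + v * Im k = 0}" for U :: "(real \<times> real) set"
  have R: "subspace (R U)" for U
  proof -
    have "subspace {k. u * Re k + v * Im k = 0}" for u v
    proof (rule subspaceI)
      fix k l and c :: real
      show "0 \<in> {k. u * Re k + v * Im k = 0}" by simp
      assume k: "k \<in> {k. u * Re k + v * Im k = 0}"
      have "u * (c * Re k) + v * (c * Im k) = c * (u * Re k + v * Im k)" by (simp add: algebra_simps)
      then show "c *\<^sub>R k \<in> {k. u * Re k + v * Im k = 0}" using k by simp
      assume l: "l \<in> {k. u * Re k + v * Im k = 0}"
      have "u * (Re k + Re l) + v * (Im k + Im l) = (u * Re k + v * Im k) + (u * Re l + v * Im l)" by (simp add: algebra_simps)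
      then show "k + l \<in> {k. u * Re k + v * Im k = 0}" using k l by simp
    qed
    then have "subspace (\<Inter>(u, v)\<in>U. {k. u * Re k + v * Im k = 0})" by (intro subspace_Inter) auto
    moreover have "(\<Inter>(u, v)\<in>U. {k. u * Re k + v * Im k = 0}) = R U" by (auto simp: R_def)
    ultimately show ?thesis by simp
  qed
  have "\<exists>U \<Lambda>. finite U \<and> (\<forall>(u, v)\<in>U. u\<^sup>2 * va + 2 * u * v * e + v\<^sup>2 * vb = 0) \<and> \<alpha> \<in> R U \<and> \<beta> \<in> R U \<and> \<Lambda> \<ge> 0 \<and>
      (\<forall>k\<in>R U. \<exists>p q. k = p *\<^sub>R \<alpha> + q *\<^sub>R \<beta> \<and> \<bar>p\<bar> + \<bar>q\<bar> \<le> \<Lambda> * norm k)"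
  proof -
    \<comment> \<open>The possible supports are a point, the imaginary axis, a line that is a graph
      over the real axis, and the plane. Accordingly \<open>U\<close> consists of two, one, one and
      no null vectors.\<close>
    consider "\<sigma> = 0" "\<tau> = 0" | "\<sigma> = 0" "\<tau> > 0" | "\<sigma> > 0" "\<tau> = 0" | "\<sigma> > 0" "\<tau> > 0"
      using \<sigma>(1) \<tau>(1) by linarith
    then show ?thesis
    proof cases
      case 1
      then have "va = 0" "vb = 0" "e = 0" using \<sigma>(2) \<tau>(2) e0 by auto
      moreover have "\<exists>p q. k = p *\<^sub>R \<alpha> + q *\<^sub>R \<beta> \<and> \<bar>p\<bar> + \<bar>q\<bar> \<le> 0 * norm k" if k: "k \<in> R {(1, 0), (0, 1)}" for k
      proof -
        have "k = 0" using k by (simp add: R_def complex_eq_iff)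
        then show ?thesis by (intro exI[of _ 0]) simp
      qed
      ultimately show ?thesis
        using 1 \<alpha> \<beta> by (intro exI[of _ "{(1, 0), (0, 1)}"] exI[of _ 0]) (simp add: R_def)
    next
      case 2
      then have "va = 0" "e = 0" using \<sigma>(2) e0 by auto
      moreover have "\<exists>p q. k = p *\<^sub>R \<alpha> + q *\<^sub>R \<beta> \<and> \<bar>p\<bar> + \<bar>q\<bar> \<le> 1 / \<tau> * norm k" if k: "k \<in> R {(1, 0)}" for k
      proof (intro exI conjI)
        show "k = 0 *\<^sub>R \<alpha> + (Im k / \<tau>) *\<^sub>R \<beta>" using k 2 \<beta> by (simp add: R_def complex_eq_iff)
        show "\<bar>0\<bar> + \<bar>Im k / \<tau>\<bar> \<le> 1 / \<tau> * norm k"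
          using 2 abs_Im_le_cmod[of k] by (simp add: divide_right_mono)
      qed
      ultimately show ?thesis
        using 2 \<alpha> \<beta> by (intro exI[of _ "{(1, 0)}"] exI[of _ "1 / \<tau>"]) (simp add: R_def)
    next
      case 3
      then have va: "va > 0" using \<sigma>(2) zero_less_power by blast
      have vb: "vb = e\<^sup>2 / va" using 3 \<tau>(2) by simp
      have deg: "e\<^sup>2 * va + 2 * e * (- va) * e + (- va)\<^sup>2 * vb = 0"
        using va by (simp add: vb power2_eq_square)
      have "\<exists>p q. k = p *\<^sub>R \<alpha> + q *\<^sub>R \<beta> \<and> \<bar>p\<bar> + \<bar>q\<bar> \<le> 1 / \<sigma> * norm k" if k: "k \<in> R {(e, - va)}" for k
      proof (intro exI conjI)
        have "Im k = Re k / \<sigma> * (e / \<sigma>)"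
          using k va \<sigma>(2) by (simp add: R_def field_simps power2_eq_square)
        then show "k = (Re k / \<sigma>) *\<^sub>R \<alpha> + 0 *\<^sub>R \<beta>" using 3 \<alpha> by (simp add: complex_eq_iff)
        show "\<bar>Re k / \<sigma>\<bar> + \<bar>0\<bar> \<le> 1 / \<sigma> * norm k"
          using 3 abs_Re_le_cmod[of k] by (simp add: divide_right_mono)
      qed
      moreover have "\<alpha> \<in> R {(e, - va)}" "\<beta> \<in> R {(e, - va)}"
        using 3 \<alpha> \<beta> \<sigma>(2)[symmetric] by (simp_all add: R_def power2_eq_square)
      ultimately show ?thesis
        using 3 deg by (intro exI[of _ "{(e, - va)}"] exI[of _ "1 / \<sigma>"]) simp
    next
      case 4
      \<comment> \<open>The system is triangular: \<open>p\<close> is found from the real part, then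
        \<open>q\<close> from the imaginary part; the two estimates add up to this constant.\<close>
      define \<Lambda> where "\<Lambda> = 1 / \<sigma> + (1 + \<bar>e / \<sigma>\<bar> / \<sigma>) / \<tau>"
      have "\<exists>p q. k = p *\<^sub>R \<alpha> + q *\<^sub>R \<beta> \<and> \<bar>p\<bar> + \<bar>q\<bar> \<le> \<Lambda> * norm k" for k
      proof (intro exI conjI)
        define p where "p = Re k / \<sigma>"
        define q where "q = (Im k - p * (e / \<sigma>)) / \<tau>"
        show "k = p *\<^sub>R \<alpha> + q *\<^sub>R \<beta>" using 4 \<alpha> \<beta> by (simp add: complex_eq_iff p_def q_def)
        have p: "\<bar>p\<bar> \<le> norm k / \<sigma>"
          using 4 abs_Re_le_cmod[of k] by (simp add: p_def divide_right_mono)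
        have "\<bar>Im k - p * (e / \<sigma>)\<bar> \<le> \<bar>Im k\<bar> + \<bar>p\<bar> * \<bar>e / \<sigma>\<bar>" unfolding abs_mult[symmetric] by (rule abs_triangle_ineq4)
        also have "\<dots> \<le> norm k + norm k / \<sigma> * \<bar>e / \<sigma>\<bar>"
          using abs_Im_le_cmod[of k] mult_right_mono[OF p, of "\<bar>e / \<sigma>\<bar>"] by simp
        finally have "\<bar>q\<bar> \<le> (norm k + norm k / \<sigma> * \<bar>e / \<sigma>\<bar>) / \<tau>"
          unfolding q_def using 4 by (simp add: divide_right_mono)
        then have "\<bar>p\<bar> + \<bar>q\<bar> \<le> norm k / \<sigma> + (norm k + norm k / \<sigma> * \<bar>e / \<sigma>\<bar>) / \<tau>" using p by linarith
        also have "\<dots> = \<Lambda> * norm k" using 4 by (simp add: \<Lambda>_def field_simps)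
        finally show "\<bar>p\<bar> + \<bar>q\<bar> \<le> \<Lambda> * norm k" .
      qed
      moreover have "\<Lambda> \<ge> 0" using 4 by (simp add: \<Lambda>_def)
      ultimately show ?thesis by (intro exI[of _ "{}"] exI[of _ \<Lambda>]) (simp add: R_def)
    qed
  qed
  then obtain U \<Lambda> where *: "finite U" "\<forall>(u, v)\<in>U. u\<^sup>2 * va + 2 * u * v * e + v\<^sup>2 * vb = 0" "\<alpha> \<in> R U" "\<beta> \<in> R U" "\<Lambda> \<ge> 0"
      "\<forall>k\<in>R U. \<exists>p q. k = p *\<^sub>R \<alpha> + q *\<^sub>R \<beta> \<and> \<bar>p\<bar> + \<bar>q\<bar> \<le> \<Lambda> * norm k"
    by blast
  show "\<exists>U R \<Lambda>. finite U \<and> (\<forall>(u, v)\<in>U. u\<^sup>2 * va + 2 * u * v * e + v\<^sup>2 * vb = 0) \<and>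
      R = {k. \<forall>(u, v)\<in>U. u * Re k + v * Im k = 0} \<and> subspace R \<and> \<alpha> \<in> R \<and> \<beta> \<in> R \<and> \<Lambda> \<ge> 0 \<and>
      (\<forall>k\<in>R. \<exists>p q. k = p *\<^sub>R \<alpha> + q *\<^sub>R \<beta> \<and> \<bar>p\<bar> + \<bar>q\<bar> \<le> \<Lambda> * norm k)"
    by (intro exI[of _ U] exI[of _ "R U"] exI[of _ \<Lambda>] conjI * R) (simp add: R_def)
qed

text \<open>Centring by \<open>\<theta> * time n\<close> makes the drift split exactly along the
  recursion, with the share \<open>\<theta> * gap n j\<close> for a step. Division by the total
  weight \<open>pochhammer \<theta> n\<close> turns the combinatorial coefficients into the
  probabilities \<open>pr n j\<close>.\<close>

lemma (in ewens) cycle_average_recursion: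
  fixes h :: "nat \<Rightarrow> complex" and G :: "complex \<Rightarrow> real" and \<mu> :: complex
  defines "A \<equiv> \<lambda>n y. cycle_sum \<theta> n (\<lambda>M. G (y + (\<Sum>m\<in>#M. h m) - (\<theta> * time n) *\<^sub>R \<mu>)) / pochhammer \<theta> n"
  shows "A 0 y = G y"
    and "n \<ge> 1 \<Longrightarrow> A n y = (\<Sum>j<n. pr n j * A j (y + h (n - j) - (\<theta> * gap n j) *\<^sub>R \<mu>))"
proof -
  show "A 0 y = G y" by (simp add: A_def time_def)
  assume n: "n \<ge> 1"
  have "A n y = (\<Sum>j<n. \<theta> * fact (n - 1) / fact j *
      cycle_sum \<theta> j (\<lambda>M. G (y + (\<Sum>m\<in>#add_mset (n - j) M. h m) - (\<theta> * time n) *\<^sub>R \<mu>))) / pochhammer \<theta> n"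
    unfolding A_def by (subst cycle_sum_recursion[OF n]) (rule refl)
  also have "\<dots> = (\<Sum>j<n. pr n j * A j (y + h (n - j) - (\<theta> * gap n j) *\<^sub>R \<mu>))"
    unfolding sum_divide_distrib
  proof (rule sum.cong[OF refl])
    fix j
    have arg: "y + (\<Sum>m\<in>#add_mset (n - j) M. h m) - (\<theta> * time n) *\<^sub>R \<mu> =
        y + h (n - j) - (\<theta> * gap n j) *\<^sub>R \<mu> + (\<Sum>m\<in>#M. h m) - (\<theta> * time j) *\<^sub>R \<mu>" for M
      by (simp add: gap_def algebra_simps)
    have "pochhammer \<theta> j > 0" "pochhammer \<theta> n > 0" using theta_pos by (simp_all add: pochhammer_pos)
    moreover have "(fact n :: real) = real n * fact (n - 1)" using n by (simp add: fact_reduce)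
    ultimately have "\<theta> * fact (n - 1) / fact j / pochhammer \<theta> n = pr n j / pochhammer \<theta> j"
      using n by (simp add: pr_def wt_def field_simps)
    then show "\<theta> * fact (n - 1) / fact j *
      cycle_sum \<theta> j (\<lambda>M. G (y + (\<Sum>m\<in>#add_mset (n - j) M. h m) - (\<theta> * time n) *\<^sub>R \<mu>)) / pochhammer \<theta> n =
      pr n j * A j (y + h (n - j) - (\<theta> * gap n j) *\<^sub>R \<mu>)"
      unfolding A_def arg by (metis (no_types, lifting) times_divide_eq_left times_divide_eq_right)
  qed
  finally show "A n y = (\<Sum>j<n. pr n j * A j (y + h (n - j) - (\<theta> * gap n j) *\<^sub>R \<mu>))" .
qed

lemma gauss2_dilate:
  "gauss2 \<alpha> \<beta> s (\<lambda>y. F ((1 / sqrt t) *\<^sub>R y)) 0 = gauss2 \<alpha> \<beta> (s / t) F 0"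
  by (simp add: gauss2_def gauss_avg_def real_sqrt_divide scaleR_add_right mult_ac)

text \<open>Reduces the distance to means along the orbit. A null vector of the covariance must
  annihilate the drift and all but finitely many increments; those exceptions are set to 0 in
  \<open>h'\<close>, so that \<open>lindeberg\<close> can work inside the support
  \<open>R\<close>.\<close>

lemma ewens_weak_wasserstein_bound:
  fixes h :: "nat \<Rightarrow> complex"
  assumes \<theta>: "\<theta> > 0" and h: "h = (\<lambda>m. Ln (f (x ^ m)))"
    and mean: "power_mean (\<lambda>m. Re (h m)) (Re (m_mean f x))" "power_mean (\<lambda>m. Im (h m)) (Im (m_mean f x))"
    and cov: "power_mean (\<lambda>m. Re (h m) * Re (h m)) va" "power_mean (\<lambda>m. Im (h m) * Im (h m)) vb"
      "power_mean (\<lambda>m. Re (h m) * Im (h m)) e"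
    and fourth: "power_mean (\<lambda>m. cmod (h m) ^ 4) c4"
    and degenerate: "\<And>u v. u\<^sup>2 * va + 2 * u * v * e + v\<^sup>2 * vb = 0 \<Longrightarrow>
      u * Re (m_mean f x) + v * Im (m_mean f x) = 0 \<and> finite {m. u * Re (h m) + v * Im (h m) \<noteq> 0}"
    and N: "centered_complex_gaussian M N (\<theta> * va) (\<theta> * vb) (\<theta> * e)"
  shows "\<exists>C. \<forall>\<^sub>F n in sequentially.
    weak_wasserstein M N (ewens_measure \<theta> n) (normalized_w \<theta> f x n) \<le> ennreal (C * ln (real n) powr (- 1 / 2))"
proof -
  interpret ewens \<theta> by unfold_locales (rule \<theta>)
  define \<mu> where "\<mu> = m_mean f x"
  define \<alpha> where "\<alpha> = Complex (sqrt (\<theta> * va)) (\<theta> * e / sqrt (\<theta> * va))"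
  define \<beta> where "\<beta> = Complex 0 (sqrt (\<theta> * vb - (\<theta> * e)\<^sup>2 / (\<theta> * va)))"
  have zero: "linear_growth (\<lambda>_::complex. 0)" by (rule linear_growth_bounded[of _ 0]) auto
  note gauss = centered_complex_gaussian_expectation[OF N zero]
  have "\<theta> * va = 0 \<longrightarrow> \<theta> * e = 0" using gauss(3) by blast
  note axes = gaussian_axes[OF gauss(1) this gauss(4), folded \<alpha>_def \<beta>_def]
  obtain U R \<Lambda> where U: "finite U" "\<forall>(u, v)\<in>U. u\<^sup>2 * (\<theta> * va) + 2 * u * v * (\<theta> * e) + v\<^sup>2 * (\<theta> * vb) = 0"
    and R: "R = {k. \<forall>(u, v)\<in>U. u * Re k + v * Im k = 0}" "subspace R" "\<alpha> \<in> R" "\<beta> \<in> R"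
    and \<Lambda>: "\<Lambda> \<ge> 0" "\<forall>k\<in>R. \<exists>p q. k = p *\<^sub>R \<alpha> + q *\<^sub>R \<beta> \<and> \<bar>p\<bar> + \<bar>q\<bar> \<le> \<Lambda> * norm k"
    using axes(4) by (elim exE conjE) (rule that)
  have deg: "u * Re \<mu> + v * Im \<mu> = 0" "finite {m. u * Re (h m) + v * Im (h m) \<noteq> 0}" if "(u, v) \<in> U" for u v
  proof -
    have "\<theta> * (u\<^sup>2 * va + 2 * u * v * e + v\<^sup>2 * vb) = 0" using U(2) that by (auto simp: algebra_simps)
    then have "u\<^sup>2 * va + 2 * u * v * e + v\<^sup>2 * vb = 0" using \<theta> by simp
    from degenerate[OF this] show "u * Re \<mu> + v * Im \<mu> = 0" "finite {m. u * Re (h m) + v * Im (h m) \<noteq> 0}"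
      unfolding \<mu>_def by auto
  qed
  define S where "S = {m. h m \<notin> R}"
  have "S \<subseteq> (\<Union>(u, v)\<in>U. {m. u * Re (h m) + v * Im (h m) \<noteq> 0})" unfolding S_def R(1) by auto
  moreover have "finite (\<Union>(u, v)\<in>U. {m. u * Re (h m) + v * Im (h m) \<noteq> 0})" using U(1) deg(2) by auto
  ultimately have S: "finite S" by (rule finite_subset)
  define h' where "h' m = (if m \<in> S then 0 else h m)" for m
  have h': "h' m = h m" if "m \<notin> S" for m using that by (simp add: h'_def)
  have h'R: "h' m \<in> R" for m using R(2) by (auto simp: h'_def S_def subspace_0)
  have \<mu>R: "\<mu> \<in> R" unfolding R(1) using deg(1) by auto
  have cong: "power_mean (\<lambda>m. q (h' m)) \<nu>" if "power_mean (\<lambda>m. q (h m)) \<nu>" for q \<nu>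
    by (rule power_mean_cong_finite[OF that S]) (simp add: h')
  note means = cong[of Re, OF mean(1)[folded \<mu>_def]] cong[of Im, OF mean(2)[folded \<mu>_def]]
    cong[of "\<lambda>z. Re z * Re z", OF cov(1)] cong[of "\<lambda>z. Im z * Im z", OF cov(2)]
    cong[of "\<lambda>z. Re z * Im z", OF cov(3)] cong[of "\<lambda>z. cmod z ^ 4", OF fourth]
  have "power_mean (\<lambda>m. cmod (h m - h' m)) 0"
    by (rule power_mean_finite_support[OF S]) (simp add: h')
  then have "\<exists>C\<ge>0. \<forall>b\<^sub>1 b\<^sub>2 G G\<^sub>1 G\<^sub>2 A. b\<^sub>1 \<ge> 0 \<longrightarrow> b\<^sub>2 \<ge> 0 \<longrightarrow> C2_fun b\<^sub>1 b\<^sub>2 G G\<^sub>1 G\<^sub>2 \<longrightarrow> (\<forall>y. A 0 y = G y) \<longrightarrow>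
    (\<forall>n\<ge>1. \<forall>y. A n y = (\<Sum>j<n. pr n j * A j (y + h (n - j) - (\<theta> * gap n j) *\<^sub>R \<mu>))) \<longrightarrow>
    (\<forall>n y. \<bar>A n y - gauss2 \<alpha> \<beta> (time n) G y\<bar> \<le> C * (b\<^sub>1 + b\<^sub>2) + C * b\<^sub>2 * sqrt (time n + 1))"
    by (rule lindeberg[OF means _ R(2-4) \<mu>R h'R \<Lambda>(1) bspec[OF \<Lambda>(2)] axes(1-3)])
  then obtain C where C: "C \<ge> 0" and lind: "\<And>b\<^sub>1 b\<^sub>2 G G\<^sub>1 G\<^sub>2 A n y. b\<^sub>1 \<ge> 0 \<Longrightarrow> b\<^sub>2 \<ge> 0 \<Longrightarrow> C2_fun b\<^sub>1 b\<^sub>2 G G\<^sub>1 G\<^sub>2 \<Longrightarrow> (\<And>y. A 0 y = G y) \<Longrightarrow>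
    (\<And>n y. n \<ge> 1 \<Longrightarrow> A n y = (\<Sum>j<n. pr n j * A j (y + h (n - j) - (\<theta> * gap n j) *\<^sub>R \<mu>))) \<Longrightarrow>
    \<bar>A n y - gauss2 \<alpha> \<beta> (time n) G y\<bar> \<le> C * (b\<^sub>1 + b\<^sub>2) + C * b\<^sub>2 * sqrt (time n + 1)"
    by (elim exE conjE) (rule that, assumption, blast)
  obtain K where K: "\<And>n. n \<ge> 1 \<Longrightarrow> \<bar>time n - ln (real n)\<bar> \<le> K" using time_ln by blast
  have K0: "K \<ge> 0" using K[of 1] by linarith
  \<comment> \<open>The first two summands pay for the Lindeberg bound, the third for the starting
    point \<open>y\<close>, whose size is governed by \<open>time n - ln n\<close>, and the last for
    changing the time scale to 1.\<close>
  define C' where "C' = 6 * C + 4 * C * sqrt (K + 2) + 2 * \<theta> * K * norm \<mu> + 2 * (norm \<alpha> + norm \<beta>) * K"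
  have main: "\<bar>(\<integral>\<omega>. g (N \<omega>) \<partial>M) - (\<integral>\<sigma>. g (normalized_w \<theta> f x n \<sigma>) \<partial>ewens_measure \<theta> n)\<bar> \<le> C' * ln (real n) powr (- 1 / 2)"
    if n: "n \<ge> 3" and g: "g \<in> weak_wasserstein_tests" for n g
  proof -
    obtain g\<^sub>1 g\<^sub>2 where g12: "C2_fun 2 4 g g\<^sub>1 g\<^sub>2" using C2_fun_weak_wasserstein_test[OF g] by blast
    define L where "L = ln (real n)"
    \<comment> \<open>\<open>exp 1 \<le> 3\<close> gives \<open>L \<ge> 1\<close>, so that the scale
      factor \<open>r\<close> is at most 1.\<close>
    have "exp 1 \<le> real n" using order.trans[OF exp_le, of "real n"] n by simp
    then have L: "L \<ge> 1" using n by (simp add: L_def ln_ge_iff)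
    define r where "r = 1 / sqrt L"
    have "L * 1 \<le> L * L" using L by (intro mult_left_mono) auto
    then have "sqrt L \<le> L" using L real_sqrt_le_mono[of L "L * L"] by simp
    then have r: "0 < r" "r \<le> 1" "r\<^sup>2 = 1 / L" "1 / L \<le> r" using L
      by (auto simp: r_def power_divide divide_le_eq_1 real_sqrt_ge_one field_simps)
    have T: "\<bar>time n - L\<bar> \<le> K" using K[of n] n by (simp add: L_def)
    define G where "G y = g (r *\<^sub>R y)" for y
    have G: "C2_fun (r * 2) (r\<^sup>2 * 4) G (\<lambda>y h. r * g\<^sub>1 (r *\<^sub>R y) h) (\<lambda>y k h. r\<^sup>2 * g\<^sub>2 (r *\<^sub>R y) k h)"
      unfolding G_def[abs_def] by (rule C2_fun_scale[OF g12]) (use r in simp)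
    define A where "A n y = cycle_sum \<theta> n (\<lambda>M. G (y + (\<Sum>m\<in>#M. h m) - (\<theta> * time n) *\<^sub>R \<mu>)) / pochhammer \<theta> n" for n y
    \<comment> \<open>This starting point converts the centring by \<open>time n\<close> into the
      centring by \<open>ln n\<close> used in \<open>normalized_w\<close>.\<close>
    define y where "y = (\<theta> * (time n - L)) *\<^sub>R \<mu>"
    have e1: "\<bar>A n y - gauss2 \<alpha> \<beta> (time n) G y\<bar> \<le> C * (r * 2 + r\<^sup>2 * 4) + C * (r\<^sup>2 * 4) * sqrt (time n + 1)"
      unfolding A_def by (rule lind[OF _ _ G cycle_average_recursion]) (use r(1) in auto)
    have norm_w: "normalized_w \<theta> f x n \<sigma> = r *\<^sub>R (w_stat f x n \<sigma>) - (\<theta> * sqrt L) *\<^sub>R \<mu>" for \<sigma>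
      by (simp add: normalized_w_def L_def r_def \<mu>_def scaleR_conv_of_real divide_inverse mult.commute)
    have "L * r = sqrt L" using L by (simp add: r_def real_div_sqrt)
    then have arg: "r *\<^sub>R w - (\<theta> * sqrt L) *\<^sub>R \<mu> = r *\<^sub>R (y + w - (\<theta> * time n) *\<^sub>R \<mu>)" for w
      by (simp add: y_def algebra_simps flip: \<open>L * r = sqrt L\<close>)
    have An: "(\<integral>\<sigma>. g (normalized_w \<theta> f x n \<sigma>) \<partial>ewens_measure \<theta> n) = A n y"
      unfolding norm_w integral_ewens_measure[OF \<theta>, where G = "\<lambda>w. g (r *\<^sub>R w - (\<theta> * sqrt L) *\<^sub>R \<mu>)"]
      unfolding A_def G_def arg h ..
    have e2: "\<bar>gauss2 \<alpha> \<beta> (time n) G y - gauss2 \<alpha> \<beta> (time n) G 0\<bar> \<le> r * 2 * (\<theta> * K * norm \<mu>)"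
    proof -
      interpret GG: C2_fun "r * 2" "r\<^sup>2 * 4" "gauss2 \<alpha> \<beta> (time n) G" "\<lambda>y h'. gauss2 \<alpha> \<beta> (time n) (\<lambda>y. r * g\<^sub>1 (r *\<^sub>R y) h') y"
        "\<lambda>y k h'. gauss2 \<alpha> \<beta> (time n) (\<lambda>y. r\<^sup>2 * g\<^sub>2 (r *\<^sub>R y) k h') y"
        by (rule C2_fun_gauss2[OF G])
      have "norm y \<le> \<theta> * K * norm \<mu>"
        unfolding y_def using \<theta> T by (simp add: abs_mult mult_right_mono mult_left_mono)
      then have "r * 2 * norm y \<le> r * 2 * (\<theta> * K * norm \<mu>)" using r(1) by simp
      then show ?thesis using order.trans[OF GG.lipschitz[of 0 y]] by simp
    qed
    have dil: "gauss2 \<alpha> \<beta> (time n) G 0 = gauss2 \<alpha> \<beta> (time n / L) g 0"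
      unfolding G_def[abs_def] r_def by (rule gauss2_dilate)
    have sq: "\<bar>sqrt (time n / L) - sqrt 1\<bar> \<le> K * r"
    proof -
      define s where "s = sqrt (time n / L)"
      have s: "s \<ge> 0" "s\<^sup>2 = time n / L" using L time_nonneg[of n] by (simp_all add: s_def)
      \<comment> \<open>As \<open>s + 1\<close> is at least 1, the square root is no farther from 1
        than its argument.\<close>
      have "\<bar>s - 1\<bar> * 1 \<le> \<bar>s - 1\<bar> * \<bar>s + 1\<bar>" using s by (intro mult_left_mono) auto
      also have "\<dots> = \<bar>time n / L - 1\<bar>" unfolding abs_mult[symmetric] s(2)[symmetric] by (simp add: algebra_simps power2_eq_square)
      also have "\<dots> = \<bar>time n - L\<bar> * (1 / L)" using L by (simp add: diff_divide_distrib[symmetric] field_simps flip: abs_mult)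
      also have "\<dots> \<le> K * r" using T r L K0 by (intro mult_mono) auto
      finally show ?thesis by (simp add: s_def)
    qed
    have e3: "\<bar>gauss2 \<alpha> \<beta> (time n / L) g 0 - gauss2 \<alpha> \<beta> 1 g 0\<bar> \<le> 2 * (norm \<alpha> + norm \<beta>) * (K * r)"
      using order.trans[OF gauss2_scale_lipschitz[OF g12, of \<alpha> \<beta> "time n / L" 0 1] mult_left_mono[OF sq, of "2 * (norm \<alpha> + norm \<beta>)"]]
      by simp
    have gN: "(\<integral>\<omega>. g (N \<omega>) \<partial>M) = gauss2 \<alpha> \<beta> 1 g 0"
      unfolding \<alpha>_def \<beta>_def by (rule centered_complex_gaussian_expectation(5)[OF N C2_fun.growth[OF g12]])
    have "sqrt (time n + 1) \<le> sqrt (L * (K + 2))"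
    proof (rule real_sqrt_le_mono)
      have "K * 1 \<le> K * L" using K0 L by (intro mult_left_mono) auto
      then show "time n + 1 \<le> L * (K + 2)" using T L by (simp add: algebra_simps)
    qed
    also have "\<dots> = sqrt L * sqrt (K + 2)" by (simp add: real_sqrt_mult)
    finally have "r\<^sup>2 * sqrt (time n + 1) \<le> r\<^sup>2 * (sqrt L * sqrt (K + 2))" by (rule mult_left_mono) simp
    also have "\<dots> = r * sqrt (K + 2)" unfolding r(3) \<open>L * r = sqrt L\<close>[symmetric] using L by simp
    finally have "4 * C * (r\<^sup>2 * sqrt (time n + 1)) \<le> 4 * C * (r * sqrt (K + 2))" using C by (intro mult_left_mono) auto
    moreover have "C * (r\<^sup>2 * 4) \<le> C * (r * 4)" using C r by (intro mult_left_mono) auto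
    ultimately have "\<bar>A n y - gauss2 \<alpha> \<beta> (time n) G y\<bar> \<le> (6 * C + 4 * C * sqrt (K + 2)) * r"
      using e1 by (simp add: algebra_simps)
    then have "\<bar>gauss2 \<alpha> \<beta> 1 g 0 - A n y\<bar> \<le> (6 * C + 4 * C * sqrt (K + 2)) * r + r * 2 * (\<theta> * K * norm \<mu>) + 2 * (norm \<alpha> + norm \<beta>) * (K * r)"
      using e2 e3 unfolding dil by linarith
    also have "\<dots> = C' * r" by (simp add: C'_def algebra_simps)
    also have "r = ln (real n) powr (- 1 / 2)"
      using L by (simp add: r_def L_def powr_minus_divide powr_half_sqrt flip: minus_divide_left)
    finally show ?thesis unfolding gN An .
  qed
  have "weak_wasserstein M N (ewens_measure \<theta> n) (normalized_w \<theta> f x n) \<le> ennreal (C' * ln (real n) powr (- 1 / 2))" if "n \<ge> 3" for n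
    unfolding weak_wasserstein_def by (intro SUP_least ennreal_leI main[OF that])
  then show ?thesis by (intro exI[of _ C'] eventually_sequentiallyI[of 3])
qed

section \<open>The two kinds of points on the circle\<close>

lemma circle_integral_cong:
  fixes F G :: "real \<Rightarrow> 'a::{banach, second_countable_topology}"
  assumes Z: "finite Z" "Z \<noteq> {}" "Z \<subseteq> sphere 0 1" and eq: "\<And>s. circle_dist Z s > 0 \<Longrightarrow> F s = G s"
  shows "(LINT s:{0..1}|lborel. F s) = (LINT s:{0..1}|lborel. G s)"
  unfolding set_lebesgue_integral_def
proof (rule integral_discrete_difference)
  show "countable {s \<in> {0..1}. circle_dist Z s = 0}"
    by (rule countable_finite[OF integrable_circle_dist_powr(3)[OF Z]])
  fix s assume "s \<notin> {s \<in> {0..1}. circle_dist Z s = 0}"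
  then show "indicator {0..1} s *\<^sub>R F s = indicator {0..1} s *\<^sub>R G s"
    using eq[of s] circle_dist_nonneg[of Z s] by (auto simp: indicator_def less_le)
qed auto

lemma circle_tame_integral_lincomb:
  assumes Z: "finite Z" "Z \<noteq> {}" "Z \<subseteq> sphere 0 1" and \<phi>: "circle_tame Z x \<phi>" and \<psi>: "circle_tame Z x \<psi>"
  shows "(LINT s:{0..1}|lborel. u * \<phi> (cis (2 * pi * s)) + v * \<psi> (cis (2 * pi * s))) =
    u * (LINT s:{0..1}|lborel. \<phi> (cis (2 * pi * s))) + v * (LINT s:{0..1}|lborel. \<psi> (cis (2 * pi * s)))"
  using circle_tame_set_integrable[OF Z \<phi>] circle_tame_set_integrable[OF Z \<psi>]
  by (subst set_integral_add(2)) (simp_all add: set_integrable_mult_right)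

lemma root_of_unity_order:
  assumes "root_of_unity x"
  shows "root_order x \<ge> 1" "x ^ root_order x = 1"
proof -
  have "\<exists>p. p \<ge> 1 \<and> x ^ p = 1" using assms unfolding root_of_unity_def by blast
  from LeastI_ex[OF this] show "root_order x \<ge> 1" "x ^ root_order x = 1" unfolding root_order_def by auto
qed

lemma ewens_bound_periodic:
  assumes \<theta>: "\<theta> > 0" and x: "root_of_unity x" and nz: "\<forall>m\<in>{1..root_order x}. f (x ^ m) \<noteq> 0"
    and N: "centered_complex_gaussian M N (\<theta> * V_a f x) (\<theta> * V_b f x) (\<theta> * E_ab f x)"
  shows "\<exists>C. \<forall>\<^sub>F n in sequentially.
    weak_wasserstein M N (ewens_measure \<theta> n) (normalized_w \<theta> f x n) \<le> ennreal (C * ln (real n) powr (- 1 / 2))"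
proof -
  define p where "p = root_order x"
  have p: "p \<ge> 1" "x ^ p = 1" using root_of_unity_order[OF x] by (auto simp: p_def)
  define h where "h m = Ln (f (x ^ m))" for m
  have per: "h (m + p) = h m" for m using p(2) by (simp add: h_def power_add)
  have mean: "power_mean (\<lambda>m. q (h m)) ((\<Sum>m=1..p. q (h m)) / real p)" for q
    by (rule power_mean_periodic[OF p(1)]) (simp add: per)
  have Re_h: "ln (cmod (f (x ^ m))) = Re (h m)" if "m \<in> {1..p}" for m
    using nz that by (simp add: h_def p_def)
  have sums: "(\<Sum>m=1..p. (ln (cmod (f (x ^ m))))\<^sup>2) = (\<Sum>m=1..p. Re (h m) * Re (h m))"
    "(\<Sum>m=1..p. (Im (Ln (f (x ^ m))))\<^sup>2) = (\<Sum>m=1..p. Im (h m) * Im (h m))"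
    "(\<Sum>m=1..p. ln (cmod (f (x ^ m))) * Im (Ln (f (x ^ m)))) = (\<Sum>m=1..p. Re (h m) * Im (h m))"
    by (rule sum.cong; simp add: Re_h power2_eq_square h_def[symmetric])+
  have V: "V_a f x = (\<Sum>m=1..p. Re (h m) * Re (h m)) / real p" "V_b f x = (\<Sum>m=1..p. Im (h m) * Im (h m)) / real p"
    "E_ab f x = (\<Sum>m=1..p. Re (h m) * Im (h m)) / real p"
    unfolding V_a_def V_b_def E_ab_def circle_mean_def p_def[symmetric] if_P[OF x] sums
    by simp_all
  have \<mu>: "Re (m_mean f x) = (\<Sum>m=1..p. Re (h m)) / real p" "Im (m_mean f x) = (\<Sum>m=1..p. Im (h m)) / real p"
    unfolding m_mean_def circle_mean_def p_def[symmetric] using x by (simp_all add: h_def)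
  show ?thesis
  proof (rule ewens_weak_wasserstein_bound[OF \<theta> _ _ _ _ _ _ _ _ N])
    show "h = (\<lambda>m. Ln (f (x ^ m)))" by (simp add: fun_eq_iff h_def)
    show "power_mean (\<lambda>m. Re (h m)) (Re (m_mean f x))" "power_mean (\<lambda>m. Im (h m)) (Im (m_mean f x))"
      unfolding \<mu> by (rule mean)+
    show "power_mean (\<lambda>m. Re (h m) * Re (h m)) (V_a f x)" "power_mean (\<lambda>m. Im (h m) * Im (h m)) (V_b f x)"
      "power_mean (\<lambda>m. Re (h m) * Im (h m)) (E_ab f x)"
      unfolding V by (rule mean[of "\<lambda>z. Re z * Re z"] mean[of "\<lambda>z. Im z * Im z"] mean[of "\<lambda>z. Re z * Im z"])+
    show "power_mean (\<lambda>m. cmod (h m) ^ 4) ((\<Sum>m=1..p. cmod (h m) ^ 4) / real p)" by (rule mean[of "\<lambda>z. cmod z ^ 4"])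
    fix u v assume q: "u\<^sup>2 * V_a f x + 2 * u * v * E_ab f x + v\<^sup>2 * V_b f x = 0"
    \<comment> \<open>In a null direction the sum of squares of the linear form over a period is 0,
      so the form vanishes at every index, and so does its mean.\<close>
    have "(\<Sum>m=1..p. (u * Re (h m) + v * Im (h m))\<^sup>2) =
        u\<^sup>2 * (\<Sum>m=1..p. Re (h m) * Re (h m)) + 2 * u * v * (\<Sum>m=1..p. Re (h m) * Im (h m)) + v\<^sup>2 * (\<Sum>m=1..p. Im (h m) * Im (h m))"
      unfolding sum_distrib_left sum.distrib[symmetric] by (rule sum.cong) (simp_all add: power2_eq_square algebra_simps)
    also have "\<dots> = real p * (u\<^sup>2 * V_a f x + 2 * u * v * E_ab f x + v\<^sup>2 * V_b f x)"
      unfolding V using p(1) by (simp add: distrib_left)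
    finally have "(\<Sum>m=1..p. (u * Re (h m) + v * Im (h m))\<^sup>2) = 0" using q by simp
    then have z1: "u * Re (h m) + v * Im (h m) = 0" if "m \<in> {1..p}" for m
      using that by (subst (asm) sum_nonneg_eq_0_iff) auto
    have z: "u * Re (h m) + v * Im (h m) = 0" for m
    proof (induction m rule: less_induct)
      case (less m)
      \<comment> \<open>Index 0 lies outside the period \<open>{1..p}\<close> but inside the set to
        be proved finite; periodicity carries it to \<open>p\<close>.\<close>
      consider "m = 0" | "m \<in> {1..p}" | "m > p" by fastforce
      then show ?case
      proof cases
        case 1
        then show ?thesis using z1[of p] per[of 0] p(1) by simp
      next
        case 3
        then show ?thesis using less[of "m - p"] per[of "m - p"] p(1) by simp
      qed (rule z1)
    qed
    have "u * Re (m_mean f x) + v * Im (m_mean f x) = (\<Sum>m=1..p. u * Re (h m) + v * Im (h m)) / real p"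
      unfolding \<mu> by (simp add: sum.distrib sum_distrib_left add_divide_distrib)
    then show "u * Re (m_mean f x) + v * Im (m_mean f x) = 0 \<and> finite {m. u * Re (h m) + v * Im (h m) \<noteq> 0}"
      by (simp add: z)
  qed
qed

lemma ewens_bound_equidistributed:
  assumes \<theta>: "\<theta> > 0" and f: "real_analytic_on_circle f" and x: "\<not> root_of_unity x" "finite_type x" "x \<in> sphere 0 1"
    and zeros: "\<forall>z\<in>sphere 0 1. f z = 0 \<longrightarrow> root_of_unity z"
    and N: "centered_complex_gaussian M N (\<theta> * V_a f x) (\<theta> * V_b f x) (\<theta> * E_ab f x)"
  shows "\<exists>C. \<forall>\<^sub>F n in sequentially.
    weak_wasserstein M N (ewens_measure \<theta> n) (normalized_w \<theta> f x n) \<le> ennreal (C * ln (real n) powr (- 1 / 2))"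
proof -
  define a where "a z = Re (Ln (f z))" for z
  define b where "b z = Im (Ln (f z))" for z
  obtain Z where Z: "finite Z" "Z \<noteq> {}" "Z \<subseteq> sphere 0 1" "{z \<in> sphere 0 1. f z = 0} \<subseteq> Z"
    and a: "circle_tame Z x a" and b: "circle_tame Z x b"
    using analytic_tame[OF f x zeros] unfolding a_def[abs_def] b_def[abs_def] by metis
  have aa: "circle_tame Z x (\<lambda>z. a z * a z)" and bb: "circle_tame Z x (\<lambda>z. b z * b z)" and ab: "circle_tame Z x (\<lambda>z. a z * b z)"
    using a b by (auto intro: circle_tame_mult)
  have sq: "circle_tame Z x (\<lambda>z. 1 * (a z * a z) + 1 * (b z * b z))" by (rule circle_tame_lincomb[OF aa bb])
  note mean = circle_tame_power_mean[OF Z(1-3) x(2)]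
  note Zc = Z(1-3)
  have ln_cmod: "ln (cmod (f (cis (2 * pi * s)))) = a (cis (2 * pi * s))" if "circle_dist Z s > 0" for s
  proof -
    have "cis (2 * pi * s) \<notin> Z" using that by (auto simp: circle_dist_def)
    moreover have "cis (2 * pi * s) \<in> sphere 0 1" by simp
    ultimately have "f (cis (2 * pi * s)) \<noteq> 0" using Z(4) by blast
    then show ?thesis by (simp add: a_def)
  qed
  have V: "V_a f x = (LINT s:{0..1}|lborel. a (cis (2 * pi * s)) * a (cis (2 * pi * s)))"
    "V_b f x = (LINT s:{0..1}|lborel. b (cis (2 * pi * s)) * b (cis (2 * pi * s)))"
    "E_ab f x = (LINT s:{0..1}|lborel. a (cis (2 * pi * s)) * b (cis (2 * pi * s)))"
    unfolding V_a_def V_b_def E_ab_def circle_mean_def if_not_P[OF x(1)] b_def[symmetric]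
    by (rule circle_integral_cong[OF Zc]; simp add: ln_cmod power2_eq_square)+
  \<comment> \<open>A nonintegrable function has integral 0 by convention, so integrability is what
    lets real and imaginary parts pass inside the integral.\<close>
  have ints: "set_integrable lborel {0..1} (\<lambda>s. Ln (f (cis (2 * pi * s))))"
  proof -
    have of_real: "set_integrable lborel {0..1} (\<lambda>s. complex_of_real (\<phi> s))" if "set_integrable lborel {0..1} \<phi>" for \<phi>
    proof -
      have "integrable lborel (\<lambda>s. complex_of_real (indicator {0..1} s *\<^sub>R \<phi> s))"
        using that unfolding set_integrable_def by (rule integrable_of_real)
      then show ?thesis unfolding set_integrable_def by (simp add: scaleR_conv_of_real)
    qed
    have "set_integrable lborel {0..1} (\<lambda>s. complex_of_real (a (cis (2 * pi * s))) + \<i> * complex_of_real (b (cis (2 * pi * s))))"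
      using circle_tame_set_integrable[OF Zc a] circle_tame_set_integrable[OF Zc b]
      by (intro set_integral_add set_integrable_mult_right of_real)
    moreover have "complex_of_real (a z) + \<i> * complex_of_real (b z) = Ln (f z)" for z
      by (simp add: a_def b_def complex_eq_iff)
    ultimately show ?thesis by simp
  qed
  have \<mu>: "Re (m_mean f x) = (LINT s:{0..1}|lborel. a (cis (2 * pi * s)))" "Im (m_mean f x) = (LINT s:{0..1}|lborel. b (cis (2 * pi * s)))"
    unfolding m_mean_def circle_mean_def if_not_P[OF x(1)] set_lebesgue_integral_def a_def b_def
    using ints unfolding set_integrable_def by (simp_all flip: integral_Re integral_Im)
  show ?thesis
  proof (rule ewens_weak_wasserstein_bound[OF \<theta> refl _ _ _ _ _ _ _ N])
    show "power_mean (\<lambda>m. Re (Ln (f (x ^ m)))) (Re (m_mean f x))" "power_mean (\<lambda>m. Im (Ln (f (x ^ m)))) (Im (m_mean f x))"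
      unfolding \<mu> using mean[OF a] mean[OF b] by (simp_all add: a_def b_def)
    show "power_mean (\<lambda>m. Re (Ln (f (x ^ m))) * Re (Ln (f (x ^ m)))) (V_a f x)"
      "power_mean (\<lambda>m. Im (Ln (f (x ^ m))) * Im (Ln (f (x ^ m)))) (V_b f x)"
      "power_mean (\<lambda>m. Re (Ln (f (x ^ m))) * Im (Ln (f (x ^ m)))) (E_ab f x)"
      unfolding V using mean[OF aa] mean[OF bb] mean[OF ab] by (simp_all add: a_def b_def)
    \<comment> \<open>The fourth power of the modulus is a polynomial in the tame real and imaginary
      parts, so its power mean follows from the closure properties.\<close>
    have "cmod w ^ 4 = (1 * (Re w * Re w) + 1 * (Im w * Im w)) * (1 * (Re w * Re w) + 1 * (Im w * Im w))" for w
    proof -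
      have "cmod w ^ 4 = (cmod w ^ 2) ^ 2" by simp
      also have "\<dots> = (Re w ^ 2 + Im w ^ 2) ^ 2" by (simp only: cmod_power2)
      finally show ?thesis by (simp add: power2_eq_square)
    qed
    then show "power_mean (\<lambda>m. cmod (Ln (f (x ^ m))) ^ 4) (LINT s:{0..1}|lborel.
        (1 * (a (cis (2 * pi * s)) * a (cis (2 * pi * s))) + 1 * (b (cis (2 * pi * s)) * b (cis (2 * pi * s)))) *
        (1 * (a (cis (2 * pi * s)) * a (cis (2 * pi * s))) + 1 * (b (cis (2 * pi * s)) * b (cis (2 * pi * s)))))"
      using mean[OF circle_tame_mult[OF sq sq]] by (simp only: a_def b_def)
    fix u v assume q: "u\<^sup>2 * V_a f x + 2 * u * v * E_ab f x + v\<^sup>2 * V_b f x = 0"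
    \<comment> \<open>The linear form belonging to a null direction: its square has integral 0, so
      it vanishes off \<open>Z\<close>.\<close>
    define \<phi> where "\<phi> z = u * a z + v * b z" for z
    have \<phi>: "circle_tame Z x \<phi>" unfolding \<phi>_def[abs_def] by (rule circle_tame_lincomb[OF a b])
    have split: "\<phi> z * \<phi> z = 1 * (u\<^sup>2 * (a z * a z) + (2 * u * v) * (a z * b z)) + v\<^sup>2 * (b z * b z)" for z
      by (simp add: \<phi>_def power2_eq_square algebra_simps)
    have "(LINT s:{0..1}|lborel. \<phi> (cis (2 * pi * s)) * \<phi> (cis (2 * pi * s))) = 0"
      unfolding split circle_tame_integral_lincomb[OF Zc circle_tame_lincomb[OF aa ab] bb]
        circle_tame_integral_lincomb[OF Zc aa ab] V[symmetric]
      using q by simp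
    note \<phi>0 = circle_tame_eq_0[OF Zc \<phi> this]
    have "(LINT s:{0..1}|lborel. \<phi> (cis (2 * pi * s))) = (LINT s:{0..1::real}|lborel. 0)"
      by (rule circle_integral_cong[OF Zc]) (rule \<phi>0)
    then have "u * Re (m_mean f x) + v * Im (m_mean f x) = 0"
      unfolding \<mu> \<phi>_def circle_tame_integral_lincomb[OF Zc a b] by simp
    \<comment> \<open>The powers of \<open>x\<close> are distinct because \<open>x\<close> is not a
      root of unity, so the orbit meets the finite set \<open>Z\<close> only finitely often.\<close>
    moreover have "finite {m. \<phi> (x ^ m) \<noteq> 0}"
    proof (rule finite_subset)
      show "{m. \<phi> (x ^ m) \<noteq> 0} \<subseteq> (\<lambda>m. x ^ m) -` Z"
      proof
        fix m assume m: "m \<in> {m. \<phi> (x ^ m) \<noteq> 0}"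
        obtain t where "x = cis (2 * pi * t)" using circle_point[OF x(3)] by blast
        then have xm: "x ^ m = cis (2 * pi * (real m * t))" by (simp add: Complex.DeMoivre mult_ac)
        then have "circle_dist Z (real m * t) = 0"
          using m \<phi>0[of "real m * t"] circle_dist_nonneg[of Z "real m * t"] by (auto simp: less_le)
        then show "m \<in> (\<lambda>m. x ^ m) -` Z"
          using in_closed_iff_infdist_zero[OF finite_imp_closed[OF Z(1)] Z(2), of "x ^ m"] by (simp add: circle_dist_def xm)
      qed
      have "x ^ m \<noteq> x ^ n" if "m < n" for m n :: nat
      proof
        assume "x ^ m = x ^ n"
        then have "x ^ m * x ^ (n - m) = x ^ m * 1" using that power_add[of x m "n - m"] by simp
        then have "x ^ (n - m) = 1" using x(3) by auto
        then show False using x(1) that unfolding root_of_unity_def by (metis One_nat_def Suc_leI zero_less_diff)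
      qed
      then have "inj (\<lambda>m::nat. x ^ m)" by (metis injI linorder_neqE_nat)
      then show "finite ((\<lambda>m. x ^ m) -` Z)" using Z(1) by (rule finite_vimageI[rotated])
    qed
    ultimately show "u * Re (m_mean f x) + v * Im (m_mean f x) = 0 \<and>
      finite {m. u * Re (Ln (f (x ^ m))) + v * Im (Ln (f (x ^ m))) \<noteq> 0}"
      unfolding \<phi>_def a_def b_def by blast
  qed
qed

theorem theorem6p5:
  fixes \<theta> :: real and f :: "complex \<Rightarrow> complex" and x :: complex
    and M :: "'w measure" and \<N> :: "'w \<Rightarrow> complex"
  assumes "\<theta> > 0"
    and "real_analytic_on_circle f"
    and "x \<in> sphere 0 1"
    and "(\<not> root_of_unity x \<and> finite_type x \<and> (\<forall>z\<in>sphere 0 1. f z = 0 \<longrightarrow> root_of_unity z))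
       \<or> (root_of_unity x \<and> (\<forall>m\<in>{1..root_order x}. f (x ^ m) \<noteq> 0))"
    and "centered_complex_gaussian M \<N> (\<theta> * V_a f x) (\<theta> * V_b f x) (\<theta> * E_ab f x)"
  shows "\<exists>C::real. \<forall>\<^sub>F n in sequentially.
           weak_wasserstein M \<N> (ewens_measure \<theta> n) (normalized_w \<theta> f x n)
             \<le> ennreal (C * ln (real n) powr (- 1 / 2))"
  using assms(4)
proof (elim disjE conjE)
  assume "\<not> root_of_unity x" "finite_type x" "\<forall>z\<in>sphere 0 1. f z = 0 \<longrightarrow> root_of_unity z"
  then show ?thesis using assms(1-3,5) by (intro ewens_bound_equidistributed) auto
next
  assume "root_of_unity x" "\<forall>m\<in>{1..root_order x}. f (x ^ m) \<noteq> 0"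
  then show ?thesis using assms(1,5) by (intro ewens_bound_periodic) auto
qed

end
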